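(* Let $U^{\tau}(\mathcal G)$ be the subalgebra of $wU_q^{\tau}(\mathcal G)$ generated by $K_i,\bar K_i,D_i,\bar D_i,E_i,F_i$ ($i\in I$) and $J^{m-1}$. Then $T$ is a weak antipode of $U^{\tau}(\mathcal G)$, and $U^{\tau}(\mathcal G)$ is a weak Hopf algebra.
   Context: **Cartan datum.** $I=\{1,\dots,n\}$ or $I$ is the set of positive integers. $A=(a_{ij})_{i,j\in I}$ is a Borcherds-Cartan matrix: $a_{ij}\in\mathbf Z$; $a_{ii}=2$ or $a_{ii}\le0$; $a_{ij}\le0$ for $i\ne j$; $a_{ij}=0$ if and only if $a_{ji}=0$. It is symmetrizable: there is $D=\mathrm{diag}\{s_i>0\mid i\in I\}$ with $DA$ symmetric. $\mathcal G$ is the associated generalized Kac-Moody algebra. $\mathbf K$ is a field of characteristic $0$, $q\in\mathbf K$, $q_i=q^{s_i}$, and $q_i\ne\pm1,0$ for all $i\in I$. Put $[k]_\nu=\frac{\nu^k-\nu^{-k}}{\nu-\nu^{-1}}$, $[k]!_\nu=[k]_\nu\cdots[1]_\nu$, $[0]!_\nu=1$, $\left[{k\atop r}\right]_\nu=\frac{[k]!_\nu}{[r]!_\nu[k-r]!_\nu}$, and let $\left[{k\atop r}\right]_i$ be its value at $\nu=q_i$. **The algebra $wU_q^\tau(\mathcal G)$.** Fix a positive integer $m$ and $\tau=(\{\kappa_i\}_{i\in I}\,|\,\{\kappa_i'\}_{i\in I})$, where $\kappa_i,\kappa_i'\in\{0,1\}$ are the types (zero or one) of $E_i$ and $F_i$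 respectively. $wU_q^\tau(\mathcal G)$ is the associative $\mathbf K$-algebra with unit $1$ generated by $J$, $E_i,F_i,K_i,\bar K_i,D_i,\bar D_i$ ($i\in I$) with the following defining relations, for all $i,j\in I$: - $1\ne J^{m-1}=K_i\bar K_i=D_i\bar D_i$ (so $m\ge2$), $J^m=J$; - $J,K_i,\bar K_i,D_i,\bar D_i$ ($i\in I$) commute pairwise, and $XJ^{m-1}=X$ for $X=K_i,\bar K_i,D_i,\bar D_i$; - $E_i,F_i$ are of type $\tau$, that is: if $E_i$ is of type one, $K_jE_i=q_i^{a_{ij}}E_iK_j$ and $\bar K_jE_i=q_i^{-a_{ij}}E_i\bar K_j$; if $E_i$ is of type zero, $K_jE_i\bar K_j=q_i^{a_{ij}}E_i$; if $F_i$ is of type one, $K_jF_i=q_i^{-a_{ij}}F_iK_j$ and $\bar K_jF_i=q_i^{a_{ij}}F_i\bar K_j$; if $F_i$ is of type zero, $K_jF_i\bar K_j=q_i^{-a_{ij}}F_i$; - $E_iF_j-F_jE_i=\delta_{ij}\frac{K_i-\bar K_i}{q_i-q_i^{-1}}$; - $\sum_{r=0}^{1-a_{ij}}(-1)^r\left[{1-a_{ij}\atop r}\right]_iX_i^{1-a_{ij}-r}X_jX_i^r=0$ for $X=E$ and for $X=F$, if $a_{ii}=2$, $i\ne j$; - $E_iE_j-E_jE_i=F_iF_j-F_jF_i=0$ if $a_{ij}=0$. **Bialgebra structure.** $wU_q^\tau(\mathcal G)$ is taken with the comultiplication $\Delta$ and counit $\varepsilon$, algebra morphisms given by $\Delta(X)=X\otimes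 X$, $\varepsilon(X)=1$ for $X=J,K_i,\bar K_i,D_i,\bar D_i$; $\varepsilon(E_i)=\varepsilon(F_i)=0$; $\Delta(E_i)=1\otimes E_i+E_i\otimes K_i$ if $E_i$ is of type one, $\Delta(E_i)=J^{m-1}\otimes E_i+E_i\otimes K_i$ if $E_i$ is of type zero; $\Delta(F_i)=F_i\otimes1+\bar K_i\otimes F_i$ if $F_i$ is of type one, $\Delta(F_i)=F_i\otimes J^{m-1}+\bar K_i\otimes F_i$ if $F_i$ is of type zero. $U^\tau(\mathcal G)$ is a sub-bialgebra. **The map $T$.** $T:wU_q^\tau(\mathcal G)\to wU_q^\tau(\mathcal G)$ is given on generators by $T(1)=1$, $T(J)=J$, $T(K_i)=\bar K_i$, $T(\bar K_i)=K_i$, $T(D_i)=\bar D_i$, $T(\bar D_i)=D_i$, $T(E_i)=-E_i\bar K_i$, $T(F_i)=-K_iF_i$, and extended as an anti-automorphism. **Weak Hopf algebra.** A bialgebra $H$ is called a weak Hopf algebra if there is an anti-automorphism $T$ of $H$ such that $\mathrm{id}_H*T*\mathrm{id}_H=\mathrm{id}_H$ and $T*\mathrm{id}_H*T=T$, where $*$ is the convolution product; such a $T$ is called a weak antipode.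
   Formalization: T is shown to be a weak antipode as an anti-endomorphism; it is shown bijective only if all E_i, F_i are of type zero, since otherwise T(E_i J^{m-1}) = T(E_i) (or likewise for F_i) and T is not injective. The weak Hopf property is shown with another, bijective, weak antipode. *)

theory Defs
  imports
    "HOL-Algebra.QuotRing"
    "HOL-Algebra.Subrings"
    "HOL-Algebra.Algebraic_Closure_Type"
    "HOL-Library.Poly_Mapping"
    "HOL-Computational_Algebra.Formal_Laurent_Series"
begin

section \<open>Associative unital algebras over a field\<close>

text \<open>
  An algebra over the field given by the type \<open>'k\<close> is a record of type \<open>('k, 'a) module\<close>,
  which carries a ring structure as well. The locale \<open>algebra\<close> of HOL-Algebra
  requires commutativity and cannot be used.
\<close>

definition k_algebra :: "('k::field, 'a) module \<Rightarrow> bool" where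
  "k_algebra A \<longleftrightarrow> ring A \<and> Module.module (ring_of_type_algebra :: 'k ring) A \<and>
     (\<forall>c. \<forall>x\<in>carrier A. \<forall>y\<in>carrier A.
        (c \<odot>\<^bsub>A\<^esub> x) \<otimes>\<^bsub>A\<^esub> y = c \<odot>\<^bsub>A\<^esub> (x \<otimes>\<^bsub>A\<^esub> y) \<and>
        x \<otimes>\<^bsub>A\<^esub> (c \<odot>\<^bsub>A\<^esub> y) = c \<odot>\<^bsub>A\<^esub> (x \<otimes>\<^bsub>A\<^esub> y))"

definition scalar_algebra :: "('k::field, 'k) module" where
  "scalar_algebra = \<lparr>carrier = UNIV, monoid.mult = (*), one = 1, zero = 0, add = (+), module.smult = (*)\<rparr>"

definition alg_hom :: "('k, 'a) module \<Rightarrow> ('k, 'b) module \<Rightarrow> ('a \<Rightarrow> 'b) set" where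
  "alg_hom A B = {h \<in> ring_hom A B. \<forall>c. \<forall>x\<in>carrier A. h (c \<odot>\<^bsub>A\<^esub> x) = c \<odot>\<^bsub>B\<^esub> h x}"

definition op_alg :: "('k, 'a) module \<Rightarrow> ('k, 'a) module" where
  "op_alg A = A\<lparr>monoid.mult := \<lambda>x y. y \<otimes>\<^bsub>A\<^esub> x\<rparr>"

definition subalgebra :: "('k, 'a) module \<Rightarrow> 'a set \<Rightarrow> bool" where
  "subalgebra A C \<longleftrightarrow> C \<subseteq> carrier A \<and> subring C A \<and> (\<forall>c. \<forall>x\<in>C. c \<odot>\<^bsub>A\<^esub> x \<in> C)"

definition generated_subalgebra :: "('k, 'a) module \<Rightarrow> 'a set \<Rightarrow> ('k, 'a) module" where
  "generated_subalgebra A S = A\<lparr>carrier := (subalgebra A) hull S\<rparr>"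

text \<open>The quotient of \<open>A\<close> by \<open>N\<close>: the ring \<open>A Quot N\<close> together with its scalar multiplication.\<close>

definition quot_alg :: "('k, 'a) module \<Rightarrow> 'a set \<Rightarrow> ('k, 'a set) module" where
  "quot_alg A N =
     \<lparr>carrier = a_rcosets\<^bsub>A\<^esub> N, monoid.mult = rcoset_mult A N, one = N +>\<^bsub>A\<^esub> \<one>\<^bsub>A\<^esub>,
      zero = N, add = set_add A, module.smult = (\<lambda>c Z. \<Union>x\<in>Z. N +>\<^bsub>A\<^esub> (c \<odot>\<^bsub>A\<^esub> x))\<rparr>"


section \<open>Tensor products\<close>

text \<open>
  \<open>tensor V W\<close> consists of the formal linear combinations of pairs, modulo the subspace
  spanned by the bilinearity relations. The product of formal combinations is the bilinear
  extension of \<open>(a, b) (c, d) = (a c, b d)\<close>, so the quotient has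
  \<open>(a \<otimes> b) (c \<otimes> d) = a c \<otimes> b d\<close>.
\<close>

definition pair_algebra ::
  "('k::field, 'a) module \<Rightarrow> ('k, 'b) module \<Rightarrow> ('k, ('a \<times> 'b) \<Rightarrow>\<^sub>0 'k) module" where
  "pair_algebra V W =
     \<lparr>carrier = {t. Poly_Mapping.keys t \<subseteq> carrier V \<times> carrier W},
      monoid.mult = (\<lambda>t u. \<Sum>p\<in>Poly_Mapping.keys t. \<Sum>r\<in>Poly_Mapping.keys u.
         Poly_Mapping.single (fst p \<otimes>\<^bsub>V\<^esub> fst r, snd p \<otimes>\<^bsub>W\<^esub> snd r)
           (Poly_Mapping.lookup t p * Poly_Mapping.lookup u r)),
      one = Poly_Mapping.single (\<one>\<^bsub>V\<^esub>, \<one>\<^bsub>W\<^esub>) 1,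
      zero = 0, add = (+), module.smult = (\<lambda>c. Poly_Mapping.map ((*) c))\<rparr>"

definition bilinear_relations ::
  "('k::field, 'a) module \<Rightarrow> ('k, 'b) module \<Rightarrow> (('a \<times> 'b) \<Rightarrow>\<^sub>0 'k) set" where
  "bilinear_relations V W =
     {Poly_Mapping.single (x \<oplus>\<^bsub>V\<^esub> x', y) 1 - Poly_Mapping.single (x, y) 1
        - Poly_Mapping.single (x', y) 1 | x x' y.
        x \<in> carrier V \<and> x' \<in> carrier V \<and> y \<in> carrier W} \<union>
     {Poly_Mapping.single (x, y \<oplus>\<^bsub>W\<^esub> y') 1 - Poly_Mapping.single (x, y) 1
        - Poly_Mapping.single (x, y') 1 | x y y'.
        x \<in> carrier V \<and> y \<in> carrier W \<and> y' \<in> carrier W} \<union>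
     {Poly_Mapping.single (c \<odot>\<^bsub>V\<^esub> x, y) 1 - Poly_Mapping.single (x, y) c | c x y.
        x \<in> carrier V \<and> y \<in> carrier W} \<union>
     {Poly_Mapping.single (x, c \<odot>\<^bsub>W\<^esub> y) 1 - Poly_Mapping.single (x, y) c | c x y.
        x \<in> carrier V \<and> y \<in> carrier W}"

definition tensor_kernel ::
  "('k::field, 'a) module \<Rightarrow> ('k, 'b) module \<Rightarrow> (('a \<times> 'b) \<Rightarrow>\<^sub>0 'k) set" where
  "tensor_kernel V W =
     (\<lambda>N. submodule N (ring_of_type_algebra :: 'k ring) (pair_algebra V W))
       hull (bilinear_relations V W)"

definition tensor ::
  "('k::field, 'a) module \<Rightarrow> ('k, 'b) module \<Rightarrow> ('k, (('a \<times> 'b) \<Rightarrow>\<^sub>0 'k) set) module" where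
  "tensor V W = quot_alg (pair_algebra V W) (tensor_kernel V W)"

definition pure_tensor ::
  "('k::field, 'a) module \<Rightarrow> ('k, 'b) module \<Rightarrow> 'a \<Rightarrow> 'b \<Rightarrow> (('a \<times> 'b) \<Rightarrow>\<^sub>0 'k) set" where
  "pure_tensor V W x y = tensor_kernel V W +>\<^bsub>pair_algebra V W\<^esub> Poly_Mapping.single (x, y) 1"

text \<open>
  \<open>tensor_lift Z \<beta>\<close> is the linear map into \<open>Z\<close> with \<open>x \<otimes> y \<mapsto> \<beta> x y\<close>, for bilinear \<open>\<beta>\<close>.
\<close>

definition tensor_lift ::
  "('k::field, 'c) module \<Rightarrow> ('a \<Rightarrow> 'b \<Rightarrow> 'c) \<Rightarrow> (('a \<times> 'b) \<Rightarrow>\<^sub>0 'k) set \<Rightarrow> 'c" where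
  "tensor_lift Z \<beta> C = the_elem
     ((\<lambda>t. \<Oplus>\<^bsub>Z\<^esub>p\<in>Poly_Mapping.keys t.
          Poly_Mapping.lookup t p \<odot>\<^bsub>Z\<^esub> \<beta> (fst p) (snd p)) ` C)"

text \<open>\<open>tensor_map V W f g\<close> is \<open>f \<otimes> g\<close>, with values in the tensor product of \<open>V\<close> and \<open>W\<close>.\<close>

definition tensor_map ::
  "('k::field, 'c) module \<Rightarrow> ('k, 'd) module \<Rightarrow> ('a \<Rightarrow> 'c) \<Rightarrow> ('b \<Rightarrow> 'd)
    \<Rightarrow> (('a \<times> 'b) \<Rightarrow>\<^sub>0 'k) set \<Rightarrow> (('c \<times> 'd) \<Rightarrow>\<^sub>0 'k) set" where
  "tensor_map V W f g = tensor_lift (tensor V W) (\<lambda>x y. pure_tensor V W (f x) (g y))"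

text \<open>The canonical map from \<open>(H \<otimes> H) \<otimes> H\<close> to \<open>H \<otimes> (H \<otimes> H)\<close>.\<close>

definition tensor_assoc ::
  "('k::field, 'a) module
    \<Rightarrow> (((('a \<times> 'a) \<Rightarrow>\<^sub>0 'k) set \<times> 'a) \<Rightarrow>\<^sub>0 'k) set
    \<Rightarrow> (('a \<times> (('a \<times> 'a) \<Rightarrow>\<^sub>0 'k) set) \<Rightarrow>\<^sub>0 'k) set" where
  "tensor_assoc H =
     (let HH = tensor H H; Z = tensor H HH in
       tensor_lift Z (\<lambda>t z. tensor_lift Z
         (\<lambda>x y. pure_tensor H HH x (pure_tensor H H y z)) t))"


section \<open>Bialgebras and weak Hopf algebras\<close>

definition bialgebra ::
  "('k::field, 'a) module \<Rightarrow> ('a \<Rightarrow> (('a \<times> 'a) \<Rightarrow>\<^sub>0 'k) set) \<Rightarrow> ('a \<Rightarrow> 'k) \<Rightarrow> bool" where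
  "bialgebra H \<Delta> \<epsilon> \<longleftrightarrow>
     k_algebra H \<and>
     \<Delta> \<in> alg_hom H (tensor H H) \<and>
     \<epsilon> \<in> alg_hom H scalar_algebra \<and>
     (\<forall>x\<in>carrier H.
        tensor_assoc H (tensor_map (tensor H H) H \<Delta> (\<lambda>y. y) (\<Delta> x))
          = tensor_map H (tensor H H) (\<lambda>y. y) \<Delta> (\<Delta> x)) \<and>
     (\<forall>x\<in>carrier H. tensor_lift H (\<lambda>y z. \<epsilon> y \<odot>\<^bsub>H\<^esub> z) (\<Delta> x) = x) \<and>
     (\<forall>x\<in>carrier H. tensor_lift H (\<lambda>y z. \<epsilon> z \<odot>\<^bsub>H\<^esub> y) (\<Delta> x) = x)"

definition convolution ::
  "('k::field, 'a) module \<Rightarrow> ('a \<Rightarrow> (('a \<times> 'a) \<Rightarrow>\<^sub>0 'k) set)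
    \<Rightarrow> ('a \<Rightarrow> 'a) \<Rightarrow> ('a \<Rightarrow> 'a) \<Rightarrow> 'a \<Rightarrow> 'a" where
  "convolution H \<Delta> f g x = tensor_lift H (\<lambda>y z. f y \<otimes>\<^bsub>H\<^esub> g z) (\<Delta> x)"

text \<open>
  A weak antipode is required here to be an anti-endomorphism of the algebra, not a bijective
  one. Bijectivity is imposed in the definition of a weak Hopf algebra below. It cannot be
  imposed on the map \<open>antiT\<close> below: if \<open>E\<^sub>i\<close> is of type one and
  \<open>e = J\<^bsup>m-1\<^esup>\<close>, then \<open>E\<^sub>i e \<noteq> E\<^sub>i\<close>, but \<open>antiT\<close> sends both to \<open>- E\<^sub>i Kb\<^sub>i\<close>.
\<close>

definition weak_antipode ::
  "('k::field, 'a) module \<Rightarrow> ('a \<Rightarrow> (('a \<times> 'a) \<Rightarrow>\<^sub>0 'k) set) \<Rightarrow> ('a \<Rightarrow> 'a) \<Rightarrow> bool" where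
  "weak_antipode H \<Delta> T \<longleftrightarrow>
     T \<in> alg_hom H (op_alg H) \<and>
     (\<forall>x\<in>carrier H.
        convolution H \<Delta> (convolution H \<Delta> (\<lambda>y. y) T) (\<lambda>y. y) x = x \<and>
        convolution H \<Delta> (convolution H \<Delta> T (\<lambda>y. y)) T x = T x)"

definition weak_hopf_algebra ::
  "('k::field, 'a) module \<Rightarrow> ('a \<Rightarrow> (('a \<times> 'a) \<Rightarrow>\<^sub>0 'k) set) \<Rightarrow> ('a \<Rightarrow> 'k) \<Rightarrow> bool" where
  "weak_hopf_algebra H \<Delta> \<epsilon> \<longleftrightarrow>
     bialgebra H \<Delta> \<epsilon> \<and>
     (\<exists>T. weak_antipode H \<Delta> T \<and> bij_betw T (carrier H) (carrier H))"


section \<open>Gaussian binomial coefficients\<close>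

text \<open>
  The quotients are formed in the field of formal Laurent series in \<open>\<nu>\<close>; the binomial
  coefficients are Laurent polynomials there and are evaluated afterwards, because
  the number substituted for \<open>\<nu>\<close> may be a root of unity.
\<close>

definition qnum :: "nat \<Rightarrow> 'k::field fls" where
  "qnum k = (fls_X ^ k - inverse fls_X ^ k) / (fls_X - inverse fls_X)"

definition qfact :: "nat \<Rightarrow> 'k::field fls" where
  "qfact k = (\<Prod>t=1..k. qnum t)"

definition qbinom :: "nat \<Rightarrow> nat \<Rightarrow> 'k::field fls" where
  "qbinom k r = qfact k / (qfact r * qfact (k - r))"

definition laurent_eval :: "'k::field fls \<Rightarrow> 'k \<Rightarrow> 'k" where
  "laurent_eval f c = (\<Sum>n | fls_nth f n \<noteq> 0. fls_nth f n * c powi n)"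


section \<open>Data\<close>

record 'k wq_datum =
  idx :: "nat set"
  cartan :: "nat \<Rightarrow> nat \<Rightarrow> int"
  symm :: "nat \<Rightarrow> nat"
  qpar :: 'k
  jexp :: nat
  tyE :: "nat \<Rightarrow> nat"
  tyF :: "nat \<Rightarrow> nat"

definition borcherds_cartan :: "nat set \<Rightarrow> (nat \<Rightarrow> nat \<Rightarrow> int) \<Rightarrow> bool" where
  "borcherds_cartan I a \<longleftrightarrow>
     (\<forall>i\<in>I. a i i = 2 \<or> a i i \<le> 0) \<and>
     (\<forall>i\<in>I. \<forall>j\<in>I. i \<noteq> j \<longrightarrow> a i j \<le> 0) \<and>
     (\<forall>i\<in>I. \<forall>j\<in>I. a i j = 0 \<longleftrightarrow> a j i = 0)"

definition qi :: "'k::field wq_datum \<Rightarrow> nat \<Rightarrow> 'k" where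
  "qi P i = qpar P ^ symm P i"

text \<open>
  The inequality \<open>1 \<noteq> J\<^bsup>m-1\<^esup>\<close> among the relations is the condition \<open>m \<ge> 2\<close> here;
  it then holds in the algebra presented by the remaining relations.
\<close>

definition valid_wq_datum :: "'k::field wq_datum \<Rightarrow> bool" where
  "valid_wq_datum P \<longleftrightarrow>
     ((\<exists>n\<ge>1. idx P = {1..n}) \<or> idx P = {1..}) \<and>
     borcherds_cartan (idx P) (cartan P) \<and>
     (\<forall>i\<in>idx P. symm P i > 0) \<and>
     (\<forall>i\<in>idx P. \<forall>j\<in>idx P. int (symm P i) * cartan P i j = int (symm P j) * cartan P j i) \<and>
     (\<forall>i\<in>idx P. qi P i \<noteq> 0 \<and> qi P i \<noteq> 1 \<and> qi P i \<noteq> - 1) \<and>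
     jexp P \<ge> 2 \<and>
     (\<forall>i\<in>idx P. tyE P i \<in> {0, 1} \<and> tyF P i \<in> {0, 1})"


section \<open>The free algebra\<close>

datatype gen = GJ | GE nat | GF nat | GK nat | GKb nat | GD nat | GDb nat

instantiation list :: (type) monoid_add
begin
definition zero_list :: "'a list" where "zero_list = []"
definition plus_list :: "'a list \<Rightarrow> 'a list \<Rightarrow> 'a list" where "plus_list = (@)"
instance by standard (simp_all add: zero_list_def plus_list_def)
end

text \<open>
  Words form a monoid under concatenation, so the multiplication of \<open>gen list \<Rightarrow>\<^sub>0 'k\<close>
  provided by \<open>Poly_Mapping\<close> is that of the free algebra.
\<close>

type_synonym 'k fa = "gen list \<Rightarrow>\<^sub>0 'k"

definition gens :: "nat set \<Rightarrow> gen set" where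
  "gens I = {GJ} \<union> (\<Union>i\<in>I. {GE i, GF i, GK i, GKb i, GD i, GDb i})"

definition free_algebra :: "nat set \<Rightarrow> ('k::field, 'k fa) module" where
  "free_algebra I =
     \<lparr>carrier = {x. \<forall>w\<in>Poly_Mapping.keys x. set w \<subseteq> gens I}, monoid.mult = (*), one = 1,
      zero = 0, add = (+), module.smult = (\<lambda>c. Poly_Mapping.map ((*) c))\<rparr>"

text \<open>The algebra morphism from the free algebra to \<open>B\<close> with prescribed values on the generators.\<close>

definition free_lift :: "('k::field, 'b) module \<Rightarrow> (gen \<Rightarrow> 'b) \<Rightarrow> 'k fa \<Rightarrow> 'b" where
  "free_lift B \<phi> x = (\<Oplus>\<^bsub>B\<^esub>w\<in>Poly_Mapping.keys x.
     Poly_Mapping.lookup x w \<odot>\<^bsub>B\<^esub> foldr (\<lambda>g b. \<phi> g \<otimes>\<^bsub>B\<^esub> b) w \<one>\<^bsub>B\<^esub>)"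


section \<open>The algebra \<open>wU\<^sub>q\<^sup>\<tau>(G)\<close>\<close>

abbreviation gvar :: "gen \<Rightarrow> 'k::field fa" where
  "gvar g \<equiv> Poly_Mapping.single [g] 1"

abbreviation const :: "'k::field \<Rightarrow> 'k fa" where
  "const c \<equiv> Poly_Mapping.single [] c"

definition torus_gens :: "nat set \<Rightarrow> gen set" where
  "torus_gens I = {GJ} \<union> (\<Union>i\<in>I. {GK i, GKb i, GD i, GDb i})"

definition torus_relations :: "'k::field wq_datum \<Rightarrow> 'k fa set" where
  "torus_relations P =
     (let I = idx P; e = gvar GJ ^ (jexp P - 1) in
       {gvar (GK i) * gvar (GKb i) - e | i. i \<in> I} \<union>
       {gvar (GD i) * gvar (GDb i) - e | i. i \<in> I} \<union>
       {gvar GJ ^ jexp P - gvar GJ} \<union>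
       {gvar g * gvar h - gvar h * gvar g | g h. g \<in> torus_gens I \<and> h \<in> torus_gens I} \<union>
       {gvar g * e - gvar g | g. g \<in> torus_gens I - {GJ}})"

definition type_relations :: "'k::field wq_datum \<Rightarrow> 'k fa set" where
  "type_relations P =
     (let I = idx P; w = (\<lambda>i j. qi P i powi cartan P i j);
          w' = (\<lambda>i j. qi P i powi (- cartan P i j)) in
       {gvar (GK j) * gvar (GE i) - const (w i j) * gvar (GE i) * gvar (GK j) | i j.
          i \<in> I \<and> j \<in> I \<and> tyE P i = 1} \<union>
       {gvar (GKb j) * gvar (GE i) - const (w' i j) * gvar (GE i) * gvar (GKb j) | i j.
          i \<in> I \<and> j \<in> I \<and> tyE P i = 1} \<union>
       {gvar (GK j) * gvar (GE i) * gvar (GKb j) - const (w i j) * gvar (GE i) | i j.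
          i \<in> I \<and> j \<in> I \<and> tyE P i = 0} \<union>
       {gvar (GK j) * gvar (GF i) - const (w' i j) * gvar (GF i) * gvar (GK j) | i j.
          i \<in> I \<and> j \<in> I \<and> tyF P i = 1} \<union>
       {gvar (GKb j) * gvar (GF i) - const (w i j) * gvar (GF i) * gvar (GKb j) | i j.
          i \<in> I \<and> j \<in> I \<and> tyF P i = 1} \<union>
       {gvar (GK j) * gvar (GF i) * gvar (GKb j) - const (w' i j) * gvar (GF i) | i j.
          i \<in> I \<and> j \<in> I \<and> tyF P i = 0})"

definition EF_relations :: "'k::field wq_datum \<Rightarrow> 'k fa set" where
  "EF_relations P =
     {gvar (GE i) * gvar (GF j) - gvar (GF j) * gvar (GE i)
        - (if i = j then const (inverse (qi P i - inverse (qi P i))) * (gvar (GK i) - gvar (GKb i))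
           else 0) | i j. i \<in> idx P \<and> j \<in> idx P}"

definition serre_element :: "'k::field wq_datum \<Rightarrow> (nat \<Rightarrow> gen) \<Rightarrow> nat \<Rightarrow> nat \<Rightarrow> 'k fa" where
  "serre_element P Z i j =
     (let N = nat (1 - cartan P i j) in
       \<Sum>r=0..N. const ((- 1) ^ r * laurent_eval (qbinom N r) (qi P i))
         * gvar (Z i) ^ (N - r) * gvar (Z j) * gvar (Z i) ^ r)"

definition serre_relations :: "'k::field wq_datum \<Rightarrow> 'k fa set" where
  "serre_relations P =
     {serre_element P Z i j | Z i j. Z \<in> {GE, GF} \<and> i \<in> idx P \<and> j \<in> idx P \<and>
        cartan P i i = 2 \<and> i \<noteq> j} \<union>
     {gvar (Z i) * gvar (Z j) - gvar (Z j) * gvar (Z i) | Z i j. Z \<in> {GE, GF} \<and>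
        i \<in> idx P \<and> j \<in> idx P \<and> cartan P i j = 0}"

definition wU_ideal :: "'k::field wq_datum \<Rightarrow> 'k fa set" where
  "wU_ideal P = Idl\<^bsub>free_algebra (idx P)\<^esub>
     (torus_relations P \<union> type_relations P \<union> EF_relations P \<union> serre_relations P)"

definition wU :: "'k::field wq_datum \<Rightarrow> ('k, 'k fa set) module" where
  "wU P = quot_alg (free_algebra (idx P)) (wU_ideal P)"

definition wgen :: "'k::field wq_datum \<Rightarrow> gen \<Rightarrow> 'k fa set" where
  "wgen P g = wU_ideal P +>\<^bsub>free_algebra (idx P)\<^esub> gvar g"

definition wJe :: "'k::field wq_datum \<Rightarrow> 'k fa set" where
  "wJe P = wgen P GJ [^]\<^bsub>wU P\<^esub> (jexp P - 1)"

text \<open>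
  The map induced on \<open>wU P\<close> by the morphism of the free algebra with the given values
  on generators. It is meaningful when that morphism respects the relations.
\<close>

definition induced_hom ::
  "('k::field, 'b) module \<Rightarrow> (gen \<Rightarrow> 'b) \<Rightarrow> 'k fa set \<Rightarrow> 'b" where
  "induced_hom B \<phi> Z = the_elem (free_lift B \<phi> ` Z)"

definition wDelta ::
  "'k::field wq_datum \<Rightarrow> 'k fa set \<Rightarrow> (('k fa set \<times> 'k fa set) \<Rightarrow>\<^sub>0 'k) set" where
  "wDelta P =
     (let H = wU P; HH = tensor H H; v = wgen P; pt = pure_tensor H H;
          u = (\<lambda>t. if t = (1::nat) then \<one>\<^bsub>H\<^esub> else wJe P) in
       induced_hom HH (\<lambda>g. case g of
           GE i \<Rightarrow> pt (u (tyE P i)) (v (GE i)) \<oplus>\<^bsub>HH\<^esub> pt (v (GE i)) (v (GK i))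
         | GF i \<Rightarrow> pt (v (GF i)) (u (tyF P i)) \<oplus>\<^bsub>HH\<^esub> pt (v (GKb i)) (v (GF i))
         | _ \<Rightarrow> pt (v g) (v g)))"

definition wepsilon :: "'k::field wq_datum \<Rightarrow> 'k fa set \<Rightarrow> 'k" where
  "wepsilon P = induced_hom scalar_algebra (\<lambda>g. case g of GE i \<Rightarrow> 0 | GF i \<Rightarrow> 0 | _ \<Rightarrow> 1)"

text \<open>Anti-multiplicativity is expressed by taking values in the opposite algebra.\<close>

definition antiT :: "'k::field wq_datum \<Rightarrow> 'k fa set \<Rightarrow> 'k fa set" where
  "antiT P =
     (let H = wU P; v = wgen P in
       induced_hom (op_alg H) (\<lambda>g. case g of
           GJ \<Rightarrow> v GJ
         | GK i \<Rightarrow> v (GKb i)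
         | GKb i \<Rightarrow> v (GK i)
         | GD i \<Rightarrow> v (GDb i)
         | GDb i \<Rightarrow> v (GD i)
         | GE i \<Rightarrow> \<ominus>\<^bsub>H\<^esub> (v (GE i) \<otimes>\<^bsub>H\<^esub> v (GKb i))
         | GF i \<Rightarrow> \<ominus>\<^bsub>H\<^esub> (v (GK i) \<otimes>\<^bsub>H\<^esub> v (GF i))))"


section \<open>The subalgebra \<open>U\<^sup>\<tau>(G)\<close>\<close>

definition Utau :: "'k::field wq_datum \<Rightarrow> ('k, 'k fa set) module" where
  "Utau P = generated_subalgebra (wU P) (insert (wJe P) (wgen P ` (gens (idx P) - {GJ})))"

text \<open>
  The tensor square of \<open>Utau P\<close> is formed from \<open>Utau P\<close> itself. The comultiplication is the
  restriction of \<open>wDelta P\<close>, its values being pulled back along the inclusion of tensor squares.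
\<close>

definition Udelta ::
  "'k::field wq_datum \<Rightarrow> 'k fa set \<Rightarrow> (('k fa set \<times> 'k fa set) \<Rightarrow>\<^sub>0 'k) set" where
  "Udelta P x = (THE t. t \<in> carrier (tensor (Utau P) (Utau P)) \<and>
     tensor_map (wU P) (wU P) (\<lambda>y. y) (\<lambda>y. y) t = wDelta P x)"

end

theory Submission
  imports Defs
begin

text \<open>
  The element \<open>e = J\<^bsup>m-1\<^esup> = K\<^sub>i Kb\<^sub>i\<close> is a central idempotent, because the factors produced
  by moving \<open>K\<^sub>i\<close> and \<open>Kb\<^sub>i\<close> past a generator cancel. With \<open>f = 1 - e\<close> the algebra splits into two
  parts. On the \<open>e\<close>-part \<open>K\<^sub>i\<close> is invertible and one computes as in a quantized enveloping algebra,
  where \<open>T\<close> is an antipode. On the \<open>f\<close>-part the \<open>K\<^sub>i\<close>, \<open>Kb\<^sub>i\<close>, \<open>D\<^sub>i\<close>, \<open>Db\<^sub>i\<close> and the generators of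
  type zero vanish, and every \<open>E\<^sub>i\<close> commutes with every \<open>F\<^sub>j\<close>.

  All maps are built in one way. A representation of the relations in an algebra \<open>B\<close> (locale
  \<open>wq_rep\<close>) is a choice of values of the generators for which the relations hold, and it induces a
  morphism from \<open>wU\<close> to \<open>B\<close> (\<open>induced_hom_rep\<close>). From one representation in \<open>B\<close> new ones arise in
  the tensor square (\<open>deltarep_rep\<close>, giving the comultiplication), in the opposite algebra
  (\<open>antirep_rep\<close>, giving antipodes), and in \<open>B\<close> itself with \<open>J\<close> replaced by \<open>e\<close> (\<open>rep_J_to_e\<close>,
  giving a retraction of \<open>wU\<close> onto \<open>Utau\<close>). The hard relation is the quantum Serre relation. By the
  q-binomial theorem it says that an iterated q-commutator vanishes (\<open>serre_element_fold\<close>), with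
  scalars \<open>c\<^sub>1, \<dots>, c\<^sub>N\<close> in geometric progression. The q-commutators commute with each other, so they
  may be applied in either order. For \<open>\<Delta>(E\<^sub>i) = x + y\<close> and \<open>\<Delta>(E\<^sub>j) = b + b'\<close> the first order removes
  \<open>y\<close> from the action on \<open>b\<close> and the second removes \<open>x\<close> from the action on \<open>b'\<close>, and the relation
  for the sum reduces to the relations for \<open>x\<close>, \<open>b\<close> and for \<open>y\<close>, \<open>b'\<close> (\<open>fold_qcomm_sum_zero\<close>).

  The retraction makes \<open>U \<otimes> U \<rightarrow> wU \<otimes> wU\<close> injective for \<open>U = Utau\<close>: composing with the tensor square
  of the retraction gives the identity (\<open>retr_tensor_incl\<close>). This is why the comultiplication of \<open>U\<close>
  is well defined.

  There is a family \<open>T\<^sub>d\<close> of anti-endomorphisms of \<open>U\<close>, parametrized by a scalar \<open>d\<close>, with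
  \<open>T\<^sub>d(E\<^sub>i) = - E\<^sub>i Kb\<^sub>i + d E\<^sub>i f\<close> and \<open>T\<^sub>d(F\<^sub>i) = - K\<^sub>i F\<^sub>i + d F\<^sub>i f\<close>. The map \<open>T\<close> of the theorem is
  \<open>T\<^sub>0\<close>. It sends \<open>E\<^sub>i f\<close> to zero, so it need not be injective, but if all generators have type zero
  then \<open>E\<^sub>i f = F\<^sub>i f = 0\<close> and all \<open>T\<^sub>d\<close> agree. The map \<open>T\<^sub>1\<close> is always bijective
  (\<open>antirep_inverse\<close>), so it serves as the weak antipode that makes \<open>U\<close> a weak Hopf algebra. Each \<open>T\<^sub>d\<close>
  is a weak antipode, for the following reason. The convolution \<open>id * T * id\<close> is not multiplicative,
  so it is embedded into the family \<open>conv3 z x = \<Sum> x\<^sub>1 z T(x\<^sub>2) x\<^sub>3\<close>. Multiplying \<open>x\<close> on the right by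
  a generator leads to a value at \<open>x\<close> with another parameter \<open>z\<close>. At \<open>z = e\<close> the familiar antipode
  cancellation gives \<open>e x\<close> (\<open>conv3_e\<close>), and for those \<open>z\<close> in the \<open>f\<close>-part that commute with all \<open>E\<^sub>i\<close>
  the value is \<open>x z\<close> (\<open>conv3_E_central\<close>). Adding the cases \<open>z = e\<close> and \<open>z = f\<close> gives \<open>x\<close>. The
  identity \<open>T * id * T = T\<close> is obtained from a similar family \<open>conv3'\<close>.
\<close>

section \<open>Algebras over a field\<close>

text \<open>
  The class of algebras as a locale: as a sublocale of \<open>ring\<close> it makes the ring lemmas available for
  noncommutative algebras.
\<close>

locale kalg = fixes A :: "('k::field, 'a) module" (structure)
  assumes k_algebra: "k_algebra A"

sublocale kalg \<subseteq> ring A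
  using k_algebra by (simp add: k_algebra_def)

lemma k_algebraI:
  fixes A :: "('k::field, 'a) module" (structure)
  assumes "abelian_group A" "monoid A"
    and "\<And>x y z. x \<in> carrier A \<Longrightarrow> y \<in> carrier A \<Longrightarrow> z \<in> carrier A \<Longrightarrow> (x \<oplus> y) \<otimes> z = x \<otimes> z \<oplus> y \<otimes> z"
    and "\<And>x y z. x \<in> carrier A \<Longrightarrow> y \<in> carrier A \<Longrightarrow> z \<in> carrier A \<Longrightarrow> z \<otimes> (x \<oplus> y) = z \<otimes> x \<oplus> z \<otimes> y"
    and "\<And>c x. x \<in> carrier A \<Longrightarrow> c \<odot> x \<in> carrier A"
    and "\<And>c d x. x \<in> carrier A \<Longrightarrow> (c + d) \<odot> x = c \<odot> x \<oplus> d \<odot> x"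
    and "\<And>c x y. x \<in> carrier A \<Longrightarrow> y \<in> carrier A \<Longrightarrow> c \<odot> (x \<oplus> y) = c \<odot> x \<oplus> c \<odot> y"
    and "\<And>c d x. x \<in> carrier A \<Longrightarrow> (c * d) \<odot> x = c \<odot> (d \<odot> x)"
    and "\<And>x. x \<in> carrier A \<Longrightarrow> 1 \<odot> x = x"
    and "\<And>c x y. x \<in> carrier A \<Longrightarrow> y \<in> carrier A \<Longrightarrow> (c \<odot> x) \<otimes> y = c \<odot> (x \<otimes> y)"
    and "\<And>c x y. x \<in> carrier A \<Longrightarrow> y \<in> carrier A \<Longrightarrow> x \<otimes> (c \<odot> y) = c \<odot> (x \<otimes> y)"
  shows "k_algebra A"
  unfolding k_algebra_def
proof (intro conjI allI ballI)
  show "ring A" by (rule ringI) (use assms in auto)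
  have "cring (ring_of_type_algebra :: 'k ring)" ..
  then show "module (ring_of_type_algebra :: 'k ring) A"
    by (rule moduleI) (use assms in \<open>auto simp: ring_of_type_algebra_def\<close>)
qed (use assms in auto)

context kalg
begin

lemma module_A: "module (ring_of_type_algebra :: 'k ring) A"
  using k_algebra by (simp add: k_algebra_def)

lemma type_algebra_simps:
  "carrier ring_of_type_algebra = UNIV" "monoid.mult ring_of_type_algebra = (*)"
  "one ring_of_type_algebra = 1" "zero ring_of_type_algebra = 0" "add ring_of_type_algebra = (+)"
  by (simp_all add: ring_of_type_algebra_def fun_eq_iff)

lemma smult_closed [simp, intro]: "x \<in> carrier A \<Longrightarrow> c \<odot> x \<in> carrier A"
  using module.smult_closed[OF module_A] by (simp add: type_algebra_simps)

lemma smult_l_distr: "x \<in> carrier A \<Longrightarrow> (c + d) \<odot> x = c \<odot> x \<oplus> d \<odot> x"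
  using module.smult_l_distr[OF module_A] by (simp add: type_algebra_simps)

lemma smult_r_distr: "x \<in> carrier A \<Longrightarrow> y \<in> carrier A \<Longrightarrow> c \<odot> (x \<oplus> y) = c \<odot> x \<oplus> c \<odot> y"
  using module.smult_r_distr[OF module_A] by (simp add: type_algebra_simps)

lemma smult_smult [simp]: "x \<in> carrier A \<Longrightarrow> c \<odot> (d \<odot> x) = (c * d) \<odot> x"
  using module.smult_assoc1[OF module_A] by (simp add: type_algebra_simps)

lemma smult_one [simp]: "x \<in> carrier A \<Longrightarrow> 1 \<odot> x = x"
  using module.smult_one[OF module_A] by (simp add: type_algebra_simps)

lemma smult_l_null [simp]: "x \<in> carrier A \<Longrightarrow> 0 \<odot> x = \<zero>"
  using module.smult_l_null[OF module_A] by (simp add: type_algebra_simps)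

lemma smult_r_null [simp]: "c \<odot> \<zero> = \<zero>"
  using module.smult_r_null[OF module_A] by (simp add: type_algebra_simps)

lemma mult_smult_l [simp]: "x \<in> carrier A \<Longrightarrow> y \<in> carrier A \<Longrightarrow> (c \<odot> x) \<otimes> y = c \<odot> (x \<otimes> y)"
  using k_algebra by (simp add: k_algebra_def)

lemma mult_smult_r [simp]: "x \<in> carrier A \<Longrightarrow> y \<in> carrier A \<Longrightarrow> x \<otimes> (c \<odot> y) = c \<odot> (x \<otimes> y)"
  using k_algebra by (simp add: k_algebra_def)

lemma a_inv_smult: "x \<in> carrier A \<Longrightarrow> \<ominus> x = (- 1) \<odot> x"
  using smult_l_distr[of x "1" "- 1"] by (simp add: minus_equality a_comm)

lemma a_minus_smult: "x \<in> carrier A \<Longrightarrow> y \<in> carrier A \<Longrightarrow> x \<ominus> y = x \<oplus> (- 1) \<odot> y"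
  by (simp add: minus_eq a_inv_smult)

lemma a_minus_eq_zero_iff: "x \<in> carrier A \<Longrightarrow> y \<in> carrier A \<Longrightarrow> x \<ominus> y = \<zero> \<longleftrightarrow> x = y"
  by (metis minus_eq minus_minus a_inv_closed minus_equality r_neg)

lemma submodule_iff:
  "submodule N (ring_of_type_algebra :: 'k ring) A \<longleftrightarrow>
    N \<subseteq> carrier A \<and> \<zero> \<in> N \<and> (\<forall>x\<in>N. \<forall>y\<in>N. x \<oplus> y \<in> N) \<and> (\<forall>c. \<forall>x\<in>N. c \<odot> x \<in> N)"
    (is "?L \<longleftrightarrow> ?R")
proof
  assume L: ?L
  interpret M: module "ring_of_type_algebra :: 'k ring" A by (rule module_A)
  note E = M.submoduleE[OF L]
  have 1: "c \<odot> x \<in> N" if "x \<in> N" for c x using E(4)[of c x] that by (simp add: type_algebra_simps)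
  obtain x where "x \<in> N" using E(2) by auto
  then have "\<zero> \<in> N" using 1[of x 0] E(1) by auto
  then show ?R using E 1 by auto
next
  assume R: ?R
  then show ?L
    by (intro module.submoduleI[OF module_A]) (auto simp: a_inv_smult subset_iff)
qed

lemma submoduleI:
  assumes "N \<subseteq> carrier A" "\<zero> \<in> N" "\<And>x y. x \<in> N \<Longrightarrow> y \<in> N \<Longrightarrow> x \<oplus> y \<in> N"
    "\<And>c x. x \<in> N \<Longrightarrow> c \<odot> x \<in> N"
  shows "submodule N (ring_of_type_algebra :: 'k ring) A"
  using assms by (simp add: submodule_iff)

lemma submodule_Inter:
  assumes "\<And>N. N \<in> F \<Longrightarrow> submodule N (ring_of_type_algebra :: 'k ring) A" "F \<noteq> {}"
  shows "submodule (\<Inter>F) (ring_of_type_algebra :: 'k ring) A"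
  using assms unfolding submodule_iff by blast

lemma subalgebra_iff:
  "subalgebra A C \<longleftrightarrow> C \<subseteq> carrier A \<and> \<one> \<in> C \<and> (\<forall>x\<in>C. \<forall>y\<in>C. x \<oplus> y \<in> C) \<and>
    (\<forall>x\<in>C. \<forall>y\<in>C. x \<otimes> y \<in> C) \<and> (\<forall>c. \<forall>x\<in>C. c \<odot> x \<in> C)" (is "?L \<longleftrightarrow> ?R")
proof
  assume L: ?L
  then have "subring C A" by (simp add: subalgebra_def)
  from subringE[OF this] L show ?R by (auto simp: subalgebra_def)
next
  assume R: ?R
  have "subring C A"
    by (rule subringI) (use R in \<open>auto simp: a_inv_smult subset_iff\<close>)
  with R show ?L by (simp add: subalgebra_def)
qed

end

lemma (in kalg) subalgebra_k_algebra:
  assumes "subalgebra A C"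
  shows "k_algebra (A\<lparr>carrier := C\<rparr>)"
proof -
  have C: "C \<subseteq> carrier A" "subring C A" "\<And>c x. x \<in> C \<Longrightarrow> c \<odot> x \<in> C"
    using assms by (auto simp: subalgebra_def)
  interpret S: ring "A\<lparr>carrier := C\<rparr>" by (rule subring_is_ring) (rule C)
  show ?thesis
  proof (rule k_algebraI)
    show "abelian_group (A\<lparr>carrier := C\<rparr>)" "monoid (A\<lparr>carrier := C\<rparr>)" by (rule S.is_abelian_group, rule S.is_monoid)
  qed (use C(1,3) in \<open>auto simp: subset_iff l_distr r_distr smult_l_distr smult_r_distr\<close>)
qed

lemma k_algebra_op_alg: assumes "k_algebra A" shows "k_algebra (op_alg A)"
proof -
  interpret kalg A using assms by (simp add: kalg_def)
  show ?thesis
  proof (rule k_algebraI)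
    show "abelian_group (op_alg A)"
      by (rule abelian_groupI) (auto simp: op_alg_def a_ac intro: l_neg)
    show "monoid (op_alg A)" by (rule monoidI) (auto simp: op_alg_def m_assoc)
  qed (auto simp: op_alg_def l_distr r_distr smult_l_distr smult_r_distr)
qed

lemma op_alg_simps [simp]:
  "carrier (op_alg A) = carrier A" "zero (op_alg A) = zero A" "one (op_alg A) = one A"
  "add (op_alg A) = add A" "module.smult (op_alg A) = module.smult A"
  "x \<otimes>\<^bsub>op_alg A\<^esub> y = y \<otimes>\<^bsub>A\<^esub> x"
  by (simp_all add: op_alg_def)

lemma k_algebra_scalar: "k_algebra (scalar_algebra :: ('k::field, 'k) module)"
proof (rule k_algebraI)
  show "abelian_group (scalar_algebra :: ('k, 'k) module)"
    by (rule abelian_groupI) (auto simp: scalar_algebra_def algebra_simps intro: exI[of _ "- x" for x])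
  show "monoid (scalar_algebra :: ('k, 'k) module)"
    by (rule monoidI) (auto simp: scalar_algebra_def)
qed (auto simp: scalar_algebra_def algebra_simps)

lemma scalar_algebra_simps [simp]:
  "carrier scalar_algebra = UNIV" "zero scalar_algebra = 0" "one scalar_algebra = 1"
  "x \<oplus>\<^bsub>scalar_algebra\<^esub> y = x + y" "x \<otimes>\<^bsub>scalar_algebra\<^esub> y = x * y"
  "x \<odot>\<^bsub>scalar_algebra\<^esub> y = x * y"
  by (simp_all add: scalar_algebra_def)

subsection \<open>Algebra morphisms\<close>

lemma alg_homI:
  assumes "\<And>x. x \<in> carrier A \<Longrightarrow> h x \<in> carrier B"
    "\<And>x y. x \<in> carrier A \<Longrightarrow> y \<in> carrier A \<Longrightarrow> h (x \<oplus>\<^bsub>A\<^esub> y) = h x \<oplus>\<^bsub>B\<^esub> h y"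
    "\<And>x y. x \<in> carrier A \<Longrightarrow> y \<in> carrier A \<Longrightarrow> h (x \<otimes>\<^bsub>A\<^esub> y) = h x \<otimes>\<^bsub>B\<^esub> h y"
    "\<And>c x. x \<in> carrier A \<Longrightarrow> h (c \<odot>\<^bsub>A\<^esub> x) = c \<odot>\<^bsub>B\<^esub> h x"
    "h \<one>\<^bsub>A\<^esub> = \<one>\<^bsub>B\<^esub>"
  shows "h \<in> alg_hom A B"
  using assms by (auto simp: alg_hom_def intro!: ring_hom_memI)

locale alg_hom_pair = A: kalg A + B: kalg B
  for A :: "('k::field, 'a) module" and B :: "('k::field, 'b) module" and h +
  assumes h: "h \<in> alg_hom A B"
begin

lemma closed [simp]: "x \<in> carrier A \<Longrightarrow> h x \<in> carrier B"
  using h by (auto simp: alg_hom_def ring_hom_def)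
lemma add: "x \<in> carrier A \<Longrightarrow> y \<in> carrier A \<Longrightarrow> h (x \<oplus>\<^bsub>A\<^esub> y) = h x \<oplus>\<^bsub>B\<^esub> h y"
  using h by (auto simp: alg_hom_def ring_hom_def)
lemma mult: "x \<in> carrier A \<Longrightarrow> y \<in> carrier A \<Longrightarrow> h (x \<otimes>\<^bsub>A\<^esub> y) = h x \<otimes>\<^bsub>B\<^esub> h y"
  using h by (auto simp: alg_hom_def ring_hom_def)
lemma one [simp]: "h \<one>\<^bsub>A\<^esub> = \<one>\<^bsub>B\<^esub>"
  using h by (auto simp: alg_hom_def ring_hom_def)
lemma smult: "x \<in> carrier A \<Longrightarrow> h (c \<odot>\<^bsub>A\<^esub> x) = c \<odot>\<^bsub>B\<^esub> h x"
  using h by (auto simp: alg_hom_def)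
lemma zero [simp]: "h \<zero>\<^bsub>A\<^esub> = \<zero>\<^bsub>B\<^esub>"
  using smult[of "\<zero>\<^bsub>A\<^esub>" 0] by simp
lemma a_inv: "x \<in> carrier A \<Longrightarrow> h (\<ominus>\<^bsub>A\<^esub> x) = \<ominus>\<^bsub>B\<^esub> h x"
  by (simp add: A.a_inv_smult B.a_inv_smult smult)
lemma minus: "x \<in> carrier A \<Longrightarrow> y \<in> carrier A \<Longrightarrow> h (x \<ominus>\<^bsub>A\<^esub> y) = h x \<ominus>\<^bsub>B\<^esub> h y"
  by (simp add: A.minus_eq B.minus_eq add a_inv)
lemma nat_pow: "x \<in> carrier A \<Longrightarrow> h (x [^]\<^bsub>A\<^esub> (n::nat)) = h x [^]\<^bsub>B\<^esub> n"
  by (induction n) (simp_all add: mult)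

end

lemma alg_hom_compose:
  assumes "f \<in> alg_hom A B" "g \<in> alg_hom B C"
  shows "(\<lambda>x. g (f x)) \<in> alg_hom A C"
  using assms by (auto simp: alg_hom_def ring_hom_def Pi_iff)

text \<open>
  This reduces the comparison of two morphisms to a generating set.
\<close>

lemma (in kalg) alg_hom_eqI_subalgebra:
  assumes "kalg B" "f \<in> alg_hom A B" "g \<in> alg_hom A B"
  shows "subalgebra A {x \<in> carrier A. f x = g x}"
proof -
  interpret B: kalg B by fact
  interpret f: alg_hom_pair A B f using assms by unfold_locales
  interpret g: alg_hom_pair A B g using assms by unfold_locales
  show ?thesis by (auto simp: subalgebra_iff f.add g.add f.mult g.mult f.smult g.smult)
qed

subsection \<open>Linear extension\<close>

definition lin_ext :: "('k::field, 'c) module \<Rightarrow> ('w \<Rightarrow> 'c) \<Rightarrow> ('w \<Rightarrow>\<^sub>0 'k) \<Rightarrow> 'c" where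
  "lin_ext Z f t = (\<Oplus>\<^bsub>Z\<^esub>p\<in>Poly_Mapping.keys t. Poly_Mapping.lookup t p \<odot>\<^bsub>Z\<^esub> f p)"

lemma keys_subset_induct [consumes 1, case_names zero add]:
  fixes t :: "'w \<Rightarrow>\<^sub>0 'k::field"
  assumes "Poly_Mapping.keys t \<subseteq> S" and "P 0"
    and "\<And>p c t. p \<in> S \<Longrightarrow> Poly_Mapping.keys t \<subseteq> S \<Longrightarrow> P t \<Longrightarrow> P (Poly_Mapping.single p c + t)"
  shows "P t"
  using assms(1)
proof (induction t rule: update_induct)
  case const
  then show ?case using assms(2) by simp
next
  case (update f a b)
  have eq: "Poly_Mapping.update a b f = Poly_Mapping.single a b + f"
    by (rule poly_mapping_eqI) (use update in \<open>auto simp: lookup_update lookup_add lookup_single not_in_keys_iff_lookup_eq_zero\<close>)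
  have "Poly_Mapping.keys (Poly_Mapping.update a b f) = insert a (Poly_Mapping.keys f)"
    using update by (simp add: keys_update)
  with update eq assms(3) show ?case by auto
qed

lemma lookup_map_mult [simp]:
  "Poly_Mapping.lookup (Poly_Mapping.map ((*) c) t) p = c * Poly_Mapping.lookup t p" for c :: "'k::field"
  by (simp add: Poly_Mapping.map.rep_eq when_def)

lemma keys_map_mult: "Poly_Mapping.keys (Poly_Mapping.map ((*) c) t) \<subseteq> Poly_Mapping.keys t" for c :: "'k::field"
  by (auto simp: in_keys_iff)

context kalg
begin

lemma lin_ext_superset:
  assumes "f \<in> S \<rightarrow> carrier A" "finite U" "Poly_Mapping.keys t \<subseteq> U" "U \<subseteq> S"
  shows "lin_ext A f t = (\<Oplus>p\<in>U. Poly_Mapping.lookup t p \<odot> f p)"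
  unfolding lin_ext_def
  by (rule add.finprod_mono_neutral_cong_left)
    (use assms in \<open>auto simp: Pi_iff subset_iff in_keys_iff\<close>)

lemma lin_ext_closed [simp]:
  assumes "f \<in> S \<rightarrow> carrier A" "Poly_Mapping.keys t \<subseteq> S"
  shows "lin_ext A f t \<in> carrier A"
  unfolding lin_ext_def by (rule finsum_closed) (use assms in auto)

lemma lin_ext_zero [simp]: "lin_ext A f 0 = \<zero>"
  by (simp add: lin_ext_def)

lemma lin_ext_add:
  assumes f: "f \<in> S \<rightarrow> carrier A" and "Poly_Mapping.keys t \<subseteq> S" "Poly_Mapping.keys u \<subseteq> S"
  shows "lin_ext A f (t + u) = lin_ext A f t \<oplus> lin_ext A f u"
proof -
  let ?U = "Poly_Mapping.keys t \<union> Poly_Mapping.keys u"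
  have U: "finite ?U" "?U \<subseteq> S" using assms by auto
  have fU: "\<And>p. p \<in> ?U \<Longrightarrow> f p \<in> carrier A" using f U by auto
  show ?thesis
    unfolding lin_ext_superset[OF f U(1) keys_add U(2)]
      lin_ext_superset[OF f U(1) Un_upper1 U(2)] lin_ext_superset[OF f U(1) Un_upper2 U(2)]
    by (simp add: lookup_add fU smult_l_distr Pi_iff finsum_addf del: Un_iff cong: finsum_cong)
qed

lemma lin_ext_smult:
  assumes f: "f \<in> S \<rightarrow> carrier A" and t: "Poly_Mapping.keys t \<subseteq> S"
  shows "lin_ext A f (Poly_Mapping.map ((*) c) t) = c \<odot> lin_ext A f t"
proof -
  have ft: "\<And>p. p \<in> Poly_Mapping.keys t \<Longrightarrow> f p \<in> carrier A" using f t by auto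
  have "lin_ext A f (Poly_Mapping.map ((*) c) t) = (\<Oplus>p\<in>Poly_Mapping.keys t. c \<odot> (Poly_Mapping.lookup t p \<odot> f p))"
    unfolding lin_ext_superset[OF f finite_keys keys_map_mult t]
    by (rule finsum_cong') (use ft in auto)
  also have "\<dots> = c \<odot> lin_ext A f t"
    unfolding lin_ext_def
    using module.finsum_smult_ldistr[OF module_A, of "Poly_Mapping.keys t" c "\<lambda>p. Poly_Mapping.lookup t p \<odot> f p"] ft
    by (auto simp: type_algebra_simps Pi_iff)
  finally show ?thesis .
qed

lemma lin_ext_single:
  assumes "f p \<in> carrier A"
  shows "lin_ext A f (Poly_Mapping.single p c) = c \<odot> f p"
proof (cases "c = 0")
  case False
  then have "lin_ext A f (Poly_Mapping.single p c) = (\<Oplus>q\<in>{p}. Poly_Mapping.lookup (Poly_Mapping.single p c) q \<odot> f q)"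
    by (simp add: lin_ext_def)
  also have "\<dots> = c \<odot> f p" using assms by (subst finsum_insert) auto
  finally show ?thesis .
qed (use assms in simp)

end

subsection \<open>Algebras of finitely supported functions\<close>

text \<open>
  Both the free algebra and the pair algebra from which a tensor product is formed have this shape,
  with \<open>S\<close> the set of words or of pairs. Only the multiplication \<open>M\<close> and its unit differ, and the
  algebra axioms need to be checked on basis elements only.
\<close>

definition pm_algebra :: "'w set \<Rightarrow> (('w \<Rightarrow>\<^sub>0 'k) \<Rightarrow> ('w \<Rightarrow>\<^sub>0 'k) \<Rightarrow> ('w \<Rightarrow>\<^sub>0 'k)) \<Rightarrow> ('w \<Rightarrow>\<^sub>0 'k) \<Rightarrow> ('k::field, 'w \<Rightarrow>\<^sub>0 'k) module" where
  "pm_algebra S M o1 = \<lparr>carrier = {t. Poly_Mapping.keys t \<subseteq> S}, monoid.mult = M, one = o1,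
     zero = 0, add = (+), module.smult = (\<lambda>c. Poly_Mapping.map ((*) c))\<rparr>"

lemma pm_algebra_simps [simp]:
  "carrier (pm_algebra S M o1) = {t. Poly_Mapping.keys t \<subseteq> S}" "monoid.mult (pm_algebra S M o1) = M"
  "one (pm_algebra S M o1) = o1" "zero (pm_algebra S M o1) = 0" "add (pm_algebra S M o1) = (+)"
  "module.smult (pm_algebra S M o1) = (\<lambda>c. Poly_Mapping.map ((*) c))"
  by (simp_all add: pm_algebra_def)

lemma k_algebra_pm_algebra:
  fixes M :: "('w \<Rightarrow>\<^sub>0 'k::field) \<Rightarrow> ('w \<Rightarrow>\<^sub>0 'k) \<Rightarrow> ('w \<Rightarrow>\<^sub>0 'k)"
  assumes add_l: "\<And>t u v. M (t + u) v = M t v + M u v" and add_r: "\<And>t u v. M v (t + u) = M v t + M v u"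
    and sm_l: "\<And>c t u. M (Poly_Mapping.map ((*) c) t) u = Poly_Mapping.map ((*) c) (M t u)"
    and sm_r: "\<And>c t u. M t (Poly_Mapping.map ((*) c) u) = Poly_Mapping.map ((*) c) (M t u)"
    and closed: "\<And>p r. p \<in> S \<Longrightarrow> r \<in> S \<Longrightarrow> Poly_Mapping.keys (M (Poly_Mapping.single p 1) (Poly_Mapping.single r 1)) \<subseteq> S"
    and assoc: "\<And>p r s. p \<in> S \<Longrightarrow> r \<in> S \<Longrightarrow> s \<in> S \<Longrightarrow>
      M (M (Poly_Mapping.single p 1) (Poly_Mapping.single r 1)) (Poly_Mapping.single s 1)
      = M (Poly_Mapping.single p 1) (M (Poly_Mapping.single r 1) (Poly_Mapping.single s 1))"
    and o1: "Poly_Mapping.keys o1 \<subseteq> S"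
    and l1: "\<And>p. p \<in> S \<Longrightarrow> M o1 (Poly_Mapping.single p 1) = Poly_Mapping.single p 1"
    and r1: "\<And>p. p \<in> S \<Longrightarrow> M (Poly_Mapping.single p 1) o1 = Poly_Mapping.single p 1"
  shows "k_algebra (pm_algebra S M o1)"
proof -
  define sm :: "'k \<Rightarrow> ('w \<Rightarrow>\<^sub>0 'k) \<Rightarrow> ('w \<Rightarrow>\<^sub>0 'k)" where "sm c = Poly_Mapping.map ((*) c)" for c
  have lookup_sm [simp]: "Poly_Mapping.lookup (sm c t) p = c * Poly_Mapping.lookup t p" for c p and t :: "'w \<Rightarrow>\<^sub>0 'k"
    by (simp add: sm_def)
  have keys_sm: "Poly_Mapping.keys (sm c t) \<subseteq> Poly_Mapping.keys t" for c and t :: "'w \<Rightarrow>\<^sub>0 'k"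
    unfolding sm_def by (rule keys_map_mult)
  have single: "Poly_Mapping.single p c = sm c (Poly_Mapping.single p 1)" for p :: 'w and c
    by (rule poly_mapping_eqI) (simp add: lookup_single when_def)
  have sm_add: "sm c (t + u) = sm c t + sm c u" for c and t u :: "'w \<Rightarrow>\<^sub>0 'k"
    by (rule poly_mapping_eqI) (simp add: lookup_add algebra_simps)
  have sm_sm: "sm c (sm d t) = sm (c * d) t" for c d and t :: "'w \<Rightarrow>\<^sub>0 'k"
    by (rule poly_mapping_eqI) (simp add: algebra_simps)
  note sm_l = sm_l[folded sm_def] and sm_r = sm_r[folded sm_def]
  have zl: "M 0 t = 0" and zr: "M t 0 = 0" for t
    using add_l[of 0 0 t] add_r[of t 0 0] by simp_all
  have keys_add': "Poly_Mapping.keys (t + u) \<subseteq> S" if "Poly_Mapping.keys t \<subseteq> S" "Poly_Mapping.keys u \<subseteq> S"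
    for t u :: "'w \<Rightarrow>\<^sub>0 'k" using keys_add[of t u] that by blast
  have keys_sm': "Poly_Mapping.keys (sm c t) \<subseteq> S" if "Poly_Mapping.keys t \<subseteq> S"
    for c and t :: "'w \<Rightarrow>\<^sub>0 'k" using keys_sm that by blast
  have keys_M1: "Poly_Mapping.keys (M (Poly_Mapping.single p 1) u) \<subseteq> S" if "Poly_Mapping.keys u \<subseteq> S" "p \<in> S" for p u
    using that(1)
  proof (induction rule: keys_subset_induct)
    case (add r c u)
    then show ?case by (subst single) (simp add: add_r sm_r keys_add' keys_sm' closed that)
  qed (simp add: zr)
  have keys_M: "Poly_Mapping.keys (M t u) \<subseteq> S" if "Poly_Mapping.keys t \<subseteq> S" "Poly_Mapping.keys u \<subseteq> S" for t u
    using that(1)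
  proof (induction rule: keys_subset_induct)
    case (add r c u)
    then show ?case by (subst single) (simp add: add_l sm_l keys_add' keys_sm' keys_M1 that)
  qed (simp add: zl)
  have assoc1: "M (M (Poly_Mapping.single p 1) (Poly_Mapping.single r 1)) v
      = M (Poly_Mapping.single p 1) (M (Poly_Mapping.single r 1) v)"
    if "Poly_Mapping.keys v \<subseteq> S" "p \<in> S" "r \<in> S" for p r v
    using that(1)
  proof (induction rule: keys_subset_induct)
    case (add s c v)
    then show ?case by (subst single, subst (4) single) (simp add: add_r sm_r assoc that)
  qed (simp add: zr)
  have assoc2: "M (M (Poly_Mapping.single p 1) u) v = M (Poly_Mapping.single p 1) (M u v)"
    if "Poly_Mapping.keys u \<subseteq> S" "Poly_Mapping.keys v \<subseteq> S" "p \<in> S" for p u v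
    using that(1)
  proof (induction rule: keys_subset_induct)
    case (add r c u)
    then show ?case
      by (simp add: add_r add_l single[of r c] sm_r sm_l assoc1 that)
  qed (simp add: zr zl)
  have assoc3: "M (M t u) v = M t (M u v)"
    if "Poly_Mapping.keys t \<subseteq> S" "Poly_Mapping.keys u \<subseteq> S" "Poly_Mapping.keys v \<subseteq> S" for t u v
    using that(1)
  proof (induction rule: keys_subset_induct)
    case (add p c t)
    then show ?case
      by (simp add: add_l single[of p c] sm_l assoc2 that)
  qed (simp add: zl)
  have l1': "M o1 t = t" if "Poly_Mapping.keys t \<subseteq> S" for t
    using that
  proof (induction rule: keys_subset_induct)
    case (add p c t)
    then show ?case by (simp add: add_r single[of p c] sm_r l1)
  qed (simp add: zr)
  have r1': "M t o1 = t" if "Poly_Mapping.keys t \<subseteq> S" for t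
    using that
  proof (induction rule: keys_subset_induct)
    case (add p c t)
    then show ?case by (simp add: add_l single[of p c] sm_l r1)
  qed (simp add: zl)
  show ?thesis
  proof (rule k_algebraI)
    show "abelian_group (pm_algebra S M o1)"
    proof (rule abelian_groupI)
      show "\<exists>y\<in>carrier (pm_algebra S M o1). y \<oplus>\<^bsub>pm_algebra S M o1\<^esub> x = \<zero>\<^bsub>pm_algebra S M o1\<^esub>"
        if "x \<in> carrier (pm_algebra S M o1)" for x
        by (rule bexI[of _ "sm (- 1) x"])
          (use that keys_sm' in \<open>auto intro!: poly_mapping_eqI simp: lookup_add\<close>)
    qed (use keys_add' in \<open>auto simp: ac_simps\<close>)
    show "monoid (pm_algebra S M o1)"
      by (rule monoidI) (use keys_M o1 in \<open>simp_all add: assoc3 l1' r1'\<close>)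
  qed (use keys_sm' in \<open>simp_all add: add_l add_r sm_l sm_r keys_M assoc3 sm_add sm_sm
    sm_def[symmetric]\<close>, (rule poly_mapping_eqI, simp add: lookup_add algebra_simps)+)
qed

subsection \<open>Linear maps and spanning sets\<close>

definition lin_map :: "('k::field, 'a) module \<Rightarrow> ('k, 'b) module \<Rightarrow> ('a \<Rightarrow> 'b) \<Rightarrow> bool" where
  "lin_map A B h \<longleftrightarrow> (\<forall>x\<in>carrier A. h x \<in> carrier B) \<and>
     (\<forall>x\<in>carrier A. \<forall>y\<in>carrier A. h (x \<oplus>\<^bsub>A\<^esub> y) = h x \<oplus>\<^bsub>B\<^esub> h y) \<and>
     (\<forall>c. \<forall>x\<in>carrier A. h (c \<odot>\<^bsub>A\<^esub> x) = c \<odot>\<^bsub>B\<^esub> h x)"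

lemma lin_mapD:
  assumes "lin_map A B h"
  shows "x \<in> carrier A \<Longrightarrow> h x \<in> carrier B"
    "x \<in> carrier A \<Longrightarrow> y \<in> carrier A \<Longrightarrow> h (x \<oplus>\<^bsub>A\<^esub> y) = h x \<oplus>\<^bsub>B\<^esub> h y"
    "x \<in> carrier A \<Longrightarrow> h (c \<odot>\<^bsub>A\<^esub> x) = c \<odot>\<^bsub>B\<^esub> h x"
  using assms by (auto simp: lin_map_def)

lemma lin_mapI:
  assumes "\<And>x. x \<in> carrier A \<Longrightarrow> h x \<in> carrier B"
    "\<And>x y. x \<in> carrier A \<Longrightarrow> y \<in> carrier A \<Longrightarrow> h (x \<oplus>\<^bsub>A\<^esub> y) = h x \<oplus>\<^bsub>B\<^esub> h y"
    "\<And>c x. x \<in> carrier A \<Longrightarrow> h (c \<odot>\<^bsub>A\<^esub> x) = c \<odot>\<^bsub>B\<^esub> h x"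
  shows "lin_map A B h"
  using assms by (auto simp: lin_map_def)

lemma alg_hom_lin_map: "h \<in> alg_hom A B \<Longrightarrow> lin_map A B h"
  by (auto simp: alg_hom_def ring_hom_def lin_map_def)

lemma lin_map_zero:
  assumes "lin_map A B h" "kalg A" "kalg B"
  shows "h \<zero>\<^bsub>A\<^esub> = \<zero>\<^bsub>B\<^esub>"
proof -
  interpret A: kalg A by fact
  interpret B: kalg B by fact
  show ?thesis
    using lin_mapD(3)[OF assms(1), of "\<zero>\<^bsub>A\<^esub>" 0] lin_mapD(1)[OF assms(1), of "\<zero>\<^bsub>A\<^esub>"] by simp
qed

lemma lin_map_minus:
  assumes "lin_map A B h" "kalg A" "kalg B" "x \<in> carrier A" "y \<in> carrier A"
  shows "h (x \<ominus>\<^bsub>A\<^esub> y) = h x \<ominus>\<^bsub>B\<^esub> h y"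
proof -
  interpret A: kalg A by fact
  interpret B: kalg B by fact
  show ?thesis
    using assms(4,5) by (simp add: A.a_minus_smult B.a_minus_smult lin_mapD[OF assms(1)])
qed

lemma lin_map_comp: "lin_map A B f \<Longrightarrow> lin_map B C g \<Longrightarrow> lin_map A C (\<lambda>x. g (f x))"
  by (simp add: lin_map_def)

text \<open>
  Spanning is stated through submodules rather than finite linear combinations because that is the
  form in which it is used: a property that is closed under linear combinations and holds on \<open>G\<close>
  holds everywhere.
\<close>

definition spans :: "('k::field, 'a) module \<Rightarrow> 'a set \<Rightarrow> bool" where
  "spans A G \<longleftrightarrow> G \<subseteq> carrier A \<and>
    (\<forall>N. submodule N (ring_of_type_algebra :: 'k ring) A \<longrightarrow> G \<subseteq> N \<longrightarrow> carrier A \<subseteq> N)"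

lemma (in kalg) spans_induct [consumes 2, case_names zero add smult gen]:
  assumes "spans A G" "x \<in> carrier A"
    and "P \<zero>"
    and "\<And>x y. x \<in> carrier A \<Longrightarrow> y \<in> carrier A \<Longrightarrow> P x \<Longrightarrow> P y \<Longrightarrow> P (x \<oplus> y)"
    and "\<And>c x. x \<in> carrier A \<Longrightarrow> P x \<Longrightarrow> P (c \<odot> x)"
    and "\<And>g. g \<in> G \<Longrightarrow> P g"
  shows "P x"
proof -
  have "submodule {x \<in> carrier A. P x} (ring_of_type_algebra :: 'k ring) A"
    by (rule submoduleI) (use assms in auto)
  with assms(1,2,6) show ?thesis unfolding spans_def by blast
qed

text \<open>
  Both sides of \<open>h (x y) = h x h y\<close> are bilinear in \<open>x\<close> and \<open>y\<close>, so a spanning set suffices.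
\<close>

lemma lin_map_alg_hom:
  assumes G: "spans A G" and "kalg A" "kalg B" and h: "lin_map A B h"
    and one: "h \<one>\<^bsub>A\<^esub> = \<one>\<^bsub>B\<^esub>"
    and mult: "\<And>x y. x \<in> G \<Longrightarrow> y \<in> G \<Longrightarrow> h (x \<otimes>\<^bsub>A\<^esub> y) = h x \<otimes>\<^bsub>B\<^esub> h y"
  shows "h \<in> alg_hom A B"
proof -
  interpret A: kalg A by fact
  interpret B: kalg B by fact
  note hs [simp] = lin_mapD[OF h] lin_map_zero[OF h \<open>kalg A\<close> \<open>kalg B\<close>]
  have Gc [simp]: "x \<in> carrier A" if "x \<in> G" for x using G that by (auto simp: spans_def)
  have 1: "h (x \<otimes>\<^bsub>A\<^esub> y) = h x \<otimes>\<^bsub>B\<^esub> h y" if "x \<in> G" "y \<in> carrier A" for x y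
    using G that(2) by (induction rule: A.spans_induct)
      (use that(1) in \<open>simp_all add: A.r_distr B.r_distr mult\<close>)
  have 2: "h (x \<otimes>\<^bsub>A\<^esub> y) = h x \<otimes>\<^bsub>B\<^esub> h y" if "x \<in> carrier A" "y \<in> carrier A" for x y
    using G that(1) by (induction rule: A.spans_induct)
      (use that(2) in \<open>simp_all add: A.l_distr B.l_distr 1\<close>)
  show ?thesis by (rule alg_homI) (simp_all add: 2 one)
qed

lemma (in kalg) lin_ext_lin_map:
  assumes "f \<in> S \<rightarrow> carrier A"
  shows "lin_map (pm_algebra S M o1) A (lin_ext A f)"
  using assms by (auto intro!: lin_mapI simp: lin_ext_add lin_ext_smult)

lemma pm_algebra_spans:
  assumes "k_algebra (pm_algebra S M o1)"
  shows "spans (pm_algebra S M o1) ((\<lambda>p. Poly_Mapping.single p 1) ` S)"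
proof -
  interpret kalg "pm_algebra S M o1" using assms by (simp add: kalg_def)
  have "t \<in> N" if N: "submodule N (ring_of_type_algebra :: 'b ring) (pm_algebra S M o1)"
    "(\<lambda>p. Poly_Mapping.single p 1) ` S \<subseteq> N" "Poly_Mapping.keys t \<subseteq> S" for N t
    using that(3)
  proof (induction rule: keys_subset_induct)
    case (add p c t)
    have "Poly_Mapping.single p c = Poly_Mapping.map ((*) c) (Poly_Mapping.single p 1)"
      by (rule poly_mapping_eqI) (simp add: lookup_single when_def)
    moreover have "Poly_Mapping.single p 1 \<in> N" using N(2) add(1) by auto
    then have "c \<odot>\<^bsub>pm_algebra S M o1\<^esub> Poly_Mapping.single p 1 \<in> N" using N(1) unfolding submodule_iff by blast
    ultimately have "Poly_Mapping.single p c \<in> N" by simp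
    then show ?case using N(1) add(3) by (simp add: submodule_iff)
  qed (use N in \<open>auto simp: submodule_iff\<close>)
  then show ?thesis by (auto simp: spans_def)
qed

subsection \<open>The free algebra\<close>

lemma single_zero_one: "Poly_Mapping.single (0 :: 'w::zero) (1::'k::zero_neq_one) = 1"
  by simp

lemma free_algebra_pm: "free_algebra I = pm_algebra {w. set w \<subseteq> gens I} (*) 1"
  by (auto simp: free_algebra_def pm_algebra_def)

lemma k_algebra_free: "k_algebra (free_algebra I :: ('k::field, 'k fa) module)"
  unfolding free_algebra_pm
proof (rule k_algebra_pm_algebra)
  show "Poly_Mapping.map ((*) c) t * u = Poly_Mapping.map ((*) c) (t * u)" for c and t u :: "'k fa"
    by (simp add: mult_map_scale_conv_mult mult.assoc)
  have comm: "Poly_Mapping.single 0 c * t = t * Poly_Mapping.single 0 c" for c and t :: "'k fa"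
  proof -
    have "Poly_Mapping.keys t \<subseteq> UNIV" by simp
    then show ?thesis by (induction rule: keys_subset_induct) (auto simp: algebra_simps mult_single)
  qed
  show "t * Poly_Mapping.map ((*) c) u = Poly_Mapping.map ((*) c) (t * u)" for c and t u :: "'k fa"
    unfolding mult_map_scale_conv_mult mult.assoc[symmetric] comm[of c t] ..
qed (auto simp: algebra_simps mult_single plus_list_def zero_list_def simp del: single_one simp flip: single_zero_one)

lemma free_lift_eq: "free_lift B \<phi> = lin_ext B (\<lambda>w. foldr (\<lambda>g b. \<phi> g \<otimes>\<^bsub>B\<^esub> b) w \<one>\<^bsub>B\<^esub>)"
  by (simp add: free_lift_def lin_ext_def fun_eq_iff)

context
  fixes B :: "('k::field, 'b) module" and I and \<phi> :: "gen \<Rightarrow> 'b"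
  assumes B: "k_algebra B" and \<phi>: "\<phi> \<in> gens I \<rightarrow> carrier B"
begin

interpretation B: kalg B using B by (simp add: kalg_def)

lemma free_word_closed: "set w \<subseteq> gens I \<Longrightarrow> foldr (\<lambda>g b. \<phi> g \<otimes>\<^bsub>B\<^esub> b) w \<one>\<^bsub>B\<^esub> \<in> carrier B"
  using \<phi> by (induction w) auto

lemma free_word_append: "set w \<subseteq> gens I \<Longrightarrow> set v \<subseteq> gens I \<Longrightarrow>
  foldr (\<lambda>g b. \<phi> g \<otimes>\<^bsub>B\<^esub> b) (w @ v) \<one>\<^bsub>B\<^esub>
   = foldr (\<lambda>g b. \<phi> g \<otimes>\<^bsub>B\<^esub> b) w \<one>\<^bsub>B\<^esub> \<otimes>\<^bsub>B\<^esub> foldr (\<lambda>g b. \<phi> g \<otimes>\<^bsub>B\<^esub> b) v \<one>\<^bsub>B\<^esub>"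
  using \<phi> by (induction w) (auto simp: B.m_assoc Pi_iff free_word_closed simp del: foldr_append)

lemma free_lift_single:
  "set w \<subseteq> gens I \<Longrightarrow> free_lift B \<phi> (Poly_Mapping.single w c) = c \<odot>\<^bsub>B\<^esub> foldr (\<lambda>g b. \<phi> g \<otimes>\<^bsub>B\<^esub> b) w \<one>\<^bsub>B\<^esub>"
  unfolding free_lift_eq by (rule B.lin_ext_single) (rule free_word_closed)

lemma free_lift_gvar: "g \<in> gens I \<Longrightarrow> free_lift B \<phi> (gvar g) = \<phi> g"
  using \<phi> by (subst free_lift_single) (auto simp: Pi_iff)

lemma free_lift_hom: "free_lift B \<phi> \<in> alg_hom (free_algebra I) B"
proof (rule lin_map_alg_hom)
  let ?W = "{w. set w \<subseteq> gens I}"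
  show "spans (free_algebra I) ((\<lambda>p. Poly_Mapping.single p (1::'k)) ` ?W)"
    unfolding free_algebra_pm by (rule pm_algebra_spans) (use k_algebra_free in \<open>simp add: free_algebra_pm\<close>)
  show "kalg (free_algebra I :: ('k, 'k fa) module)" "kalg B" using k_algebra_free B by (simp_all add: kalg_def)
  show "lin_map (free_algebra I) B (free_lift B \<phi>)"
    unfolding free_algebra_pm free_lift_eq by (rule B.lin_ext_lin_map) (auto intro: free_word_closed)
  show "free_lift B \<phi> \<one>\<^bsub>free_algebra I\<^esub> = \<one>\<^bsub>B\<^esub>"
  proof -
    have "(1 :: 'k fa) = Poly_Mapping.single [] 1" by (simp flip: zero_list_def)
    then show ?thesis using free_lift_single[of "[]" 1] by (simp add: free_algebra_pm)
  qed
  show "free_lift B \<phi> (x \<otimes>\<^bsub>free_algebra I\<^esub> y) = free_lift B \<phi> x \<otimes>\<^bsub>B\<^esub> free_lift B \<phi> y"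
    if "x \<in> (\<lambda>p. Poly_Mapping.single p 1) ` ?W" "y \<in> (\<lambda>p. Poly_Mapping.single p 1) ` ?W" for x y
    using that by (auto simp: free_algebra_pm mult_single plus_list_def free_lift_single
        free_word_append free_word_closed simp del: foldr_append)
qed

end

subsection \<open>Quotients\<close>

text \<open>
  A surjection that respects all operations carries the algebra axioms along. It is applied to the
  projection onto a quotient.
\<close>

lemma k_algebra_image:
  fixes A :: "('k::field, 'a) module" and Q :: "('k, 'b) module"
  assumes "k_algebra A" and car: "carrier Q = q ` carrier A"
    and add: "\<And>x y. x \<in> carrier A \<Longrightarrow> y \<in> carrier A \<Longrightarrow> q x \<oplus>\<^bsub>Q\<^esub> q y = q (x \<oplus>\<^bsub>A\<^esub> y)"
    and mult: "\<And>x y. x \<in> carrier A \<Longrightarrow> y \<in> carrier A \<Longrightarrow> q x \<otimes>\<^bsub>Q\<^esub> q y = q (x \<otimes>\<^bsub>A\<^esub> y)"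
    and smult: "\<And>c x. x \<in> carrier A \<Longrightarrow> c \<odot>\<^bsub>Q\<^esub> q x = q (c \<odot>\<^bsub>A\<^esub> x)"
    and zero: "\<zero>\<^bsub>Q\<^esub> = q \<zero>\<^bsub>A\<^esub>" and one: "\<one>\<^bsub>Q\<^esub> = q \<one>\<^bsub>A\<^esub>"
  shows "k_algebra Q" "q \<in> alg_hom A Q"
proof -
  interpret A: kalg A using assms(1) by (simp add: kalg_def)
  have cl: "q x \<in> carrier Q" if "x \<in> carrier A" for x using that unfolding car by (rule imageI)
  note ops = cl add mult smult zero one
  show "k_algebra Q"
  proof (rule k_algebraI)
    show "abelian_group Q"
    proof (rule abelian_groupI, unfold car, safe)
      show "\<exists>y\<in>q ` carrier A. y \<oplus>\<^bsub>Q\<^esub> q x = \<zero>\<^bsub>Q\<^esub>" if "x \<in> carrier A" for x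
        by (rule bexI[of _ "q (\<ominus>\<^bsub>A\<^esub> x)"]) (simp_all add: that ops A.l_neg)
    qed (simp_all add: ops imageI A.a_assoc, simp add: A.a_comm)
    show "monoid Q" by (rule monoidI, unfold car, safe) (simp_all add: ops imageI A.m_assoc)
  qed (unfold car, safe, simp_all add: ops imageI A.l_distr A.r_distr A.smult_l_distr A.smult_r_distr)
  show "q \<in> alg_hom A Q" by (rule alg_homI) (simp_all add: ops)
qed

locale kalg_ideal = kalg A + ideal N A for A :: "('k::field, 'a) module" (structure) and N
begin

text \<open>
  A ring ideal is a subspace, since \<open>c x = (c 1) x\<close>.
\<close>

lemma smult_ideal: "x \<in> N \<Longrightarrow> c \<odot> x \<in> N"
  using I_l_closed[of x "c \<odot> \<one>"] a_subset by (auto simp: subset_iff)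

lemma coset_eq_iff: "x \<in> carrier A \<Longrightarrow> y \<in> carrier A \<Longrightarrow> N +> x = N +> y \<longleftrightarrow> x \<ominus> y \<in> N"
  using quotient_eq_iff_same_a_r_cos[OF is_ideal] by blast

lemma quot_alg_k_algebra: "k_algebra (quot_alg A N)"
  and quot_alg_proj: "(\<lambda>x. N +> x) \<in> alg_hom A (quot_alg A N)"
proof -
  have smult: "(\<Union>x\<in>N +> y. N +> (c \<odot> x)) = N +> (c \<odot> y)" if y: "y \<in> carrier A" for c y
  proof -
    have "N +> (c \<odot> x) = N +> (c \<odot> y)" if "x \<in> N +> y" for x
    proof -
      obtain n where n: "n \<in> N" "x = n \<oplus> y" using \<open>x \<in> N +> y\<close> by (auto simp: a_r_coset_def r_coset_def)
      then have nc: "n \<in> carrier A" using a_subset by auto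
      have "c \<odot> x \<ominus> c \<odot> y = c \<odot> n"
        using n nc y by (simp add: smult_r_distr minus_eq a_assoc r_neg)
      with n nc y show ?thesis by (simp add: coset_eq_iff smult_ideal)
    qed
    moreover have "y \<in> N +> y" using y by (rule a_rcos_self)
    ultimately show ?thesis by blast
  qed
  have car: "carrier (quot_alg A N) = (\<lambda>x. N +> x) ` carrier A"
    by (auto simp: quot_alg_def A_RCOSETS_def RCOSETS_def a_r_coset_def)
  note * = k_algebra_image[where Q = "quot_alg A N" and q = "\<lambda>x. N +> x", OF k_algebra car]
  have z: "\<zero>\<^bsub>quot_alg A N\<^esub> = N +> \<zero>" using a_rcos_const[of \<zero>] additive_subgroup.zero_closed[OF additive_subgroup_axioms] by (simp add: quot_alg_def)
  have s: "c \<odot>\<^bsub>quot_alg A N\<^esub> (N +> x) = N +> (c \<odot> x)" if "x \<in> carrier A" for c x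
    using smult that by (simp add: quot_alg_def)
  show "k_algebra (quot_alg A N)"
    by (rule *(1)[OF _ _ s z]) (simp_all add: quot_alg_def a_rcos_sum rcoset_mult_add)
  show "(\<lambda>x. N +> x) \<in> alg_hom A (quot_alg A N)"
    by (rule *(2)[OF _ _ s z]) (simp_all add: quot_alg_def a_rcos_sum rcoset_mult_add)
qed

lemma quot_alg_carrier: "carrier (quot_alg A N) = (\<lambda>x. N +> x) ` carrier A"
    by (auto simp: quot_alg_def A_RCOSETS_def RCOSETS_def a_r_coset_def)

text \<open>
  A linear map that vanishes on \<open>N\<close> is constant on each coset. This is how maps defined by \<open>the_elem\<close>
  of an image, like \<open>tensor_lift\<close> and \<open>induced_hom\<close>, are evaluated.
\<close>

lemma the_elem_coset:
  assumes "kalg B" "lin_map A B h" "\<And>n. n \<in> N \<Longrightarrow> h n = \<zero>\<^bsub>B\<^esub>" "x \<in> carrier A"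
  shows "the_elem (h ` (N +> x)) = h x"
proof -
  interpret B: kalg B by fact
  have "h y = h x" if y: "y \<in> N +> x" for y
  proof -
    obtain n where "n \<in> N" "y = n \<oplus> x" using y by (auto simp: a_r_coset_def r_coset_def)
    then show ?thesis
      using assms(3,4) a_subset lin_mapD(1)[OF assms(2,4)] lin_mapD(2)[OF assms(2), of n x] by auto
  qed
  moreover have "x \<in> N +> x" using assms(4) by (rule a_rcos_self)
  ultimately have "h ` (N +> x) = {h x}" by blast
  then show ?thesis by simp
qed

end

subsection \<open>Tensor products\<close>

definition bilinear_map :: "('k::field, 'a) module \<Rightarrow> ('k, 'b) module \<Rightarrow> ('k, 'c) module \<Rightarrow> ('a \<Rightarrow> 'b \<Rightarrow> 'c) \<Rightarrow> bool" where
  "bilinear_map V W Z \<beta> \<longleftrightarrow> (\<forall>y\<in>carrier W. lin_map V Z (\<lambda>x. \<beta> x y)) \<and> (\<forall>x\<in>carrier V. lin_map W Z (\<beta> x))"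

lemma bilinear_mapD:
  assumes "bilinear_map V W Z \<beta>"
  shows "x \<in> carrier V \<Longrightarrow> y \<in> carrier W \<Longrightarrow> \<beta> x y \<in> carrier Z"
    "x \<in> carrier V \<Longrightarrow> x' \<in> carrier V \<Longrightarrow> y \<in> carrier W \<Longrightarrow> \<beta> (x \<oplus>\<^bsub>V\<^esub> x') y = \<beta> x y \<oplus>\<^bsub>Z\<^esub> \<beta> x' y"
    "x \<in> carrier V \<Longrightarrow> y \<in> carrier W \<Longrightarrow> y' \<in> carrier W \<Longrightarrow> \<beta> x (y \<oplus>\<^bsub>W\<^esub> y') = \<beta> x y \<oplus>\<^bsub>Z\<^esub> \<beta> x y'"
    "x \<in> carrier V \<Longrightarrow> y \<in> carrier W \<Longrightarrow> \<beta> (c \<odot>\<^bsub>V\<^esub> x) y = c \<odot>\<^bsub>Z\<^esub> \<beta> x y"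
    "x \<in> carrier V \<Longrightarrow> y \<in> carrier W \<Longrightarrow> \<beta> x (c \<odot>\<^bsub>W\<^esub> y) = c \<odot>\<^bsub>Z\<^esub> \<beta> x y"
  using assms by (simp_all add: bilinear_map_def lin_map_def)

lemma bilinear_mapI:
  assumes "\<And>x y. x \<in> carrier V \<Longrightarrow> y \<in> carrier W \<Longrightarrow> \<beta> x y \<in> carrier Z"
    "\<And>x x' y. x \<in> carrier V \<Longrightarrow> x' \<in> carrier V \<Longrightarrow> y \<in> carrier W \<Longrightarrow> \<beta> (x \<oplus>\<^bsub>V\<^esub> x') y = \<beta> x y \<oplus>\<^bsub>Z\<^esub> \<beta> x' y"
    "\<And>x y y'. x \<in> carrier V \<Longrightarrow> y \<in> carrier W \<Longrightarrow> y' \<in> carrier W \<Longrightarrow> \<beta> x (y \<oplus>\<^bsub>W\<^esub> y') = \<beta> x y \<oplus>\<^bsub>Z\<^esub> \<beta> x y'"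
    "\<And>x y c. x \<in> carrier V \<Longrightarrow> y \<in> carrier W \<Longrightarrow> \<beta> (c \<odot>\<^bsub>V\<^esub> x) y = c \<odot>\<^bsub>Z\<^esub> \<beta> x y"
    "\<And>x y c. x \<in> carrier V \<Longrightarrow> y \<in> carrier W \<Longrightarrow> \<beta> x (c \<odot>\<^bsub>W\<^esub> y) = c \<odot>\<^bsub>Z\<^esub> \<beta> x y"
  shows "bilinear_map V W Z \<beta>"
  using assms by (simp add: bilinear_map_def lin_map_def)

text \<open>
  The bilinear extension of a map \<open>f\<close> of bases. The multiplication of the pair algebra has this form.
\<close>

definition pm_bilinear :: "('p \<Rightarrow> 'r \<Rightarrow> 's) \<Rightarrow> ('p \<Rightarrow>\<^sub>0 'k::field) \<Rightarrow> ('r \<Rightarrow>\<^sub>0 'k) \<Rightarrow> ('s \<Rightarrow>\<^sub>0 'k)" where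
  "pm_bilinear f t u = (\<Sum>p\<in>Poly_Mapping.keys t. \<Sum>r\<in>Poly_Mapping.keys u.
     Poly_Mapping.single (f p r) (Poly_Mapping.lookup t p * Poly_Mapping.lookup u r))"

lemma pm_bilinear_superset:
  assumes "finite T" "finite U" "Poly_Mapping.keys t \<subseteq> T" "Poly_Mapping.keys u \<subseteq> U"
  shows "pm_bilinear f t u = (\<Sum>p\<in>T. \<Sum>r\<in>U.
     Poly_Mapping.single (f p r) (Poly_Mapping.lookup t p * Poly_Mapping.lookup u r))"
proof -
  let ?g = "\<lambda>p r. Poly_Mapping.single (f p r) (Poly_Mapping.lookup t p * Poly_Mapping.lookup u r)"
  have g0: "?g p r = 0" if "p \<notin> Poly_Mapping.keys t \<or> r \<notin> Poly_Mapping.keys u" for p r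
    using that unfolding not_in_keys_iff_lookup_eq_zero by (elim disjE) simp_all
  have "(\<Sum>r\<in>Poly_Mapping.keys u. ?g p r) = (\<Sum>r\<in>U. ?g p r)" for p
    by (rule sum.mono_neutral_left[OF assms(2,4)]) (blast intro: g0)
  moreover have "(\<Sum>p\<in>Poly_Mapping.keys t. \<Sum>r\<in>U. ?g p r) = (\<Sum>p\<in>T. \<Sum>r\<in>U. ?g p r)"
    by (rule sum.mono_neutral_left[OF assms(1,3)]) (auto intro!: sum.neutral g0)
  ultimately show ?thesis unfolding pm_bilinear_def by simp
qed

lemma pm_bilinear_add_left: "pm_bilinear f (t + u) v = pm_bilinear f t v + pm_bilinear f u v"
proof -
  let ?T = "Poly_Mapping.keys t \<union> Poly_Mapping.keys u"
  note s = pm_bilinear_superset[of ?T "Poly_Mapping.keys v"]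
  show ?thesis
    by (subst (1 2 3) s) (auto simp: keys_add lookup_add distrib_right single_add sum.distrib)
qed

lemma pm_bilinear_add_right: "pm_bilinear f v (t + u) = pm_bilinear f v t + pm_bilinear f v u"
proof -
  let ?T = "Poly_Mapping.keys t \<union> Poly_Mapping.keys u"
  note s = pm_bilinear_superset[of "Poly_Mapping.keys v" ?T]
  show ?thesis
    by (subst (1 2 3) s) (auto simp: keys_add lookup_add distrib_left single_add sum.distrib)
qed

lemma map_mult_sum: "Poly_Mapping.map ((*) c) (sum g A) = (\<Sum>a\<in>A. Poly_Mapping.map ((*) c) (g a))" for c :: "'k::field"
  by (rule poly_mapping_eqI) (simp add: lookup_sum sum_distrib_left)

lemma pm_bilinear_smult_left: "pm_bilinear f (Poly_Mapping.map ((*) c) t) v = Poly_Mapping.map ((*) c) (pm_bilinear f t v)"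
  by (subst pm_bilinear_superset[of "Poly_Mapping.keys t" "Poly_Mapping.keys v"])
    (auto simp: pm_bilinear_def map_mult_sum keys_map_mult mult.assoc intro: subsetD[OF keys_map_mult])

lemma pm_bilinear_smult_right: "pm_bilinear f v (Poly_Mapping.map ((*) c) t) = Poly_Mapping.map ((*) c) (pm_bilinear f v t)"
  by (subst pm_bilinear_superset[of "Poly_Mapping.keys v" "Poly_Mapping.keys t"])
    (auto simp: pm_bilinear_def map_mult_sum keys_map_mult mult.left_commute intro: subsetD[OF keys_map_mult])

lemma pm_bilinear_single [simp]:
  "pm_bilinear f (Poly_Mapping.single p a) (Poly_Mapping.single r b) = Poly_Mapping.single (f p r) (a * b)"
  by (simp add: pm_bilinear_def)

locale kalg2 = V: kalg V + W: kalg W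
  for V :: "('k::field, 'a) module" and W :: "('k, 'b) module"
begin

abbreviation "PA \<equiv> pair_algebra V W"
abbreviation "pmult \<equiv> pm_bilinear (\<lambda>p r. (fst p \<otimes>\<^bsub>V\<^esub> fst r, snd p \<otimes>\<^bsub>W\<^esub> snd r)) :: _ \<Rightarrow> _ \<Rightarrow> ('a \<times> 'b) \<Rightarrow>\<^sub>0 'k"

lemma pair_algebra_pm:
  "PA = pm_algebra (carrier V \<times> carrier W) pmult (Poly_Mapping.single (\<one>\<^bsub>V\<^esub>, \<one>\<^bsub>W\<^esub>) 1)"
  by (simp add: pair_algebra_def pm_algebra_def pm_bilinear_def fun_eq_iff)

lemma k_algebra_pair: "k_algebra PA"
  unfolding pair_algebra_pm
  by (rule k_algebra_pm_algebra)
    (auto simp: pm_bilinear_add_left pm_bilinear_add_right pm_bilinear_smult_left pm_bilinear_smult_right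
       V.m_assoc W.m_assoc)

lemma pair_spans: "spans PA ((\<lambda>p. Poly_Mapping.single p 1) ` (carrier V \<times> carrier W))"
  using pm_algebra_spans k_algebra_pair unfolding pair_algebra_pm .

lemma pair_simps:
  "\<zero>\<^bsub>PA\<^esub> = 0" "\<one>\<^bsub>PA\<^esub> = Poly_Mapping.single (\<one>\<^bsub>V\<^esub>, \<one>\<^bsub>W\<^esub>) 1" "x \<oplus>\<^bsub>PA\<^esub> y = x + y"
  "c \<odot>\<^bsub>PA\<^esub> x = Poly_Mapping.map ((*) c) x" "x \<otimes>\<^bsub>PA\<^esub> y = pmult x y"
  "x \<in> carrier PA \<longleftrightarrow> Poly_Mapping.keys x \<subseteq> carrier V \<times> carrier W"
  by (simp_all add: pair_algebra_pm)

interpretation P: kalg "pair_algebra V W" using k_algebra_pair by (simp add: kalg_def)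

lemma pair_minus: "x \<in> carrier PA \<Longrightarrow> y \<in> carrier PA \<Longrightarrow> x \<ominus>\<^bsub>PA\<^esub> y = x - y"
  by (subst P.a_minus_smult) (auto simp: pair_simps lookup_add lookup_minus intro!: poly_mapping_eqI)

abbreviation "TK \<equiv> tensor_kernel V W"
abbreviation "TT \<equiv> tensor V W"
abbreviation "pt \<equiv> pure_tensor V W"

lemma relation_cases:
  assumes "r \<in> bilinear_relations V W"
  obtains (1) x x' y where "x \<in> carrier V" "x' \<in> carrier V" "y \<in> carrier W"
      "r = Poly_Mapping.single (x \<oplus>\<^bsub>V\<^esub> x', y) 1 - Poly_Mapping.single (x, y) 1 - Poly_Mapping.single (x', y) 1"
  | (2) x y y' where "x \<in> carrier V" "y \<in> carrier W" "y' \<in> carrier W"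
      "r = Poly_Mapping.single (x, y \<oplus>\<^bsub>W\<^esub> y') 1 - Poly_Mapping.single (x, y) 1 - Poly_Mapping.single (x, y') 1"
  | (3) c x y where "x \<in> carrier V" "y \<in> carrier W"
      "r = Poly_Mapping.single (c \<odot>\<^bsub>V\<^esub> x, y) 1 - Poly_Mapping.single (x, y) c"
  | (4) c x y where "x \<in> carrier V" "y \<in> carrier W"
      "r = Poly_Mapping.single (x, c \<odot>\<^bsub>W\<^esub> y) 1 - Poly_Mapping.single (x, y) c"
  using assms unfolding bilinear_relations_def
proof (elim UnE CollectE exE conjE)
qed (rule 1 2 3 4; assumption)+

lemma single_pair_closed: "x \<in> carrier V \<Longrightarrow> y \<in> carrier W \<Longrightarrow> Poly_Mapping.single (x, y) c \<in> carrier PA"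
  by (simp add: pair_algebra_pm)

lemma diff_pair_closed: "x \<in> carrier PA \<Longrightarrow> y \<in> carrier PA \<Longrightarrow> x - y \<in> carrier PA"
  using P.minus_closed[of x y] pair_minus[of x y] by metis

lemma bilinear_relations_carrier: "bilinear_relations V W \<subseteq> carrier PA"
proof
  fix r assume "r \<in> bilinear_relations V W"
  then show "r \<in> carrier PA"
  proof (cases rule: relation_cases)
    case 1 then show ?thesis by (metis diff_pair_closed single_pair_closed V.a_closed)
  next
    case 2 then show ?thesis by (metis diff_pair_closed single_pair_closed W.a_closed)
  next
    case 3 then show ?thesis by (metis diff_pair_closed single_pair_closed V.smult_closed)
  next
    case 4 then show ?thesis by (metis diff_pair_closed single_pair_closed W.smult_closed)
  qed
qed

lemma tensor_kernel_submodule: "submodule TK (ring_of_type_algebra :: 'k ring) PA"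
  unfolding tensor_kernel_def hull_def
  by (rule P.submodule_Inter) (use module.carrier_is_submodule[OF P.module_A] bilinear_relations_carrier in auto)

lemma tensor_kernel_relations: "r \<in> bilinear_relations V W \<Longrightarrow> r \<in> TK"
  unfolding tensor_kernel_def by (rule hull_inc)

lemma tensor_kernel_minimal:
  assumes "submodule N (ring_of_type_algebra :: 'k ring) PA" "bilinear_relations V W \<subseteq> N"
  shows "TK \<subseteq> N"
  unfolding tensor_kernel_def by (rule hull_minimal) (use assms in auto)

lemma pm_bilinear_minus_left: "pm_bilinear f (t - u) v = pm_bilinear f t v - pm_bilinear f u v"
  using pm_bilinear_add_left[of f "t - u" u v] by simp

lemma pm_bilinear_minus_right: "pm_bilinear f v (t - u) = pm_bilinear f v t - pm_bilinear f v u"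
  using pm_bilinear_add_right[of f v "t - u" u] by simp

lemma relationI:
  "x \<in> carrier V \<Longrightarrow> x' \<in> carrier V \<Longrightarrow> y \<in> carrier W \<Longrightarrow>
    Poly_Mapping.single (x \<oplus>\<^bsub>V\<^esub> x', y) 1 - Poly_Mapping.single (x, y) 1 - Poly_Mapping.single (x', y) 1 \<in> bilinear_relations V W"
  "x \<in> carrier V \<Longrightarrow> y \<in> carrier W \<Longrightarrow> y' \<in> carrier W \<Longrightarrow>
    Poly_Mapping.single (x, y \<oplus>\<^bsub>W\<^esub> y') 1 - Poly_Mapping.single (x, y) 1 - Poly_Mapping.single (x, y') 1 \<in> bilinear_relations V W"
  "x \<in> carrier V \<Longrightarrow> y \<in> carrier W \<Longrightarrow>
    Poly_Mapping.single (c \<odot>\<^bsub>V\<^esub> x, y) 1 - Poly_Mapping.single (x, y) c \<in> bilinear_relations V W"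
  "x \<in> carrier V \<Longrightarrow> y \<in> carrier W \<Longrightarrow>
    Poly_Mapping.single (x, c \<odot>\<^bsub>W\<^esub> y) 1 - Poly_Mapping.single (x, y) c \<in> bilinear_relations V W"
  unfolding bilinear_relations_def by blast+

text \<open>
  Multiplying a bilinearity relation by a basis element gives a bilinearity relation again. Hence the
  subspace spanned by them is already a two-sided ideal.
\<close>

lemma relation_mult:
  assumes "r \<in> bilinear_relations V W" "a \<in> carrier V" "b \<in> carrier W"
  shows "pmult r (Poly_Mapping.single (a, b) 1) \<in> bilinear_relations V W"
    "pmult (Poly_Mapping.single (a, b) 1) r \<in> bilinear_relations V W"
  using assms(1)
  by (cases rule: relation_cases;
      use assms(2,3) in \<open>simp add: pm_bilinear_minus_left pm_bilinear_minus_right V.l_distr V.r_distr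
        W.l_distr W.r_distr relationI del: single_one\<close>)+

lemma tensor_kernel_ideal: "ideal TK PA"
proof (rule idealI)
  note sub = tensor_kernel_submodule
  note subE = sub[unfolded P.submodule_iff]
  have TK0: "0 \<in> TK" and TKa: "\<And>x y. x \<in> TK \<Longrightarrow> y \<in> TK \<Longrightarrow> x + y \<in> TK"
    and TKs: "\<And>c x. x \<in> TK \<Longrightarrow> Poly_Mapping.map ((*) c) x \<in> TK" and TKc: "TK \<subseteq> carrier PA"
    using subE unfolding pair_simps by blast+
  show "ring PA" by (rule P.ring_axioms)
  show "subgroup TK (add_monoid PA)" using sub by (simp add: submodule_def)
  have genK: "pmult a (Poly_Mapping.single p 1) \<in> TK \<and> pmult (Poly_Mapping.single p 1) a \<in> TK"
    if "a \<in> TK" "p \<in> carrier V \<times> carrier W" for a p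
  proof -
    let ?N = "{a \<in> TK. pmult a (Poly_Mapping.single p 1) \<in> TK \<and> pmult (Poly_Mapping.single p 1) a \<in> TK}"
    have z: "pmult 0 x = 0" "pmult x 0 = 0" for x by (simp_all add: pm_bilinear_def)
    have "submodule ?N (ring_of_type_algebra :: 'k ring) PA"
    proof (rule P.submoduleI)
      show "?N \<subseteq> carrier PA" using TKc by blast
    qed (simp_all only: pair_simps z mem_Collect_eq TK0 TKa TKs simp_thms pm_bilinear_add_left
        pm_bilinear_add_right pm_bilinear_smult_left pm_bilinear_smult_right)
    moreover have "bilinear_relations V W \<subseteq> ?N"
      using that(2) by (auto intro!: tensor_kernel_relations relation_mult)
    ultimately show ?thesis using tensor_kernel_minimal that(1) by blast
  qed
  have all: "pmult a x \<in> TK \<and> pmult x a \<in> TK" if a: "a \<in> TK" and "x \<in> carrier PA" for a x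
    using pair_spans that(2)
  proof (induction rule: P.spans_induct)
    case zero
    show ?case using subE by (simp add: pair_simps pm_bilinear_def)
  next
    case (add x y)
    then show ?case using subE by (simp add: pair_simps pm_bilinear_add_left pm_bilinear_add_right)
  next
    case (smult c x)
    then show ?case using subE by (simp add: pair_simps pm_bilinear_smult_left pm_bilinear_smult_right)
  next
    case (gen g)
    then obtain p where p: "p \<in> carrier V \<times> carrier W" and g: "g = Poly_Mapping.single p 1" by blast
    show ?case unfolding g by (rule genK[OF a p])
  qed
  show "x \<otimes>\<^bsub>PA\<^esub> a \<in> TK" "a \<otimes>\<^bsub>PA\<^esub> x \<in> TK" if "a \<in> TK" "x \<in> carrier PA" for a x
    using all[OF that] by (simp_all add: pair_simps)
qed

lemma kalg_ideal_tensor_kernel: "kalg_ideal PA TK"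
  by (intro kalg_ideal.intro P.kalg_axioms tensor_kernel_ideal)

lemma k_algebra_tensor: "k_algebra TT"
  unfolding tensor_def by (rule kalg_ideal.quot_alg_k_algebra[OF kalg_ideal_tensor_kernel])

end

lemma spans_image:
  fixes A :: "('k::field, 'a) module" and Q :: "('k, 'b) module"
  assumes "k_algebra A" "k_algebra Q" "q \<in> alg_hom A Q" "carrier Q = q ` carrier A" "spans A G"
  shows "spans Q (q ` G)"
proof -
  interpret A: kalg A using assms(1) by (simp add: kalg_def)
  interpret Q: kalg Q using assms(2) by (simp add: kalg_def)
  interpret q: alg_hom_pair A Q q using assms(3) by unfold_locales
  have "carrier Q \<subseteq> N" if N: "submodule N (ring_of_type_algebra :: 'k ring) Q" "q ` G \<subseteq> N" for N
  proof -
    have "submodule {x \<in> carrier A. q x \<in> N} (ring_of_type_algebra :: 'k ring) A"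
      by (rule A.submoduleI) (use N(1) in \<open>simp_all add: Q.submodule_iff q.add q.smult subset_iff\<close>)
    moreover have "G \<subseteq> {x \<in> carrier A. q x \<in> N}" using N(2) assms(5) unfolding spans_def by blast
    ultimately have "carrier A \<subseteq> {x \<in> carrier A. q x \<in> N}" using assms(5) unfolding spans_def by blast
    then show ?thesis unfolding assms(4) by blast
  qed
  moreover have "q ` G \<subseteq> carrier Q" using assms(4,5) unfolding spans_def by blast
  ultimately show ?thesis unfolding spans_def by blast
qed

context kalg2
begin

sublocale T: kalg "tensor V W" using k_algebra_tensor by (simp add: kalg_def)

interpretation P: kalg "pair_algebra V W" using k_algebra_pair by (simp add: kalg_def)

interpretation PI: kalg_ideal "pair_algebra V W" "tensor_kernel V W" by (rule kalg_ideal_tensor_kernel)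

abbreviation "coset \<equiv> \<lambda>t. tensor_kernel V W +>\<^bsub>pair_algebra V W\<^esub> t"

interpretation Q: alg_hom_pair "pair_algebra V W" "tensor V W" coset
  using PI.quot_alg_proj by unfold_locales (simp add: tensor_def)

lemma tensor_carrier: "carrier TT = coset ` carrier PA"
  unfolding tensor_def by (rule PI.quot_alg_carrier)

lemma pt_coset: "pt x y = coset (Poly_Mapping.single (x, y) 1)"
  by (simp add: pure_tensor_def)

lemma pt_closed [simp, intro]: "x \<in> carrier V \<Longrightarrow> y \<in> carrier W \<Longrightarrow> pt x y \<in> carrier TT"
  unfolding pt_coset by (rule Q.closed) (rule single_pair_closed)

lemma coset_eqI: "x \<in> carrier PA \<Longrightarrow> y \<in> carrier PA \<Longrightarrow> x - y \<in> TK \<Longrightarrow> coset x = coset y"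
  using PI.coset_eq_iff[of x y] pair_minus[of x y] by simp

lemma pt_add_l: 
  assumes "x \<in> carrier V" "x' \<in> carrier V" "y \<in> carrier W"
  shows "pt (x \<oplus>\<^bsub>V\<^esub> x') y = pt x y \<oplus>\<^bsub>TT\<^esub> pt x' y"
proof -
  have "pt x y \<oplus>\<^bsub>TT\<^esub> pt x' y = coset (Poly_Mapping.single (x, y) 1 + Poly_Mapping.single (x', y) 1)"
    unfolding pt_coset using Q.add[OF single_pair_closed single_pair_closed, of x y x' y 1 1] assms
    by (simp only: pair_simps)
  also have "\<dots> = pt (x \<oplus>\<^bsub>V\<^esub> x') y"
    unfolding pt_coset
  proof (rule coset_eqI[symmetric])
    show "Poly_Mapping.single (x, y) 1 + Poly_Mapping.single (x', y) 1 \<in> carrier PA"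
      using P.a_closed[OF single_pair_closed single_pair_closed, of x y x' y 1 1] assms by (simp only: pair_simps)
    show "Poly_Mapping.single (x \<oplus>\<^bsub>V\<^esub> x', y) 1 - (Poly_Mapping.single (x, y) 1 + Poly_Mapping.single (x', y) 1) \<in> TK"
      using tensor_kernel_relations[OF relationI(1)[OF assms]] by (simp only: diff_diff_eq)
  qed (use assms in \<open>simp add: single_pair_closed\<close>)
  finally show ?thesis by simp
qed

lemma pt_add_r: 
  assumes "x \<in> carrier V" "y \<in> carrier W" "y' \<in> carrier W"
  shows "pt x (y \<oplus>\<^bsub>W\<^esub> y') = pt x y \<oplus>\<^bsub>TT\<^esub> pt x y'"
proof -
  have "pt x y \<oplus>\<^bsub>TT\<^esub> pt x y' = coset (Poly_Mapping.single (x, y) 1 + Poly_Mapping.single (x, y') 1)"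
    unfolding pt_coset using Q.add[OF single_pair_closed single_pair_closed, of x y x y' 1 1] assms
    by (simp only: pair_simps)
  also have "\<dots> = pt x (y \<oplus>\<^bsub>W\<^esub> y')"
    unfolding pt_coset
  proof (rule coset_eqI[symmetric])
    show "Poly_Mapping.single (x, y) 1 + Poly_Mapping.single (x, y') 1 \<in> carrier PA"
      using P.a_closed[OF single_pair_closed single_pair_closed, of x y x y' 1 1] assms by (simp only: pair_simps)
    show "Poly_Mapping.single (x, y \<oplus>\<^bsub>W\<^esub> y') 1 - (Poly_Mapping.single (x, y) 1 + Poly_Mapping.single (x, y') 1) \<in> TK"
      using tensor_kernel_relations[OF relationI(2)[OF assms]] by (simp only: diff_diff_eq)
  qed (use assms in \<open>simp add: single_pair_closed\<close>)
  finally show ?thesis by simp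
qed

lemma smult_pt:
  assumes "x \<in> carrier V" "y \<in> carrier W"
  shows "c \<odot>\<^bsub>TT\<^esub> pt x y = coset (Poly_Mapping.single (x, y) c)"
  unfolding pt_coset using Q.smult[OF single_pair_closed, of x y c 1] assms by (simp add: pair_simps(4))

lemma pt_smult_l:
  assumes "x \<in> carrier V" "y \<in> carrier W"
  shows "pt (c \<odot>\<^bsub>V\<^esub> x) y = c \<odot>\<^bsub>TT\<^esub> pt x y"
  unfolding smult_pt[OF assms] unfolding pt_coset
  by (rule coset_eqI) (use assms tensor_kernel_relations[OF relationI(3)[OF assms]] in \<open>simp_all add: single_pair_closed\<close>)

lemma pt_smult_r:
  assumes "x \<in> carrier V" "y \<in> carrier W"
  shows "pt x (c \<odot>\<^bsub>W\<^esub> y) = c \<odot>\<^bsub>TT\<^esub> pt x y"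
  unfolding smult_pt[OF assms] unfolding pt_coset
  by (rule coset_eqI) (use assms tensor_kernel_relations[OF relationI(4)[OF assms]] in \<open>simp_all add: single_pair_closed\<close>)

lemma pt_mult:
  assumes "x \<in> carrier V" "y \<in> carrier W" "x' \<in> carrier V" "y' \<in> carrier W"
  shows "pt x y \<otimes>\<^bsub>TT\<^esub> pt x' y' = pt (x \<otimes>\<^bsub>V\<^esub> x') (y \<otimes>\<^bsub>W\<^esub> y')"
  unfolding pt_coset using Q.mult[OF single_pair_closed single_pair_closed, of x y x' y' 1 1] assms
  by (simp add: pair_simps(5))

lemma pt_one: "\<one>\<^bsub>TT\<^esub> = pt \<one>\<^bsub>V\<^esub> \<one>\<^bsub>W\<^esub>"
  using Q.one unfolding pt_coset pair_simps by simp

lemma tensor_spans: "spans TT {pt x y | x y. x \<in> carrier V \<and> y \<in> carrier W}"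
proof -
  have "{pt x y | x y. x \<in> carrier V \<and> y \<in> carrier W}
      = coset ` (\<lambda>p. Poly_Mapping.single p 1) ` (carrier V \<times> carrier W)"
    unfolding pt_coset by (auto simp: image_iff)
  then show ?thesis
    using spans_image[OF k_algebra_pair k_algebra_tensor Q.h tensor_carrier pair_spans] by simp
qed

text \<open>
  No case for scalars appears, since a scalar can be absorbed into the first factor of a pure tensor.
\<close>

lemma tensor_induct [consumes 1, case_names pt add]:
  assumes "t \<in> carrier TT"
    and "\<And>x y. x \<in> carrier V \<Longrightarrow> y \<in> carrier W \<Longrightarrow> P (pt x y)"
    and "\<And>t u. t \<in> carrier TT \<Longrightarrow> u \<in> carrier TT \<Longrightarrow> P t \<Longrightarrow> P u \<Longrightarrow> P (t \<oplus>\<^bsub>TT\<^esub> u)"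
  shows "P t"
proof -
  have "\<forall>c. P (c \<odot>\<^bsub>TT\<^esub> t)" using tensor_spans assms(1)
  proof (induction rule: T.spans_induct)
    case zero
    have "\<zero>\<^bsub>TT\<^esub> = pt \<zero>\<^bsub>V\<^esub> \<zero>\<^bsub>W\<^esub>" using pt_smult_l[of "\<zero>\<^bsub>V\<^esub>" "\<zero>\<^bsub>W\<^esub>" 0] by simp
    then have "P \<zero>\<^bsub>TT\<^esub>" using assms(2)[of "\<zero>\<^bsub>V\<^esub>" "\<zero>\<^bsub>W\<^esub>"] V.zero_closed W.zero_closed by metis
    then show ?case by simp
  next
    case (add x y) then show ?case using assms(3) by (simp add: T.smult_r_distr)
  next
    case (smult c x) then show ?case by simp
  next
    case (gen g)
    then obtain x y where "x \<in> carrier V" "y \<in> carrier W" "g = pt x y" by blast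
    then show ?case using assms(2)[of "c \<odot>\<^bsub>V\<^esub> x" y for c] by (simp add: pt_smult_l)
  qed
  then have "P (1 \<odot>\<^bsub>TT\<^esub> t)" by blast
  then show ?thesis using assms(1) by simp
qed

lemma tensor_eqI:
  assumes "k_algebra Z" "lin_map TT Z f" "lin_map TT Z g"
    and "\<And>x y. x \<in> carrier V \<Longrightarrow> y \<in> carrier W \<Longrightarrow> f (pt x y) = g (pt x y)" "t \<in> carrier TT"
  shows "f t = g t"
  using assms(5) by (induction rule: tensor_induct)
    (simp_all add: assms(4) lin_mapD(2)[OF assms(2)] lin_mapD(2)[OF assms(3)])

context
  fixes Z :: "('k, 'c) module" and \<beta>
  assumes Z: "k_algebra Z" and \<beta>: "bilinear_map V W Z \<beta>"
begin

interpretation Z: kalg Z using Z by (simp add: kalg_def)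

abbreviation (input) "\<beta>x \<equiv> lin_ext Z (\<lambda>p. \<beta> (fst p) (snd p))"

lemma lin_ext_pair: "lin_map PA Z \<beta>x"
  unfolding pair_algebra_pm
  by (rule Z.lin_ext_lin_map) (use bilinear_mapD(1)[OF \<beta>] in auto)

lemma lin_ext_pair_single: "x \<in> carrier V \<Longrightarrow> y \<in> carrier W \<Longrightarrow> \<beta>x (Poly_Mapping.single (x, y) c) = c \<odot>\<^bsub>Z\<^esub> \<beta> x y"
  by (subst Z.lin_ext_single) (simp_all add: bilinear_mapD(1)[OF \<beta>])

lemma lin_ext_pair_diff: "t \<in> carrier PA \<Longrightarrow> u \<in> carrier PA \<Longrightarrow> \<beta>x t = \<beta>x u \<Longrightarrow> \<beta>x (t - u) = \<zero>\<^bsub>Z\<^esub>"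
  using lin_map_minus[OF lin_ext_pair P.kalg_axioms Z.kalg_axioms, of t u] lin_mapD(1)[OF lin_ext_pair, of u]
  by (simp add: pair_minus Z.minus_eq Z.r_neg)

text \<open>
  The kernel of the linear extension of a bilinear map is a subspace that contains the bilinearity
  relations.
\<close>

lemma lin_ext_kernel: "t \<in> TK \<Longrightarrow> \<beta>x t = \<zero>\<^bsub>Z\<^esub>"
proof -
  let ?N = "{t \<in> carrier PA. \<beta>x t = \<zero>\<^bsub>Z\<^esub>}"
  note l = lin_mapD[OF lin_ext_pair]
  have "submodule ?N (ring_of_type_algebra :: 'k ring) PA"
    by (rule P.submoduleI) (auto simp: l lin_map_zero[OF lin_ext_pair P.kalg_axioms Z.kalg_axioms])
  moreover have "r \<in> ?N" if r: "r \<in> bilinear_relations V W" for r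
  proof -
    note \<beta>s = bilinear_mapD[OF \<beta>]
    have sum: "\<beta>x (Poly_Mapping.single (x, y) 1 + Poly_Mapping.single (x', y') 1) = \<beta> x y \<oplus>\<^bsub>Z\<^esub> \<beta> x' y'"
      "Poly_Mapping.single (x, y) 1 + Poly_Mapping.single (x', y') 1 \<in> carrier PA"
      if "x \<in> carrier V" "y \<in> carrier W" "x' \<in> carrier V" "y' \<in> carrier W" for x y x' y'
      using l(2)[OF single_pair_closed single_pair_closed, of x y x' y' 1 1] 
        P.a_closed[OF single_pair_closed single_pair_closed, of x y x' y' 1 1] that
      by (simp_all add: pair_simps(3) lin_ext_pair_single \<beta>s)
    have "\<beta>x r = \<zero>\<^bsub>Z\<^esub>" using r
    proof (cases rule: relation_cases)
      case (1 x x' y)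
      then show ?thesis unfolding 1(4) diff_diff_eq
        by (intro lin_ext_pair_diff) (simp_all add: single_pair_closed sum lin_ext_pair_single \<beta>s del: single_one)
    next
      case (2 x y y')
      then show ?thesis unfolding 2(4) diff_diff_eq
        by (intro lin_ext_pair_diff) (simp_all add: single_pair_closed sum lin_ext_pair_single \<beta>s del: single_one)
    next
      case (3 c x y)
      then show ?thesis unfolding 3(3)
        by (intro lin_ext_pair_diff) (simp_all add: single_pair_closed sum lin_ext_pair_single \<beta>s del: single_one)
    next
      case (4 c x y)
      then show ?thesis unfolding 4(3)
        by (intro lin_ext_pair_diff) (simp_all add: single_pair_closed sum lin_ext_pair_single \<beta>s del: single_one)
    qed
    with r bilinear_relations_carrier show ?thesis by blast
  qed
  ultimately show "t \<in> TK \<Longrightarrow> \<beta>x t = \<zero>\<^bsub>Z\<^esub>" using tensor_kernel_minimal by blast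
qed

lemma tensor_lift_coset: "t \<in> carrier PA \<Longrightarrow> tensor_lift Z \<beta> (coset t) = \<beta>x t"
  unfolding tensor_lift_def lin_ext_def[symmetric]
  by (rule PI.the_elem_coset[OF Z.kalg_axioms lin_ext_pair lin_ext_kernel])

lemma tensor_lift_lin_map: "lin_map TT Z (tensor_lift Z \<beta>)"
proof (rule lin_mapI)
  note l = lin_mapD[OF lin_ext_pair]
  show "tensor_lift Z \<beta> x \<in> carrier Z" if "x \<in> carrier TT" for x
    using that l(1) unfolding tensor_carrier by (auto simp: tensor_lift_coset)
  show "tensor_lift Z \<beta> (x \<oplus>\<^bsub>TT\<^esub> y) = tensor_lift Z \<beta> x \<oplus>\<^bsub>Z\<^esub> tensor_lift Z \<beta> y"
    if xy: "x \<in> carrier TT" "y \<in> carrier TT" for x y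
  proof -
    obtain t u where "t \<in> carrier PA" "u \<in> carrier PA" "x = coset t" "y = coset u"
      using xy unfolding tensor_carrier by blast
    then show ?thesis by (simp add: Q.add[symmetric] tensor_lift_coset l)
  qed
  show "tensor_lift Z \<beta> (c \<odot>\<^bsub>TT\<^esub> x) = c \<odot>\<^bsub>Z\<^esub> tensor_lift Z \<beta> x" if x: "x \<in> carrier TT" for x c
  proof -
    obtain t where "t \<in> carrier PA" "x = coset t"
      using x unfolding tensor_carrier by blast
    then show ?thesis by (simp add: Q.smult[symmetric] tensor_lift_coset l)
  qed
qed

lemma tensor_lift_pt: "x \<in> carrier V \<Longrightarrow> y \<in> carrier W \<Longrightarrow> tensor_lift Z \<beta> (pt x y) = \<beta> x y"
  unfolding pt_coset by (simp add: tensor_lift_coset single_pair_closed lin_ext_pair_single bilinear_mapD(1)[OF \<beta>] del: single_one)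

lemma tensor_lift_alg_hom:
  assumes "\<beta> \<one>\<^bsub>V\<^esub> \<one>\<^bsub>W\<^esub> = \<one>\<^bsub>Z\<^esub>"
    and "\<And>x y x' y'. x \<in> carrier V \<Longrightarrow> y \<in> carrier W \<Longrightarrow> x' \<in> carrier V \<Longrightarrow> y' \<in> carrier W \<Longrightarrow>
      \<beta> (x \<otimes>\<^bsub>V\<^esub> x') (y \<otimes>\<^bsub>W\<^esub> y') = \<beta> x y \<otimes>\<^bsub>Z\<^esub> \<beta> x' y'"
  shows "tensor_lift Z \<beta> \<in> alg_hom TT Z"
  by (rule lin_map_alg_hom[OF tensor_spans T.kalg_axioms Z.kalg_axioms tensor_lift_lin_map])
    (auto simp: pt_one pt_mult tensor_lift_pt assms)

end

end

subsection \<open>Maps between tensor products\<close>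

lemma (in kalg2) tensor_lift_cong:
  assumes Z: "k_algebra Z" "bilinear_map V W Z \<beta>" "bilinear_map V W Z \<gamma>" 
    and eq: "\<And>x y. x \<in> carrier V \<Longrightarrow> y \<in> carrier W \<Longrightarrow> \<beta> x y = \<gamma> x y" and t: "t \<in> carrier TT"
  shows "tensor_lift Z \<beta> t = tensor_lift Z \<gamma> t"
  by (rule tensor_eqI[OF Z(1) tensor_lift_lin_map tensor_lift_lin_map _ t])
    (simp_all add: Z tensor_lift_pt eq)

text \<open>
  A family of bilinear maps that depends linearly on a parameter \<open>a\<close> has lifts that depend linearly on
  \<open>a\<close>. The associativity map is such a double lift, and the parameter \<open>z\<close> of the convolutions
  \<open>conv3\<close> and \<open>conv3'\<close> is of this kind.
\<close>

lemma (in kalg2) tensor_lift_linear_parameter: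
  assumes Z: "k_algebra Z" and \<beta>: "\<And>a. a \<in> carrier B \<Longrightarrow> bilinear_map V W Z (\<beta> a)"
    and lin: "\<And>x y. x \<in> carrier V \<Longrightarrow> y \<in> carrier W \<Longrightarrow> lin_map B Z (\<lambda>a. \<beta> a x y)"
    and B: "k_algebra B" and t: "t \<in> carrier TT"
  shows "lin_map B Z (\<lambda>a. tensor_lift Z (\<beta> a) t)"
proof -
  interpret Z: kalg Z using Z by (simp add: kalg_def)
  interpret B: kalg B using B by (simp add: kalg_def)
  show ?thesis using t
  proof (induction rule: tensor_induct)
    case (pt x y)
    note l = lin_mapD[OF lin[OF pt]]
    show ?case by (rule lin_mapI) (simp_all add: tensor_lift_pt[OF Z \<beta>] pt l)
  next
    case (add t u)
    note l = lin_mapD[OF add(3)] lin_mapD[OF add(4)]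
    have s: "tensor_lift Z (\<beta> a) (t \<oplus>\<^bsub>TT\<^esub> u) = tensor_lift Z (\<beta> a) t \<oplus>\<^bsub>Z\<^esub> tensor_lift Z (\<beta> a) u"
      if "a \<in> carrier B" for a
      using lin_mapD(2)[OF tensor_lift_lin_map[OF Z \<beta>[OF that]]] add by simp
    show ?case by (rule lin_mapI) (simp_all add: s l Z.a_ac Z.smult_r_distr)
  qed
qed

lemma (in kalg2) bilinear_translate:
  assumes \<beta>: "bilinear_map V W Z \<beta>" and ab: "a \<in> carrier V" "b \<in> carrier W"
  shows "bilinear_map V W Z (\<lambda>x y. \<beta> (x \<otimes>\<^bsub>V\<^esub> a) (y \<otimes>\<^bsub>W\<^esub> b))"
  by (rule bilinear_mapI) (simp_all add: bilinear_mapD[OF \<beta>] ab V.l_distr W.l_distr)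

text \<open>
  Since \<open>\<Delta>(x g) = \<Delta>(x) \<Delta>(g)\<close> and \<open>\<Delta>(g)\<close> is a sum of at most two pure tensors, this turns a
  convolution at \<open>x g\<close> into convolutions at \<open>x\<close>.
\<close>

lemma (in kalg2) tensor_lift_mult_pt:
  assumes Z: "k_algebra Z" and \<beta>: "bilinear_map V W Z \<beta>" and ab: "a \<in> carrier V" "b \<in> carrier W" "t \<in> carrier TT"
  shows "tensor_lift Z \<beta> (t \<otimes>\<^bsub>TT\<^esub> pt a b) = tensor_lift Z (\<lambda>x y. \<beta> (x \<otimes>\<^bsub>V\<^esub> a) (y \<otimes>\<^bsub>W\<^esub> b)) t"
proof (rule tensor_eqI[OF Z _ _ _ ab(3)])
  note l = lin_mapD[OF tensor_lift_lin_map[OF Z \<beta>]]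
  show "lin_map TT Z (tensor_lift Z (\<lambda>x y. \<beta> (x \<otimes>\<^bsub>V\<^esub> a) (y \<otimes>\<^bsub>W\<^esub> b)))"
    by (rule tensor_lift_lin_map[OF Z bilinear_translate[OF \<beta> ab(1,2)]])
  show "lin_map TT Z (\<lambda>t. tensor_lift Z \<beta> (t \<otimes>\<^bsub>TT\<^esub> pt a b))"
    by (rule lin_mapI) (simp_all add: l ab(1,2) T.l_distr)
qed (simp_all add: pt_mult ab tensor_lift_pt[OF Z \<beta>] tensor_lift_pt[OF Z bilinear_translate[OF \<beta> ab(1,2)]])

locale kalg4 = S: kalg2 V W + R: kalg2 V' W'
  for V :: "('k::field, 'a) module" and W :: "('k, 'b) module"
    and V' :: "('k, 'c) module" and W' :: "('k, 'd) module"
begin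

lemma tensor_map_bilinear:
  assumes f: "lin_map V V' f" and g: "lin_map W W' g"
  shows "bilinear_map V W (tensor V' W') (\<lambda>x y. pure_tensor V' W' (f x) (g y))"
  by (rule bilinear_mapI)
    (simp_all add: lin_mapD[OF f] lin_mapD[OF g] R.pt_add_l R.pt_add_r R.pt_smult_l R.pt_smult_r)

lemma tensor_map_pt:
  assumes "lin_map V V' f" "lin_map W W' g" "x \<in> carrier V" "y \<in> carrier W"
  shows "tensor_map V' W' f g (pure_tensor V W x y) = pure_tensor V' W' (f x) (g y)"
  unfolding tensor_map_def
  by (rule S.tensor_lift_pt[OF R.k_algebra_tensor tensor_map_bilinear]) (use assms in simp_all)

lemma tensor_map_lin_map:
  assumes "lin_map V V' f" "lin_map W W' g"
  shows "lin_map (tensor V W) (tensor V' W') (tensor_map V' W' f g)"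
  unfolding tensor_map_def
  by (rule S.tensor_lift_lin_map[OF R.k_algebra_tensor tensor_map_bilinear]) (use assms in simp_all)

lemma tensor_map_alg_hom:
  assumes f: "f \<in> alg_hom V V'" and g: "g \<in> alg_hom W W'"
  shows "tensor_map V' W' f g \<in> alg_hom (tensor V W) (tensor V' W')"
proof -
  interpret f: alg_hom_pair V V' f using f by unfold_locales
  interpret g: alg_hom_pair W W' g using g by unfold_locales
  show ?thesis
    unfolding tensor_map_def
    by (rule S.tensor_lift_alg_hom[OF R.k_algebra_tensor tensor_map_bilinear])
      (simp_all add: alg_hom_lin_map f g f.mult g.mult R.pt_mult R.pt_one)
qed

end

locale kalg_cube = HH: kalg2 A A + HHH: kalg2 A "tensor A A" + HHH': kalg2 "tensor A A" A
  for A :: "('k::field, 'a) module" (structure)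
begin

abbreviation "assoc_inner z \<equiv> \<lambda>x y. pure_tensor A (tensor A A) x (pure_tensor A A y z)"

lemma assoc_inner_bilinear: "z \<in> carrier A \<Longrightarrow> bilinear_map A A (tensor A (tensor A A)) (assoc_inner z)"
  by (rule bilinear_mapI)
    (simp_all add: HHH.pt_add_l HHH.pt_add_r HHH.pt_smult_l HHH.pt_smult_r
      HH.pt_add_l HH.pt_add_r HH.pt_smult_l HH.pt_smult_r)

lemma assoc_bilinear:
  "bilinear_map (tensor A A) A (tensor A (tensor A A)) (\<lambda>t z. tensor_lift (tensor A (tensor A A)) (assoc_inner z) t)"
  unfolding bilinear_map_def
proof (intro conjI ballI)
  show "lin_map A (tensor A (tensor A A)) (\<lambda>z. tensor_lift (tensor A (tensor A A)) (assoc_inner z) t)"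
    if "t \<in> carrier (tensor A A)" for t
    by (rule HH.tensor_lift_linear_parameter[OF HHH.k_algebra_tensor assoc_inner_bilinear _ HH.V.k_algebra that])
      (auto intro!: lin_mapI simp: HHH.pt_add_r HHH.pt_smult_r HH.pt_add_r HH.pt_smult_r)
qed (rule HH.tensor_lift_lin_map[OF HHH.k_algebra_tensor assoc_inner_bilinear])

lemma assoc_inner_pt:
  "x \<in> carrier A \<Longrightarrow> y \<in> carrier A \<Longrightarrow> z \<in> carrier A \<Longrightarrow>
    tensor_lift (tensor A (tensor A A)) (assoc_inner z) (pure_tensor A A x y)
      = pure_tensor A (tensor A A) x (pure_tensor A A y z)"
  by (rule HH.tensor_lift_pt[OF HHH.k_algebra_tensor assoc_inner_bilinear])

lemma tensor_assoc_pt: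
  assumes "x \<in> carrier A" "y \<in> carrier A" "z \<in> carrier A"
  shows "tensor_assoc A (pure_tensor (tensor A A) A (pure_tensor A A x y) z)
      = pure_tensor A (tensor A A) x (pure_tensor A A y z)"
  unfolding tensor_assoc_def Let_def
  by (subst HHH'.tensor_lift_pt[OF HHH.k_algebra_tensor assoc_bilinear]) (simp_all add: assms assoc_inner_pt)

text \<open>
  The first argument of the outer lift ranges over \<open>A \<otimes> A\<close>, so multiplicativity needs an induction over
  sums of pure tensors in each of the two factors that are multiplied.
\<close>

lemma tensor_assoc_alg_hom: "tensor_assoc A \<in> alg_hom (tensor (tensor A A) A) (tensor A (tensor A A))"
proof -
  let ?Z = "tensor A (tensor A A)"
  let ?F = "\<lambda>t z. tensor_lift ?Z (assoc_inner z) t"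
  note b = bilinear_mapD[OF assoc_bilinear]
  have 1: "?F (pure_tensor A A x y \<otimes>\<^bsub>tensor A A\<^esub> u) (z \<otimes> w) = ?F (pure_tensor A A x y) z \<otimes>\<^bsub>?Z\<^esub> ?F u w"
    if u: "u \<in> carrier (tensor A A)" and c: "x \<in> carrier A" "y \<in> carrier A" "z \<in> carrier A" "w \<in> carrier A" for x y u z w
    using u by (induction rule: HH.tensor_induct)
      (simp_all add: c HH.pt_mult assoc_inner_pt HHH.pt_mult HH.T.r_distr HHH.T.r_distr b)
  have 2: "?F (t \<otimes>\<^bsub>tensor A A\<^esub> u) (z \<otimes> w) = ?F t z \<otimes>\<^bsub>?Z\<^esub> ?F u w"
    if t: "t \<in> carrier (tensor A A)" and c: "u \<in> carrier (tensor A A)" "z \<in> carrier A" "w \<in> carrier A" for t u z w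
    using t
  proof (induction rule: HH.tensor_induct)
    case (pt x y)
    then show ?case using c by (intro 1)
  next
    case (add t t')
    then show ?case using c by (simp add: HH.T.l_distr HHH.T.l_distr b)
  qed
  show ?thesis
    unfolding tensor_assoc_def Let_def
    by (rule HHH'.tensor_lift_alg_hom[OF HHH.k_algebra_tensor assoc_bilinear])
      (simp_all add: 2 HH.pt_one assoc_inner_pt HHH.pt_one)
qed

end

lemma kalg_cubeI: "kalg A \<Longrightarrow> kalg_cube A"
  by (intro kalg_cube.intro kalg2.intro) (simp_all add: kalg_def kalg2.k_algebra_tensor kalg2.intro)

section \<open>Quantum Serre elements as iterated q-commutators\<close>

lemma fls_X_pow_diff_nonzero: "k > 0 \<Longrightarrow> fls_X ^ k - inverse fls_X ^ k \<noteq> (0 :: 'k::field fls)"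
proof
  assume k: "k > 0" and "fls_X ^ k - inverse fls_X ^ k = (0 :: 'k fls)"
  then have "fls_nth (fls_X ^ k - inverse fls_X ^ k :: 'k fls) (int k) = 0" by simp
  then show False
    using k by (simp add: fls_X_power_conv_shift_1 fls_inverse_X fls_X_inv_power_conv_shift_1)
qed

lemma qnum_nonzero: "k > 0 \<Longrightarrow> (qnum k :: 'k::field fls) \<noteq> 0"
  using fls_X_pow_diff_nonzero[of k, where ?'k = 'k] fls_X_pow_diff_nonzero[of 1, where ?'k = 'k] by (simp add: qnum_def)

lemma qfact_0 [simp]: "qfact 0 = 1" and qfact_Suc [simp]: "qfact (Suc n) = qfact n * qnum (Suc n)"
  by (simp_all add: qfact_def)

lemma qfact_nonzero: "(qfact k :: 'k::field fls) \<noteq> 0"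
  by (induction k) (simp_all add: qnum_nonzero)

lemma qnum_add: "(qnum (r + m) :: 'k::field fls) = fls_X ^ r * qnum m + inverse fls_X ^ m * qnum r"
proof -
  have "(fls_X * inverse fls_X :: 'k fls) = 1" by (simp add: fls_inverse_X fls_X_times_conv_shift)
  then have "fls_X ^ (r + m) - inverse fls_X ^ (r + m) =
    (fls_X ^ r * (fls_X ^ m - inverse fls_X ^ m) + inverse fls_X ^ m * (fls_X ^ r - inverse fls_X ^ r) :: 'k fls)"
    by (simp add: algebra_simps power_add)
  then show ?thesis unfolding qnum_def by (simp add: add_divide_distrib)
qed

lemma qbinom_zero [simp]: "qbinom n 0 = (1 :: 'k::field fls)" and qbinom_self [simp]: "qbinom n n = (1 :: 'k::field fls)"
  by (simp_all add: qbinom_def qfact_nonzero)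

text \<open>
  The two powers of \<open>\<nu>\<close> come from the addition rule \<open>qnum_add\<close>. The recursion
  expresses binomial coefficients without division, and therefore carries over to their values at
  roots of unity.
\<close>

lemma qbinom_pascal:
  "(qbinom (Suc (Suc k + m)) (Suc k) :: 'k::field fls)
    = fls_X ^ Suc k * qbinom (Suc k + m) (Suc k) + inverse fls_X ^ Suc m * qbinom (Suc k + m) k"
proof -
  let ?F = "qfact :: nat \<Rightarrow> 'k fls" and ?Q = "qnum :: nat \<Rightarrow> 'k fls"
  have "?Q (Suc (Suc k + m)) = fls_X ^ Suc k * ?Q (Suc m) + inverse fls_X ^ Suc m * ?Q (Suc k)"
    using qnum_add[of "Suc k" "Suc m"] by simp
  then have "(qbinom (Suc (Suc k + m)) (Suc k) :: 'k fls)
    = ?F (Suc k + m) * (fls_X ^ Suc k * ?Q (Suc m) + inverse fls_X ^ Suc m * ?Q (Suc k)) / (?F k * ?Q (Suc k) * (?F m * ?Q (Suc m)))"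
    by (simp add: qbinom_def del: power_Suc)
  also have "\<dots> = fls_X ^ Suc k * (?F (Suc k + m) / (?F k * ?Q (Suc k) * ?F m)) +
     inverse fls_X ^ Suc m * (?F (Suc k + m) / (?F k * (?F m * ?Q (Suc m))))"
    using qfact_nonzero[of k, where ?'k = 'k] qfact_nonzero[of m, where ?'k = 'k]
      qnum_nonzero[of "Suc k", where ?'k = 'k] qnum_nonzero[of "Suc m", where ?'k = 'k]
    by (simp add: divide_simps del: power_Suc add_Suc qfact_Suc) (simp add: algebra_simps del: power_Suc add_Suc qfact_Suc)
  also have "\<dots> = fls_X ^ Suc k * qbinom (Suc k + m) (Suc k) + inverse fls_X ^ Suc m * qbinom (Suc k + m) k"
    by (simp add: qbinom_def del: power_Suc)
  finally show ?thesis .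
qed

text \<open>
  The evaluation \<open>laurent_eval\<close> sums over the support, and a sum over an infinite set is \<open>0\<close>. Hence it
  is additive only on series of finite support.
\<close>

definition laurent_poly :: "'k::field fls \<Rightarrow> bool" where
  "laurent_poly f \<longleftrightarrow> finite {n. fls_nth f n \<noteq> 0}"

lemma laurent_poly_1: "laurent_poly 1"
  unfolding laurent_poly_def by (rule finite_subset[of _ "{0}"]) auto

lemma laurent_poly_add: "laurent_poly f \<Longrightarrow> laurent_poly g \<Longrightarrow> laurent_poly (f + g)"
  unfolding laurent_poly_def
  by (rule finite_subset[of _ "{n. fls_nth f n \<noteq> 0} \<union> {n. fls_nth g n \<noteq> 0}"]) auto

lemma laurent_poly_shift: "laurent_poly f \<Longrightarrow> laurent_poly (fls_shift m f)"
  unfolding laurent_poly_def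
  by (rule finite_subset[of _ "(\<lambda>n. n - m) ` {n. fls_nth f n \<noteq> 0}"]) (auto simp: image_iff, metis add_diff_cancel_right')

lemma laurent_eval_superset:
  assumes "finite U" "{n. fls_nth f n \<noteq> 0} \<subseteq> U"
  shows "laurent_eval f c = (\<Sum>n\<in>U. fls_nth f n * c powi n)"
  unfolding laurent_eval_def by (rule sum.mono_neutral_left) (use assms in auto)

lemma laurent_eval_1: "laurent_eval 1 c = 1"
  by (subst laurent_eval_superset[of "{0}"]) auto

lemma laurent_eval_add:
  assumes "laurent_poly f" "laurent_poly g"
  shows "laurent_eval (f + g) c = laurent_eval f c + laurent_eval g c"
proof -
  let ?U = "{n. fls_nth f n \<noteq> 0} \<union> {n. fls_nth g n \<noteq> 0}"
  have U: "finite ?U" using assms by (simp add: laurent_poly_def)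
  show ?thesis
    by (subst (1 2 3) laurent_eval_superset[OF U]) (auto simp: algebra_simps sum.distrib)
qed

lemma laurent_eval_shift:
  assumes "laurent_poly f" "c \<noteq> 0"
  shows "laurent_eval (fls_shift m f) c = c powi (- m) * laurent_eval f c"
proof -
  have "laurent_eval (fls_shift m f) c = (\<Sum>n | fls_nth f n \<noteq> 0. fls_nth f n * c powi (n - m))"
    unfolding laurent_eval_def
    by (rule sum.reindex_bij_witness[of _ "\<lambda>n. n - m" "\<lambda>n. n + m"]) auto
  also have "\<dots> = c powi (- m) * laurent_eval f c"
    unfolding laurent_eval_def using assms(2)
    by (simp add: sum_distrib_left power_int_diff power_int_minus divide_inverse mult_ac)
  finally show ?thesis .
qed

definition qbin :: "'k::field \<Rightarrow> nat \<Rightarrow> nat \<Rightarrow> 'k" where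
  "qbin v n r = laurent_eval (qbinom n r) v"

lemma laurent_poly_qbinom: "r \<le> n \<Longrightarrow> laurent_poly (qbinom n r :: 'k::field fls)"
proof (induction n arbitrary: r)
  case 0 then show ?case by (simp add: laurent_poly_1)
next
  case (Suc n)
  show ?case
  proof (cases "r = 0 \<or> r = Suc n")
    case False
    then obtain k m where km: "r = Suc k" "n = Suc k + m" using Suc.prems
      by (metis Suc_le_D le_SucE less_eqE old.nat.exhaust)
    have "laurent_poly (qbinom n (Suc k) :: 'k fls)" "laurent_poly (qbinom n k :: 'k fls)" using Suc.IH[of "Suc k"] Suc.IH[of k] km by simp_all
    then show ?thesis unfolding km(2) unfolding km(1) qbinom_pascal fls_inverse_X
      by (simp only: fls_X_power_times_conv_shift fls_X_inv_power_times_conv_shift)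
        (intro laurent_poly_add laurent_poly_shift)
  qed (auto simp: laurent_poly_1)
qed

lemma qbin_0 [simp]: "qbin v n 0 = 1" and qbin_self [simp]: "qbin v n n = 1"
  by (simp_all add: qbin_def laurent_eval_1)

lemma qbin_pascal:
  assumes v: "v \<noteq> 0" and r: "Suc k \<le> n"
  shows "qbin v (Suc n) (Suc k) = v ^ Suc k * qbin v n (Suc k) + inverse v ^ (n - k) * qbin v n k"
proof -
  obtain m where m: "n = Suc k + m" using r by (metis less_eqE)
  have l: "laurent_poly (qbinom n (Suc k) :: 'a fls)" "laurent_poly (qbinom n k :: 'a fls)"
    using r by (simp_all add: laurent_poly_qbinom)
  have "qbin v (Suc n) (Suc k) = laurent_eval (fls_shift (- int (Suc k)) (qbinom n (Suc k)) + fls_shift (int (Suc m)) (qbinom n k)) v"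
    unfolding m qbin_def qbinom_pascal fls_inverse_X
    by (simp only: fls_X_power_times_conv_shift fls_X_inv_power_times_conv_shift)
  also have "\<dots> = v powi int (Suc k) * qbin v n (Suc k) + v powi (- int (Suc m)) * qbin v n k"
    by (simp only: laurent_eval_add[OF laurent_poly_shift[OF l(1)] laurent_poly_shift[OF l(2)]]
        laurent_eval_shift[OF l(1) v] laurent_eval_shift[OF l(2) v] qbin_def minus_minus)
  also have "n - k = Suc m" using m by simp
  then have "v powi (- int (Suc m)) = inverse v ^ (n - k)"
    by (simp only: power_int_minus power_int_of_nat power_inverse)
  finally show ?thesis by (simp only: power_int_of_nat)
qed

text \<open>
  In the free algebra the q-commutator is also given by its plain formula with \<open>*\<close> and \<open>-\<close>: there the
  simplifier rules of a ring type are available, without side conditions on carriers.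
\<close>

definition fa_qcomm :: "'k::field fa \<Rightarrow> 'k \<Rightarrow> 'k fa \<Rightarrow> 'k fa" where
  "fa_qcomm x c b = x * b - const c * (b * x)"

lemma const_comm: "const c * t = t * const c" for t :: "'k::field fa"
proof -
  have "Poly_Mapping.keys t \<subseteq> UNIV" by simp
  then show ?thesis
    by (induction rule: keys_subset_induct) (simp_all add: algebra_simps mult_single plus_list_def)
qed

lemma const_mult: "const c * const d = const (c * d)" for c :: "'k::field"
  by (simp add: mult_single plus_list_def)

lemma const_mult_left: "const c * (const d * t) = const (c * d) * t" for t :: "'k::field fa"
  by (simp add: const_mult mult.assoc[symmetric])

lemma const_left_comm: "s * (const c * t) = const c * (s * t)" for t :: "'k::field fa"
  by (metis const_comm mult.assoc)

lemma const_1: "const 1 = (1 :: 'k::field fa)"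
  by (simp flip: zero_list_def)

lemma fa_qcomm_sum:
  fixes x b :: "'k::field fa" and C :: "nat \<Rightarrow> 'k"
  shows "fa_qcomm x d (\<Sum>r=0..N. const (C r) * (x ^ (N - r) * b * x ^ r))
    = (\<Sum>r=0..Suc N. const ((if r \<le> N then C r else 0) - (if r = 0 then 0 else d * C (r - 1))) * (x ^ (Suc N - r) * b * x ^ r))"
proof -
  let ?m = "\<lambda>r. x ^ (Suc N - r) * b * x ^ r"
  have cadd: "const (c - c') * t = const c * t - const c' * t" for c c' and t :: "'k fa"
    by (simp add: single_diff algebra_simps)
  have 1: "x * (\<Sum>r=0..N. const (C r) * (x ^ (N - r) * b * x ^ r)) = (\<Sum>r=0..Suc N. const (if r \<le> N then C r else 0) * ?m r)"
    by (simp add: sum_distrib_left const_left_comm[of x] mult.assoc Suc_diff_le)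
  have "const d * ((\<Sum>r=0..N. const (C r) * (x ^ (N - r) * b * x ^ r)) * x)
      = (\<Sum>r=0..N. const (d * C r) * (x ^ (N - r) * b * x ^ Suc r))"
    by (simp add: sum_distrib_left sum_distrib_right const_mult_left mult.assoc power_commutes)
  also have "\<dots> = (\<Sum>r=0..Suc N. const (if r = 0 then 0 else d * C (r - 1)) * ?m r)"
    by (subst sum.atLeast0_atMost_Suc_shift) simp
  finally have 2: "const d * ((\<Sum>r=0..N. const (C r) * (x ^ (N - r) * b * x ^ r)) * x) = \<dots>" .
  show ?thesis unfolding fa_qcomm_def 1 2 by (simp only: cadd sum_subtractf)
qed

text \<open>
  The q-binomial theorem for the commuting operators of left and right multiplication by \<open>x\<close>. The
  factor \<open>s\<close> is present for the induction: the list of scalars for \<open>N + 1\<close> is \<open>v\<close> times the list for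
  \<open>N\<close> followed by \<open>v\<^bsup>-N\<^esup>\<close>.
\<close>

lemma serre_fold_scaled:
  assumes v: "v \<noteq> (0::'k::field)"
  shows "fold (fa_qcomm x) (map (\<lambda>t. s * v powi (int N - 1 - 2 * int t)) [0..<N]) b
    = (\<Sum>r=0..N. const ((- 1) ^ r * s ^ r * qbin v N r) * (x ^ (N - r) * b * x ^ r))"
proof (induction N arbitrary: s)
  case 0
  show ?case by (simp add: const_1)
next
  case (Suc N)
  have "map (\<lambda>t. s * v powi (int (Suc N) - 1 - 2 * int t)) [0..<Suc N]
    = map (\<lambda>t. (s * v) * v powi (int N - 1 - 2 * int t)) [0..<N] @ [s * inverse v ^ N]"
  proof -
    have "int (Suc N) - 1 - 2 * int N = - int N" by simp
    then have e: "v powi (int (Suc N) - 1 - 2 * int N) = inverse v ^ N"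
      by (simp only: power_int_minus power_int_of_nat power_inverse)
    have p: "v powi (int (Suc N) - 1 - 2 * int t) = v * v powi (int N - 1 - 2 * int t)" for t
      using power_int_add_1'[of v "int N - 1 - 2 * int t"] v by simp
    show ?thesis by (simp only: upt_Suc_append[OF le0] map_append list.map e) (simp only: p mult.assoc)
  qed
  then have "fold (fa_qcomm x) (map (\<lambda>t. s * v powi (int (Suc N) - 1 - 2 * int t)) [0..<Suc N]) b
    = fa_qcomm x (s * inverse v ^ N) (\<Sum>r=0..N. const ((- 1) ^ r * (s * v) ^ r * qbin v N r) * (x ^ (N - r) * b * x ^ r))"
    by (simp only: Suc.IH fold_append fold.simps comp_apply id_apply)
  also have "\<dots> = (\<Sum>r=0..Suc N. const ((- 1) ^ r * s ^ r * qbin v (Suc N) r) * (x ^ (Suc N - r) * b * x ^ r))"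
    unfolding fa_qcomm_sum
  proof (rule sum.cong[OF refl])
    fix r assume r: "r \<in> {0..Suc N}"
    have "(if r \<le> N then (- 1) ^ r * (s * v) ^ r * qbin v N r else 0) -
        (if r = 0 then 0 else s * inverse v ^ N * ((- 1) ^ (r - 1) * (s * v) ^ (r - 1) * qbin v N (r - 1)))
      = (- 1) ^ r * s ^ r * qbin v (Suc N) r"
    proof (cases r)
      case (Suc k)
      have kN: "k \<le> N" using r Suc by simp
      have vk: "inverse v ^ N * v ^ k = inverse v ^ (N - k)"
        using v kN by (simp add: power_diff power_inverse field_simps)
      show ?thesis
      proof (cases "Suc k \<le> N")
        case True
        have "s * inverse v ^ N * ((- 1) ^ k * (s * v) ^ k * qbin v N k) = (- 1) ^ k * s ^ Suc k * (inverse v ^ (N - k) * qbin v N k)"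
          by (simp only: power_mult_distrib vk[symmetric] power_Suc mult_ac)
        then show ?thesis using True Suc by (auto simp: qbin_pascal[OF v True] power_mult_distrib algebra_simps)
      next
        case False
        then have "k = N" using kN by simp
        then show ?thesis using Suc v by (simp add: power_mult_distrib field_simps power_inverse)
      qed
    qed simp
    then show "const ((if r \<le> N then (- 1) ^ r * (s * v) ^ r * qbin v N r else 0) -
        (if r = 0 then 0 else s * inverse v ^ N * ((- 1) ^ (r - 1) * (s * v) ^ (r - 1) * qbin v N (r - 1)))) * (x ^ (Suc N - r) * b * x ^ r)
      = const ((- 1) ^ r * s ^ r * qbin v (Suc N) r) * (x ^ (Suc N - r) * b * x ^ r)" by simp
  qed
  finally show ?case .
qed

text \<open>
  The weights met on passing \<open>y\<close> through \<open>b\<close>, \<open>x b\<close>, \<open>x x b\<close>, \<open>\<dots>\<close> when \<open>y b = l b y\<close> and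
  \<open>y x = u x y\<close>.
\<close>

definition ladder :: "'k::field \<Rightarrow> 'k \<Rightarrow> nat \<Rightarrow> 'k list" where
  "ladder l u N = map (\<lambda>t. l * u ^ t) [0..<N]"

definition serre_len :: "'k wq_datum \<Rightarrow> nat \<Rightarrow> nat \<Rightarrow> nat" where
  "serre_len P i j = nat (1 - cartan P i j)"

text \<open>
  The scalar in \<open>K\<^sub>j E\<^sub>i = wt\<^sub>i\<^sub>j E\<^sub>i K\<^sub>j\<close>.
\<close>

definition wt :: "'k::field wq_datum \<Rightarrow> nat \<Rightarrow> nat \<Rightarrow> 'k" where
  "wt P i j = qi P i powi cartan P i j"

lemma powi_ladder: "v \<noteq> 0 \<Longrightarrow> v powi a * (v powi b) ^ t = v powi (a + b * int t)" for v :: "'k::field"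
proof -
  assume v: "v \<noteq> 0"
  have "(v powi b) ^ t = v powi (b * int t)" by (simp only: power_int_mult power_int_of_nat)
  then show ?thesis using v by (simp add: power_int_add)
qed

text \<open>
  The scalars \<open>q\<^sub>i\<^bsup>N-1-2t\<^esup>\<close> of the q-binomial theorem, with \<open>N = 1 - a\<^sub>i\<^sub>j\<close>, run from \<open>q\<^sub>i\<^bsup>-a\<^esup>\<close> to
  \<open>q\<^sub>i\<^bsup>a\<^esup>\<close> for \<open>a = a\<^sub>i\<^sub>j\<close> in steps of \<open>q\<^sub>i\<^bsup>-2\<^esup>\<close>, and \<open>2 = a\<^sub>i\<^sub>i\<close>. So they form a ladder of inverse
  weights. Being symmetric under inversion, they are also the ladder of weights read backwards, and
  both readings are used in \<open>fold_qcomm_sum_zero\<close>.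
\<close>

lemma serre_element_fold:
  assumes v: "qi P i \<noteq> 0" and a: "cartan P i i = 2" "cartan P i j \<le> 0"
  shows "serre_element P Z i j = fold (fa_qcomm (gvar (Z i))) (ladder (inverse (wt P i j)) (inverse (wt P i i)) (serre_len P i j)) (gvar (Z j))"
    and "rev (ladder (wt P i j) (wt P i i) (serre_len P i j)) = ladder (inverse (wt P i j)) (inverse (wt P i i)) (serre_len P i j)"
proof -
  let ?N = "serre_len P i j" and ?v = "qi P i"
  have N: "int ?N = 1 - cartan P i j" using a by (simp add: serre_len_def)
  have e: "inverse (wt P i j) * inverse (wt P i i) ^ t = ?v powi (int ?N - 1 - 2 * int t)" for t
  proof -
    have "inverse (wt P i j) * inverse (wt P i i) ^ t = ?v powi (- cartan P i j + (- 2) * int t)"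
      unfolding wt_def a power_int_minus[symmetric] by (rule powi_ladder[OF v])
    moreover have "- cartan P i j + (- 2) * int t = int ?N - 1 - 2 * int t" unfolding N by simp
    ultimately show ?thesis by (simp only:)
  qed
  have *: "ladder (inverse (wt P i j)) (inverse (wt P i i)) ?N = map (\<lambda>t. 1 * ?v powi (int ?N - 1 - 2 * int t)) [0..<?N]"
    unfolding ladder_def e by simp
  show "serre_element P Z i j = fold (fa_qcomm (gvar (Z i))) (ladder (inverse (wt P i j)) (inverse (wt P i i)) ?N) (gvar (Z j))"
    unfolding * serre_fold_scaled[OF v] serre_element_def Let_def
    by (simp add: serre_len_def qbin_def mult.assoc)
  show "rev (ladder (wt P i j) (wt P i i) ?N) = ladder (inverse (wt P i j)) (inverse (wt P i i)) ?N"
  proof (rule nth_equalityI)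
    fix t assume t: "t < length (rev (ladder (wt P i j) (wt P i i) ?N))"
    then have t': "t < ?N" by (simp add: ladder_def)
    have "rev (ladder (wt P i j) (wt P i i) ?N) ! t = wt P i j * wt P i i ^ (?N - Suc t)"
      using t' by (simp add: ladder_def rev_nth)
    also have "\<dots> = ?v powi (cartan P i j + 2 * int (?N - Suc t))"
      unfolding wt_def a by (rule powi_ladder[OF v])
    also have "cartan P i j + 2 * int (?N - Suc t) = int ?N - 1 - 2 * int t" using N t' by simp
    finally show "rev (ladder (wt P i j) (wt P i i) ?N) ! t = ladder (inverse (wt P i j)) (inverse (wt P i i)) ?N ! t"
      using t' by (simp add: ladder_def e)
  qed (simp add: ladder_def)
qed

text \<open>
  \<open>x b - c b x\<close>, with the subtraction written through \<open>\<odot>\<close> so that a single set of distributive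
  laws covers all terms.
\<close>

definition qcomm :: "('k::field, 'a) module \<Rightarrow> 'a \<Rightarrow> 'k \<Rightarrow> 'a \<Rightarrow> 'a" where
  "qcomm A x c b = x \<otimes>\<^bsub>A\<^esub> b \<oplus>\<^bsub>A\<^esub> (- c) \<odot>\<^bsub>A\<^esub> (b \<otimes>\<^bsub>A\<^esub> x)"

lemma fa_qcomm_eq: "fa_qcomm = qcomm (free_algebra I)"
  by (intro ext) (simp add: fa_qcomm_def qcomm_def free_algebra_def mult_map_scale_conv_mult zero_list_def single_uminus)

lemma ladder_Suc: "ladder l u (Suc N) = ladder l u N @ [l * u ^ N]"
  by (simp add: ladder_def)

lemma ladder_0: "ladder l u 0 = []"
  by (simp add: ladder_def)

context kalg
begin

lemma qcomm_closed [simp]: "x \<in> carrier A \<Longrightarrow> b \<in> carrier A \<Longrightarrow> qcomm A x c b \<in> carrier A"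
  by (simp add: qcomm_def)

lemma fold_qcomm_closed [simp]: "x \<in> carrier A \<Longrightarrow> b \<in> carrier A \<Longrightarrow> fold (qcomm A x) cs b \<in> carrier A"
  by (induction cs arbitrary: b) simp_all

lemma qcomm_add: "x \<in> carrier A \<Longrightarrow> b \<in> carrier A \<Longrightarrow> b' \<in> carrier A \<Longrightarrow>
  qcomm A x c (b \<oplus> b') = qcomm A x c b \<oplus> qcomm A x c b'"
  by (simp add: qcomm_def r_distr l_distr smult_r_distr a_ac)

lemma qcomm_smult: "x \<in> carrier A \<Longrightarrow> b \<in> carrier A \<Longrightarrow> qcomm A x c (d \<odot> b) = d \<odot> qcomm A x c b"
  by (simp add: qcomm_def smult_r_distr mult.commute)

lemma fold_qcomm_add: "x \<in> carrier A \<Longrightarrow> b \<in> carrier A \<Longrightarrow> b' \<in> carrier A \<Longrightarrow>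
  fold (qcomm A x) cs (b \<oplus> b') = fold (qcomm A x) cs b \<oplus> fold (qcomm A x) cs b'"
  by (induction cs arbitrary: b b') (simp_all add: qcomm_add)

lemma fold_qcomm_smult: "x \<in> carrier A \<Longrightarrow> b \<in> carrier A \<Longrightarrow>
  fold (qcomm A x) cs (d \<odot> b) = d \<odot> fold (qcomm A x) cs b"
  by (induction cs arbitrary: b) (simp_all add: qcomm_smult)

lemma qcomm_commute: "x \<in> carrier A \<Longrightarrow> b \<in> carrier A \<Longrightarrow>
  qcomm A x c (qcomm A x d b) = qcomm A x d (qcomm A x c b)"
  by (simp add: qcomm_def r_distr l_distr smult_r_distr m_assoc a_ac mult.commute)

lemma fold_qcomm_shift: "x \<in> carrier A \<Longrightarrow> b \<in> carrier A \<Longrightarrow>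
  fold (qcomm A x) cs (qcomm A x c b) = qcomm A x c (fold (qcomm A x) cs b)"
proof (induction cs arbitrary: b)
  case (Cons d cs)
  have "fold (qcomm A x) (d # cs) (qcomm A x c b) = fold (qcomm A x) cs (qcomm A x c (qcomm A x d b))"
    using Cons.prems by (simp add: qcomm_commute[of x b d c])
  also have "\<dots> = qcomm A x c (fold (qcomm A x) cs (qcomm A x d b))"
    using Cons.prems by (intro Cons.IH) simp_all
  finally show ?case by simp
qed simp

text \<open>
  Left and right multiplication by \<open>x\<close> commute, so q-commutators with \<open>x\<close> commute with each other.
\<close>

lemma fold_qcomm_rev: "x \<in> carrier A \<Longrightarrow> b \<in> carrier A \<Longrightarrow>
  fold (qcomm A x) (rev cs) b = fold (qcomm A x) cs b"
  by (induction cs arbitrary: b) (simp_all add: fold_qcomm_shift)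

lemma qcomm_weight:
  assumes "x \<in> carrier A" "y \<in> carrier A" "b \<in> carrier A"
    and "y \<otimes> b = l \<odot> (b \<otimes> y)" "y \<otimes> x = u \<odot> (x \<otimes> y)"
  shows "y \<otimes> qcomm A x c b = (l * u) \<odot> (qcomm A x c b \<otimes> y)"
proof -
  have 1: "y \<otimes> (x \<otimes> b) = (l * u) \<odot> (x \<otimes> b \<otimes> y)"
    using assms by (simp add: m_assoc[symmetric]) (simp add: m_assoc assms(4) mult.commute)
  have 2: "y \<otimes> (b \<otimes> x) = (l * u) \<odot> (b \<otimes> x \<otimes> y)"
    using assms by (simp add: m_assoc[symmetric]) (simp add: m_assoc assms(5))
  show ?thesis
    using assms(1-3) by (simp add: qcomm_def r_distr l_distr 1 2 smult_r_distr mult.commute)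
qed

lemma qcomm_weight':
  assumes "x \<in> carrier A" "y \<in> carrier A" "b \<in> carrier A"
    and "b \<otimes> y = l \<odot> (y \<otimes> b)" "x \<otimes> y = u \<odot> (y \<otimes> x)"
  shows "qcomm A x c b \<otimes> y = (l * u) \<odot> (y \<otimes> qcomm A x c b)"
proof -
  have 1: "x \<otimes> b \<otimes> y = (l * u) \<odot> (y \<otimes> (x \<otimes> b))"
    using assms(1-3) by (simp add: m_assoc assms(4)) (simp add: m_assoc[symmetric] assms(5))
  have 2: "b \<otimes> x \<otimes> y = (l * u) \<odot> (y \<otimes> (b \<otimes> x))"
    using assms(1-3) by (simp add: m_assoc assms(5)) (simp add: m_assoc[symmetric] assms(4) mult.commute)
  show ?thesis
    using assms(1-3) by (simp add: qcomm_def r_distr l_distr 1 2 smult_r_distr mult.commute)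
qed

lemma smult_add_cancel: "x \<in> carrier A \<Longrightarrow> c + d = 0 \<Longrightarrow> c \<odot> x \<oplus> d \<odot> x = \<zero>"
  by (simp add: smult_l_distr[symmetric])

text \<open>
  The term \<open>y b - c b y\<close> vanishes when \<open>c\<close> is the weight with which \<open>y\<close> passes \<open>b\<close>.
\<close>

lemma qcomm_drop_left:
  assumes c: "x \<in> carrier A" "y \<in> carrier A" "b \<in> carrier A" and y: "y \<otimes> b = c \<odot> (b \<otimes> y)"
  shows "qcomm A (x \<oplus> y) c b = qcomm A x c b"
proof -
  have "c \<odot> (b \<otimes> y) \<oplus> (- c) \<odot> (b \<otimes> y) = \<zero>" using c by (intro smult_add_cancel) simp_all
  then show ?thesis
    using c by (simp add: qcomm_def l_distr r_distr y smult_r_distr a_ac)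
qed

text \<open>
  After \<open>t\<close> steps \<open>y\<close> passes the result with weight \<open>l u\<^bsup>t\<^esup>\<close>, which is the scalar of the next step, so
  \<open>y\<close> drops out each time. For \<open>N \<le> 1\<close> there is at most one step and \<open>y x\<close> does not matter. This covers
  the relation for \<open>a\<^sub>i\<^sub>j = 0\<close>, in which \<open>a\<^sub>i\<^sub>i\<close> is arbitrary.
\<close>

lemma fold_qcomm_ladder_left:
  assumes c: "x \<in> carrier A" "y \<in> carrier A" "b \<in> carrier A"
    and y: "y \<otimes> b = l \<odot> (b \<otimes> y)" and yx: "N \<le> 1 \<or> y \<otimes> x = u \<odot> (x \<otimes> y)"
  shows "fold (qcomm A (x \<oplus> y)) (ladder l u N) b = fold (qcomm A x) (ladder l u N) b"
proof -
  let ?f = "\<lambda>N. fold (qcomm A x) (ladder l u N) b"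
  have "(N \<le> 1 \<or> y \<otimes> x = u \<odot> (x \<otimes> y)) \<Longrightarrow> fold (qcomm A (x \<oplus> y)) (ladder l u N) b = ?f N \<and>
    (N = 0 \<or> y \<otimes> x = u \<odot> (x \<otimes> y) \<longrightarrow> y \<otimes> ?f N = (l * u ^ N) \<odot> (?f N \<otimes> y))" for N
  proof (induction N)
    case 0 then show ?case using y by (simp add: ladder_0)
  next
    case (Suc N)
    have IH: "fold (qcomm A (x \<oplus> y)) (ladder l u N) b = ?f N" "y \<otimes> ?f N = (l * u ^ N) \<odot> (?f N \<otimes> y)"
      using Suc by auto
    have 1: "fold (qcomm A (x \<oplus> y)) (ladder l u (Suc N)) b = ?f (Suc N)"
      using c IH(2) by (simp add: ladder_Suc IH(1) qcomm_drop_left)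
    have 2: "y \<otimes> ?f (Suc N) = (l * u ^ Suc N) \<odot> (?f (Suc N) \<otimes> y)" if "y \<otimes> x = u \<odot> (x \<otimes> y)"
      using qcomm_weight[OF c(1,2) _ IH(2) that] c by (simp add: ladder_Suc mult_ac)
    show ?case using 1 2 by simp
  qed
  then show ?thesis using yx by blast
qed

lemma qcomm_drop_right:
  assumes c: "x \<in> carrier A" "y \<in> carrier A" "b \<in> carrier A" and x: "b \<otimes> x = c' \<odot> (x \<otimes> b)" "c * c' = 1"
  shows "qcomm A (x \<oplus> y) c b = qcomm A y c b"
proof -
  have "1 \<odot> (x \<otimes> b) \<oplus> (- 1) \<odot> (x \<otimes> b) = \<zero>" using c by (intro smult_add_cancel) simp_all
  then have "x \<otimes> b \<oplus> (- 1) \<odot> (x \<otimes> b) = \<zero>" using c by simp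
  have cancel: "x \<otimes> b \<oplus> (v \<oplus> ((- 1) \<odot> (x \<otimes> b) \<oplus> w)) = v \<oplus> w" if "v \<in> carrier A" "w \<in> carrier A" for v w
  proof -
    have "x \<otimes> b \<oplus> (v \<oplus> ((- 1) \<odot> (x \<otimes> b) \<oplus> w)) = (x \<otimes> b \<oplus> (- 1) \<odot> (x \<otimes> b)) \<oplus> (v \<oplus> w)"
      using c that by (simp add: a_ac)
    also have "\<dots> = v \<oplus> w" using \<open>x \<otimes> b \<oplus> (- 1) \<odot> (x \<otimes> b) = \<zero>\<close> c that by simp
    finally show ?thesis .
  qed
  show ?thesis
    using c x(2) by (simp add: qcomm_def l_distr r_distr x(1) smult_r_distr a_ac cancel)
qed

text \<open>
  The mirror image: here \<open>x\<close> stands to the right of the results and drops out, which needs the inverse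
  weights.
\<close>

lemma fold_qcomm_ladder_right:
  assumes c: "x \<in> carrier A" "y \<in> carrier A" "b \<in> carrier A"
    and x: "b \<otimes> x = l \<odot> (x \<otimes> b)" and yx: "N \<le> 1 \<or> y \<otimes> x = u \<odot> (x \<otimes> y)" and lu: "l \<noteq> 0" "u \<noteq> 0"
  shows "fold (qcomm A (x \<oplus> y)) (ladder (inverse l) (inverse u) N) b = fold (qcomm A y) (ladder (inverse l) (inverse u) N) b"
proof -
  let ?L = "ladder (inverse l) (inverse u)"
  let ?f = "\<lambda>N. fold (qcomm A y) (?L N) b"
  have "(N \<le> 1 \<or> y \<otimes> x = u \<odot> (x \<otimes> y)) \<Longrightarrow> fold (qcomm A (x \<oplus> y)) (?L N) b = ?f N \<and>
    (N = 0 \<or> y \<otimes> x = u \<odot> (x \<otimes> y) \<longrightarrow> ?f N \<otimes> x = (l * u ^ N) \<odot> (x \<otimes> ?f N))" for N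
  proof (induction N)
    case 0 then show ?case using x by (simp add: ladder_0)
  next
    case (Suc N)
    have IH: "fold (qcomm A (x \<oplus> y)) (?L N) b = ?f N" "?f N \<otimes> x = (l * u ^ N) \<odot> (x \<otimes> ?f N)"
      using Suc by auto
    have 1: "fold (qcomm A (x \<oplus> y)) (?L (Suc N)) b = ?f (Suc N)"
    proof -
      have "inverse l * inverse u ^ N * (l * u ^ N) = 1" using lu by (simp add: power_inverse field_simps)
      then show ?thesis
        using c qcomm_drop_right[OF c(1,2) _ IH(2)] by (simp add: ladder_Suc IH(1))
    qed
    have 2: "?f (Suc N) \<otimes> x = (l * u ^ Suc N) \<odot> (x \<otimes> ?f (Suc N))" if "y \<otimes> x = u \<odot> (x \<otimes> y)"
      using qcomm_weight'[OF c(2,1) _ IH(2) that] c by (simp add: ladder_Suc mult_ac)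
    show ?case using 1 2 by simp
  qed
  then show ?thesis using yx by blast
qed

lemma qcomm_twist:
  assumes c: "x \<in> carrier A" "b \<in> carrier A" "k \<in> carrier A" "m \<in> carrier A"
    and r: "k \<otimes> b = \<rho> \<odot> (b \<otimes> k)" "m \<otimes> x = \<rho> \<odot> (x \<otimes> m)" "k \<otimes> m = m \<otimes> k"
  shows "qcomm A (\<alpha> \<odot> (x \<otimes> k)) c (\<beta> \<odot> (b \<otimes> m)) = (\<alpha> * \<beta> * \<rho>) \<odot> (qcomm A x c b \<otimes> (k \<otimes> m))"
proof -
  have 1: "(x \<otimes> k) \<otimes> (b \<otimes> m) = \<rho> \<odot> (x \<otimes> b \<otimes> (k \<otimes> m))"
  proof -
    have "(x \<otimes> k) \<otimes> (b \<otimes> m) = x \<otimes> ((k \<otimes> b) \<otimes> m)" using c by (simp add: m_assoc)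
    also have "\<dots> = \<rho> \<odot> (x \<otimes> b \<otimes> (k \<otimes> m))" using c by (simp add: r m_assoc)
    finally show ?thesis .
  qed
  have 2: "(b \<otimes> m) \<otimes> (x \<otimes> k) = \<rho> \<odot> (b \<otimes> x \<otimes> (k \<otimes> m))"
  proof -
    have "(b \<otimes> m) \<otimes> (x \<otimes> k) = b \<otimes> ((m \<otimes> x) \<otimes> k)" using c by (simp add: m_assoc)
    also have "\<dots> = \<rho> \<odot> (b \<otimes> x \<otimes> (k \<otimes> m))" using c by (simp add: r m_assoc)
    finally show ?thesis .
  qed
  show ?thesis
    using c by (simp add: qcomm_def 1 2 l_distr smult_r_distr mult_ac)
qed

text \<open>
  Multiplying the arguments \<open>x\<close> and \<open>b\<close> by elements \<open>k\<close> and \<open>m\<close> that commute with them up to scalars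
  changes the iterated q-commutator only by a factor on the right and a scalar.
  Elements like \<open>E\<^sub>i Kb\<^sub>i\<close> in an antipode and \<open>E\<^sub>i \<otimes> K\<^sub>i\<close> in a comultiplication are of this kind.
  The same weight \<open>\<rho>\<close> occurs twice because \<open>wt\<close> is symmetric.
\<close>

lemma fold_qcomm_twist:
  assumes c: "x \<in> carrier A" "b \<in> carrier A" "k \<in> carrier A" "m \<in> carrier A"
    and k: "k \<otimes> x = \<kappa> \<odot> (x \<otimes> k)"
    and r: "k \<otimes> b = \<rho> \<odot> (b \<otimes> k)" "m \<otimes> x = \<rho> \<odot> (x \<otimes> m)" "k \<otimes> m = m \<otimes> k"
  shows "\<exists>s. \<exists>z\<in>carrier A. fold (qcomm A (\<alpha> \<odot> (x \<otimes> k))) cs (\<beta> \<odot> (b \<otimes> m)) = s \<odot> (fold (qcomm A x) cs b \<otimes> z)"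
  using c(2,4) r
proof (induction cs arbitrary: b m \<beta> \<rho>)
  case Nil
  then show ?case by auto
next
  case (Cons d cs)
  note c' = c(1,3) Cons.prems(1,2)
  have "k \<otimes> qcomm A x d b = (\<rho> * \<kappa>) \<odot> (qcomm A x d b \<otimes> k)"
    using c' Cons.prems(3) k by (intro qcomm_weight) simp_all
  moreover have "k \<otimes> m \<otimes> x = (\<rho> * \<kappa>) \<odot> (x \<otimes> (k \<otimes> m))"
  proof -
    have "k \<otimes> m \<otimes> x = \<rho> \<odot> (k \<otimes> x \<otimes> m)" using c' Cons.prems(4) by (simp add: m_assoc)
    then show ?thesis using c' k by (simp add: m_assoc)
  qed
  moreover have "k \<otimes> (k \<otimes> m) = k \<otimes> m \<otimes> k" using c' by (simp add: m_assoc Cons.prems(5)[symmetric])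
  ultimately have "\<exists>s. \<exists>z\<in>carrier A. fold (qcomm A (\<alpha> \<odot> (x \<otimes> k))) cs ((\<alpha> * \<beta> * \<rho>) \<odot> (qcomm A x d b \<otimes> (k \<otimes> m)))
      = s \<odot> (fold (qcomm A x) cs (qcomm A x d b) \<otimes> z)"
    using c' by (intro Cons.IH) simp_all
  then show ?case
    using qcomm_twist[OF c(1) Cons.prems(1) c(3) Cons.prems(2-5), of \<alpha> d \<beta>] by simp
qed

lemma fold_qcomm_twist_zero:
  assumes "x \<in> carrier A" "b \<in> carrier A" "k \<in> carrier A" "m \<in> carrier A"
    and "k \<otimes> x = \<kappa> \<odot> (x \<otimes> k)"
    and "k \<otimes> b = \<rho> \<odot> (b \<otimes> k)" "m \<otimes> x = \<rho> \<odot> (x \<otimes> m)" "k \<otimes> m = m \<otimes> k"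
    and "fold (qcomm A x) cs b = \<zero>"
  shows "fold (qcomm A (\<alpha> \<odot> (x \<otimes> k))) cs (\<beta> \<odot> (b \<otimes> m)) = \<zero>"
  using fold_qcomm_twist[OF assms(1-8), of \<alpha> cs \<beta>] assms(9) by auto

end

lemma (in alg_hom_pair) fold_qcomm: "x \<in> carrier A \<Longrightarrow> b \<in> carrier A \<Longrightarrow>
  h (fold (qcomm A x) cs b) = fold (qcomm B (h x)) cs (h b)"
  by (induction cs arbitrary: b) (simp_all add: qcomm_def add mult smult)

text \<open>
  The sum \<open>x + y\<close> acts on \<open>b\<close> through \<open>x\<close> alone when the scalars are taken as the ladder of weights,
  and on \<open>d\<close> through \<open>y\<close> alone when they are taken as the ladder of inverse weights. By \<open>rev\<close> these are
  the same scalars in opposite order, and the order does not matter.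
\<close>

lemma (in kalg) fold_qcomm_sum_zero:
  assumes c: "x \<in> carrier A" "y \<in> carrier A" "b \<in> carrier A" "d \<in> carrier A"
    and yb: "y \<otimes> b = l \<odot> (b \<otimes> y)" and dx: "d \<otimes> x = l \<odot> (x \<otimes> d)"
    and yx: "N \<le> 1 \<or> y \<otimes> x = u \<odot> (x \<otimes> y)" and lu: "l \<noteq> 0" "u \<noteq> 0"
    and rev: "rev (ladder l u N) = ladder (inverse l) (inverse u) N"
    and 0: "fold (qcomm A x) (ladder (inverse l) (inverse u) N) b = \<zero>"
      "fold (qcomm A y) (ladder (inverse l) (inverse u) N) d = \<zero>"
  shows "fold (qcomm A (x \<oplus> y)) (ladder (inverse l) (inverse u) N) (b \<oplus> d) = \<zero>"
proof -
  let ?L = "ladder (inverse l) (inverse u) N"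
  have "fold (qcomm A (x \<oplus> y)) ?L b = fold (qcomm A (x \<oplus> y)) (ladder l u N) b"
    unfolding rev[symmetric] using c by (simp add: fold_qcomm_rev)
  also have "\<dots> = fold (qcomm A x) (ladder l u N) b" by (rule fold_qcomm_ladder_left[OF c(1-3) yb yx])
  also have "\<dots> = fold (qcomm A x) ?L b" unfolding rev[symmetric] using c by (simp add: fold_qcomm_rev)
  finally have 1: "fold (qcomm A (x \<oplus> y)) ?L b = \<zero>" by (simp add: 0)
  have 2: "fold (qcomm A (x \<oplus> y)) ?L d = \<zero>"
    using fold_qcomm_ladder_right[OF c(1,2,4) dx yx lu] 0 by simp
  show ?thesis using c by (simp add: fold_qcomm_add 1 2)
qed

section \<open>Representations of the relations\<close>

text \<open>
  The relation \<open>E\<^sub>i E\<^sub>j = E\<^sub>j E\<^sub>i\<close> for \<open>a\<^sub>i\<^sub>j = 0\<close> is the Serre relation of length one, since the only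
  scalar is then \<open>1\<close>. Treating both at once includes pairs with \<open>a\<^sub>i\<^sub>i \<le> 0\<close>.
\<close>

definition serre_pair :: "'k wq_datum \<Rightarrow> nat \<Rightarrow> nat \<Rightarrow> bool" where
  "serre_pair P i j \<longleftrightarrow> cartan P i i = 2 \<and> i \<noteq> j \<or> cartan P i j = 0"

abbreviation serre_scalars :: "'k::field wq_datum \<Rightarrow> nat \<Rightarrow> nat \<Rightarrow> 'k list" where
  "serre_scalars P i j \<equiv> ladder (inverse (wt P i j)) (inverse (wt P i i)) (serre_len P i j)"

text \<open>
  The relations in a form that does not depend on the types. Both types give the commutation rules of
  \<open>E\<^sub>i\<close> and \<open>F\<^sub>i\<close> with \<open>K\<^sub>j\<close> and \<open>Kb\<^sub>j\<close>, and type zero says in addition that \<open>e\<close> acts on the generator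
  as the identity (\<open>type_zero_iff\<close>). The equation \<open>J\<^bsup>m\<^esup> = J\<close> is written as \<open>J e = J\<close>, to avoid powers
  other than \<open>e = J\<^bsup>m-1\<^esup>\<close>.
\<close>

locale wq_rep = kalg B for B :: "('k::field, 'b) module" (structure) +
  fixes P :: "'k wq_datum" and \<phi> :: "gen \<Rightarrow> 'b"
  assumes gen_closed: "\<And>g. g \<in> gens (idx P) \<Longrightarrow> \<phi> g \<in> carrier B"
    and K_Kb_raw: "\<And>i. i \<in> idx P \<Longrightarrow> \<phi> (GK i) \<otimes> \<phi> (GKb i) = \<phi> GJ [^] (jexp P - 1)"
    and D_Db_raw: "\<And>i. i \<in> idx P \<Longrightarrow> \<phi> (GD i) \<otimes> \<phi> (GDb i) = \<phi> GJ [^] (jexp P - 1)"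
    and J_e_raw: "\<phi> GJ \<otimes> \<phi> GJ [^] (jexp P - 1) = \<phi> GJ"
    and torus_comm: "\<And>g h. g \<in> torus_gens (idx P) \<Longrightarrow> h \<in> torus_gens (idx P) \<Longrightarrow> \<phi> g \<otimes> \<phi> h = \<phi> h \<otimes> \<phi> g"
    and torus_e_raw: "\<And>g. g \<in> torus_gens (idx P) - {GJ} \<Longrightarrow> \<phi> g \<otimes> \<phi> GJ [^] (jexp P - 1) = \<phi> g"
    and K_E: "\<And>i j. i \<in> idx P \<Longrightarrow> j \<in> idx P \<Longrightarrow> \<phi> (GK j) \<otimes> \<phi> (GE i) = wt P i j \<odot> (\<phi> (GE i) \<otimes> \<phi> (GK j))"
    and Kb_E: "\<And>i j. i \<in> idx P \<Longrightarrow> j \<in> idx P \<Longrightarrow> \<phi> (GKb j) \<otimes> \<phi> (GE i) = inverse (wt P i j) \<odot> (\<phi> (GE i) \<otimes> \<phi> (GKb j))"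
    and K_F: "\<And>i j. i \<in> idx P \<Longrightarrow> j \<in> idx P \<Longrightarrow> \<phi> (GK j) \<otimes> \<phi> (GF i) = inverse (wt P i j) \<odot> (\<phi> (GF i) \<otimes> \<phi> (GK j))"
    and Kb_F: "\<And>i j. i \<in> idx P \<Longrightarrow> j \<in> idx P \<Longrightarrow> \<phi> (GKb j) \<otimes> \<phi> (GF i) = wt P i j \<odot> (\<phi> (GF i) \<otimes> \<phi> (GKb j))"
    and type0_E_raw: "\<And>i. i \<in> idx P \<Longrightarrow> tyE P i = 0 \<Longrightarrow> \<phi> GJ [^] (jexp P - 1) \<otimes> \<phi> (GE i) = \<phi> (GE i)"
    and type0_F_raw: "\<And>i. i \<in> idx P \<Longrightarrow> tyF P i = 0 \<Longrightarrow> \<phi> GJ [^] (jexp P - 1) \<otimes> \<phi> (GF i) = \<phi> (GF i)"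
    and E_F: "\<And>i j. i \<in> idx P \<Longrightarrow> j \<in> idx P \<Longrightarrow> \<phi> (GE i) \<otimes> \<phi> (GF j) = \<phi> (GF j) \<otimes> \<phi> (GE i) \<oplus>
      (if i = j then inverse (qi P i - inverse (qi P i)) \<odot> (\<phi> (GK i) \<oplus> (- 1) \<odot> \<phi> (GKb i)) else \<zero>)"
    and serre: "\<And>Z i j. Z \<in> {GE, GF} \<Longrightarrow> i \<in> idx P \<Longrightarrow> j \<in> idx P \<Longrightarrow> serre_pair P i j \<Longrightarrow>
      fold (qcomm B (\<phi> (Z i))) (serre_scalars P i j) (\<phi> (Z j)) = \<zero>"

lemma wt_nonzero: "valid_wq_datum P \<Longrightarrow> i \<in> idx P \<Longrightarrow> wt P i j \<noteq> 0"
  by (simp add: wt_def valid_wq_datum_def)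

lemma wt_sym: 
  assumes "valid_wq_datum P" "i \<in> idx P" "j \<in> idx P"
  shows "wt P i j = wt P j i"
proof -
  have "int (symm P i) * cartan P i j = int (symm P j) * cartan P j i"
    using assms by (simp add: valid_wq_datum_def)
  then show ?thesis unfolding wt_def qi_def
    by (simp only: power_int_of_nat[symmetric] power_int_mult[symmetric])
qed

lemma serre_pair_ladder:
  assumes "valid_wq_datum P" "i \<in> idx P" "j \<in> idx P" "serre_pair P i j"
  shows "rev (ladder (wt P i j) (wt P i i) (serre_len P i j)) = serre_scalars P i j"
    and "cartan P i j = 0 \<Longrightarrow> serre_scalars P i j = [1]"
    and "serre_len P i j \<le> 1 \<or> cartan P i i = 2"
proof -
  show 0: "cartan P i j = 0 \<Longrightarrow> serre_scalars P i j = [1]"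
    by (simp add: serre_len_def ladder_def wt_def)
  show "serre_len P i j \<le> 1 \<or> cartan P i i = 2" using assms(4) by (auto simp: serre_pair_def serre_len_def)
  show "rev (ladder (wt P i j) (wt P i i) (serre_len P i j)) = serre_scalars P i j"
  proof (cases "cartan P i j = 0")
    case True
    then show ?thesis by (simp add: serre_len_def ladder_def wt_def)
  next
    case False
    then have "cartan P i i = 2" "i \<noteq> j" using assms(4) by (auto simp: serre_pair_def)
    moreover then have "cartan P i j \<le> 0" "qi P i \<noteq> 0"
      using assms by (auto simp: valid_wq_datum_def borcherds_cartan_def)
    ultimately show ?thesis using serre_element_fold(2) by blast
  qed
qed

context kalg
begin

text \<open>
  From \<open>k x k' = w x\<close> one gets \<open>e x = x = x e\<close>, because \<open>e\<close> is a unit for \<open>k\<close> and \<open>k'\<close>. Multiplication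
  by \<open>k\<close> on the right or by \<open>k'\<close> on the left then gives the commutation rules.
\<close>

lemma type_zero_iff:
  assumes c: "k \<in> carrier A" "k' \<in> carrier A" "x \<in> carrier A" "e \<in> carrier A"
    and e: "k \<otimes> k' = e" "k' \<otimes> k = e" "k \<otimes> e = k" "k' \<otimes> e = k'" "e \<otimes> k = k" "e \<otimes> k' = k'" and w: "w \<noteq> 0"
  shows "k \<otimes> x \<otimes> k' = w \<odot> x \<longleftrightarrow>
    k \<otimes> x = w \<odot> (x \<otimes> k) \<and> k' \<otimes> x = inverse w \<odot> (x \<otimes> k') \<and> e \<otimes> x = x" (is "?L \<longleftrightarrow> ?R")
proof
  assume L: ?L
  have x: "x = inverse w \<odot> (k \<otimes> x \<otimes> k')" using c w L by simp
  have "e \<otimes> x = inverse w \<odot> ((e \<otimes> k) \<otimes> x \<otimes> k')" by (subst x) (use c in \<open>simp add: m_assoc\<close>)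
  then have ex: "e \<otimes> x = x" using x e by simp
  have "x \<otimes> e = inverse w \<odot> (k \<otimes> x \<otimes> (k' \<otimes> e))" by (subst x) (use c in \<open>simp add: m_assoc\<close>)
  then have xe: "x \<otimes> e = x" using x e by simp
  have "k \<otimes> x = k \<otimes> x \<otimes> k' \<otimes> k" using c xe e by (simp add: m_assoc)
  then have 1: "k \<otimes> x = w \<odot> (x \<otimes> k)" using L c by simp
  have "k' \<otimes> x = inverse w \<odot> (k' \<otimes> k \<otimes> (x \<otimes> k'))" by (subst x) (use c in \<open>simp add: m_assoc\<close>)
  then have 2: "k' \<otimes> x = inverse w \<odot> (x \<otimes> k')" using c ex e by (simp add: m_assoc[symmetric])
  show ?R using 1 2 ex by simp
next
  assume R: ?R
  then have R1: "k \<otimes> x = w \<odot> (x \<otimes> k)" and R2: "k' \<otimes> x = inverse w \<odot> (x \<otimes> k')" and R3: "e \<otimes> x = x"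
    by auto
  have "x = k \<otimes> (k' \<otimes> x)" using R3 e(1) c by (simp add: m_assoc[symmetric])
  also have "\<dots> = inverse w \<odot> (k \<otimes> x \<otimes> k')" unfolding R2 using c by (simp add: m_assoc)
  also have "\<dots> = x \<otimes> (k \<otimes> k')" unfolding R1 using c w by (simp add: m_assoc)
  also have "\<dots> = x \<otimes> e" by (simp add: e)
  finally have "x \<otimes> e = x" by simp
  then show ?L using R c e by (simp add: m_assoc)
qed

end

lemma gens_simps [simp]:
  "GJ \<in> gens I" "GE i \<in> gens I \<longleftrightarrow> i \<in> I" "GF i \<in> gens I \<longleftrightarrow> i \<in> I" "GK i \<in> gens I \<longleftrightarrow> i \<in> I"
  "GKb i \<in> gens I \<longleftrightarrow> i \<in> I" "GD i \<in> gens I \<longleftrightarrow> i \<in> I" "GDb i \<in> gens I \<longleftrightarrow> i \<in> I"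
  "GJ \<in> torus_gens I" "GE i \<notin> torus_gens I" "GF i \<notin> torus_gens I" "GK i \<in> torus_gens I \<longleftrightarrow> i \<in> I"
  "GKb i \<in> torus_gens I \<longleftrightarrow> i \<in> I" "GD i \<in> torus_gens I \<longleftrightarrow> i \<in> I" "GDb i \<in> torus_gens I \<longleftrightarrow> i \<in> I"
  by (auto simp: gens_def torus_gens_def)

lemma torus_gens_subset: "g \<in> torus_gens I \<Longrightarrow> g \<in> gens I"
  by (cases g) simp_all

context wq_rep
begin

abbreviation "E i \<equiv> \<phi> (GE i)"
abbreviation "F i \<equiv> \<phi> (GF i)"
abbreviation "K i \<equiv> \<phi> (GK i)"
abbreviation "Kb i \<equiv> \<phi> (GKb i)"
abbreviation "D i \<equiv> \<phi> (GD i)"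
abbreviation "Db i \<equiv> \<phi> (GDb i)"

definition e where "e = \<phi> GJ [^] (jexp P - 1)"

lemma e_closed [simp]: "e \<in> carrier B"
  using gen_closed[of GJ] by (simp add: e_def)

lemmas K_Kb = K_Kb_raw[folded e_def]
lemmas D_Db = D_Db_raw[folded e_def]
lemmas J_e = J_e_raw[folded e_def]
lemmas torus_e = torus_e_raw[folded e_def]
lemmas type0_E = type0_E_raw[folded e_def]
lemmas type0_F = type0_F_raw[folded e_def]

lemma closed [simp]:
  "\<phi> GJ \<in> carrier B" "i \<in> idx P \<Longrightarrow> E i \<in> carrier B" "i \<in> idx P \<Longrightarrow> F i \<in> carrier B"
  "i \<in> idx P \<Longrightarrow> K i \<in> carrier B" "i \<in> idx P \<Longrightarrow> Kb i \<in> carrier B"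
  "i \<in> idx P \<Longrightarrow> D i \<in> carrier B" "i \<in> idx P \<Longrightarrow> Db i \<in> carrier B"
  using gen_closed by simp_all

lemma torus_closed: "g \<in> torus_gens (idx P) \<Longrightarrow> \<phi> g \<in> carrier B"
  using gen_closed torus_gens_subset by blast

lemma pow_torus_comm: "g \<in> torus_gens (idx P) \<Longrightarrow> \<phi> GJ [^] (n::nat) \<otimes> \<phi> g = \<phi> g \<otimes> \<phi> GJ [^] n"
proof (induction n)
  case (Suc n)
  have "\<phi> GJ [^] Suc n \<otimes> \<phi> g = \<phi> GJ [^] n \<otimes> (\<phi> g \<otimes> \<phi> GJ)"
    using Suc torus_closed by (simp add: m_assoc torus_comm[of GJ g])
  also have "\<dots> = \<phi> g \<otimes> \<phi> GJ [^] Suc n" using Suc torus_closed by (simp add: m_assoc[symmetric])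
  finally show ?case .
qed (simp add: torus_closed)

lemma e_torus: "g \<in> torus_gens (idx P) \<Longrightarrow> \<phi> g \<otimes> e = \<phi> g" "g \<in> torus_gens (idx P) \<Longrightarrow> e \<otimes> \<phi> g = \<phi> g"
proof -
  show 1: "\<phi> g \<otimes> e = \<phi> g" if "g \<in> torus_gens (idx P)"
    using J_e torus_e[of g] that by (cases "g = GJ") auto
  show "e \<otimes> \<phi> g = \<phi> g" if "g \<in> torus_gens (idx P)"
    using pow_torus_comm[OF that, of "jexp P - 1", folded e_def] 1[OF that] by simp
qed

lemma Kb_K: "i \<in> idx P \<Longrightarrow> Kb i \<otimes> K i = e"
  using torus_comm[of "GK i" "GKb i"] K_Kb by simp

lemma Db_D: "i \<in> idx P \<Longrightarrow> Db i \<otimes> D i = e"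
  using torus_comm[of "GD i" "GDb i"] D_Db by simp

lemma e_idem: 
  assumes "i \<in> idx P" shows "e \<otimes> e = e"
proof -
  have "e \<otimes> e = e \<otimes> K i \<otimes> Kb i" using K_Kb[OF assms] assms by (simp add: m_assoc)
  also have "\<dots> = e" using assms by (simp only: e_torus gens_simps K_Kb)
  finally show ?thesis .
qed

end

definition wq_relations :: "'k::field wq_datum \<Rightarrow> 'k fa set" where
  "wq_relations P = torus_relations P \<union> type_relations P \<union> EF_relations P \<union> serre_relations P"

lemma Ball_image_Collect: "(\<forall>r\<in>{f x | x. Q x}. R r) \<longleftrightarrow> (\<forall>x. Q x \<longrightarrow> R (f x))"
  "(\<forall>r\<in>{g x y | x y. Q' x y}. R r) \<longleftrightarrow> (\<forall>x y. Q' x y \<longrightarrow> R (g x y))"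
  "(\<forall>r\<in>{k x y z | x y z. Q'' x y z}. R r) \<longleftrightarrow> (\<forall>x y z. Q'' x y z \<longrightarrow> R (k x y z))"
  by blast+

context
  fixes I :: "nat set"
begin

abbreviation (input) "FI \<equiv> free_algebra I :: ('k::field, 'k fa) module"

interpretation FA: kalg "free_algebra I :: ('k::field, 'k fa) module" using k_algebra_free by (simp add: kalg_def)

lemma FA_ops: fixes x :: "'k::field fa" shows "x \<otimes>\<^bsub>FI\<^esub> y = x * y" "x \<oplus>\<^bsub>FI\<^esub> y = x + y" "\<zero>\<^bsub>FI\<^esub> = 0" "\<one>\<^bsub>FI\<^esub> = 1"
  "c \<odot>\<^bsub>FI\<^esub> x = const c * x"
  by (simp_all add: free_algebra_def mult_map_scale_conv_mult zero_list_def)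

lemma FA_minus: fixes x :: "'k::field fa" shows "x \<in> carrier FI \<Longrightarrow> y \<in> carrier FI \<Longrightarrow> x \<ominus>\<^bsub>FI\<^esub> y = x - y"
  by (simp add: FA.a_minus_smult FA_ops single_uminus const_1)

lemma FA_closed:
  fixes x :: "'k::field fa" shows "g \<in> gens I \<Longrightarrow> gvar g \<in> carrier FI" "const c \<in> carrier FI"
  "x \<in> carrier FI \<Longrightarrow> y \<in> carrier FI \<Longrightarrow> x * y \<in> carrier FI"
  "x \<in> carrier FI \<Longrightarrow> y \<in> carrier FI \<Longrightarrow> x + y \<in> carrier FI"
  "x \<in> carrier FI \<Longrightarrow> y \<in> carrier FI \<Longrightarrow> x - y \<in> carrier FI"
  "x \<in> carrier FI \<Longrightarrow> x ^ n \<in> carrier FI" "0 \<in> carrier FI"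
proof -
  show "g \<in> gens I \<Longrightarrow> gvar g \<in> carrier FI" "const c \<in> carrier FI" by (simp_all add: free_algebra_def)
  show m: "x * y \<in> carrier FI" if "x \<in> carrier FI" "y \<in> carrier FI" for x y :: "'k fa"
    using FA.m_closed[OF that] by (simp only: FA_ops)
  show "x + y \<in> carrier FI" if "x \<in> carrier FI" "y \<in> carrier FI" for x y :: "'k fa"
    using FA.a_closed[OF that] by (simp only: FA_ops)
  show "x - y \<in> carrier FI" if "x \<in> carrier FI" "y \<in> carrier FI" for x y :: "'k fa"
    using FA.minus_closed[OF that] by (simp only: FA_minus[OF that])
  show "x ^ n \<in> carrier FI" if "x \<in> carrier FI" for x :: "'k fa"
  proof -
    have "(1 :: 'k fa) \<in> carrier FI" using FA.one_closed by (simp only: FA_ops)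
    then show ?thesis using that by (induction n) (simp_all add: m)
  qed
  show "0 \<in> carrier FI" using FA.zero_closed by (simp only: FA_ops)
qed

end

text \<open>
  A morphism out of the free algebra. Under it each relation, an element of the free algebra, becomes
  an equation in \<open>B\<close>.
\<close>

locale free_eval = kalg B for B :: "('k::field, 'b) module" (structure) +
  fixes P :: "'k wq_datum" and h :: "'k fa \<Rightarrow> 'b" and \<phi> :: "gen \<Rightarrow> 'b"
  assumes h: "h \<in> alg_hom (free_algebra (idx P)) B" and h_gvar: "\<And>g. g \<in> gens (idx P) \<Longrightarrow> h (gvar g) = \<phi> g"
    and valid: "valid_wq_datum P"
begin

abbreviation "FA \<equiv> free_algebra (idx P) :: ('k, 'k fa) module"

interpretation FA: kalg FA using k_algebra_free by (simp add: kalg_def)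
interpretation h: alg_hom_pair FA B h using h by unfold_locales

lemma h_closed: "x \<in> carrier FA \<Longrightarrow> h x \<in> carrier B" by simp

lemma h_ops:
  "x \<in> carrier FA \<Longrightarrow> y \<in> carrier FA \<Longrightarrow> h (x * y) = h x \<otimes> h y"
  "x \<in> carrier FA \<Longrightarrow> y \<in> carrier FA \<Longrightarrow> h (x + y) = h x \<oplus> h y"
  "x \<in> carrier FA \<Longrightarrow> y \<in> carrier FA \<Longrightarrow> h (x - y) = h x \<oplus> (- 1) \<odot> h y"
  "x \<in> carrier FA \<Longrightarrow> h (x ^ n) = h x [^] n" "h 0 = \<zero>" "h (const c) = c \<odot> \<one>"
proof -
  show m: "h (x * y) = h x \<otimes> h y" if "x \<in> carrier FA" "y \<in> carrier FA" for x y
    using h.mult[OF that] by (simp only: FA_ops)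
  show "h (x + y) = h x \<oplus> h y" if "x \<in> carrier FA" "y \<in> carrier FA" for x y
    using h.add[OF that] by (simp only: FA_ops)
  show "h (x - y) = h x \<oplus> (- 1) \<odot> h y" if "x \<in> carrier FA" "y \<in> carrier FA" for x y
    using h.minus[OF that] that by (simp only: FA_minus[OF that] a_minus_smult h_closed)
  show "h (x ^ n) = h x [^] n" if "x \<in> carrier FA" for x
  proof (induction n)
    case 0 then show ?case using h.one by (simp add: FA_ops)
  next
    case (Suc n)
    have "h (x ^ Suc n) = h (x ^ n) \<otimes> h x"
      using m[OF FA_closed(6)[OF that, of n] that] by (simp only: power_Suc power_commutes[symmetric])
    then show ?case using Suc by simp
  qed
  show "h 0 = \<zero>" using h.zero by (simp only: FA_ops)
  show "h (const c) = c \<odot> \<one>" using h.smult[of "\<one>\<^bsub>FA\<^esub>" c] h.one by (simp add: FA_ops FA.one_closed[unfolded FA_ops])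
qed

lemma h_diff_zero: "x \<in> carrier FA \<Longrightarrow> y \<in> carrier FA \<Longrightarrow> h (x - y) = \<zero> \<longleftrightarrow> h x = h y"
  using a_minus_eq_zero_iff[OF h_closed h_closed, of x y] h.minus[of x y] by (simp only: FA_minus)

lemma h_fold: "x \<in> carrier FA \<Longrightarrow> b \<in> carrier FA \<Longrightarrow>
  h (fold (fa_qcomm x) cs b) = fold (qcomm B (h x)) cs (h b)"
  unfolding fa_qcomm_eq[of "idx P"] by (rule h.fold_qcomm)

lemma phi_closed: "g \<in> gens (idx P) \<Longrightarrow> \<phi> g \<in> carrier B"
  using h_closed[OF FA_closed(1)] h_gvar by metis

lemma phi_closed' [simp]:
  "\<phi> GJ \<in> carrier B" "i \<in> idx P \<Longrightarrow> \<phi> (GE i) \<in> carrier B" "i \<in> idx P \<Longrightarrow> \<phi> (GF i) \<in> carrier B"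
  "i \<in> idx P \<Longrightarrow> \<phi> (GK i) \<in> carrier B" "i \<in> idx P \<Longrightarrow> \<phi> (GKb i) \<in> carrier B"
  "i \<in> idx P \<Longrightarrow> \<phi> (GD i) \<in> carrier B" "i \<in> idx P \<Longrightarrow> \<phi> (GDb i) \<in> carrier B"
  using phi_closed by simp_all

lemmas ev = h_diff_zero FA_closed h_ops(1,2,4-6) h_gvar torus_gens_subset

lemma J_pow: "\<phi> GJ [^] jexp P = \<phi> GJ \<otimes> \<phi> GJ [^] (jexp P - 1)"
proof -
  obtain n where "jexp P = Suc n" using valid by (cases "jexp P") (auto simp: valid_wq_datum_def)
  then show ?thesis using nat_pow_Suc2[of "\<phi> GJ" n] by simp
qed

lemma torus_iff: "(\<forall>r\<in>torus_relations P. h r = \<zero>) \<longleftrightarrow>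
   (\<forall>i\<in>idx P. \<phi> (GK i) \<otimes> \<phi> (GKb i) = \<phi> GJ [^] (jexp P - 1)) \<and>
   (\<forall>i\<in>idx P. \<phi> (GD i) \<otimes> \<phi> (GDb i) = \<phi> GJ [^] (jexp P - 1)) \<and>
   \<phi> GJ \<otimes> \<phi> GJ [^] (jexp P - 1) = \<phi> GJ \<and>
   (\<forall>g\<in>torus_gens (idx P). \<forall>h\<in>torus_gens (idx P). \<phi> g \<otimes> \<phi> h = \<phi> h \<otimes> \<phi> g) \<and>
   (\<forall>g\<in>torus_gens (idx P) - {GJ}. \<phi> g \<otimes> \<phi> GJ [^] (jexp P - 1) = \<phi> g)"
  unfolding torus_relations_def Let_def ball_Un Ball_image_Collect ball_simps
  by (simp add: ev J_pow Ball_def conj_assoc) blast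

lemma type_iff:
  assumes t: "\<forall>r\<in>torus_relations P. h r = \<zero>"
  shows "(\<forall>r\<in>type_relations P. h r = \<zero>) \<longleftrightarrow>
   (\<forall>i\<in>idx P. \<forall>j\<in>idx P.
      \<phi> (GK j) \<otimes> \<phi> (GE i) = wt P i j \<odot> (\<phi> (GE i) \<otimes> \<phi> (GK j)) \<and>
      \<phi> (GKb j) \<otimes> \<phi> (GE i) = inverse (wt P i j) \<odot> (\<phi> (GE i) \<otimes> \<phi> (GKb j)) \<and>
      \<phi> (GK j) \<otimes> \<phi> (GF i) = inverse (wt P i j) \<odot> (\<phi> (GF i) \<otimes> \<phi> (GK j)) \<and>
      \<phi> (GKb j) \<otimes> \<phi> (GF i) = wt P i j \<odot> (\<phi> (GF i) \<otimes> \<phi> (GKb j)) \<and>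
      (tyE P i = 0 \<longrightarrow> \<phi> GJ [^] (jexp P - 1) \<otimes> \<phi> (GE i) = \<phi> (GE i)) \<and>
      (tyF P i = 0 \<longrightarrow> \<phi> GJ [^] (jexp P - 1) \<otimes> \<phi> (GF i) = \<phi> (GF i)))" (is "_ \<longleftrightarrow> ?R")
proof -
  let ?e = "\<phi> GJ [^] (jexp P - 1)"
  note t = t[unfolded torus_iff]
  have tc: "\<phi> g \<otimes> \<phi> h = \<phi> h \<otimes> \<phi> g" if "g \<in> torus_gens (idx P)" "h \<in> torus_gens (idx P)" for g h
    using t that by blast
  have ec: "?e \<in> carrier B" by simp
  have pe: "\<phi> g \<otimes> ?e = \<phi> g" if "g \<in> torus_gens (idx P) - {GJ}" for g using t that by blast
  have pc: "\<phi> GJ [^] (n::nat) \<otimes> \<phi> g = \<phi> g \<otimes> \<phi> GJ [^] n" if "g \<in> torus_gens (idx P)" for g n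
  proof (induction n)
    case 0 then show ?case using phi_closed[OF torus_gens_subset[OF that]] by simp
  next
    case (Suc n)
    have "\<phi> GJ [^] Suc n \<otimes> \<phi> g = \<phi> GJ [^] n \<otimes> (\<phi> g \<otimes> \<phi> GJ)"
      using phi_closed[OF torus_gens_subset[OF that]] tc[of GJ g] that by (simp add: m_assoc)
    also have "\<dots> = \<phi> g \<otimes> \<phi> GJ [^] Suc n"
      using Suc phi_closed[OF torus_gens_subset[OF that]] by (simp add: m_assoc[symmetric])
    finally show ?case .
  qed
  have KKb: "\<phi> (GK j) \<otimes> \<phi> (GKb j) = ?e" if "j \<in> idx P" for j using t that by blast
  have z: "\<phi> (GK j) \<otimes> x \<otimes> \<phi> (GKb j) = w \<odot> x \<longleftrightarrow>
    \<phi> (GK j) \<otimes> x = w \<odot> (x \<otimes> \<phi> (GK j)) \<and> \<phi> (GKb j) \<otimes> x = inverse w \<odot> (x \<otimes> \<phi> (GKb j)) \<and> ?e \<otimes> x = x"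
    if "j \<in> idx P" "x \<in> carrier B" "w \<noteq> 0" for j x w
    using that pe[of "GK j"] pe[of "GKb j"] pc[of "GK j"] pc[of "GKb j"] KKb[of j] tc[of "GK j" "GKb j"]
    by (intro type_zero_iff) simp_all
  have iw: "qi P i powi (- cartan P i j) = inverse (wt P i j)" "qi P i powi cartan P i j = wt P i j" for i j
    by (simp_all add: wt_def power_int_minus)
  have wn: "wt P i j \<noteq> 0" if "i \<in> idx P" for i j using wt_nonzero[OF valid that] .
  have ty: "(tyE P i = 0 \<or> tyE P i = 1) \<and> (tyF P i = 0 \<or> tyF P i = 1)" if "i \<in> idx P" for i
    using valid that by (auto simp: valid_wq_datum_def)
  have "(\<forall>r\<in>type_relations P. h r = \<zero>) \<longleftrightarrow>
    (\<forall>i\<in>idx P. \<forall>j\<in>idx P.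
      (tyE P i = 1 \<longrightarrow> \<phi> (GK j) \<otimes> \<phi> (GE i) = wt P i j \<odot> (\<phi> (GE i) \<otimes> \<phi> (GK j)) \<and>
        \<phi> (GKb j) \<otimes> \<phi> (GE i) = inverse (wt P i j) \<odot> (\<phi> (GE i) \<otimes> \<phi> (GKb j))) \<and>
      (tyE P i = 0 \<longrightarrow> \<phi> (GK j) \<otimes> \<phi> (GE i) \<otimes> \<phi> (GKb j) = wt P i j \<odot> \<phi> (GE i)) \<and>
      (tyF P i = 1 \<longrightarrow> \<phi> (GK j) \<otimes> \<phi> (GF i) = inverse (wt P i j) \<odot> (\<phi> (GF i) \<otimes> \<phi> (GK j)) \<and>
        \<phi> (GKb j) \<otimes> \<phi> (GF i) = wt P i j \<odot> (\<phi> (GF i) \<otimes> \<phi> (GKb j))) \<and>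
      (tyF P i = 0 \<longrightarrow> \<phi> (GK j) \<otimes> \<phi> (GF i) \<otimes> \<phi> (GKb j) = inverse (wt P i j) \<odot> \<phi> (GF i)))"
    unfolding type_relations_def Let_def ball_Un Ball_image_Collect iw
    by (simp add: ev Ball_def) auto
  also have "\<dots> \<longleftrightarrow> ?R"
  proof (intro ball_cong refl)
    fix i j assume ij: "i \<in> idx P" "j \<in> idx P"
    show "(tyE P i = 1 \<longrightarrow> \<phi> (GK j) \<otimes> \<phi> (GE i) = wt P i j \<odot> (\<phi> (GE i) \<otimes> \<phi> (GK j)) \<and>
        \<phi> (GKb j) \<otimes> \<phi> (GE i) = inverse (wt P i j) \<odot> (\<phi> (GE i) \<otimes> \<phi> (GKb j))) \<and>
      (tyE P i = 0 \<longrightarrow> \<phi> (GK j) \<otimes> \<phi> (GE i) \<otimes> \<phi> (GKb j) = wt P i j \<odot> \<phi> (GE i)) \<and>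
      (tyF P i = 1 \<longrightarrow> \<phi> (GK j) \<otimes> \<phi> (GF i) = inverse (wt P i j) \<odot> (\<phi> (GF i) \<otimes> \<phi> (GK j)) \<and>
        \<phi> (GKb j) \<otimes> \<phi> (GF i) = wt P i j \<odot> (\<phi> (GF i) \<otimes> \<phi> (GKb j))) \<and>
      (tyF P i = 0 \<longrightarrow> \<phi> (GK j) \<otimes> \<phi> (GF i) \<otimes> \<phi> (GKb j) = inverse (wt P i j) \<odot> \<phi> (GF i)) \<longleftrightarrow>
      \<phi> (GK j) \<otimes> \<phi> (GE i) = wt P i j \<odot> (\<phi> (GE i) \<otimes> \<phi> (GK j)) \<and>
      \<phi> (GKb j) \<otimes> \<phi> (GE i) = inverse (wt P i j) \<odot> (\<phi> (GE i) \<otimes> \<phi> (GKb j)) \<and>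
      \<phi> (GK j) \<otimes> \<phi> (GF i) = inverse (wt P i j) \<odot> (\<phi> (GF i) \<otimes> \<phi> (GK j)) \<and>
      \<phi> (GKb j) \<otimes> \<phi> (GF i) = wt P i j \<odot> (\<phi> (GF i) \<otimes> \<phi> (GKb j)) \<and>
      (tyE P i = 0 \<longrightarrow> ?e \<otimes> \<phi> (GE i) = \<phi> (GE i)) \<and>
      (tyF P i = 0 \<longrightarrow> ?e \<otimes> \<phi> (GF i) = \<phi> (GF i))"
      using ty[OF ij(1)] unfolding z[OF ij(2) phi_closed'(2)[OF ij(1)] wn[OF ij(1)]]
        z[OF ij(2) phi_closed'(3)[OF ij(1)] nonzero_imp_inverse_nonzero[OF wn[OF ij(1)]]] inverse_inverse_eq
      by auto
  qed
  finally show ?thesis .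
qed

lemma EF_iff: "(\<forall>r\<in>EF_relations P. h r = \<zero>) \<longleftrightarrow> (\<forall>i\<in>idx P. \<forall>j\<in>idx P.
   \<phi> (GE i) \<otimes> \<phi> (GF j) = \<phi> (GF j) \<otimes> \<phi> (GE i) \<oplus>
      (if i = j then inverse (qi P i - inverse (qi P i)) \<odot> (\<phi> (GK i) \<oplus> (- 1) \<odot> \<phi> (GKb i)) else \<zero>))"
proof -
  have "h (gvar (GE i) * gvar (GF j) - gvar (GF j) * gvar (GE i)
        - (if i = j then const (inverse (qi P i - inverse (qi P i))) * (gvar (GK i) - gvar (GKb i)) else 0)) = \<zero> \<longleftrightarrow>
    \<phi> (GE i) \<otimes> \<phi> (GF j) = \<phi> (GF j) \<otimes> \<phi> (GE i) \<oplus>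
      (if i = j then inverse (qi P i - inverse (qi P i)) \<odot> (\<phi> (GK i) \<oplus> (- 1) \<odot> \<phi> (GKb i)) else \<zero>)"
    if "i \<in> idx P" "j \<in> idx P" for i j
    unfolding diff_diff_eq
    by (subst h_diff_zero) (use that in \<open>simp_all add: FA_closed h_ops h_gvar\<close>)
  then show ?thesis
    unfolding EF_relations_def Ball_image_Collect by blast
qed

lemma serre_iff: "(\<forall>r\<in>serre_relations P. h r = \<zero>) \<longleftrightarrow> (\<forall>Z\<in>{GE, GF}. \<forall>i\<in>idx P. \<forall>j\<in>idx P.
   serre_pair P i j \<longrightarrow> fold (qcomm B (\<phi> (Z i))) (serre_scalars P i j) (\<phi> (Z j)) = \<zero>)"
proof -
  have Zg: "Z i \<in> gens (idx P)" if "Z \<in> {GE, GF}" "i \<in> idx P" for Z i using that by auto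
  have 1: "h (serre_element P Z i j) = fold (qcomm B (\<phi> (Z i))) (serre_scalars P i j) (\<phi> (Z j))"
    if "Z \<in> {GE, GF}" "i \<in> idx P" "j \<in> idx P" "cartan P i i = 2" "i \<noteq> j" for Z i j
  proof -
    have "cartan P i j \<le> 0" "qi P i \<noteq> 0" using valid that by (auto simp: valid_wq_datum_def borcherds_cartan_def)
    then show ?thesis
      using that(4) Zg[OF that(1,2)] Zg[OF that(1,3)] by (simp add: serre_element_fold(1) h_fold FA_closed h_gvar)
  qed
  have 2: "h (gvar (Z i) * gvar (Z j) - gvar (Z j) * gvar (Z i)) = fold (qcomm B (\<phi> (Z i))) (serre_scalars P i j) (\<phi> (Z j))"
    if "Z \<in> {GE, GF}" "i \<in> idx P" "j \<in> idx P" "cartan P i j = 0" for Z i j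
    using serre_pair_ladder(2)[OF valid that(2,3) _ that(4)] Zg[OF that(1,2)] Zg[OF that(1,3)] that(4)
    by (simp add: ev h_ops(3) qcomm_def serre_pair_def)
  show ?thesis
  proof
    assume L: "\<forall>r\<in>serre_relations P. h r = \<zero>"
    show "\<forall>Z\<in>{GE, GF}. \<forall>i\<in>idx P. \<forall>j\<in>idx P.
       serre_pair P i j \<longrightarrow> fold (qcomm B (\<phi> (Z i))) (serre_scalars P i j) (\<phi> (Z j)) = \<zero>"
    proof (intro ballI impI)
      fix Z i j assume a: "Z \<in> {GE, GF}" "i \<in> idx P" "j \<in> idx P" and s: "serre_pair P i j"
      from s consider "cartan P i i = 2" "i \<noteq> j" | "cartan P i j = 0" unfolding serre_pair_def by blast
      then show "fold (qcomm B (\<phi> (Z i))) (serre_scalars P i j) (\<phi> (Z j)) = \<zero>"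
      proof cases
        case A: 1
        have "serre_element P Z i j \<in> serre_relations P" unfolding serre_relations_def using A a by blast
        then show ?thesis using L 1[OF a A] by metis
      next
        case A: 2
        have "gvar (Z i) * gvar (Z j) - gvar (Z j) * gvar (Z i) \<in> serre_relations P"
          unfolding serre_relations_def using A a by blast
        then show ?thesis using L 2[OF a A] by metis
      qed
    qed
  next
    assume R: "\<forall>Z\<in>{GE, GF}. \<forall>i\<in>idx P. \<forall>j\<in>idx P.
       serre_pair P i j \<longrightarrow> fold (qcomm B (\<phi> (Z i))) (serre_scalars P i j) (\<phi> (Z j)) = \<zero>"
    show "\<forall>r\<in>serre_relations P. h r = \<zero>"
      unfolding serre_relations_def ball_Un Ball_image_Collect
    proof (intro conjI allI impI; elim conjE)
      fix Z i j assume a: "Z \<in> {GE, GF}" "i \<in> idx P" "j \<in> idx P"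
      show "h (serre_element P Z i j) = \<zero>" if A: "cartan P i i = 2" "i \<noteq> j"
        unfolding 1[OF a A] using R a A unfolding serre_pair_def by blast
      show "h (gvar (Z i) * gvar (Z j) - gvar (Z j) * gvar (Z i)) = \<zero>" if A: "cartan P i j = 0"
        unfolding 2[OF a A] using R a A unfolding serre_pair_def by blast
    qed
  qed
qed

text \<open>
  The two directions have different uses. One shows that the generators of \<open>wU\<close> form a
  representation, the other that a representation induces a morphism out of \<open>wU\<close>.
\<close>

lemma relations_iff_rep: "(\<forall>r\<in>wq_relations P. h r = \<zero>) \<longleftrightarrow> wq_rep B P \<phi>"
proof
  assume "\<forall>r\<in>wq_relations P. h r = \<zero>"
  then have t: "\<forall>r\<in>torus_relations P. h r = \<zero>" "\<forall>r\<in>type_relations P. h r = \<zero>"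
    "\<forall>r\<in>EF_relations P. h r = \<zero>" "\<forall>r\<in>serre_relations P. h r = \<zero>"
    by (simp_all add: wq_relations_def)
  note a = t(1)[unfolded torus_iff] t(2)[unfolded type_iff[OF t(1)]] t(3)[unfolded EF_iff] t(4)[unfolded serre_iff]
  show "wq_rep B P \<phi>"
  proof (intro wq_rep.intro kalg_axioms wq_rep_axioms.intro)
  qed (use a phi_closed in blast)+
next
  assume "wq_rep B P \<phi>"
  then interpret R: wq_rep B P \<phi> .
  have "\<forall>r\<in>torus_relations P. h r = \<zero>"
    unfolding torus_iff using R.K_Kb_raw R.D_Db_raw R.J_e_raw R.torus_comm R.torus_e_raw by blast
  note t = this
  moreover have "\<forall>r\<in>type_relations P. h r = \<zero>"
    unfolding type_iff[OF t] using R.K_E R.Kb_E R.K_F R.Kb_F R.type0_E_raw R.type0_F_raw by blast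
  moreover have "\<forall>r\<in>EF_relations P. h r = \<zero>"
    unfolding EF_iff using R.E_F by blast
  moreover have "\<forall>r\<in>serre_relations P. h r = \<zero>"
    unfolding serre_iff using R.serre by blast
  ultimately show "\<forall>r\<in>wq_relations P. h r = \<zero>" unfolding wq_relations_def by blast
qed

end

section \<open>The algebra \<open>wU\<close> and its universal property\<close>

lemma wq_relations_closed: 
  fixes P :: "'k::field wq_datum"
  shows "wq_relations P \<subseteq> carrier (free_algebra (idx P))"
proof -
  let ?C = "carrier (free_algebra (idx P) :: ('k, 'k fa) module)"
  note c = FA_closed[where I = "idx P"]
  have sum: "(\<Sum>r=0..N. f r) \<in> ?C" if "\<And>r. f r \<in> ?C" for f and N :: nat
    by (induction N) (simp_all add: that c)
  have "serre_element P Z i j \<in> ?C" if "Z \<in> {GE, GF}" "i \<in> idx P" "j \<in> idx P" for Z i j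
    unfolding serre_element_def Let_def by (intro sum c) (use that in auto)
  then have "\<forall>r\<in>wq_relations P. r \<in> ?C"
    unfolding wq_relations_def torus_relations_def type_relations_def EF_relations_def serre_relations_def
      Let_def ball_Un Ball_image_Collect
    by (auto simp: c torus_gens_subset intro!: c)
  then show ?thesis by blast
qed

locale wq_datum =
  fixes P :: "'k::field wq_datum"
  assumes valid: "valid_wq_datum P"
begin

abbreviation "I \<equiv> idx P"
abbreviation "FA \<equiv> free_algebra (idx P) :: ('k, 'k fa) module"
abbreviation "H \<equiv> wU P"

lemma wU_ideal_eq: "wU_ideal P = Idl\<^bsub>FA\<^esub> (wq_relations P)"
  by (simp add: wU_ideal_def wq_relations_def)

lemma kalg_ideal_wU: "kalg_ideal FA (wU_ideal P)"
proof -
  interpret FA: kalg FA using k_algebra_free by (simp add: kalg_def)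
  show ?thesis unfolding wU_ideal_eq
    by (intro kalg_ideal.intro FA.kalg_axioms FA.genideal_ideal wq_relations_closed)
qed

lemma k_algebra_wU: "k_algebra H"
  unfolding wU_def by (rule kalg_ideal.quot_alg_k_algebra[OF kalg_ideal_wU])

lemma wU_proj: "(\<lambda>x. wU_ideal P +>\<^bsub>FA\<^esub> x) \<in> alg_hom FA H"
  unfolding wU_def by (rule kalg_ideal.quot_alg_proj[OF kalg_ideal_wU])

lemma wU_rep: "wq_rep H P (wgen P)"
proof -
  interpret N: kalg_ideal FA "wU_ideal P" by (rule kalg_ideal_wU)
  interpret ev: free_eval H P "\<lambda>x. wU_ideal P +>\<^bsub>FA\<^esub> x" "wgen P"
    by (intro free_eval.intro free_eval_axioms.intro wU_proj valid)
      (simp_all add: kalg_def k_algebra_wU wgen_def)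
  have "wU_ideal P +>\<^bsub>FA\<^esub> r = \<zero>\<^bsub>H\<^esub>" if "r \<in> wq_relations P" for r
  proof -
    have "r \<in> wU_ideal P" unfolding wU_ideal_eq using N.genideal_self[OF wq_relations_closed] that by blast
    then show ?thesis unfolding wU_def by (simp add: quot_alg_def N.a_rcos_const)
  qed
  then show ?thesis using ev.relations_iff_rep by blast
qed

text \<open>
  The kernel of the morphism from the free algebra is an ideal that contains the relations, hence
  contains the ideal generated by them.
\<close>

lemma induced_hom_rep:
  assumes "wq_rep B P \<phi>"
  shows "induced_hom B \<phi> \<in> alg_hom H B"
    and "\<And>g. g \<in> gens I \<Longrightarrow> induced_hom B \<phi> (wgen P g) = \<phi> g"
proof -
  interpret R: wq_rep B P \<phi> by fact
  interpret N: kalg_ideal FA "wU_ideal P" by (rule kalg_ideal_wU)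
  have cl: "\<phi> \<in> gens I \<rightarrow> carrier B" using R.gen_closed by blast
  note fl = free_lift_hom[OF R.k_algebra cl]
  interpret ev: free_eval B P "free_lift B \<phi>" \<phi>
    by (intro free_eval.intro free_eval_axioms.intro fl valid R.kalg_axioms free_lift_gvar[OF R.k_algebra cl])
  interpret fl: alg_hom_pair FA B "free_lift B \<phi>" using fl by unfold_locales
  have rel: "free_lift B \<phi> r = \<zero>\<^bsub>B\<^esub>" if "r \<in> wq_relations P" for r
    using ev.relations_iff_rep assms that by blast
  let ?K = "{x \<in> carrier FA. free_lift B \<phi> x = \<zero>\<^bsub>B\<^esub>}"
  have "ideal ?K FA"
  proof (rule idealI[OF N.ring_axioms])
    have "submodule ?K (ring_of_type_algebra :: 'k ring) FA"
      by (rule N.submoduleI) (auto simp: fl.add fl.smult)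
    then show "subgroup ?K (add_monoid FA)" by (simp add: submodule_def)
  qed (simp_all add: fl.mult)
  then have "wU_ideal P \<subseteq> ?K"
    unfolding wU_ideal_eq by (rule N.genideal_minimal) (use rel wq_relations_closed in blast)
  then have ker: "free_lift B \<phi> n = \<zero>\<^bsub>B\<^esub>" if "n \<in> wU_ideal P" for n using that by blast
  have eq: "induced_hom B \<phi> (wU_ideal P +>\<^bsub>FA\<^esub> x) = free_lift B \<phi> x" if "x \<in> carrier FA" for x
    unfolding induced_hom_def
    by (rule N.the_elem_coset[OF R.kalg_axioms alg_hom_lin_map[OF fl] ker that])
  interpret q: alg_hom_pair FA H "\<lambda>x. wU_ideal P +>\<^bsub>FA\<^esub> x"
    using wU_proj k_algebra_wU N.kalg_axioms by (simp add: alg_hom_pair_def alg_hom_pair_axioms_def kalg_def)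
  have car: "carrier H = (\<lambda>x. wU_ideal P +>\<^bsub>FA\<^esub> x) ` carrier FA"
    unfolding wU_def by (rule N.quot_alg_carrier)
  show "induced_hom B \<phi> \<in> alg_hom H B"
  proof (rule alg_homI)
    show "induced_hom B \<phi> \<one>\<^bsub>H\<^esub> = \<one>\<^bsub>B\<^esub>" using q.one eq[OF N.one_closed] by simp
    show "induced_hom B \<phi> x \<in> carrier B" if "x \<in> carrier H" for x
      using that unfolding car by (auto simp: eq)
    show "induced_hom B \<phi> (c \<odot>\<^bsub>H\<^esub> x) = c \<odot>\<^bsub>B\<^esub> induced_hom B \<phi> x" if x: "x \<in> carrier H" for x c
    proof -
      obtain t where "t \<in> carrier FA" "x = wU_ideal P +>\<^bsub>FA\<^esub> t" using x unfolding car by blast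
      then show ?thesis by (simp add: q.smult[symmetric] eq fl.smult)
    qed
    fix x y assume xy: "x \<in> carrier H" "y \<in> carrier H"
    obtain t u where *: "t \<in> carrier FA" "x = wU_ideal P +>\<^bsub>FA\<^esub> t" "u \<in> carrier FA" "y = wU_ideal P +>\<^bsub>FA\<^esub> u"
      using xy unfolding car by blast
    show "induced_hom B \<phi> (x \<oplus>\<^bsub>H\<^esub> y) = induced_hom B \<phi> x \<oplus>\<^bsub>B\<^esub> induced_hom B \<phi> y"
      using * by (simp add: q.add[symmetric] eq fl.add)
    show "induced_hom B \<phi> (x \<otimes>\<^bsub>H\<^esub> y) = induced_hom B \<phi> x \<otimes>\<^bsub>B\<^esub> induced_hom B \<phi> y"
      using * by (simp add: q.mult[symmetric] eq fl.mult)
  qed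
  show "induced_hom B \<phi> (wgen P g) = \<phi> g" if "g \<in> gens I" for g
    unfolding wgen_def using eq[OF FA_closed(1)[OF that]] ev.h_gvar[OF that] by simp
qed

end

section \<open>New representations from old ones\<close>

locale wq_rep_valid = wq_rep B P \<phi>
  for B :: "('k::field, 'b) module" (structure) and P :: "'k wq_datum" and \<phi> :: "gen \<Rightarrow> 'b" +
  assumes valid: "valid_wq_datum P"
begin

lemma idx_nonempty: "1 \<in> idx P"
  using valid by (auto simp: valid_wq_datum_def)

lemma e_e [simp]: "e \<otimes> e = e" using e_idem[OF idx_nonempty] .

text \<open>
  The factor from moving \<open>Kb\<^sub>i\<close> past \<open>E\<^sub>i\<close> is inverse to that from moving \<open>K\<^sub>i\<close>, so \<open>e = K\<^sub>i Kb\<^sub>i\<close>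
  passes unchanged.
\<close>

lemma e_E: "i \<in> idx P \<Longrightarrow> e \<otimes> E i = E i \<otimes> e"
proof -
  assume i: "i \<in> idx P"
  have "e \<otimes> E i = K i \<otimes> (Kb i \<otimes> E i)" using i K_Kb[OF i] by (simp add: m_assoc[symmetric])
  also have "\<dots> = inverse (wt P i i) \<odot> (K i \<otimes> E i \<otimes> Kb i)" using i by (simp add: Kb_E m_assoc)
  also have "\<dots> = E i \<otimes> (K i \<otimes> Kb i)" using i wt_nonzero[OF valid i, of i] by (simp add: K_E m_assoc)
  finally show ?thesis using i by (simp add: K_Kb)
qed

lemma e_F: "i \<in> idx P \<Longrightarrow> e \<otimes> F i = F i \<otimes> e"
proof -
  assume i: "i \<in> idx P"
  have "e \<otimes> F i = K i \<otimes> (Kb i \<otimes> F i)" using i K_Kb[OF i] by (simp add: m_assoc[symmetric])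
  also have "\<dots> = wt P i i \<odot> (K i \<otimes> F i \<otimes> Kb i)" using i by (simp add: Kb_F m_assoc)
  also have "\<dots> = F i \<otimes> (K i \<otimes> Kb i)" using i wt_nonzero[OF valid i, of i] by (simp add: K_F m_assoc)
  finally show ?thesis using i by (simp add: K_Kb)
qed

lemma e_central_gen: "g \<in> gens (idx P) \<Longrightarrow> e \<otimes> \<phi> g = \<phi> g \<otimes> e"
  by (cases g) (simp_all add: e_E e_F e_torus)

lemma e_pow: "n > 0 \<Longrightarrow> e [^] (n::nat) = e"
proof (induction n)
  case (Suc n) then show ?case by (cases n) simp_all
qed simp

text \<open>
  Apart from commuting with the torus and satisfying \<open>J e = J\<close>, \<open>J\<close> enters only through \<open>e\<close>, and
  \<open>e\<^bsup>m-1\<^esup> = e\<close>. The representation obtained from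
  \<open>wU\<close> in this way takes values in \<open>Utau\<close> and fixes the generators of \<open>Utau\<close>, so it induces a
  retraction.
\<close>

lemma rep_J_to_e: "wq_rep B P (\<phi>(GJ := e))"
proof -
  have j: "jexp P - 1 > 0" using valid by (auto simp: valid_wq_datum_def)
  have ee: "e [^] (jexp P - 1) = e" by (rule e_pow[OF j])
  have upd: "(\<phi>(GJ := e)) g \<otimes> e = (\<phi>(GJ := e)) g" "e \<otimes> (\<phi>(GJ := e)) g = (\<phi>(GJ := e)) g"
    if "g \<in> torus_gens (idx P)" for g
    using that e_torus by (cases "g = GJ"; simp)+
  show ?thesis
  proof (intro wq_rep.intro kalg_axioms wq_rep_axioms.intro; (unfold fun_upd_same ee)?)
    show "(\<phi>(GJ := e)) g \<otimes> (\<phi>(GJ := e)) h = (\<phi>(GJ := e)) h \<otimes> (\<phi>(GJ := e)) g"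
      if "g \<in> torus_gens (idx P)" "h \<in> torus_gens (idx P)" for g h
      using upd[OF that(1)] upd[OF that(2)] torus_comm[OF that] by (cases "g = GJ"; cases "h = GJ"; simp)
    show "fold (qcomm B ((\<phi>(GJ := e)) (Z i))) (serre_scalars P i j) ((\<phi>(GJ := e)) (Z j)) = \<zero>"
      if "Z \<in> {GE, GF}" "i \<in> idx P" "j \<in> idx P" "serre_pair P i j" for Z i j
      using serre[OF that] that(1) by auto
    show "(\<phi>(GJ := e)) g \<in> carrier B" if "g \<in> gens (idx P)" for g
      using gen_closed[OF that] by simp
    show "(\<phi>(GJ := e)) g \<otimes> e = (\<phi>(GJ := e)) g" if "g \<in> torus_gens (idx P) - {GJ}" for g
      using upd(1) that by blast
  qed (simp_all add: K_Kb D_Db K_E Kb_E K_F Kb_F type0_E type0_F E_F)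
qed

definition f where "f = \<one> \<oplus> (- 1) \<odot> e"

lemma f_closed [simp]: "f \<in> carrier B" by (simp add: f_def)

lemma one_split: "\<one> = e \<oplus> f"
proof -
  have "e \<oplus> f = \<one> \<oplus> (1 \<odot> e \<oplus> (- 1) \<odot> e)" by (simp add: f_def a_ac)
  then show ?thesis using smult_add_cancel[of e 1 "- 1"] by simp
qed

lemma minus_zero_smult: "x \<in> carrier B \<Longrightarrow> x \<oplus> (- 1) \<odot> x = \<zero>"
  using smult_add_cancel[of x 1 "- 1"] by simp

lemma e_f [simp]: "e \<otimes> f = \<zero>" "f \<otimes> e = \<zero>" "f \<otimes> f = f"
proof -
  show 1: "e \<otimes> f = \<zero>" and "f \<otimes> e = \<zero>" by (simp_all add: f_def r_distr l_distr minus_zero_smult)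
  have "f \<otimes> f = f \<oplus> (- 1) \<odot> (e \<otimes> f)" by (subst f_def) (simp add: l_distr)
  then show "f \<otimes> f = f" using 1 by simp
qed

lemma f_central: "x \<in> carrier B \<Longrightarrow> e \<otimes> x = x \<otimes> e \<Longrightarrow> f \<otimes> x = x \<otimes> f"
  by (simp add: f_def l_distr r_distr)

lemma f_zero: "x \<in> carrier B \<Longrightarrow> e \<otimes> x = x \<Longrightarrow> f \<otimes> x = \<zero>" "x \<in> carrier B \<Longrightarrow> x \<otimes> e = x \<Longrightarrow> x \<otimes> f = \<zero>"
  by (simp_all add: f_def l_distr r_distr minus_zero_smult)

lemma f_torus: "g \<in> torus_gens (idx P) \<Longrightarrow> f \<otimes> \<phi> g = \<zero>" "g \<in> torus_gens (idx P) \<Longrightarrow> \<phi> g \<otimes> f = \<zero>"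
  using f_zero[of "\<phi> g"] e_torus[of g] torus_closed[of g] by simp_all

lemma f_EF: "i \<in> idx P \<Longrightarrow> f \<otimes> E i = E i \<otimes> f" "i \<in> idx P \<Longrightarrow> f \<otimes> F i = F i \<otimes> f"
  using f_central e_E e_F by simp_all

text \<open>
  The commutator of \<open>E\<^sub>i\<close> and \<open>F\<^sub>j\<close> is a combination of \<open>K\<^sub>i\<close> and \<open>Kb\<^sub>i\<close>, which \<open>f\<close> annihilates.
\<close>

lemma f_E_F: 
  assumes "i \<in> idx P" "j \<in> idx P"
  shows "f \<otimes> (E i \<otimes> F j) = f \<otimes> (F j \<otimes> E i)"
proof (cases "i = j")
  case True
  have "f \<otimes> (c \<odot> (K j \<oplus> (- 1) \<odot> Kb j)) = \<zero>" for c
    using assms by (subst mult_smult_r) (simp_all add: r_distr f_torus)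
  then show ?thesis using assms True E_F[OF assms] by (simp add: r_distr)
qed (use assms E_F[OF assms] in simp)

subsection \<open>The opposite algebra\<close>

text \<open>
  Candidates for antipodes and for their inverses. On the \<open>e\<close>-part they send \<open>E\<^sub>i\<close> to a multiple of
  \<open>E\<^sub>i Kb\<^sub>i\<close> and \<open>F\<^sub>i\<close> to a multiple of \<open>F\<^sub>i K\<^sub>i\<close>, on the \<open>f\<close>-part they multiply \<open>E\<^sub>i\<close> and \<open>F\<^sub>i\<close> by the
  scalar \<open>d\<close>. For \<open>d = 1\<close> nothing of the \<open>f\<close>-part is lost, and for \<open>d = 0\<close> the
  generators vanish there.
\<close>

definition antirep :: "(nat \<Rightarrow> 'k) \<Rightarrow> (nat \<Rightarrow> 'k) \<Rightarrow> 'k \<Rightarrow> gen \<Rightarrow> 'b" where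
  "antirep \<alpha> \<beta> d g = (case g of GJ \<Rightarrow> \<phi> GJ | GK i \<Rightarrow> Kb i | GKb i \<Rightarrow> K i
     | GD i \<Rightarrow> Db i | GDb i \<Rightarrow> D i
     | GE i \<Rightarrow> \<alpha> i \<odot> (E i \<otimes> Kb i) \<oplus> d \<odot> (E i \<otimes> f)
     | GF i \<Rightarrow> \<beta> i \<odot> (F i \<otimes> K i) \<oplus> d \<odot> (F i \<otimes> f))"

lemma antirep_simps [simp]:
  "antirep \<alpha> \<beta> d GJ = \<phi> GJ" "antirep \<alpha> \<beta> d (GK i) = Kb i" "antirep \<alpha> \<beta> d (GKb i) = K i"
  "antirep \<alpha> \<beta> d (GD i) = Db i" "antirep \<alpha> \<beta> d (GDb i) = D i"
  "antirep \<alpha> \<beta> d (GE i) = \<alpha> i \<odot> (E i \<otimes> Kb i) \<oplus> d \<odot> (E i \<otimes> f)"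
  "antirep \<alpha> \<beta> d (GF i) = \<beta> i \<odot> (F i \<otimes> K i) \<oplus> d \<odot> (F i \<otimes> f)"
  by (simp_all add: antirep_def)

lemma antirep_closed: "g \<in> gens (idx P) \<Longrightarrow> antirep \<alpha> \<beta> d g \<in> carrier B"
  by (cases g) simp_all

lemma qcomm_op: "c \<noteq> 0 \<Longrightarrow> x \<in> carrier B \<Longrightarrow> b \<in> carrier B \<Longrightarrow> qcomm (op_alg B) x c b = (- c) \<odot> qcomm B x (inverse c) b"
  by (simp add: qcomm_def smult_r_distr a_comm)

text \<open>
  Reversing the multiplication turns \<open>x b - c b x\<close> into \<open>- c (x b - c\<^bsup>-1\<^esup> b x)\<close>. Since the scalars of a
  Serre relation are closed under inversion, the relation is preserved.
\<close>

lemma fold_qcomm_op: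
  assumes "0 \<notin> set cs" "x \<in> carrier B" "b \<in> carrier B"
  shows "\<exists>s. fold (qcomm (op_alg B) x) cs b = s \<odot> fold (qcomm B x) (map inverse cs) b"
  using assms
proof (induction cs arbitrary: b)
  case Nil
  then show ?case by (auto intro: exI[of _ 1])
next
  case (Cons c cs)
  interpret O: kalg "op_alg B" using k_algebra_op_alg[OF k_algebra] by (simp add: kalg_def)
  have "fold (qcomm (op_alg B) x) (c # cs) b = fold (qcomm (op_alg B) x) cs ((- c) \<odot> qcomm B x (inverse c) b)"
    using Cons.prems by (simp add: qcomm_op)
  also have "\<dots> = (- c) \<odot> fold (qcomm (op_alg B) x) cs (qcomm B x (inverse c) b)"
    using O.fold_qcomm_smult[of x "qcomm B x (inverse c) b" cs "- c"] Cons.prems by simp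
  finally have 1: "fold (qcomm (op_alg B) x) (c # cs) b = (- c) \<odot> fold (qcomm (op_alg B) x) cs (qcomm B x (inverse c) b)" .
  obtain s where "fold (qcomm (op_alg B) x) cs (qcomm B x (inverse c) b)
      = s \<odot> fold (qcomm B x) (map inverse cs) (qcomm B x (inverse c) b)"
    using Cons.IH[of "qcomm B x (inverse c) b"] Cons.prems by auto
  then have "fold (qcomm (op_alg B) x) (c # cs) b = (- c * s) \<odot> fold (qcomm B x) (map inverse (c # cs)) b"
    unfolding 1 using Cons.prems by simp
  then show ?case by blast
qed

lemma nat_pow_op: "x \<in> carrier B \<Longrightarrow> x [^]\<^bsub>op_alg B\<^esub> (n::nat) = x [^] n"
proof (induction n)
  case (Suc n)
  then show ?case using nat_pow_Suc2[of x n] by (simp add: nat_pow_def[of "op_alg B"])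
qed (simp add: nat_pow_def)

lemma KbQ: assumes "i \<in> idx P" "j \<in> idx P" "g \<in> {GE i, GF i}" "k \<in> {GK j, GKb j}"
  shows "\<phi> k \<otimes> (\<phi> g \<otimes> f) = \<zero>" "\<phi> g \<otimes> f \<otimes> \<phi> k = \<zero>"
proof -
  have c: "\<phi> k \<in> carrier B" "\<phi> g \<in> carrier B" using assms by auto
  have "\<phi> k \<otimes> f = \<zero>" "f \<otimes> \<phi> k = \<zero>" using assms by (auto simp: f_torus)
  moreover have "f \<otimes> \<phi> g = \<phi> g \<otimes> f" using assms f_EF by auto
  ultimately show "\<phi> k \<otimes> (\<phi> g \<otimes> f) = \<zero>" "\<phi> g \<otimes> f \<otimes> \<phi> k = \<zero>"
    using c by (metis m_assoc f_closed l_null, metis m_assoc f_closed r_null)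
qed

end

context wq_rep_valid
begin

lemma commute_extend:
  assumes "x \<in> carrier B" "k \<in> carrier B" "k' \<in> carrier B" "k \<otimes> x = c \<odot> (x \<otimes> k)" "k \<otimes> k' = k' \<otimes> k"
  shows "k \<otimes> (x \<otimes> k') = c \<odot> (x \<otimes> k' \<otimes> k)"
proof -
  have "k \<otimes> (x \<otimes> k') = k \<otimes> x \<otimes> k'" using assms(1-3) by (simp add: m_assoc)
  also have "\<dots> = c \<odot> (x \<otimes> (k \<otimes> k'))" using assms(1-3) by (simp add: assms(4) m_assoc)
  finally show ?thesis using assms(1-3) by (simp add: assms(5) m_assoc)
qed

lemma antirep_commute:
  assumes "g \<in> {GE i, GF i}" "k \<in> {GK j, GKb j}" "i \<in> idx P" "j \<in> idx P"
    and "\<phi> k \<otimes> \<phi> g = c \<odot> (\<phi> g \<otimes> \<phi> k)" "c \<noteq> 0"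
  shows "antirep \<alpha> \<beta> d g \<otimes> \<phi> k = inverse c \<odot> (\<phi> k \<otimes> antirep \<alpha> \<beta> d g)"
proof -
  have k: "\<phi> k \<in> carrier B" "\<phi> g \<in> carrier B" using assms by auto
  have KQ: "\<phi> k \<otimes> (\<phi> g \<otimes> f) = \<zero>" "\<phi> g \<otimes> f \<otimes> \<phi> k = \<zero>" by (rule KbQ[OF assms(3,4,1,2)])+
  obtain a k' where g: "antirep \<alpha> \<beta> d g = a \<odot> (\<phi> g \<otimes> \<phi> k') \<oplus> d \<odot> (\<phi> g \<otimes> f)" and k': "k' \<in> torus_gens (idx P)"
    using assms(1,3) by auto
  have k'c: "\<phi> k' \<in> carrier B" using torus_closed[OF k'] .
  have kk: "\<phi> k \<otimes> \<phi> k' = \<phi> k' \<otimes> \<phi> k" using torus_comm[OF _ k', of k] assms(2,4) by auto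
  have "\<phi> k \<otimes> antirep \<alpha> \<beta> d g = c \<odot> (antirep \<alpha> \<beta> d g \<otimes> \<phi> k)"
    unfolding g using k k'c KQ commute_extend[OF k(2,1) k'c assms(5) kk]
    by (simp add: r_distr l_distr mult.commute)
  then show ?thesis using assms(6) antirep_closed[of g \<alpha> \<beta> d] assms(1,3) k by auto
qed

text \<open>
  The condition on \<open>\<alpha>\<close> and \<open>\<beta>\<close> comes from the relation between \<open>E\<^sub>i\<close> and \<open>F\<^sub>i\<close>: the commutator of
  \<open>\<alpha> E\<^sub>i Kb\<^sub>i\<close> and \<open>\<beta> F\<^sub>i K\<^sub>i\<close> is \<open>\<alpha> \<beta> wt\<^sub>i\<^sub>i\<close> times that of \<open>E\<^sub>i\<close> and \<open>F\<^sub>i\<close>, up to a factor \<open>e\<close>. The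
  summands with \<open>Kb\<^sub>i\<close> or \<open>K\<^sub>i\<close> and those with \<open>f\<close> annihilate each other, and the latter commute by
  \<open>f_E_F\<close>, so \<open>d\<close> is free.
\<close>

lemma antirep_rep:
  assumes \<alpha>\<beta>: "\<And>i. i \<in> idx P \<Longrightarrow> \<alpha> i * \<beta> i * wt P i i = 1"
  shows "wq_rep (op_alg B) P (antirep \<alpha> \<beta> d)"
proof -
  let ?T = "antirep \<alpha> \<beta> d"
  have e_op: "\<phi> GJ [^]\<^bsub>op_alg B\<^esub> (jexp P - 1) = e" using nat_pow_op[of "\<phi> GJ" "jexp P - 1"] by (simp add: e_def)
  have wn: "wt P i j \<noteq> 0" if "i \<in> idx P" for i j using wt_nonzero[OF valid that] .
  have torus: "\<exists>g'\<in>torus_gens (idx P). ?T g = \<phi> g'" if "g \<in> torus_gens (idx P)" for g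
    using that by (cases g) (auto intro: bexI[of _ GJ])
  have wF: "inverse (wt P i j) \<noteq> 0" if "i \<in> idx P" for i j using wn[OF that] by simp
  show ?thesis
  proof (intro wq_rep.intro wq_rep_axioms.intro; (unfold op_alg_simps antirep_simps(1-5) e_op)?)
    show "kalg (op_alg B)" using k_algebra_op_alg[OF k_algebra] by (simp add: kalg_def)
    show "?T g \<in> carrier B" if "g \<in> gens (idx P)" for g using antirep_closed[OF that] .
    show "K i \<otimes> Kb i = e" "D i \<otimes> Db i = e" if "i \<in> idx P" for i
      using that K_Kb D_Db by auto
    show "e \<otimes> \<phi> GJ = \<phi> GJ" by (simp add: e_torus)
    show "?T h \<otimes> ?T g = ?T g \<otimes> ?T h" if "g \<in> torus_gens (idx P)" "h \<in> torus_gens (idx P)" for g h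
      using torus[OF that(1)] torus[OF that(2)] torus_comm by force
    show "e \<otimes> ?T g = ?T g" if gg: "g \<in> torus_gens (idx P) - {GJ}" for g
    proof -
      obtain g' where "g' \<in> torus_gens (idx P)" "?T g = \<phi> g'" using torus[of g] gg by blast
      then show ?thesis using e_torus(2)[of g'] by simp
    qed
    fix i j assume ij: "i \<in> idx P" "j \<in> idx P"
    show "?T (GE i) \<otimes> Kb j = wt P i j \<odot> (Kb j \<otimes> ?T (GE i))"
      using antirep_commute[OF _ _ ij Kb_E[OF ij] wF[OF ij(1)]] by simp
    show "?T (GE i) \<otimes> K j = inverse (wt P i j) \<odot> (K j \<otimes> ?T (GE i))"
      using antirep_commute[OF _ _ ij K_E[OF ij] wn[OF ij(1)]] by simp
    show "?T (GF i) \<otimes> Kb j = inverse (wt P i j) \<odot> (Kb j \<otimes> ?T (GF i))"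
      using antirep_commute[OF _ _ ij Kb_F[OF ij] wn[OF ij(1)]] by simp
    show "?T (GF i) \<otimes> K j = wt P i j \<odot> (K j \<otimes> ?T (GF i))"
      using antirep_commute[OF _ _ ij K_F[OF ij] wF[OF ij(1)]] by simp
  next
    show "?T (GE i) \<otimes> e = ?T (GE i)" if i: "i \<in> idx P" "tyE P i = 0" for i
    proof -
      have "E i \<otimes> f = \<zero>" using f_zero(1)[of "E i"] type0_E[OF i] f_EF(1)[OF i(1)] i by simp
      then show ?thesis using i by (simp add: l_distr m_assoc e_torus)
    qed
    show "?T (GF i) \<otimes> e = ?T (GF i)" if i: "i \<in> idx P" "tyF P i = 0" for i
    proof -
      have "F i \<otimes> f = \<zero>" using f_zero(1)[of "F i"] type0_F[OF i] f_EF(2)[OF i(1)] i by simp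
      then show ?thesis using i by (simp add: l_distr m_assoc e_torus)
    qed
  next
    fix i j assume ij: "i \<in> idx P" "j \<in> idx P"
    let ?PE = "E i \<otimes> Kb i" and ?QE = "E i \<otimes> f"
    let ?PF = "F j \<otimes> K j" and ?QF = "F j \<otimes> f"
    let ?s = "inverse (qi P i - inverse (qi P i))"
    let ?KK = "K j \<otimes> Kb i"
    have KKc: "Kb i \<otimes> K j = ?KK" using torus_comm[of "GKb i" "GK j"] ij by simp
    have 1: "?PF \<otimes> ?PE = wt P i j \<odot> (F j \<otimes> E i \<otimes> ?KK)"
    proof -
      have "?PF \<otimes> ?PE = F j \<otimes> (K j \<otimes> E i) \<otimes> Kb i" using ij by (simp add: m_assoc)
      then show ?thesis using ij by (simp add: K_E m_assoc)
    qed
    have 2: "?PE \<otimes> ?PF = wt P i j \<odot> (E i \<otimes> F j \<otimes> ?KK)"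
    proof -
      have "?PE \<otimes> ?PF = E i \<otimes> (Kb i \<otimes> F j) \<otimes> K j" using ij by (simp add: m_assoc)
      then show ?thesis using ij KKc wt_sym[OF valid ij] by (simp add: Kb_F m_assoc)
    qed
    have 3: "?PF \<otimes> ?QE = \<zero>" "?QF \<otimes> ?PE = \<zero>" "?PE \<otimes> ?QF = \<zero>" "?QE \<otimes> ?PF = \<zero>"
      using ij KbQ(1)[of i j "GE i" "GK j"] KbQ(1)[of j i "GF j" "GKb i"] f_EF f_torus
      by (simp_all add: m_assoc) (simp_all add: m_assoc[symmetric], simp_all add: m_assoc f_torus)
    have 4: "?QF \<otimes> ?QE = ?QE \<otimes> ?QF"
    proof -
      have "?QF \<otimes> ?QE = F j \<otimes> (f \<otimes> E i) \<otimes> f" using ij by (simp add: m_assoc)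
      also have "\<dots> = F j \<otimes> E i \<otimes> f" using ij by (simp add: f_EF m_assoc)
      also have "\<dots> = f \<otimes> (F j \<otimes> E i)" using ij f_EF by (metis closed(2,3) f_closed m_assoc)
      also have "\<dots> = f \<otimes> (E i \<otimes> F j)" using f_E_F[OF ij] by simp
      also have "\<dots> = E i \<otimes> F j \<otimes> f" using ij f_EF by (metis closed(2,3) f_closed m_assoc)
      also have "\<dots> = E i \<otimes> (f \<otimes> F j) \<otimes> f" using ij by (simp add: f_EF m_assoc)
      also have "\<dots> = ?QE \<otimes> ?QF" using ij by (simp add: m_assoc)
      finally show ?thesis .
    qed
    have 5: "\<alpha> i * \<beta> j * wt P i j \<odot> (F j \<otimes> E i \<otimes> ?KK)
      = \<alpha> i * \<beta> j * wt P i j \<odot> (E i \<otimes> F j \<otimes> ?KK) \<oplus>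
        (if i = j then ?s \<odot> (Kb i \<oplus> (- 1) \<odot> K i) else \<zero>)"
    proof (cases "i = j")
      case True
      let ?X = "F i \<otimes> E i \<otimes> e" and ?k = "K i" and ?k' = "Kb i"
      have "E i \<otimes> F i \<otimes> e = ?X \<oplus> ?s \<odot> (?k \<oplus> (- 1) \<odot> ?k')"
        using ij by (simp add: E_F l_distr e_torus)
      moreover have "?s \<odot> (?k \<oplus> (- 1) \<odot> ?k') \<oplus> ?s \<odot> (?k' \<oplus> (- 1) \<odot> ?k) = \<zero>"
      proof -
        have "?s \<odot> (?k \<oplus> (- 1) \<odot> ?k') \<oplus> ?s \<odot> (?k' \<oplus> (- 1) \<odot> ?k)
          = ?s \<odot> ((?k \<oplus> (- 1) \<odot> ?k) \<oplus> (?k' \<oplus> (- 1) \<odot> ?k'))"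
          using ij by (simp add: smult_r_distr a_ac)
        then show ?thesis using ij by (simp add: minus_zero_smult)
      qed
      ultimately show ?thesis
        using \<alpha>\<beta>[OF ij(1)] True ij by (simp add: K_Kb a_assoc)
    next
      case False
      then show ?thesis using E_F[OF ij] ij by simp
    qed
    show "?T (GF j) \<otimes> ?T (GE i) = ?T (GE i) \<otimes> ?T (GF j) \<oplus>
      (if i = j then ?s \<odot> (Kb i \<oplus> (- 1) \<odot> K i) else \<zero>)"
    proof -
      have l: "?T (GF j) \<otimes> ?T (GE i) = (\<alpha> i * \<beta> j * wt P i j) \<odot> (F j \<otimes> E i \<otimes> ?KK) \<oplus> (d * d) \<odot> (?QF \<otimes> ?QE)"
        using ij 1 3 by (simp add: l_distr r_distr smult_r_distr mult_ac del: m_assoc)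
      have r: "?T (GE i) \<otimes> ?T (GF j) = (\<alpha> i * \<beta> j * wt P i j) \<odot> (E i \<otimes> F j \<otimes> ?KK) \<oplus> (d * d) \<odot> (?QE \<otimes> ?QF)"
        using ij 2 3 by (simp add: l_distr r_distr smult_r_distr mult_ac del: m_assoc)
      show ?thesis unfolding l r 5 4 using ij by (simp add: a_ac)
    qed
  next
    fix Z i j assume Z: "Z \<in> {GE, GF}" and ij: "i \<in> idx P" "j \<in> idx P" and s: "serre_pair P i j"
    have Zc: "\<phi> (Z i) \<in> carrier B" "\<phi> (Z j) \<in> carrier B" and Zf: "f \<otimes> \<phi> (Z i) = \<phi> (Z i) \<otimes> f" "f \<otimes> \<phi> (Z j) = \<phi> (Z j) \<otimes> f"
      using Z ij f_EF by auto
    obtain a k where T: "\<And>i. ?T (Z i) = a i \<odot> (\<phi> (Z i) \<otimes> \<phi> (k i)) \<oplus> d \<odot> (\<phi> (Z i) \<otimes> f)"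
      and k: "\<And>i. i \<in> idx P \<Longrightarrow> k i \<in> torus_gens (idx P)" "k \<in> {GK, GKb}"
      and kZ: "\<exists>r. \<phi> (k i) \<otimes> \<phi> (Z j) = r \<odot> (\<phi> (Z j) \<otimes> \<phi> (k i)) \<and> \<phi> (k j) \<otimes> \<phi> (Z i) = r \<odot> (\<phi> (Z i) \<otimes> \<phi> (k j))"
        "\<exists>r. \<phi> (k i) \<otimes> \<phi> (Z i) = r \<odot> (\<phi> (Z i) \<otimes> \<phi> (k i))"
    proof (cases "Z = GE")
      case True
      show thesis
        by (rule that[of \<alpha> GKb]) (use True ij Kb_E wt_sym[OF valid ij] in auto)
    next
      case False
      then have "Z = GF" using Z by simp
      then show thesis
        by (intro that[of \<beta> GK]) (use ij K_F wt_sym[OF valid ij] in auto)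
    qed
    have kc: "\<phi> (k i) \<in> carrier B" "\<phi> (k j) \<in> carrier B" using k(1) ij torus_closed by auto
    have kk: "\<phi> (k i) \<otimes> \<phi> (k j) = \<phi> (k j) \<otimes> \<phi> (k i)" using k(1) ij torus_comm by auto
    let ?x = "a i \<odot> (\<phi> (Z i) \<otimes> \<phi> (k i))" and ?y = "d \<odot> (\<phi> (Z i) \<otimes> f)"
    let ?b = "a j \<odot> (\<phi> (Z j) \<otimes> \<phi> (k j))" and ?d = "d \<odot> (\<phi> (Z j) \<otimes> f)"
    have S: "fold (qcomm B (\<phi> (Z i))) (serre_scalars P i j) (\<phi> (Z j)) = \<zero>" by (rule serre[OF Z ij s])
    obtain r r' where r: "\<phi> (k i) \<otimes> \<phi> (Z j) = r \<odot> (\<phi> (Z j) \<otimes> \<phi> (k i))" "\<phi> (k j) \<otimes> \<phi> (Z i) = r \<odot> (\<phi> (Z i) \<otimes> \<phi> (k j))"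
      "\<phi> (k i) \<otimes> \<phi> (Z i) = r' \<odot> (\<phi> (Z i) \<otimes> \<phi> (k i))" using kZ by blast
    have X0: "fold (qcomm B ?x) (serre_scalars P i j) ?b = \<zero>"
      by (rule fold_qcomm_twist_zero[OF Zc kc r(3,1,2) kk S])
    have Y0: "fold (qcomm B ?y) (serre_scalars P i j) ?d = \<zero>"
      by (rule fold_qcomm_twist_zero[OF Zc f_closed f_closed, where \<kappa> = 1 and \<rho> = 1]) (use Zf S Zc in simp_all)
    have kf: "\<phi> (k i) \<otimes> f = \<zero>" "f \<otimes> \<phi> (k i) = \<zero>" "\<phi> (k j) \<otimes> f = \<zero>" "f \<otimes> \<phi> (k j) = \<zero>"
      using f_torus k(1) ij by auto
    have PQ: "u \<otimes> \<phi> g \<otimes> (v \<otimes> f) = \<zero>" "v \<otimes> f \<otimes> (u \<otimes> \<phi> g) = \<zero>"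
      if c: "u \<in> carrier B" "v \<in> carrier B" "\<phi> g \<in> carrier B" and z: "\<phi> g \<otimes> f = \<zero>" "f \<otimes> \<phi> g = \<zero>"
        and cm: "f \<otimes> u = u \<otimes> f" "f \<otimes> v = v \<otimes> f" for u v g
    proof -
      have "u \<otimes> \<phi> g \<otimes> (v \<otimes> f) = u \<otimes> (\<phi> g \<otimes> f) \<otimes> v" using c by (simp add: m_assoc cm(2)[symmetric])
      then show "u \<otimes> \<phi> g \<otimes> (v \<otimes> f) = \<zero>" using c z by simp
      have "v \<otimes> f \<otimes> (u \<otimes> \<phi> g) = v \<otimes> (f \<otimes> u) \<otimes> \<phi> g" using c by (simp add: m_assoc)
      also have "\<dots> = v \<otimes> u \<otimes> (f \<otimes> \<phi> g)" using c unfolding cm(1) by (simp add: m_assoc)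
      finally show "v \<otimes> f \<otimes> (u \<otimes> \<phi> g) = \<zero>" using c z by simp
    qed
    note pq = PQ[OF Zc(1) Zc(2) kc(1) kf(1,2) Zf] PQ[OF Zc(2) Zc(1) kc(2) kf(3,4) Zf(2,1)]
      PQ[OF Zc(1) Zc(1) kc(1) kf(1,2) Zf(1,1)]
    have *: "fold (qcomm B (?x \<oplus> ?y)) (serre_scalars P i j) (?b \<oplus> ?d) = \<zero>"
      by (rule fold_qcomm_sum_zero[OF _ _ _ _ _ _ _ wn[OF ij(1)] wn[OF ij(1)] serre_pair_ladder(1)[OF valid ij s] X0 Y0])
        (use Zc kc pq in simp_all)
    have "0 \<notin> set (serre_scalars P i j)" using wn[OF ij(1)] by (auto simp: ladder_def)
    then obtain t where t: "fold (qcomm (op_alg B) (?x \<oplus> ?y)) (serre_scalars P i j) (?b \<oplus> ?d)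
      = t \<odot> fold (qcomm B (?x \<oplus> ?y)) (map inverse (serre_scalars P i j)) (?b \<oplus> ?d)"
      using fold_qcomm_op[of "serre_scalars P i j" "?x \<oplus> ?y" "?b \<oplus> ?d"] Zc kc by auto
    have m: "map inverse (serre_scalars P i j) = rev (serre_scalars P i j)"
    proof -
      have "map inverse (serre_scalars P i j) = ladder (wt P i j) (wt P i i) (serre_len P i j)"
        by (simp add: ladder_def power_inverse)
      also have "\<dots> = rev (serre_scalars P i j)"
        using arg_cong[OF serre_pair_ladder(1)[OF valid ij s], of rev] by simp
      finally show ?thesis .
    qed
    show "fold (qcomm (op_alg B) (?T (Z i))) (serre_scalars P i j) (?T (Z j)) = \<zero>"
      unfolding T t m using * Zc kc by (simp add: fold_qcomm_rev)
  qed
qed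

end

subsection \<open>The tensor square and the ground field\<close>

lemma scalar_rep:
  assumes valid: "valid_wq_datum P"
  shows "wq_rep scalar_algebra P (\<lambda>g. case g of GE i \<Rightarrow> 0 | GF i \<Rightarrow> 0 | _ \<Rightarrow> (1::'k::field))"
proof -
  interpret S: kalg "scalar_algebra :: ('k, 'k) module" using k_algebra_scalar by (simp add: kalg_def)
  have p: "(1::'k) [^]\<^bsub>scalar_algebra\<^esub> (n::nat) = 1" for n
    using S.nat_pow_one[of n] by simp
  have f: "fold (qcomm scalar_algebra (0::'k)) cs 0 = 0" for cs
    by (induction cs) (simp_all add: qcomm_def)
  show ?thesis
    by (intro wq_rep.intro S.kalg_axioms wq_rep_axioms.intro)
      (auto simp: p f torus_gens_def)
qed

context wq_rep_valid
begin

text \<open>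
  In the comultiplication a generator of type one is paired with \<open>1\<close> and one of type zero with \<open>e\<close>.
  In both cases this element acts on the generator as the identity (\<open>unit_of_type_EF\<close>), is central
  and group-like, so no distinction of types is needed below except on the \<open>f\<close>-part.
\<close>

definition unit_of_type :: "nat \<Rightarrow> 'b" where
  "unit_of_type t = (if t = 1 then \<one> else e)"

abbreviation "uE i \<equiv> unit_of_type (tyE P i)"
abbreviation "uF i \<equiv> unit_of_type (tyF P i)"

lemma unit_of_type_facts [simp]:
  "unit_of_type t \<in> carrier B"
  "e \<otimes> unit_of_type t = e" "unit_of_type t \<otimes> e = e"
  "g \<in> torus_gens (idx P) \<Longrightarrow> unit_of_type t \<otimes> \<phi> g = \<phi> g"
  "g \<in> torus_gens (idx P) \<Longrightarrow> \<phi> g \<otimes> unit_of_type t = \<phi> g"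
  by (auto simp: unit_of_type_def e_torus torus_closed)

lemma unit_of_type_comm:
  "unit_of_type t \<otimes> unit_of_type s = unit_of_type s \<otimes> unit_of_type t"
  "i \<in> idx P \<Longrightarrow> unit_of_type t \<otimes> E i = E i \<otimes> unit_of_type t"
  "i \<in> idx P \<Longrightarrow> unit_of_type t \<otimes> F i = F i \<otimes> unit_of_type t"
  by (auto simp: unit_of_type_def e_E e_F)

lemma tyEF: "i \<in> idx P \<Longrightarrow> tyE P i = 0 \<or> tyE P i = 1" "i \<in> idx P \<Longrightarrow> tyF P i = 0 \<or> tyF P i = 1"
  using valid by (auto simp: valid_wq_datum_def)

lemma unit_of_type_EF [simp]:
  "i \<in> idx P \<Longrightarrow> uE i \<otimes> E i = E i"
  "i \<in> idx P \<Longrightarrow> uF i \<otimes> F i = F i"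
  "i \<in> idx P \<Longrightarrow> E i \<otimes> uE i = E i"
  "i \<in> idx P \<Longrightarrow> F i \<otimes> uF i = F i"
proof -
  show 1: "uE i \<otimes> E i = E i" if "i \<in> idx P" for i
    using tyEF(1)[OF that] type0_E[OF that] that by (auto simp: unit_of_type_def)
  show 2: "uF i \<otimes> F i = F i" if "i \<in> idx P" for i
    using tyEF(2)[OF that] type0_F[OF that] that by (auto simp: unit_of_type_def)
  show "i \<in> idx P \<Longrightarrow> E i \<otimes> uE i = E i"
    "i \<in> idx P \<Longrightarrow> F i \<otimes> uF i = F i"
    using 1 2 unit_of_type_comm by simp_all
qed

abbreviation "BB \<equiv> tensor B B"
abbreviation "pt \<equiv> pure_tensor B B"

definition deltarep :: "gen \<Rightarrow> (('b \<times> 'b) \<Rightarrow>\<^sub>0 'k) set" where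
  "deltarep g = (case g of
       GE i \<Rightarrow> pt (uE i) (E i) \<oplus>\<^bsub>BB\<^esub> pt (E i) (K i)
     | GF i \<Rightarrow> pt (F i) (uF i) \<oplus>\<^bsub>BB\<^esub> pt (Kb i) (F i)
     | _ \<Rightarrow> pt (\<phi> g) (\<phi> g))"

lemma deltarep_simps [simp]:
  "deltarep (GE i) = pt (uE i) (E i) \<oplus>\<^bsub>BB\<^esub> pt (E i) (K i)"
  "deltarep (GF i) = pt (F i) (uF i) \<oplus>\<^bsub>BB\<^esub> pt (Kb i) (F i)"
  "deltarep GJ = pt (\<phi> GJ) (\<phi> GJ)" "deltarep (GK i) = pt (K i) (K i)"
  "deltarep (GKb i) = pt (Kb i) (Kb i)" "deltarep (GD i) = pt (D i) (D i)"
  "deltarep (GDb i) = pt (Db i) (Db i)"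
  by (simp_all add: deltarep_def)

lemma deltarep_torus: "g \<in> torus_gens (idx P) \<Longrightarrow> deltarep g = pt (\<phi> g) (\<phi> g)"
  by (cases g) simp_all

lemma kalg2_BB: "kalg2 B B"
  by (intro kalg2.intro kalg_axioms)

lemma fold_qcomm_pt_left:
  assumes "x \<in> carrier B" "b \<in> carrier B"
  shows "pt (fold (qcomm B x) cs b) \<one> = fold (qcomm BB (pt x \<one>)) cs (pt b \<one>)"
proof -
  interpret T: kalg2 B B by (rule kalg2_BB)
  have "alg_hom_pair B BB (\<lambda>x. pt x \<one>)"
    by (intro alg_hom_pair.intro alg_hom_pair_axioms.intro kalg_axioms T.T.kalg_axioms alg_homI)
      (simp_all add: T.pt_add_l T.pt_mult T.pt_smult_l T.pt_one)
  from alg_hom_pair.fold_qcomm[OF this assms] show ?thesis .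
qed

lemma fold_qcomm_pt_right:
  assumes "x \<in> carrier B" "b \<in> carrier B"
  shows "pt \<one> (fold (qcomm B x) cs b) = fold (qcomm BB (pt \<one> x)) cs (pt \<one> b)"
proof -
  interpret T: kalg2 B B by (rule kalg2_BB)
  have "alg_hom_pair B BB (\<lambda>x. pt \<one> x)"
    by (intro alg_hom_pair.intro alg_hom_pair_axioms.intro kalg_axioms T.T.kalg_axioms alg_homI)
      (simp_all add: T.pt_add_r T.pt_mult T.pt_smult_r T.pt_one)
  from alg_hom_pair.fold_qcomm[OF this assms] show ?thesis .
qed

text \<open>
  The embeddings \<open>x \<mapsto> x \<otimes> 1\<close> and \<open>x \<mapsto> 1 \<otimes> x\<close> are morphisms with commuting images, so the twist
  lemma applies with trivial weights.
\<close>

lemma fold_qcomm_pt_twist: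
  assumes c: "x \<in> carrier B" "b \<in> carrier B" "k \<in> carrier B" "m \<in> carrier B"
    and km: "k \<otimes> m = m \<otimes> k" and z: "fold (qcomm B x) cs b = \<zero>"
  shows "fold (qcomm BB (pt x k)) cs (pt b m) = \<zero>\<^bsub>BB\<^esub>" "fold (qcomm BB (pt k x)) cs (pt m b) = \<zero>\<^bsub>BB\<^esub>"
proof -
  interpret T: kalg2 B B by (rule kalg2_BB)
  have z0: "pt \<zero> \<one> = \<zero>\<^bsub>BB\<^esub>" "pt \<one> \<zero> = \<zero>\<^bsub>BB\<^esub>"
    using T.pt_smult_l[of "\<zero>" \<one> 0] T.pt_smult_r[of \<one> \<zero> 0] by simp_all
  have "fold (qcomm BB (1 \<odot>\<^bsub>BB\<^esub> (pt x \<one> \<otimes>\<^bsub>BB\<^esub> pt \<one> k))) cs (1 \<odot>\<^bsub>BB\<^esub> (pt b \<one> \<otimes>\<^bsub>BB\<^esub> pt \<one> m)) = \<zero>\<^bsub>BB\<^esub>"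
    by (rule T.T.fold_qcomm_twist_zero[where \<kappa> = 1 and \<rho> = 1])
      (use c km z0 z in \<open>simp_all add: T.pt_mult fold_qcomm_pt_left[symmetric]\<close>)
  then show "fold (qcomm BB (pt x k)) cs (pt b m) = \<zero>\<^bsub>BB\<^esub>" using c by (simp add: T.pt_mult)
  have "fold (qcomm BB (1 \<odot>\<^bsub>BB\<^esub> (pt \<one> x \<otimes>\<^bsub>BB\<^esub> pt k \<one>))) cs (1 \<odot>\<^bsub>BB\<^esub> (pt \<one> b \<otimes>\<^bsub>BB\<^esub> pt m \<one>)) = \<zero>\<^bsub>BB\<^esub>"
    by (rule T.T.fold_qcomm_twist_zero[where \<kappa> = 1 and \<rho> = 1])
      (use c km z0 z in \<open>simp_all add: T.pt_mult fold_qcomm_pt_right[symmetric]\<close>)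
  then show "fold (qcomm BB (pt k x)) cs (pt m b) = \<zero>\<^bsub>BB\<^esub>" using c by (simp add: T.pt_mult)
qed

text \<open>
  In the commutator of \<open>\<Delta>(E\<^sub>i)\<close> and \<open>\<Delta>(F\<^sub>j)\<close> the mixed terms \<open>E\<^sub>i Kb\<^sub>j \<otimes> K\<^sub>i F\<^sub>j\<close> and
  \<open>Kb\<^sub>j E\<^sub>i \<otimes> F\<^sub>j K\<^sub>i\<close> agree by the symmetry of \<open>wt\<close>, and the other two give
  \<open>Kb\<^sub>i \<otimes> (K\<^sub>i - Kb\<^sub>i) + (K\<^sub>i - Kb\<^sub>i) \<otimes> K\<^sub>i\<close>, which telescopes. The Serre relation follows from
  \<open>fold_qcomm_sum_zero\<close>, the two summands of \<open>\<Delta>(E\<^sub>i)\<close> being twisted copies of \<open>E\<^sub>i\<close>.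
\<close>

lemma deltarep_rep: "wq_rep BB P deltarep"
proof -
  interpret T: kalg2 B B by (rule kalg2_BB)
  have wn: "wt P i j \<noteq> 0" if "i \<in> idx P" for i j using wt_nonzero[OF valid that] .
  have "pt (\<phi> GJ) (\<phi> GJ) [^]\<^bsub>BB\<^esub> (n::nat) = pt (\<phi> GJ [^] n) (\<phi> GJ [^] n)" for n
    by (induction n) (simp_all add: T.pt_one T.pt_mult)
  then have e_BB: "pt (\<phi> GJ) (\<phi> GJ) [^]\<^bsub>BB\<^esub> (jexp P - 1) = pt e e" by (simp add: e_def)
  have tor: "g \<in> torus_gens (idx P) \<Longrightarrow> \<phi> g \<in> carrier B" for g by (rule torus_closed)
  note ops = T.pt_mult T.T.r_distr T.T.l_distr T.T.smult_r_distr T.pt_smult_l T.pt_smult_r T.pt_closed T.T.smult_smult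
  show ?thesis
  proof (intro wq_rep.intro wq_rep_axioms.intro; (unfold deltarep_simps(3-) e_BB)?)
    show "kalg BB" by (rule T.T.kalg_axioms)
    show "deltarep g \<in> carrier BB" if "g \<in> gens (idx P)" for g
      using that by (cases g) simp_all
    show "pt (K i) (K i) \<otimes>\<^bsub>BB\<^esub> pt (Kb i) (Kb i) = pt e e"
      "pt (D i) (D i) \<otimes>\<^bsub>BB\<^esub> pt (Db i) (Db i) = pt e e" if "i \<in> idx P" for i
      using that by (simp_all add: T.pt_mult K_Kb D_Db)
    show "pt (\<phi> GJ) (\<phi> GJ) \<otimes>\<^bsub>BB\<^esub> pt e e = pt (\<phi> GJ) (\<phi> GJ)" by (simp add: T.pt_mult J_e)
    show "deltarep g \<otimes>\<^bsub>BB\<^esub> deltarep h = deltarep h \<otimes>\<^bsub>BB\<^esub> deltarep g"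
      if "g \<in> torus_gens (idx P)" "h \<in> torus_gens (idx P)" for g h
      using that tor torus_comm[OF that] by (simp add: deltarep_torus T.pt_mult)
    show "deltarep g \<otimes>\<^bsub>BB\<^esub> pt e e = deltarep g" if "g \<in> torus_gens (idx P) - {GJ}" for g
      using that tor by (simp add: deltarep_torus T.pt_mult e_torus)
  next
    show "pt e e \<otimes>\<^bsub>BB\<^esub> deltarep (GE i) = deltarep (GE i)" if i: "i \<in> idx P" "tyE P i = 0" for i
      using i type0_E[OF i] by (simp add: ops e_torus) (simp add: unit_of_type_def)
    show "pt e e \<otimes>\<^bsub>BB\<^esub> deltarep (GF i) = deltarep (GF i)" if i: "i \<in> idx P" "tyF P i = 0" for i
      using i type0_F[OF i] by (simp add: ops e_torus) (simp add: unit_of_type_def)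
  next
    fix i j assume ij: "i \<in> idx P" "j \<in> idx P"
    have tc: "K j \<otimes> K i = K i \<otimes> K j" "Kb j \<otimes> K i = K i \<otimes> Kb j"
      "K j \<otimes> Kb i = Kb i \<otimes> K j" "Kb j \<otimes> Kb i = Kb i \<otimes> Kb j"
      using ij by (simp_all add: torus_comm)
    show "pt (K j) (K j) \<otimes>\<^bsub>BB\<^esub> deltarep (GE i) = wt P i j \<odot>\<^bsub>BB\<^esub> (deltarep (GE i) \<otimes>\<^bsub>BB\<^esub> pt (K j) (K j))"
      using ij by (simp add: ops K_E tc(1))
    show "pt (Kb j) (Kb j) \<otimes>\<^bsub>BB\<^esub> deltarep (GE i) = inverse (wt P i j) \<odot>\<^bsub>BB\<^esub> (deltarep (GE i) \<otimes>\<^bsub>BB\<^esub> pt (Kb j) (Kb j))"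
      using ij by (simp add: ops Kb_E tc(2))
    show "pt (K j) (K j) \<otimes>\<^bsub>BB\<^esub> deltarep (GF i) = inverse (wt P i j) \<odot>\<^bsub>BB\<^esub> (deltarep (GF i) \<otimes>\<^bsub>BB\<^esub> pt (K j) (K j))"
      using ij by (simp add: ops K_F tc(3))
    show "pt (Kb j) (Kb j) \<otimes>\<^bsub>BB\<^esub> deltarep (GF i) = wt P i j \<odot>\<^bsub>BB\<^esub> (deltarep (GF i) \<otimes>\<^bsub>BB\<^esub> pt (Kb j) (Kb j))"
      using ij by (simp add: ops Kb_F tc(4))
  next
    fix i j assume ij: "i \<in> idx P" "j \<in> idx P"
    let ?E = "E i" and ?F = "F j" and ?K = "K i" and ?Kb = "Kb j"
    let ?u = "uE i" and ?v = "uF j"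
    let ?s = "inverse (qi P i - inverse (qi P i))"
    let ?a1 = "pt (?F \<otimes> ?u) (?E \<otimes> ?v)" and ?a2 = "pt ?Kb (?F \<otimes> ?E)" and ?a3 = "pt (?F \<otimes> ?E) ?K"
      and ?a4 = "pt (?Kb \<otimes> ?E) (?F \<otimes> ?K)"
    have l: "deltarep (GE i) \<otimes>\<^bsub>BB\<^esub> deltarep (GF j) = (pt (?u \<otimes> ?F) (?E \<otimes> ?v) \<oplus>\<^bsub>BB\<^esub> pt ?Kb (?E \<otimes> ?F)) \<oplus>\<^bsub>BB\<^esub>
      (pt (?E \<otimes> ?F) ?K \<oplus>\<^bsub>BB\<^esub> pt (?E \<otimes> ?Kb) (?K \<otimes> ?F))"
      using ij by (simp add: ops T.T.a_ac)
    have r: "deltarep (GF j) \<otimes>\<^bsub>BB\<^esub> deltarep (GE i) = (?a1 \<oplus>\<^bsub>BB\<^esub> ?a3) \<oplus>\<^bsub>BB\<^esub> (?a2 \<oplus>\<^bsub>BB\<^esub> ?a4)"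
      using ij by (simp add: ops unit_of_type_comm T.T.a_ac)
    have 1: "pt (?u \<otimes> ?F) (?E \<otimes> ?v) = ?a1" using ij by (simp add: unit_of_type_comm)
    have 4: "?a4 = pt (?E \<otimes> ?Kb) (?K \<otimes> ?F)"
      using ij wn[OF ij(1), of j] wt_sym[OF valid ij] by (simp add: Kb_E K_F T.pt_smult_l T.pt_smult_r)
    show "deltarep (GE i) \<otimes>\<^bsub>BB\<^esub> deltarep (GF j) = deltarep (GF j) \<otimes>\<^bsub>BB\<^esub> deltarep (GE i) \<oplus>\<^bsub>BB\<^esub>
      (if i = j then ?s \<odot>\<^bsub>BB\<^esub> (pt (K i) (K i) \<oplus>\<^bsub>BB\<^esub> (- 1) \<odot>\<^bsub>BB\<^esub> pt (Kb i) (Kb i)) else \<zero>\<^bsub>BB\<^esub>)"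
    proof (cases "i = j")
      case False
      then have "?E \<otimes> ?F = ?F \<otimes> ?E" using E_F[OF ij] ij by simp
      then show ?thesis unfolding l r 1 4 using ij False by (simp add: T.T.a_ac)
    next
      case True
      let ?k = "K i" and ?k' = "Kb i"
      have EF: "?E \<otimes> ?F = ?F \<otimes> ?E \<oplus> (?s \<odot> ?k \<oplus> (- ?s) \<odot> ?k')" using E_F[OF ij] ij True by (simp add: smult_r_distr)
      have p2: "pt ?Kb (?E \<otimes> ?F) = ?a2 \<oplus>\<^bsub>BB\<^esub> (?s \<odot>\<^bsub>BB\<^esub> pt ?k' ?k \<oplus>\<^bsub>BB\<^esub> (- ?s) \<odot>\<^bsub>BB\<^esub> pt ?k' ?k')"
        unfolding EF using ij True by (simp add: T.pt_add_r T.pt_smult_r)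
      have p3: "pt (?E \<otimes> ?F) ?K = ?a3 \<oplus>\<^bsub>BB\<^esub> (?s \<odot>\<^bsub>BB\<^esub> pt ?k ?k \<oplus>\<^bsub>BB\<^esub> (- ?s) \<odot>\<^bsub>BB\<^esub> pt ?k' ?k)"
        unfolding EF using ij True by (simp add: T.pt_add_l T.pt_smult_l)
      let ?A = "(?a1 \<oplus>\<^bsub>BB\<^esub> ?a3) \<oplus>\<^bsub>BB\<^esub> (?a2 \<oplus>\<^bsub>BB\<^esub> ?a4)"
      have "deltarep (GE i) \<otimes>\<^bsub>BB\<^esub> deltarep (GF j) = ?A \<oplus>\<^bsub>BB\<^esub>
        ((?s \<odot>\<^bsub>BB\<^esub> pt ?k' ?k \<oplus>\<^bsub>BB\<^esub> (- ?s) \<odot>\<^bsub>BB\<^esub> pt ?k' ?k) \<oplus>\<^bsub>BB\<^esub> (?s \<odot>\<^bsub>BB\<^esub> pt ?k ?k \<oplus>\<^bsub>BB\<^esub> (- ?s) \<odot>\<^bsub>BB\<^esub> pt ?k' ?k'))"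
        unfolding l 1 p2 p3 4 using ij by (simp add: T.T.a_ac)
      also have "?s \<odot>\<^bsub>BB\<^esub> pt ?k' ?k \<oplus>\<^bsub>BB\<^esub> (- ?s) \<odot>\<^bsub>BB\<^esub> pt ?k' ?k = \<zero>\<^bsub>BB\<^esub>"
        using ij by (intro T.T.smult_add_cancel) simp_all
      finally show ?thesis unfolding r using ij True by (simp add: T.T.smult_r_distr)
    qed
  next
    fix Z i j assume Z: "Z \<in> {GE, GF}" and ij: "i \<in> idx P" "j \<in> idx P" and s: "serre_pair P i j"
    have S: "fold (qcomm B (\<phi> (Z i))) (serre_scalars P i j) (\<phi> (Z j)) = \<zero>" by (rule serre[OF Z ij s])
    have tc: "K j \<otimes> K i = K i \<otimes> K j" "Kb j \<otimes> Kb i = Kb i \<otimes> Kb j"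
      using ij by (simp_all add: torus_comm)
    have sym: "wt P j i = wt P i j" using wt_sym[OF valid ij] by simp
    show "fold (qcomm BB (deltarep (Z i))) (serre_scalars P i j) (deltarep (Z j)) = \<zero>\<^bsub>BB\<^esub>"
    proof (cases "Z = GE")
      case True
      let ?u = "\<lambda>i. uE i"
      have S': "fold (qcomm B (E i)) (serre_scalars P i j) (E j) = \<zero>" using S True by simp
      note tw = fold_qcomm_pt_twist(2)[OF closed(2)[OF ij(1)] closed(2)[OF ij(2)] unit_of_type_facts(1) unit_of_type_facts(1) unit_of_type_comm(1) S']
        fold_qcomm_pt_twist(1)[OF closed(2)[OF ij(1)] closed(2)[OF ij(2)] closed(4)[OF ij(1)] closed(4)[OF ij(2)] tc(1)[symmetric] S']
      have "fold (qcomm BB (pt (?u i) (E i) \<oplus>\<^bsub>BB\<^esub> pt (E i) (K i))) (serre_scalars P i j)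
          (pt (?u j) (E j) \<oplus>\<^bsub>BB\<^esub> pt (E j) (K j)) = \<zero>\<^bsub>BB\<^esub>"
        by (rule T.T.fold_qcomm_sum_zero[OF _ _ _ _ _ _ _ wn[OF ij(1)] wn[OF ij(1)] serre_pair_ladder(1)[OF valid ij s] tw])
          (use ij sym in \<open>simp_all add: ops K_E unit_of_type_comm\<close>)
      then show ?thesis using True by simp
    next
      case False
      then have Zf: "Z = GF" using Z by simp
      let ?u = "\<lambda>i. uF i"
      have S': "fold (qcomm B (F i)) (serre_scalars P i j) (F j) = \<zero>" using S Zf by simp
      note tw = fold_qcomm_pt_twist(1)[OF closed(3)[OF ij(1)] closed(3)[OF ij(2)] unit_of_type_facts(1) unit_of_type_facts(1) unit_of_type_comm(1) S']
        fold_qcomm_pt_twist(2)[OF closed(3)[OF ij(1)] closed(3)[OF ij(2)] closed(5)[OF ij(1)] closed(5)[OF ij(2)] tc(2)[symmetric] S']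
      have "fold (qcomm BB (pt (F i) (?u i) \<oplus>\<^bsub>BB\<^esub> pt (Kb i) (F i))) (serre_scalars P i j)
          (pt (F j) (?u j) \<oplus>\<^bsub>BB\<^esub> pt (Kb j) (F j)) = \<zero>\<^bsub>BB\<^esub>"
        by (rule T.T.fold_qcomm_sum_zero[OF _ _ _ _ _ _ _ wn[OF ij(1)] wn[OF ij(1)] serre_pair_ladder(1)[OF valid ij s] tw])
          (use ij sym in \<open>simp_all add: ops Kb_F unit_of_type_comm\<close>)
      then show ?thesis using Zf by simp
    qed
  qed
qed

end

section \<open>The bialgebra\<close>

text \<open>
  An algebra generated by a representation with \<open>J = e\<close>, with a comultiplication that has the right
  values on the generators. \<open>Utau\<close> is the instance of interest. The arguments use nothing else about
  it, and so they are free of cosets and subalgebras.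
\<close>

locale wq_bialg = wq_rep_valid B P \<phi>
  for B :: "('k::field, 'b) module" (structure) and P :: "'k wq_datum" and \<phi> :: "gen \<Rightarrow> 'b" +
  fixes \<Delta> :: "'b \<Rightarrow> (('b \<times> 'b) \<Rightarrow>\<^sub>0 'k) set"
  assumes J_is_e: "\<phi> GJ = e"
    and generated: "\<And>C. subalgebra B C \<Longrightarrow> \<phi> ` gens (idx P) \<subseteq> C \<Longrightarrow> carrier B \<subseteq> C"
    and Delta_hom: "\<Delta> \<in> alg_hom B (tensor B B)"
    and Delta_gen: "\<And>g. g \<in> gens (idx P) \<Longrightarrow> \<Delta> (\<phi> g) = deltarep g"
begin

text \<open>
  Closure under right multiplication by generators suffices: the elements \<open>y\<close> for which it holds, for
  all \<open>x\<close>, form a subalgebra.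
\<close>

lemma gens_induct [consumes 1, case_names zero add smult one gen]:
  assumes "x \<in> carrier B"
    and "Q \<zero>" and "\<And>x y. x \<in> carrier B \<Longrightarrow> y \<in> carrier B \<Longrightarrow> Q x \<Longrightarrow> Q y \<Longrightarrow> Q (x \<oplus> y)"
    and "\<And>c x. x \<in> carrier B \<Longrightarrow> Q x \<Longrightarrow> Q (c \<odot> x)" and "Q \<one>"
    and "\<And>x g. x \<in> carrier B \<Longrightarrow> Q x \<Longrightarrow> g \<in> gens (idx P) \<Longrightarrow> Q (x \<otimes> \<phi> g)"
  shows "Q x"
proof -
  let ?C = "{y \<in> carrier B. \<forall>x\<in>carrier B. Q x \<longrightarrow> Q (x \<otimes> y)}"
  have "subalgebra B ?C"
    unfolding subalgebra_iff
    using assms(2-4) by (auto simp: r_distr m_assoc[symmetric])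
  moreover have "\<phi> ` gens (idx P) \<subseteq> ?C" using assms(6) gen_closed by auto
  ultimately have "x \<in> ?C" using generated assms(1) by blast
  then have "Q (\<one> \<otimes> x)" using assms(5) by blast
  then show ?thesis using assms(1) by simp
qed

lemma alg_hom_eq_on_gens:
  assumes "kalg C" "h \<in> alg_hom B C" "h' \<in> alg_hom B C"
    and "\<And>g. g \<in> gens (idx P) \<Longrightarrow> h (\<phi> g) = h' (\<phi> g)" "x \<in> carrier B"
  shows "h x = h' x"
proof -
  have "carrier B \<subseteq> {x \<in> carrier B. h x = h' x}"
    by (rule generated[OF alg_hom_eqI_subalgebra[OF assms(1-3)]]) (use assms(4) gen_closed in auto)
  then show ?thesis using assms(5) by blast
qed

lemma e_central: "x \<in> carrier B \<Longrightarrow> e \<otimes> x = x \<otimes> e"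
proof -
  have "subalgebra B {x \<in> carrier B. e \<otimes> x = x \<otimes> e}"
    unfolding subalgebra_iff by (auto simp: r_distr l_distr) (metis e_closed m_assoc)
  then have "carrier B \<subseteq> {x \<in> carrier B. e \<otimes> x = x \<otimes> e}"
    by (rule generated) (use e_central_gen gen_closed in auto)
  then show "x \<in> carrier B \<Longrightarrow> e \<otimes> x = x \<otimes> e" by blast
qed

lemma f_commutes: "x \<in> carrier B \<Longrightarrow> f \<otimes> x = x \<otimes> f"
  using f_central e_central by simp

lemma Delta_e: "\<Delta> e = pt e e"
  using Delta_gen[of GJ] J_is_e by simp

lemma alg_hom_pair_Delta: "alg_hom_pair B BB \<Delta>"
  by (intro alg_hom_pair.intro alg_hom_pair_axioms.intro kalg_axioms Delta_hom)
    (simp add: kalg_def kalg2.k_algebra_tensor kalg2_BB)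

lemma Delta_one: "\<Delta> \<one> = pt \<one> \<one>"
  using alg_hom_pair.one[OF alg_hom_pair_Delta] kalg2.pt_one[OF kalg2_BB] by simp

lemma Delta_unit_of_type: "\<Delta> (unit_of_type t) = pt (unit_of_type t) (unit_of_type t)"
  by (simp add: unit_of_type_def Delta_e Delta_one)

lemma Delta_torus: "g \<in> torus_gens (idx P) \<Longrightarrow> \<Delta> (\<phi> g) = pt (\<phi> g) (\<phi> g)"
  using Delta_gen[of g] deltarep_torus[of g] torus_gens_subset[of g] by simp

subsection \<open>Coassociativity and counit\<close>

lemma gens_cases:
  assumes "g \<in> gens (idx P)"
  obtains (torus) "g \<in> torus_gens (idx P)" | (E) i where "i \<in> idx P" "g = GE i" | (F) i where "i \<in> idx P" "g = GF i"
  using assms by (cases g) auto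

text \<open>
  Both sides are algebra morphisms, so they are compared on generators. There the three summands agree
  because \<open>K\<^sub>i\<close>, \<open>Kb\<^sub>i\<close> and \<open>unit_of_type\<close> are group-like.
\<close>

lemma coassoc:
  assumes "x \<in> carrier B"
  shows "tensor_assoc B (tensor_map BB B \<Delta> (\<lambda>y. y) (\<Delta> x)) = tensor_map B BB (\<lambda>y. y) \<Delta> (\<Delta> x)"
proof -
  interpret D: kalg_cube B by (rule kalg_cubeI[OF kalg_axioms])
  have i: "(\<lambda>y. y) \<in> alg_hom B B" by (simp add: alg_homI)
  have k4: "kalg4 B B BB B" "kalg4 B B B BB"
    by (intro kalg4.intro D.HH.kalg2_axioms D.HHH'.kalg2_axioms D.HHH.kalg2_axioms)+
  have h1: "tensor_map BB B \<Delta> (\<lambda>y. y) \<in> alg_hom BB (tensor BB B)" by (rule kalg4.tensor_map_alg_hom[OF k4(1) Delta_hom i])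
  have h2: "tensor_map B BB (\<lambda>y. y) \<Delta> \<in> alg_hom BB (tensor B BB)" by (rule kalg4.tensor_map_alg_hom[OF k4(2) i Delta_hom])
  have h3: "tensor_assoc B \<in> alg_hom (tensor BB B) (tensor B BB)" by (rule D.tensor_assoc_alg_hom)
  note Dl = alg_hom_lin_map[OF Delta_hom] and il = alg_hom_lin_map[OF i]
  note m1 = kalg4.tensor_map_pt[OF k4(1) Dl il] and m2 = kalg4.tensor_map_pt[OF k4(2) il Dl]
  note a = D.tensor_assoc_pt
  note l1 = lin_mapD[OF alg_hom_lin_map[OF h1]] and l2 = lin_mapD[OF alg_hom_lin_map[OF h2]] and l3 = lin_mapD[OF alg_hom_lin_map[OF h3]]
  have ptc: "pt x y \<in> carrier BB" if "x \<in> carrier B" "y \<in> carrier B" for x y using that by (rule D.HH.pt_closed)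
  have ptc': "pure_tensor BB B t y \<in> carrier (tensor BB B)" if "t \<in> carrier BB" "y \<in> carrier B" for t y
    using that by (rule D.HHH'.pt_closed)
  show ?thesis
  proof (rule alg_hom_eq_on_gens[OF _ _ _ _ assms])
    show "kalg (tensor B BB)" by (rule D.HHH.T.kalg_axioms)
    show "(\<lambda>x. tensor_assoc B (tensor_map BB B \<Delta> (\<lambda>y. y) (\<Delta> x))) \<in> alg_hom B (tensor B BB)"
      by (rule alg_hom_compose[OF alg_hom_compose[OF Delta_hom h1] h3])
    show "(\<lambda>x. tensor_map B BB (\<lambda>y. y) \<Delta> (\<Delta> x)) \<in> alg_hom B (tensor B BB)"
      by (rule alg_hom_compose[OF Delta_hom h2])
    fix g assume g: "g \<in> gens (idx P)"
    then show "tensor_assoc B (tensor_map BB B \<Delta> (\<lambda>y. y) (\<Delta> (\<phi> g))) = tensor_map B BB (\<lambda>y. y) \<Delta> (\<Delta> (\<phi> g))"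
    proof (cases rule: gens_cases)
      case torus
      then show ?thesis using torus_closed[OF torus] by (simp add: Delta_torus m1 m2 a)
    next
      case (E i)
      let ?u = "uE i"
      have c: "E i \<in> carrier B" "K i \<in> carrier B" "?u \<in> carrier B" using E by simp_all
      have d: "\<Delta> (E i) = pt ?u (E i) \<oplus>\<^bsub>BB\<^esub> pt (E i) (K i)" "\<Delta> (K i) = pt (K i) (K i)"
        using Delta_gen[of "GE i"] Delta_gen[of "GK i"] E by simp_all
      show ?thesis unfolding E(2) d(1) using c
        by (simp add: l1 l2 l3 m1 m2 ptc ptc' Delta_unit_of_type d D.HHH'.pt_add_l D.HHH.pt_add_r a D.HHH.T.a_assoc)
    next
      case (F i)
      let ?u = "uF i"
      have c: "F i \<in> carrier B" "Kb i \<in> carrier B" "?u \<in> carrier B" using F by simp_all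
      have d: "\<Delta> (F i) = pt (F i) ?u \<oplus>\<^bsub>BB\<^esub> pt (Kb i) (F i)" "\<Delta> (Kb i) = pt (Kb i) (Kb i)"
        using Delta_gen[of "GF i"] Delta_gen[of "GKb i"] F by simp_all
      show ?thesis unfolding F(2) d(1) using c
        by (simp add: l1 l2 l3 m1 m2 ptc ptc' Delta_unit_of_type d D.HHH'.pt_add_l D.HHH.pt_add_r a D.HHH.T.a_assoc)
    qed
  qed
qed

lemma bialgebra:
  assumes \<epsilon>: "\<epsilon> \<in> alg_hom B scalar_algebra"
    and \<epsilon>g: "\<And>g. g \<in> gens (idx P) \<Longrightarrow> \<epsilon> (\<phi> g) = (case g of GE i \<Rightarrow> 0 | GF i \<Rightarrow> 0 | _ \<Rightarrow> 1)"
  shows "bialgebra B \<Delta> \<epsilon>"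
proof -
  interpret T: kalg2 B B by (rule kalg2_BB)
  interpret \<epsilon>: alg_hom_pair B scalar_algebra \<epsilon>
    using \<epsilon> k_algebra_scalar by unfold_locales (simp_all add: kalg_def)
  note \<epsilon>s = \<epsilon>.add[simplified] \<epsilon>.mult[simplified] \<epsilon>.smult[simplified] \<epsilon>.one[simplified]
  have bl: "bilinear_map B B B (\<lambda>y z. \<epsilon> y \<odot> z)" "bilinear_map B B B (\<lambda>y z. \<epsilon> z \<odot> y)"
    by (rule bilinear_mapI; simp add: \<epsilon>s smult_l_distr smult_r_distr mult_ac)+
  have h1: "tensor_lift B (\<lambda>y z. \<epsilon> y \<odot> z) \<in> alg_hom BB B"
    by (rule T.tensor_lift_alg_hom[OF k_algebra bl(1)]) (simp_all add: \<epsilon>s mult_ac)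
  have h2: "tensor_lift B (\<lambda>y z. \<epsilon> z \<odot> y) \<in> alg_hom BB B"
    by (rule T.tensor_lift_alg_hom[OF k_algebra bl(2)]) (simp_all add: \<epsilon>s mult_ac)
  note l1 = lin_mapD[OF alg_hom_lin_map[OF h1]] and l2 = lin_mapD[OF alg_hom_lin_map[OF h2]]
  note p = T.tensor_lift_pt[OF k_algebra bl(1)] T.tensor_lift_pt[OF k_algebra bl(2)]
  have \<epsilon>u: "\<epsilon> (unit_of_type t) = 1" for t using \<epsilon>g[of GJ] J_is_e \<epsilon>s by (simp add: unit_of_type_def)
  have i: "(\<lambda>y. y) \<in> alg_hom B B" by (simp add: alg_homI)
  have g1: "tensor_lift B (\<lambda>y z. \<epsilon> y \<odot> z) (\<Delta> (\<phi> g)) = \<phi> g \<and> tensor_lift B (\<lambda>y z. \<epsilon> z \<odot> y) (\<Delta> (\<phi> g)) = \<phi> g"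
    if g: "g \<in> gens (idx P)" for g
    using g
  proof (cases rule: gens_cases)
    case torus
    have "\<epsilon> (\<phi> g) = 1" using \<epsilon>g[OF g] torus by (cases g) simp_all
    then show ?thesis using torus_closed[OF torus] by (simp add: Delta_torus torus p)
  next
    case (E i)
    then show ?thesis using \<epsilon>g[of "GE i"] \<epsilon>g[of "GK i"] by (simp add: Delta_gen l1 l2 p \<epsilon>u)
  next
    case (F i)
    then show ?thesis using \<epsilon>g[of "GF i"] \<epsilon>g[of "GKb i"] by (simp add: Delta_gen l1 l2 p \<epsilon>u)
  qed
  have c1: "tensor_lift B (\<lambda>y z. \<epsilon> y \<odot> z) (\<Delta> x) = x" if "x \<in> carrier B" for x
    by (rule alg_hom_eq_on_gens[OF kalg_axioms alg_hom_compose[OF Delta_hom h1] i _ that]) (use g1 in blast)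
  have c2: "tensor_lift B (\<lambda>y z. \<epsilon> z \<odot> y) (\<Delta> x) = x" if "x \<in> carrier B" for x
    by (rule alg_hom_eq_on_gens[OF kalg_axioms alg_hom_compose[OF Delta_hom h2] i _ that]) (use g1 in blast)
  show ?thesis unfolding bialgebra_def
    using k_algebra Delta_hom \<epsilon> coassoc c1 c2 by blast
qed

end

section \<open>Weak antipodes\<close>

text \<open>
  The scalars give \<open>T(E\<^sub>i) = - E\<^sub>i Kb\<^sub>i + d E\<^sub>i f\<close> and \<open>T(F\<^sub>i) = - K\<^sub>i F\<^sub>i + d F\<^sub>i f\<close>, since
  \<open>K\<^sub>i F\<^sub>i = wt\<^sub>i\<^sub>i\<^bsup>-1\<^esup> F\<^sub>i K\<^sub>i\<close>.
\<close>

definition (in wq_rep_valid) standard_antirep :: "'k \<Rightarrow> gen \<Rightarrow> 'b" where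
  "standard_antirep = antirep (\<lambda>i. - 1) (\<lambda>i. - inverse (wt P i i))"

locale wq_antipode = wq_bialg B P \<phi> \<Delta>
  for B :: "('k::field, 'b) module" (structure) and P :: "'k wq_datum" and \<phi> :: "gen \<Rightarrow> 'b" and \<Delta> +
  fixes T :: "'b \<Rightarrow> 'b" and d :: 'k
  assumes T_hom: "T \<in> alg_hom B (op_alg B)"
    and T_gen: "\<And>g. g \<in> gens (idx P) \<Longrightarrow> T (\<phi> g) = standard_antirep d g"
begin

lemma alg_hom_pair_T: "alg_hom_pair B (op_alg B) T"
  by (intro alg_hom_pair.intro alg_hom_pair_axioms.intro kalg_axioms T_hom)
    (simp add: kalg_def k_algebra_op_alg k_algebra)

lemma T_closed [simp]: "x \<in> carrier B \<Longrightarrow> T x \<in> carrier B"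
  using alg_hom_pair.closed[OF alg_hom_pair_T] by simp

lemma T_ops:
  "x \<in> carrier B \<Longrightarrow> y \<in> carrier B \<Longrightarrow> T (x \<oplus> y) = T x \<oplus> T y"
  "x \<in> carrier B \<Longrightarrow> y \<in> carrier B \<Longrightarrow> T (x \<otimes> y) = T y \<otimes> T x"
  "x \<in> carrier B \<Longrightarrow> T (c \<odot> x) = c \<odot> T x" "T \<one> = \<one>"
  using alg_hom_pair.add[OF alg_hom_pair_T] alg_hom_pair.mult[OF alg_hom_pair_T]
    alg_hom_pair.smult[OF alg_hom_pair_T] alg_hom_pair.one[OF alg_hom_pair_T] by simp_all

lemma T_vals:
  "T e = e" "i \<in> idx P \<Longrightarrow> T (K i) = Kb i" "i \<in> idx P \<Longrightarrow> T (Kb i) = K i"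
  "i \<in> idx P \<Longrightarrow> T (E i) = (- 1) \<odot> (E i \<otimes> Kb i) \<oplus> d \<odot> (E i \<otimes> f)"
  "i \<in> idx P \<Longrightarrow> T (F i) = (- inverse (wt P i i)) \<odot> (F i \<otimes> K i) \<oplus> d \<odot> (F i \<otimes> f)"
  using T_gen[of GJ] T_gen J_is_e by (simp_all add: standard_antirep_def)

lemma T_unit_of_type [simp]: "T (unit_of_type t) = unit_of_type t"
  by (simp add: unit_of_type_def T_vals T_ops)

lemma torus_T_torus:
  assumes "g \<in> torus_gens (idx P)"
  shows "\<phi> g \<otimes> T (\<phi> g) = e" "T (\<phi> g) \<otimes> \<phi> g = e" "T (\<phi> g) \<in> carrier B" "f \<otimes> T (\<phi> g) = \<zero>"
  using assms T_gen[of g] J_is_e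
  by (cases g; simp add: standard_antirep_def K_Kb Kb_K D_Db Db_D f_torus)+

lemma z_torus: 
  assumes "z \<in> carrier B" "z \<otimes> f = z" "g \<in> torus_gens (idx P)"
  shows "z \<otimes> \<phi> g = \<zero>" "\<phi> g \<otimes> z = \<zero>" "z \<otimes> T (\<phi> g) = \<zero>" "z \<otimes> e = \<zero>" "e \<otimes> z = \<zero>"
proof -
  note c = assms(1) torus_closed[OF assms(3)] torus_T_torus(3)[OF assms(3)]
  show "z \<otimes> \<phi> g = \<zero>" using m_assoc[of z f "\<phi> g"] assms c by (simp add: f_torus)
  show "z \<otimes> T (\<phi> g) = \<zero>" using m_assoc[of z f "T (\<phi> g)"] assms c by (simp add: torus_T_torus)
  show ze: "z \<otimes> e = \<zero>" using m_assoc[of z f e] assms c by simp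
  then show "e \<otimes> z = \<zero>" using e_central assms(1) by simp
  have "\<phi> g \<otimes> z = \<phi> g \<otimes> (f \<otimes> z)" using assms f_commutes by simp
  also have "\<dots> = \<zero>" using c f_torus[OF assms(3)] by (simp add: m_assoc[symmetric])
  finally show "\<phi> g \<otimes> z = \<zero>" .
qed

lemma unit_f: "z \<in> carrier B \<Longrightarrow> z \<otimes> f = z \<Longrightarrow> unit_of_type t \<otimes> z = (if t = 1 then z else \<zero>)"
  "z \<in> carrier B \<Longrightarrow> z \<otimes> f = z \<Longrightarrow> z \<otimes> unit_of_type t = (if t = 1 then z else \<zero>)"
  using z_torus(4,5)[of z GJ] by (simp_all add: unit_of_type_def)

lemma EF_f_zero: "i \<in> idx P \<Longrightarrow> tyE P i \<noteq> 1 \<Longrightarrow> E i \<otimes> f = \<zero>" "i \<in> idx P \<Longrightarrow> tyF P i \<noteq> 1 \<Longrightarrow> F i \<otimes> f = \<zero>"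
  using tyEF[of i] type0_E[of i] type0_F[of i] f_zero(1)[of "E i"] f_zero(1)[of "F i"] f_EF[of i] by auto

lemma f_T: "i \<in> idx P \<Longrightarrow> f \<otimes> T (E i) = d \<odot> (E i \<otimes> f)" "i \<in> idx P \<Longrightarrow> f \<otimes> T (F i) = d \<odot> (F i \<otimes> f)"
  "i \<in> idx P \<Longrightarrow> T (E i) \<otimes> f = d \<odot> (E i \<otimes> f)" "i \<in> idx P \<Longrightarrow> T (F i) \<otimes> f = d \<odot> (F i \<otimes> f)"
proof -
  show 1: "T (E i) \<otimes> f = d \<odot> (E i \<otimes> f)" if "i \<in> idx P" for i
    using that by (simp add: T_vals l_distr m_assoc f_torus)
  show 2: "T (F i) \<otimes> f = d \<odot> (F i \<otimes> f)" if "i \<in> idx P" for i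
    using that by (simp add: T_vals l_distr m_assoc f_torus)
  show "i \<in> idx P \<Longrightarrow> f \<otimes> T (E i) = d \<odot> (E i \<otimes> f)" "i \<in> idx P \<Longrightarrow> f \<otimes> T (F i) = d \<odot> (F i \<otimes> f)"
    using 1 2 f_commutes by simp_all
qed

text \<open>
  The cancellations \<open>T(E\<^sub>i) + E\<^sub>i Kb\<^sub>i = 0\<close> and \<open>F\<^sub>i + Kb\<^sub>i T(F\<^sub>i) = 0\<close> of an ordinary antipode hold
  after multiplication by \<open>e\<close>.
\<close>

lemma e_T: "i \<in> idx P \<Longrightarrow> e \<otimes> T (E i) = (- 1) \<odot> (E i \<otimes> Kb i)"
  "i \<in> idx P \<Longrightarrow> Kb i \<otimes> T (F i) = (- 1) \<odot> (F i \<otimes> e)"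
proof -
  assume i: "i \<in> idx P"
  have "e \<otimes> (E i \<otimes> f) = \<zero>" using i by (simp add: e_central m_assoc)
  moreover have "e \<otimes> (E i \<otimes> Kb i) = E i \<otimes> Kb i"
    using i by (simp add: e_central m_assoc e_torus)
  ultimately show "e \<otimes> T (E i) = (- 1) \<odot> (E i \<otimes> Kb i)"
    using i by (simp add: T_vals r_distr)
  have "Kb i \<otimes> (F i \<otimes> f) = \<zero>" using KbQ(1)[of i i "GF i" "GKb i"] i by simp
  moreover have "Kb i \<otimes> (F i \<otimes> K i) = wt P i i \<odot> (F i \<otimes> e)"
    using i Kb_F[OF i i] by (simp add: m_assoc[symmetric]) (simp add: m_assoc Kb_K)
  ultimately show "Kb i \<otimes> T (F i) = (- 1) \<odot> (F i \<otimes> e)"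
    using i wt_nonzero[OF valid i, of i] by (simp add: T_vals r_distr)
qed

lemma T_bilinear:
  "z \<in> carrier B \<Longrightarrow> bilinear_map B B B (\<lambda>a b. a \<otimes> z \<otimes> T b)"
  "bilinear_map B B B (\<lambda>a b. T a \<otimes> b)"
  by (rule bilinear_mapI; simp add: l_distr r_distr T_ops)+

text \<open>
  In Sweedler notation \<open>conv_left z y = \<Sum> y\<^sub>1 z T(y\<^sub>2)\<close> and \<open>conv_mid y = \<Sum> T(y\<^sub>1) y\<^sub>2\<close>. The first
  needs a parameter in the middle: for \<open>y = y' g\<close> the factors coming from \<open>g\<close> meet there, next to
  \<open>z\<close>. In the second they come to stand outside.
\<close>

definition conv_left where "conv_left z y = tensor_lift B (\<lambda>a b. a \<otimes> z \<otimes> T b) (\<Delta> y)"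
definition conv_mid where "conv_mid y = tensor_lift B (\<lambda>a b. T a \<otimes> b) (\<Delta> y)"

lemma conv_left_lin:
  "z \<in> carrier B \<Longrightarrow> lin_map B B (conv_left z)" "y \<in> carrier B \<Longrightarrow> lin_map B B (\<lambda>z. conv_left z y)"
  and conv_mid_lin: "lin_map B B conv_mid"
proof -
  interpret K: kalg2 B B by (rule kalg2_BB)
  interpret D: alg_hom_pair B BB \<Delta> by (rule alg_hom_pair_Delta)
  note Dl = alg_hom_lin_map[OF Delta_hom]
  show "z \<in> carrier B \<Longrightarrow> lin_map B B (conv_left z)"
    unfolding conv_left_def by (rule lin_map_comp[OF Dl K.tensor_lift_lin_map[OF k_algebra T_bilinear(1)]])
  show "lin_map B B conv_mid"
    unfolding conv_mid_def by (rule lin_map_comp[OF Dl K.tensor_lift_lin_map[OF k_algebra T_bilinear(2)]])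
  show "lin_map B B (\<lambda>z. conv_left z y)" if "y \<in> carrier B"
    unfolding conv_left_def
    by (rule K.tensor_lift_linear_parameter[OF k_algebra T_bilinear(1) _ k_algebra D.closed[OF that]])
      (auto intro!: lin_mapI simp: l_distr r_distr)
qed

lemma conv_left_closed [simp]: "z \<in> carrier B \<Longrightarrow> y \<in> carrier B \<Longrightarrow> conv_left z y \<in> carrier B"
  and conv_mid_closed [simp]: "y \<in> carrier B \<Longrightarrow> conv_mid y \<in> carrier B"
  using lin_mapD(1)[OF conv_left_lin(1)] lin_mapD(1)[OF conv_mid_lin] by simp_all

lemma conv_step:
  assumes \<beta>: "bilinear_map B B B \<beta>" and c: "y \<in> carrier B" "a \<in> carrier B" "b \<in> carrier B"
  shows "tensor_lift B \<beta> (\<Delta> y \<otimes>\<^bsub>BB\<^esub> pt a b) = tensor_lift B (\<lambda>y w. \<beta> (y \<otimes> a) (w \<otimes> b)) (\<Delta> y)"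
  by (rule kalg2.tensor_lift_mult_pt[OF kalg2_BB k_algebra \<beta> c(2,3)])
    (use alg_hom_pair.closed[OF alg_hom_pair_Delta c(1)] in simp)

lemma lift_Delta_prod:
  assumes \<beta>: "bilinear_map B B B \<beta>" and x: "x \<in> carrier B"
  shows "g \<in> carrier B \<Longrightarrow> \<Delta> g = pt g g \<Longrightarrow>
      tensor_lift B \<beta> (\<Delta> (x \<otimes> g)) = tensor_lift B (\<lambda>y w. \<beta> (y \<otimes> g) (w \<otimes> g)) (\<Delta> x)"
    and "i \<in> idx P \<Longrightarrow> tensor_lift B \<beta> (\<Delta> (x \<otimes> E i)) =
      tensor_lift B (\<lambda>y w. \<beta> (y \<otimes> uE i) (w \<otimes> E i)) (\<Delta> x) \<oplus>
      tensor_lift B (\<lambda>y w. \<beta> (y \<otimes> E i) (w \<otimes> K i)) (\<Delta> x)"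
    and "i \<in> idx P \<Longrightarrow> tensor_lift B \<beta> (\<Delta> (x \<otimes> F i)) =
      tensor_lift B (\<lambda>y w. \<beta> (y \<otimes> F i) (w \<otimes> uF i)) (\<Delta> x) \<oplus>
      tensor_lift B (\<lambda>y w. \<beta> (y \<otimes> Kb i) (w \<otimes> F i)) (\<Delta> x)"
proof -
  interpret K: kalg2 B B by (rule kalg2_BB)
  interpret D: alg_hom_pair B BB \<Delta> by (rule alg_hom_pair_Delta)
  note l = lin_mapD[OF K.tensor_lift_lin_map[OF k_algebra \<beta>]]
  show "tensor_lift B \<beta> (\<Delta> (x \<otimes> g)) = tensor_lift B (\<lambda>y w. \<beta> (y \<otimes> g) (w \<otimes> g)) (\<Delta> x)"
    if "g \<in> carrier B" "\<Delta> g = pt g g"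
    using that conv_step[OF \<beta> x that(1) that(1)] x by (simp add: D.mult)
  show "tensor_lift B \<beta> (\<Delta> (x \<otimes> E i)) =
      tensor_lift B (\<lambda>y w. \<beta> (y \<otimes> uE i) (w \<otimes> E i)) (\<Delta> x) \<oplus>
      tensor_lift B (\<lambda>y w. \<beta> (y \<otimes> E i) (w \<otimes> K i)) (\<Delta> x)" if "i \<in> idx P"
    using that x Delta_gen[of "GE i"] by (simp add: D.mult K.T.r_distr l conv_step[OF \<beta> x])
  show "tensor_lift B \<beta> (\<Delta> (x \<otimes> F i)) =
      tensor_lift B (\<lambda>y w. \<beta> (y \<otimes> F i) (w \<otimes> uF i)) (\<Delta> x) \<oplus>
      tensor_lift B (\<lambda>y w. \<beta> (y \<otimes> Kb i) (w \<otimes> F i)) (\<Delta> x)" if "i \<in> idx P"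
    using that x Delta_gen[of "GF i"] by (simp add: D.mult K.T.r_distr l conv_step[OF \<beta> x])
qed

lemma lift_cong:
  assumes "bilinear_map B B B \<beta>" "bilinear_map B B B \<gamma>" "x \<in> carrier B"
    "\<And>y w. y \<in> carrier B \<Longrightarrow> w \<in> carrier B \<Longrightarrow> \<beta> y w = \<gamma> y w"
  shows "tensor_lift B \<beta> (\<Delta> x) = tensor_lift B \<gamma> (\<Delta> x)"
  using kalg2.tensor_lift_cong[OF kalg2_BB k_algebra assms(1,2,4)] alg_hom_pair.closed[OF alg_hom_pair_Delta assms(3)] by blast

text \<open>
  Linear maps, in particular multiplications by fixed elements, can be taken out of a convolution.
\<close>

lemma lift_post:
  assumes \<beta>: "bilinear_map B B B \<beta>" and L: "lin_map B B L" and x: "x \<in> carrier B"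
  shows "tensor_lift B (\<lambda>y w. L (\<beta> y w)) (\<Delta> x) = L (tensor_lift B \<beta> (\<Delta> x))"
proof -
  interpret K: kalg2 B B by (rule kalg2_BB)
  have b: "bilinear_map B B B (\<lambda>y w. L (\<beta> y w))"
    by (rule bilinear_mapI) (simp_all add: bilinear_mapD[OF \<beta>] lin_mapD[OF L])
  show ?thesis
    by (rule K.tensor_eqI[OF k_algebra K.tensor_lift_lin_map[OF k_algebra b]
          lin_map_comp[OF K.tensor_lift_lin_map[OF k_algebra \<beta>] L]])
      (simp_all add: K.tensor_lift_pt[OF k_algebra b] K.tensor_lift_pt[OF k_algebra \<beta>]
        alg_hom_pair.closed[OF alg_hom_pair_Delta] x)
qed

lemma bilinear_translate':
  "bilinear_map B B B \<beta> \<Longrightarrow> a \<in> carrier B \<Longrightarrow> b \<in> carrier B \<Longrightarrow> bilinear_map B B B (\<lambda>x y. \<beta> (x \<otimes> a) (y \<otimes> b))"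
  by (rule kalg2.bilinear_translate[OF kalg2_BB])

lemma conv_left_term:
  assumes c: "z \<in> carrier B" "y \<in> carrier B" "a \<in> carrier B" "b \<in> carrier B"
  shows "tensor_lift B (\<lambda>u v. u \<otimes> a \<otimes> z \<otimes> T (v \<otimes> b)) (\<Delta> y) = conv_left (a \<otimes> z \<otimes> T b) y"
  unfolding conv_left_def
  by (rule lift_cong[OF bilinear_translate'[OF T_bilinear(1)] T_bilinear(1)]) (use c in \<open>simp_all add: T_ops m_assoc\<close>)

text \<open>
  For \<open>\<Delta>(g) = \<Sum> g\<^sub>1 \<otimes> g\<^sub>2\<close> the product \<open>y\<^sub>1 g\<^sub>1 z T(y\<^sub>2 g\<^sub>2)\<close> equals \<open>y\<^sub>1 (g\<^sub>1 z T(g\<^sub>2)) T(y\<^sub>2)\<close>.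
\<close>

lemma conv_left_mult:
  assumes "z \<in> carrier B" "y \<in> carrier B"
  shows "g \<in> carrier B \<Longrightarrow> \<Delta> g = pt g g \<Longrightarrow> conv_left z (y \<otimes> g) = conv_left (g \<otimes> z \<otimes> T g) y"
    and "i \<in> idx P \<Longrightarrow> conv_left z (y \<otimes> E i) =
      conv_left (uE i \<otimes> z \<otimes> T (E i) \<oplus> E i \<otimes> z \<otimes> Kb i) y"
    and "i \<in> idx P \<Longrightarrow> conv_left z (y \<otimes> F i) =
      conv_left (F i \<otimes> z \<otimes> uF i \<oplus> Kb i \<otimes> z \<otimes> T (F i)) y"
proof -
  note p = lift_Delta_prod[OF T_bilinear(1)[OF assms(1)] assms(2)]
  note t = conv_left_term[OF assms]
  note a = lin_mapD(2)[OF conv_left_lin(2)[OF assms(2)]]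
  show "conv_left z (y \<otimes> g) = conv_left (g \<otimes> z \<otimes> T g) y" if "g \<in> carrier B" "\<Delta> g = pt g g"
    unfolding conv_left_def[of z] p(1)[OF that] by (rule t[OF that(1) that(1)])
  show "conv_left z (y \<otimes> E i) =
      conv_left (uE i \<otimes> z \<otimes> T (E i) \<oplus> E i \<otimes> z \<otimes> Kb i) y" if "i \<in> idx P"
    unfolding conv_left_def[of z] p(2)[OF that] using that assms by (simp add: t a T_vals(2))
  show "conv_left z (y \<otimes> F i) =
      conv_left (F i \<otimes> z \<otimes> uF i \<oplus> Kb i \<otimes> z \<otimes> T (F i)) y" if "i \<in> idx P"
    unfolding conv_left_def[of z] p(3)[OF that] using that assms by (simp add: t a)
qed

subsection \<open>\<open>id * T * id = id\<close>\<close>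

text \<open>
  \<open>conv3 z x = \<Sum> x\<^sub>1 z T(x\<^sub>2) x\<^sub>3\<close>, so that \<open>id * T * id\<close> is the case \<open>z = 1\<close>. The map is not
  multiplicative in \<open>x\<close>, but by \<open>conv3_mult\<close> its values at \<open>x g\<close> are determined by those at \<open>x\<close>
  when all \<open>z\<close> are considered.
\<close>

definition conv3 where "conv3 z x = tensor_lift B (\<lambda>y w. conv_left z y \<otimes> w) (\<Delta> x)"

lemma conv3_bilinear: "z \<in> carrier B \<Longrightarrow> bilinear_map B B B (\<lambda>y w. conv_left z y \<otimes> w)"
  by (rule bilinear_mapI) (simp_all add: lin_mapD[OF conv_left_lin(1)] l_distr r_distr)

lemma conv3_lin: "z \<in> carrier B \<Longrightarrow> lin_map B B (conv3 z)" "x \<in> carrier B \<Longrightarrow> lin_map B B (\<lambda>z. conv3 z x)"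
proof -
  interpret K: kalg2 B B by (rule kalg2_BB)
  show "z \<in> carrier B \<Longrightarrow> lin_map B B (conv3 z)"
    unfolding conv3_def
    by (rule lin_map_comp[OF alg_hom_lin_map[OF Delta_hom] K.tensor_lift_lin_map[OF k_algebra conv3_bilinear]])
  show "lin_map B B (\<lambda>z. conv3 z x)" if "x \<in> carrier B"
    unfolding conv3_def
    by (rule K.tensor_lift_linear_parameter[OF k_algebra conv3_bilinear _ k_algebra])
      (auto intro!: lin_mapI simp: lin_mapD[OF conv_left_lin(2)] l_distr r_distr that alg_hom_pair.closed[OF alg_hom_pair_Delta])
qed

lemma conv3_closed [simp]: "z \<in> carrier B \<Longrightarrow> x \<in> carrier B \<Longrightarrow> conv3 z x \<in> carrier B"
  using lin_mapD(1)[OF conv3_lin(1)] by simp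

lemma conv3_zero [simp]: "x \<in> carrier B \<Longrightarrow> conv3 \<zero> x = \<zero>"
  using lin_map_zero[OF conv3_lin(2)] kalg_axioms by simp

lemma right_mult_lin: "b \<in> carrier B \<Longrightarrow> lin_map B B (\<lambda>x. x \<otimes> b)" "b \<in> carrier B \<Longrightarrow> lin_map B B (\<lambda>x. b \<otimes> x)"
  by (rule lin_mapI; simp add: l_distr r_distr)+

lemma conv3_term:
  assumes c: "z \<in> carrier B" "z' \<in> carrier B" "x \<in> carrier B" "a \<in> carrier B" "b \<in> carrier B"
    and z': "\<And>y. y \<in> carrier B \<Longrightarrow> conv_left z (y \<otimes> a) = conv_left z' y"
  shows "tensor_lift B (\<lambda>y w. conv_left z (y \<otimes> a) \<otimes> (w \<otimes> b)) (\<Delta> x) = conv3 z' x \<otimes> b"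
proof -
  have "tensor_lift B (\<lambda>y w. conv_left z (y \<otimes> a) \<otimes> (w \<otimes> b)) (\<Delta> x)
    = tensor_lift B (\<lambda>y w. (conv_left z' y \<otimes> w) \<otimes> b) (\<Delta> x)"
    by (rule lift_cong[OF bilinear_translate'[OF conv3_bilinear]])
      (use c in \<open>simp_all add: z' m_assoc bilinear_mapI lin_mapD[OF conv_left_lin(1)] l_distr r_distr\<close>)
  also have "\<dots> = conv3 z' x \<otimes> b"
    unfolding conv3_def by (rule lift_post[OF conv3_bilinear right_mult_lin(1)]) (use c in simp_all)
  finally show ?thesis .
qed

lemma conv3_mult:
  assumes z: "z \<in> carrier B" and x: "x \<in> carrier B"
  shows "g \<in> torus_gens (idx P) \<Longrightarrow> conv3 z (x \<otimes> \<phi> g) = conv3 (\<phi> g \<otimes> z \<otimes> T (\<phi> g)) x \<otimes> \<phi> g"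
    and "i \<in> idx P \<Longrightarrow> conv3 z (x \<otimes> E i) =
      conv3 (uE i \<otimes> z \<otimes> uE i) x \<otimes> E i \<oplus>
      conv3 (uE i \<otimes> z \<otimes> T (E i) \<oplus> E i \<otimes> z \<otimes> Kb i) x \<otimes> K i"
    and "i \<in> idx P \<Longrightarrow> conv3 z (x \<otimes> F i) =
      conv3 (F i \<otimes> z \<otimes> uF i \<oplus> Kb i \<otimes> z \<otimes> T (F i)) x \<otimes> uF i \<oplus>
      conv3 (Kb i \<otimes> z \<otimes> K i) x \<otimes> F i"
proof -
  note p = lift_Delta_prod[OF conv3_bilinear[OF z] x]
  note m = conv_left_mult[OF z]
  have u: "conv_left z (y \<otimes> unit_of_type t) = conv_left (unit_of_type t \<otimes> z \<otimes> unit_of_type t) y" if "y \<in> carrier B" for y t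
    using m(1)[OF that _ Delta_unit_of_type] by simp
  show "conv3 z (x \<otimes> \<phi> g) = conv3 (\<phi> g \<otimes> z \<otimes> T (\<phi> g)) x \<otimes> \<phi> g" if "g \<in> torus_gens (idx P)"
    unfolding conv3_def[of z] p(1)[OF torus_closed[OF that] Delta_torus[OF that]]
    by (rule conv3_term) (use z x torus_closed[OF that] m(1)[OF _ torus_closed[OF that] Delta_torus[OF that]] in simp_all)
  show "conv3 z (x \<otimes> E i) =
      conv3 (uE i \<otimes> z \<otimes> uE i) x \<otimes> E i \<oplus>
      conv3 (uE i \<otimes> z \<otimes> T (E i) \<oplus> E i \<otimes> z \<otimes> Kb i) x \<otimes> K i" if i: "i \<in> idx P"
    unfolding conv3_def[of z] p(2)[OF i]
    by (rule arg_cong2[where f = "(\<oplus>)"]; rule conv3_term) (use z x i m(2)[OF _ i] u in simp_all)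
  show "conv3 z (x \<otimes> F i) =
      conv3 (F i \<otimes> z \<otimes> uF i \<oplus> Kb i \<otimes> z \<otimes> T (F i)) x \<otimes> uF i \<oplus>
      conv3 (Kb i \<otimes> z \<otimes> K i) x \<otimes> F i" if i: "i \<in> idx P"
  proof -
    have Kb: "conv_left z (y \<otimes> Kb i) = conv_left (Kb i \<otimes> z \<otimes> K i) y" if "y \<in> carrier B" for y
      using m(1)[OF that _ Delta_torus[of "GKb i"]] i by (simp add: T_vals)
    show ?thesis unfolding conv3_def[of z] p(3)[OF i]
      by (rule arg_cong2[where f = "(\<oplus>)"]; rule conv3_term) (use z x i m(3)[OF _ i] Kb in simp_all)
  qed
qed

lemma conv3_one: "z \<in> carrier B \<Longrightarrow> conv3 z \<one> = z"
proof -
  assume z: "z \<in> carrier B"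
  interpret K: kalg2 B B by (rule kalg2_BB)
  have "conv_left z \<one> = z"
    unfolding conv_left_def Delta_one using z by (simp add: K.tensor_lift_pt[OF k_algebra T_bilinear(1)] T_ops)
  then show "conv3 z \<one> = z"
    unfolding conv3_def Delta_one using z by (simp add: K.tensor_lift_pt[OF k_algebra conv3_bilinear])
qed

lemma conv3_f: "z \<in> carrier B \<Longrightarrow> x \<in> carrier B \<Longrightarrow> conv3 (z \<otimes> f) x = conv3 z x \<otimes> f"
proof -
  assume c: "z \<in> carrier B" "x \<in> carrier B"
  have 1: "conv_left (z \<otimes> f) y = conv_left z y \<otimes> f" if y: "y \<in> carrier B" for y
  proof -
    have "conv_left (z \<otimes> f) y = tensor_lift B (\<lambda>a b. (a \<otimes> z \<otimes> T b) \<otimes> f) (\<Delta> y)"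
      unfolding conv_left_def
      by (rule lift_cong[OF T_bilinear(1)])
        (use c y in \<open>simp_all add: m_assoc f_commutes bilinear_mapI l_distr r_distr T_ops\<close>)
    also have "\<dots> = conv_left z y \<otimes> f"
      unfolding conv_left_def by (rule lift_post[OF T_bilinear(1) right_mult_lin(1)]) (use c y in simp_all)
    finally show ?thesis .
  qed
  have "conv3 (z \<otimes> f) x = tensor_lift B (\<lambda>y w. (conv_left z y \<otimes> w) \<otimes> f) (\<Delta> x)"
    unfolding conv3_def
    by (rule lift_cong[OF conv3_bilinear])
      (use c in \<open>simp_all add: 1 m_assoc f_commutes bilinear_mapI l_distr r_distr lin_mapD[OF conv_left_lin(1)]\<close>)
  also have "\<dots> = conv3 z x \<otimes> f"
    unfolding conv3_def by (rule lift_post[OF conv3_bilinear right_mult_lin(1)]) (use c in simp_all)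
  finally show "conv3 (z \<otimes> f) x = conv3 z x \<otimes> f" .
qed

text \<open>
  For \<open>z = e\<close> the new parameters in \<open>conv3_mult\<close> are \<open>0\<close> and \<open>e\<close>, by the cancellations of \<open>e_T\<close>, as in
  the proof that a map defined on generators is an antipode of a Hopf algebra.
\<close>

lemma conv3_e: "x \<in> carrier B \<Longrightarrow> conv3 e x = e \<otimes> x"
proof (induction rule: gens_induct)
  case zero
  then show ?case using lin_map_zero[OF conv3_lin(1)[OF e_closed]] kalg_axioms by simp
next
  case (add x y) then show ?case by (simp add: lin_mapD[OF conv3_lin(1)] r_distr)
next
  case (smult c x) then show ?case by (simp add: lin_mapD[OF conv3_lin(1)])
next
  case one then show ?case by (simp add: conv3_one)
next
  case (gen x g)
  note x = gen(1) and IH = gen(3) and m = conv3_mult[OF e_closed gen(1)]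
  from gen(2) show ?case
  proof (cases rule: gens_cases)
    case torus
    then show ?thesis using x torus_closed[OF torus] torus_T_torus[OF torus] by (simp add: m(1) e_torus IH m_assoc)
  next
    case (E i)
    have "e \<otimes> T (E i) \<oplus> E i \<otimes> e \<otimes> Kb i = \<zero>"
      using E smult_add_cancel[of "E i \<otimes> Kb i" "- 1" 1] by (simp add: e_T m_assoc e_torus)
    then show ?thesis using x E by (simp add: m(2) IH m_assoc)
  next
    case (F i)
    have "F i \<otimes> e \<oplus> Kb i \<otimes> T (F i) = \<zero>"
      using F smult_add_cancel[of "F i \<otimes> e" 1 "- 1"] by (simp add: e_T)
    then show ?thesis using x F by (simp add: m(3) IH m_assoc e_torus Kb_K)
  qed
qed

text \<open>
  On the \<open>f\<close>-part \<open>T(E\<^sub>i)\<close> and \<open>T(F\<^sub>i)\<close> do not cancel anything, and the parameter does not stay at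
  \<open>f\<close>: right multiplication of \<open>x\<close> by \<open>F\<^sub>i\<close> replaces \<open>z\<close> by \<open>F\<^sub>i z\<close>. The condition below is preserved
  by this, because \<open>E\<^sub>i\<close> and \<open>F\<^sub>j\<close> commute there, and is what the step for \<open>E\<^sub>i\<close> needs.
\<close>

definition E_central :: "'b \<Rightarrow> bool" where
  "E_central z \<longleftrightarrow> z \<in> carrier B \<and> z \<otimes> f = z \<and> (\<forall>i\<in>idx P. E i \<otimes> z = z \<otimes> E i)"

lemma E_central_f: "E_central f"
  by (simp add: E_central_def f_EF)

lemma E_central_F: 
  assumes z: "E_central z" and j: "j \<in> idx P" shows "E_central (F j \<otimes> z)"
proof -
  have c: "z \<in> carrier B" "z \<otimes> f = z" using z by (auto simp: E_central_def)
  have fz: "f \<otimes> z = z" using c f_commutes by simp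
  have "E i \<otimes> (F j \<otimes> z) = F j \<otimes> z \<otimes> E i" if i: "i \<in> idx P" for i
  proof -
    have "E i \<otimes> (F j \<otimes> z) = (E i \<otimes> F j \<otimes> f) \<otimes> z" using i j c fz by (simp add: m_assoc)
    also have "E i \<otimes> F j \<otimes> f = F j \<otimes> E i \<otimes> f" using f_E_F[OF i j] i j f_commutes by simp
    also have "\<dots> \<otimes> z = F j \<otimes> (E i \<otimes> z)" using i j c fz by (simp add: m_assoc)
    also have "\<dots> = F j \<otimes> z \<otimes> E i" using z i j c by (simp add: E_central_def m_assoc)
    finally show ?thesis .
  qed
  then show ?thesis using c j by (simp add: E_central_def m_assoc)
qed

text \<open>
  All terms with a factor \<open>K\<^sub>i\<close> or \<open>Kb\<^sub>i\<close> vanish on the \<open>f\<close>-part. What remains of \<open>conv3 z (x g)\<close> is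
  \<open>conv3 z x E\<^sub>i = x z E\<^sub>i\<close> for \<open>g = E\<^sub>i\<close> and \<open>conv3 (F\<^sub>i z) x = x F\<^sub>i z\<close> for \<open>g = F\<^sub>i\<close>. A generator of
  type zero vanishes itself.
\<close>

lemma conv3_E_central: "x \<in> carrier B \<Longrightarrow> \<forall>z. E_central z \<longrightarrow> conv3 z x = x \<otimes> z"
proof (induction rule: gens_induct)
  case zero
  then show ?case using lin_map_zero[OF conv3_lin(1)] kalg_axioms by (simp add: E_central_def)
next
  case (add x y) then show ?case by (simp add: lin_mapD[OF conv3_lin(1)] l_distr E_central_def)
next
  case (smult c x) then show ?case by (simp add: lin_mapD[OF conv3_lin(1)] E_central_def)
next
  case one then show ?case by (simp add: conv3_one E_central_def)
next
  case (gen x g)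
  note x = gen(1)
  show ?case
  proof (intro allI impI)
    fix z assume z: "E_central z"
    then have zc: "z \<in> carrier B" and zf: "z \<otimes> f = z" by (auto simp: E_central_def)
    have IH: "conv3 z x = x \<otimes> z" using gen(3) z by blast
    note m = conv3_mult[OF zc x]
    from gen(2) show "conv3 z (x \<otimes> \<phi> g) = x \<otimes> \<phi> g \<otimes> z"
    proof (cases rule: gens_cases)
      case torus
      then show ?thesis using x zc torus_closed[OF torus] torus_T_torus(3)[OF torus]
        by (simp add: m(1) z_torus[OF zc zf torus] m_assoc)
    next
      case (E i)
      have zK: "z \<otimes> Kb i = \<zero>" using z_torus(1)[OF zc zf] E by simp
      let ?w = "z \<otimes> T (E i)"
      have "?w \<otimes> f = ?w"
        using f_commutes[of "T (E i)"] E zc zf m_assoc[of z f "T (E i)"] m_assoc[of z "T (E i)" f] by simp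
      \<comment> \<open>The only term in which \<open>T (E i)\<close> occurs lies in the \<open>f\<close>-part
        and is multiplied by \<open>K i\<close>.\<close>
      then have "conv3 ?w x = conv3 ?w x \<otimes> f" using conv3_f[of ?w x] E zc x by simp
      moreover have "conv3 ?w x \<otimes> f \<otimes> K i = \<zero>" using E zc x by (simp add: m_assoc f_torus)
      ultimately have K0: "conv3 ?w x \<otimes> K i = \<zero>" by simp
      have "E i \<otimes> z = \<zero>" if "tyE P i \<noteq> 1"
        using EF_f_zero(1)[of i] that E zc zf f_commutes[OF zc] m_assoc[of "E i" f z] by simp
      moreover have "E i \<otimes> z \<otimes> Kb i = \<zero>" using E zc zK by (simp add: m_assoc)
      moreover have "E i \<otimes> z = z \<otimes> E i" using z E by (simp add: E_central_def)
      ultimately show ?thesis using E x zc zf K0 IH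
        by (cases "tyE P i = 1") (simp_all add: m(2) unit_f m_assoc)
    next
      case (F i)
      have zK: "Kb i \<otimes> z = \<zero>" using z_torus(2)[OF zc zf] F by simp
      have IH': "conv3 (F i \<otimes> z) x = x \<otimes> (F i \<otimes> z)" using gen(3) E_central_F[OF z F(1)] by blast
      have "F i \<otimes> z = \<zero>" if "tyF P i \<noteq> 1"
        using EF_f_zero(2)[of i] that F zc zf f_commutes[OF zc] m_assoc[of "F i" f z] by simp
      then show ?thesis using F x zc zf zK IH'
        by (cases "tyF P i = 1") (simp_all add: m(3) m_assoc unit_f)
    qed
  qed
qed

text \<open>
  \<open>conv3\<close> is linear in its parameter, and \<open>1 = e + f\<close>.
\<close>

lemma id_T_id: "x \<in> carrier B \<Longrightarrow> convolution B \<Delta> (convolution B \<Delta> (\<lambda>y. y) T) (\<lambda>y. y) x = x"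
proof -
  assume x: "x \<in> carrier B"
  have c: "convolution B \<Delta> (\<lambda>y. y) T y = conv_left \<one> y" if "y \<in> carrier B" for y
    unfolding convolution_def conv_left_def
    by (rule lift_cong[OF _ T_bilinear(1)]) (use that in \<open>simp_all add: bilinear_mapI l_distr r_distr T_ops\<close>)
  have "convolution B \<Delta> (convolution B \<Delta> (\<lambda>y. y) T) (\<lambda>y. y) x = conv3 \<one> x"
    unfolding convolution_def[of _ _ "convolution B \<Delta> (\<lambda>y. y) T"] conv3_def
    by (rule lift_cong[OF _ conv3_bilinear])
      (use x in \<open>simp_all add: c bilinear_mapI l_distr r_distr lin_mapD[OF conv_left_lin(1)]\<close>)
  also have "\<dots> = conv3 e x \<oplus> conv3 f x"
    using lin_mapD(2)[OF conv3_lin(2)[OF x], of e f] one_split by simp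
  also have "\<dots> = x \<otimes> (e \<oplus> f)"
    using conv3_e[OF x] conv3_E_central[OF x] E_central_f x e_central by (simp add: r_distr)
  finally show ?thesis using x by (simp add: one_split[symmetric])
qed

end

context wq_antipode
begin

subsection \<open>\<open>T * id * T = T\<close>\<close>

lemma conv_mid_mult:
  assumes y: "y \<in> carrier B"
  shows "g \<in> carrier B \<Longrightarrow> \<Delta> g = pt g g \<Longrightarrow> conv_mid (y \<otimes> g) = T g \<otimes> conv_mid y \<otimes> g"
    and "i \<in> idx P \<Longrightarrow> conv_mid (y \<otimes> E i) =
      uE i \<otimes> conv_mid y \<otimes> E i \<oplus> T (E i) \<otimes> conv_mid y \<otimes> K i"
    and "i \<in> idx P \<Longrightarrow> conv_mid (y \<otimes> F i) =
      T (F i) \<otimes> conv_mid y \<otimes> uF i \<oplus> K i \<otimes> conv_mid y \<otimes> F i"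
proof -
  note p = lift_Delta_prod[OF T_bilinear(2) y]
  have t: "tensor_lift B (\<lambda>u v. T (u \<otimes> a) \<otimes> (v \<otimes> b)) (\<Delta> y) = T a \<otimes> conv_mid y \<otimes> b"
    if c: "a \<in> carrier B" "b \<in> carrier B" for a b
  proof -
    have L: "lin_map B B (\<lambda>x. T a \<otimes> x \<otimes> b)" using c by (intro lin_mapI) (simp_all add: l_distr r_distr)
    have "tensor_lift B (\<lambda>u v. T (u \<otimes> a) \<otimes> (v \<otimes> b)) (\<Delta> y) = tensor_lift B (\<lambda>u v. T a \<otimes> (T u \<otimes> v) \<otimes> b) (\<Delta> y)"
      by (rule lift_cong[OF bilinear_translate'[OF T_bilinear(2)]])
        (use c y in \<open>simp_all add: T_ops m_assoc bilinear_mapI l_distr r_distr\<close>)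
    also have "\<dots> = T a \<otimes> conv_mid y \<otimes> b"
      unfolding conv_mid_def by (rule lift_post[OF T_bilinear(2) L y])
    finally show ?thesis .
  qed
  show "conv_mid (y \<otimes> g) = T g \<otimes> conv_mid y \<otimes> g" if "g \<in> carrier B" "\<Delta> g = pt g g"
    unfolding conv_mid_def[of "y \<otimes> g"] p(1)[OF that] by (rule t[OF that(1) that(1)])
  show "conv_mid (y \<otimes> E i) =
      uE i \<otimes> conv_mid y \<otimes> E i \<oplus> T (E i) \<otimes> conv_mid y \<otimes> K i" if "i \<in> idx P"
    unfolding conv_mid_def[of "y \<otimes> E i"] p(2)[OF that] using that by (simp add: t)
  show "conv_mid (y \<otimes> F i) =
      T (F i) \<otimes> conv_mid y \<otimes> uF i \<oplus> K i \<otimes> conv_mid y \<otimes> F i" if "i \<in> idx P"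
    unfolding conv_mid_def[of "y \<otimes> F i"] p(3)[OF that] using that by (simp add: t T_vals(3))
qed

text \<open>
  \<open>conv3' z x = \<Sum> T(x\<^sub>1) x\<^sub>2 z T(x\<^sub>3)\<close>. The parameter again stands where the factors of a new generator
  meet: between the second and the third factor, those of the first coming to stand on the left.
\<close>

definition conv3' where "conv3' z x = tensor_lift B (\<lambda>y w. conv_mid y \<otimes> z \<otimes> T w) (\<Delta> x)"

lemma conv3'_bilinear: "z \<in> carrier B \<Longrightarrow> bilinear_map B B B (\<lambda>y w. conv_mid y \<otimes> z \<otimes> T w)"
  by (rule bilinear_mapI) (simp_all add: lin_mapD[OF conv_mid_lin] l_distr r_distr T_ops)

lemma conv3'_lin: "z \<in> carrier B \<Longrightarrow> lin_map B B (conv3' z)" "x \<in> carrier B \<Longrightarrow> lin_map B B (\<lambda>z. conv3' z x)"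
proof -
  interpret K: kalg2 B B by (rule kalg2_BB)
  show "z \<in> carrier B \<Longrightarrow> lin_map B B (conv3' z)"
    unfolding conv3'_def
    by (rule lin_map_comp[OF alg_hom_lin_map[OF Delta_hom] K.tensor_lift_lin_map[OF k_algebra conv3'_bilinear]])
  show "lin_map B B (\<lambda>z. conv3' z x)" if "x \<in> carrier B"
    unfolding conv3'_def
    by (rule K.tensor_lift_linear_parameter[OF k_algebra conv3'_bilinear _ k_algebra])
      (auto intro!: lin_mapI simp: l_distr r_distr that alg_hom_pair.closed[OF alg_hom_pair_Delta])
qed

lemma conv3'_closed [simp]: "z \<in> carrier B \<Longrightarrow> x \<in> carrier B \<Longrightarrow> conv3' z x \<in> carrier B"
  using lin_mapD(1)[OF conv3'_lin(1)] by simp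

lemma conv3'_zero [simp]: "x \<in> carrier B \<Longrightarrow> conv3' \<zero> x = \<zero>"
  using lin_map_zero[OF conv3'_lin(2)] kalg_axioms by simp

text \<open>
  By \<open>conv_mid_mult\<close> each summand of \<open>conv_mid (y g\<^sub>1)\<close> has the form \<open>s conv_mid y t\<close>. Then \<open>s\<close> can be
  taken out and \<open>t\<close> joins the parameter.
\<close>

lemma conv3'_summand:
  assumes c: "s \<in> carrier B" "t \<in> carrier B" "z \<in> carrier B" "b \<in> carrier B" "x \<in> carrier B"
  shows "tensor_lift B (\<lambda>y w. s \<otimes> conv_mid y \<otimes> t \<otimes> z \<otimes> T (w \<otimes> b)) (\<Delta> x) = s \<otimes> conv3' (t \<otimes> z \<otimes> T b) x"
    and "bilinear_map B B B (\<lambda>y w. s \<otimes> conv_mid y \<otimes> t \<otimes> z \<otimes> T (w \<otimes> b))"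
proof -
  show b: "bilinear_map B B B (\<lambda>y w. s \<otimes> conv_mid y \<otimes> t \<otimes> z \<otimes> T (w \<otimes> b))"
    by (rule bilinear_mapI) (use c in \<open>simp_all add: lin_mapD[OF conv_mid_lin] l_distr r_distr T_ops\<close>)
  have "tensor_lift B (\<lambda>y w. s \<otimes> conv_mid y \<otimes> t \<otimes> z \<otimes> T (w \<otimes> b)) (\<Delta> x)
    = tensor_lift B (\<lambda>y w. s \<otimes> (conv_mid y \<otimes> (t \<otimes> z \<otimes> T b) \<otimes> T w)) (\<Delta> x)"
    by (rule lift_cong[OF b])
      (use c in \<open>simp_all add: bilinear_mapI lin_mapD[OF conv_mid_lin] l_distr r_distr T_ops m_assoc\<close>)
  also have "\<dots> = s \<otimes> conv3' (t \<otimes> z \<otimes> T b) x"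
    unfolding conv3'_def by (rule lift_post[OF conv3'_bilinear right_mult_lin(2)]) (use c in simp_all)
  finally show "tensor_lift B (\<lambda>y w. s \<otimes> conv_mid y \<otimes> t \<otimes> z \<otimes> T (w \<otimes> b)) (\<Delta> x) = s \<otimes> conv3' (t \<otimes> z \<otimes> T b) x" .
qed

lemma conv3'_term1:
  assumes c: "s \<in> carrier B" "t \<in> carrier B" "z \<in> carrier B" "a \<in> carrier B" "b \<in> carrier B" "x \<in> carrier B"
    and a: "\<And>y. y \<in> carrier B \<Longrightarrow> conv_mid (y \<otimes> a) = s \<otimes> conv_mid y \<otimes> t"
  shows "tensor_lift B (\<lambda>y w. conv_mid (y \<otimes> a) \<otimes> z \<otimes> T (w \<otimes> b)) (\<Delta> x) = s \<otimes> conv3' (t \<otimes> z \<otimes> T b) x"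
  unfolding conv3'_summand(1)[OF c(1-3,5,6), symmetric]
  by (rule lift_cong[OF bilinear_translate'[OF conv3'_bilinear] conv3'_summand(2)]) (use c in \<open>simp_all add: a\<close>)

lemma conv3'_term2:
  assumes c: "s \<in> carrier B" "t \<in> carrier B" "s' \<in> carrier B" "t' \<in> carrier B" "z \<in> carrier B" "a \<in> carrier B" "b \<in> carrier B" "x \<in> carrier B"
    and a: "\<And>y. y \<in> carrier B \<Longrightarrow> conv_mid (y \<otimes> a) = s \<otimes> conv_mid y \<otimes> t \<oplus> s' \<otimes> conv_mid y \<otimes> t'"
  shows "tensor_lift B (\<lambda>y w. conv_mid (y \<otimes> a) \<otimes> z \<otimes> T (w \<otimes> b)) (\<Delta> x)
    = s \<otimes> conv3' (t \<otimes> z \<otimes> T b) x \<oplus> s' \<otimes> conv3' (t' \<otimes> z \<otimes> T b) x"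
proof -
  interpret K: kalg2 B B by (rule kalg2_BB)
  note bb = conv3'_summand(2)[OF c(1,2,5,7,8)] conv3'_summand(2)[OF c(3,4,5,7,8)]
  let ?f = "\<lambda>y w. s \<otimes> conv_mid y \<otimes> t \<otimes> z \<otimes> T (w \<otimes> b)" and ?g = "\<lambda>y w. s' \<otimes> conv_mid y \<otimes> t' \<otimes> z \<otimes> T (w \<otimes> b)"
  have dx: "\<Delta> x \<in> carrier BB" using alg_hom_pair.closed[OF alg_hom_pair_Delta c(8)] .
  have b: "bilinear_map B B B (\<lambda>y w. conv_mid (y \<otimes> a) \<otimes> z \<otimes> T (w \<otimes> b))"
    by (rule bilinear_translate'[OF conv3'_bilinear]) (use c in simp_all)
  note lf = lin_mapD[OF K.tensor_lift_lin_map[OF k_algebra bb(1)]] and lg = lin_mapD[OF K.tensor_lift_lin_map[OF k_algebra bb(2)]]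
  have "tensor_lift B (\<lambda>y w. conv_mid (y \<otimes> a) \<otimes> z \<otimes> T (w \<otimes> b)) (\<Delta> x) = tensor_lift B ?f (\<Delta> x) \<oplus> tensor_lift B ?g (\<Delta> x)"
  proof (rule K.tensor_eqI[OF k_algebra K.tensor_lift_lin_map[OF k_algebra b] _ _ dx])
    show "lin_map BB B (\<lambda>u. tensor_lift B ?f u \<oplus> tensor_lift B ?g u)"
      by (rule lin_mapI) (simp_all add: lf lg a_ac smult_r_distr)
    show "tensor_lift B (\<lambda>y w. conv_mid (y \<otimes> a) \<otimes> z \<otimes> T (w \<otimes> b)) (pt u v) = tensor_lift B ?f (pt u v) \<oplus> tensor_lift B ?g (pt u v)"
      if "u \<in> carrier B" "v \<in> carrier B" for u v
      using that c by (simp add: K.tensor_lift_pt[OF k_algebra b] K.tensor_lift_pt[OF k_algebra bb(1)]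
          K.tensor_lift_pt[OF k_algebra bb(2)] a l_distr)
  qed
  then show ?thesis
    unfolding conv3'_summand(1)[OF c(1,2,5,7,8)] conv3'_summand(1)[OF c(3,4,5,7,8)] .
qed

lemma conv3'_mult:
  assumes z: "z \<in> carrier B" and x: "x \<in> carrier B"
  shows "g \<in> torus_gens (idx P) \<Longrightarrow> conv3' z (x \<otimes> \<phi> g) = T (\<phi> g) \<otimes> conv3' (\<phi> g \<otimes> z \<otimes> T (\<phi> g)) x"
    and "i \<in> idx P \<Longrightarrow> conv3' z (x \<otimes> E i) =
      uE i \<otimes> conv3' (uE i \<otimes> z \<otimes> T (E i)) x \<oplus>
      (uE i \<otimes> conv3' (E i \<otimes> z \<otimes> Kb i) x \<oplus>
       T (E i) \<otimes> conv3' (K i \<otimes> z \<otimes> Kb i) x)"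
    and "i \<in> idx P \<Longrightarrow> conv3' z (x \<otimes> F i) =
      (T (F i) \<otimes> conv3' (uF i \<otimes> z \<otimes> uF i) x \<oplus>
       K i \<otimes> conv3' (F i \<otimes> z \<otimes> uF i) x) \<oplus>
      K i \<otimes> conv3' (Kb i \<otimes> z \<otimes> T (F i)) x"
proof -
  note p = lift_Delta_prod[OF conv3'_bilinear[OF z] x]
  have u: "conv_mid (y \<otimes> unit_of_type t) = unit_of_type t \<otimes> conv_mid y \<otimes> unit_of_type t" if "y \<in> carrier B" for y t
    using conv_mid_mult(1)[OF that _ Delta_unit_of_type] by simp
  show "conv3' z (x \<otimes> \<phi> g) = T (\<phi> g) \<otimes> conv3' (\<phi> g \<otimes> z \<otimes> T (\<phi> g)) x" if g: "g \<in> torus_gens (idx P)"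
    unfolding conv3'_def[of z] p(1)[OF torus_closed[OF g] Delta_torus[OF g]]
    by (rule conv3'_term1) (use z x torus_closed[OF g] conv_mid_mult(1)[OF _ torus_closed[OF g] Delta_torus[OF g]] in simp_all)
  show "conv3' z (x \<otimes> E i) =
      uE i \<otimes> conv3' (uE i \<otimes> z \<otimes> T (E i)) x \<oplus>
      (uE i \<otimes> conv3' (E i \<otimes> z \<otimes> Kb i) x \<oplus>
       T (E i) \<otimes> conv3' (K i \<otimes> z \<otimes> Kb i) x)" if i: "i \<in> idx P"
    unfolding conv3'_def[of z] p(2)[OF i]
  proof (rule arg_cong2[where f = "(\<oplus>)"])
    show "tensor_lift B (\<lambda>y w. conv_mid (y \<otimes> uE i) \<otimes> z \<otimes> T (w \<otimes> E i)) (\<Delta> x) =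
      uE i \<otimes> conv3' (uE i \<otimes> z \<otimes> T (E i)) x"
      by (rule conv3'_term1) (use z x i u in simp_all)
    show "tensor_lift B (\<lambda>y w. conv_mid (y \<otimes> E i) \<otimes> z \<otimes> T (w \<otimes> K i)) (\<Delta> x) =
      uE i \<otimes> conv3' (E i \<otimes> z \<otimes> Kb i) x \<oplus>
       T (E i) \<otimes> conv3' (K i \<otimes> z \<otimes> Kb i) x"
      using conv3'_term2[where b = "K i" and a = "E i", OF _ _ _ _ z _ _ x conv_mid_mult(2)[OF _ i]] i by (simp add: T_vals(2))
  qed
  show "conv3' z (x \<otimes> F i) =
      (T (F i) \<otimes> conv3' (uF i \<otimes> z \<otimes> uF i) x \<oplus>
       K i \<otimes> conv3' (F i \<otimes> z \<otimes> uF i) x) \<oplus>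
      K i \<otimes> conv3' (Kb i \<otimes> z \<otimes> T (F i)) x" if i: "i \<in> idx P"
    unfolding conv3'_def[of z] p(3)[OF i]
  proof (rule arg_cong2[where f = "(\<oplus>)"])
    show "tensor_lift B (\<lambda>y w. conv_mid (y \<otimes> F i) \<otimes> z \<otimes> T (w \<otimes> uF i)) (\<Delta> x) =
      T (F i) \<otimes> conv3' (uF i \<otimes> z \<otimes> uF i) x \<oplus>
       K i \<otimes> conv3' (F i \<otimes> z \<otimes> uF i) x"
      using conv3'_term2[where b = "uF i" and a = "F i", OF _ _ _ _ z _ _ x conv_mid_mult(3)[OF _ i]] i by simp
    have Kb: "conv_mid (y \<otimes> Kb i) = K i \<otimes> conv_mid y \<otimes> Kb i" if "y \<in> carrier B" for y
      using conv_mid_mult(1)[OF that _ Delta_torus[of "GKb i"]] i by (simp add: T_vals)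
    show "tensor_lift B (\<lambda>y w. conv_mid (y \<otimes> Kb i) \<otimes> z \<otimes> T (w \<otimes> F i)) (\<Delta> x) =
      K i \<otimes> conv3' (Kb i \<otimes> z \<otimes> T (F i)) x"
      by (rule conv3'_term1) (use z x i Kb in simp_all)
  qed
qed

lemma conv3'_one: "z \<in> carrier B \<Longrightarrow> conv3' z \<one> = z"
proof -
  assume z: "z \<in> carrier B"
  interpret K: kalg2 B B by (rule kalg2_BB)
  have "conv_mid \<one> = \<one>"
    unfolding conv_mid_def Delta_one by (simp add: K.tensor_lift_pt[OF k_algebra T_bilinear(2)] T_ops)
  then show "conv3' z \<one> = z"
    unfolding conv3'_def Delta_one using z by (simp add: K.tensor_lift_pt[OF k_algebra conv3'_bilinear] T_ops)
qed

lemma conv3'_f: "z \<in> carrier B \<Longrightarrow> x \<in> carrier B \<Longrightarrow> conv3' (z \<otimes> f) x = conv3' z x \<otimes> f"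
proof -
  assume c: "z \<in> carrier B" "x \<in> carrier B"
  have "conv3' (z \<otimes> f) x = tensor_lift B (\<lambda>y w. (conv_mid y \<otimes> z \<otimes> T w) \<otimes> f) (\<Delta> x)"
    unfolding conv3'_def
    by (rule lift_cong[OF conv3'_bilinear])
      (use c in \<open>simp_all add: m_assoc f_commutes bilinear_mapI l_distr r_distr lin_mapD[OF conv_mid_lin] T_ops\<close>)
  also have "\<dots> = conv3' z x \<otimes> f"
    unfolding conv3'_def by (rule lift_post[OF conv3'_bilinear right_mult_lin(1)]) (use c in simp_all)
  finally show "conv3' (z \<otimes> f) x = conv3' z x \<otimes> f" .
qed

lemma conv3'_e: "x \<in> carrier B \<Longrightarrow> conv3' e x = e \<otimes> T x"
proof (induction rule: gens_induct)
  case zero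
  then show ?case using lin_map_zero[OF conv3'_lin(1)[OF e_closed]] T_ops(3)[of \<zero> 0] kalg_axioms by simp
next
  case (add x y) then show ?case by (simp add: lin_mapD[OF conv3'_lin(1)] T_ops r_distr)
next
  case (smult c x) then show ?case by (simp add: lin_mapD[OF conv3'_lin(1)] T_ops)
next
  case one then show ?case by (simp add: conv3'_one T_ops)
next
  case (gen x g)
  note x = gen(1) and IH = gen(3) and m = conv3'_mult[OF e_closed gen(1)]
  have com: "y \<otimes> (e \<otimes> T x) = e \<otimes> (y \<otimes> T x)" if "y \<in> carrier B" for y
    using that x e_central[OF that] by (simp add: m_assoc[symmetric])
  note add = lin_mapD(2)[OF conv3'_lin(2)[OF x]]
  from gen(2) show ?case
  proof (cases rule: gens_cases)
    case torus
    then show ?thesis using x torus_closed[OF torus] torus_T_torus[OF torus] by (simp add: m(1) e_torus IH T_ops com)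
  next
    case (E i)
    let ?u = "uE i"
    have "e \<otimes> T (E i) \<oplus> E i \<otimes> e \<otimes> Kb i = \<zero>"
      using E smult_add_cancel[of "E i \<otimes> Kb i" "- 1" 1] by (simp add: e_T m_assoc e_torus)
    then have "conv3' (e \<otimes> T (E i)) x \<oplus> conv3' (E i \<otimes> e \<otimes> Kb i) x = \<zero>"
      using add[of "e \<otimes> T (E i)" "E i \<otimes> e \<otimes> Kb i"] E x by simp
    then have "?u \<otimes> conv3' (e \<otimes> T (E i)) x \<oplus> ?u \<otimes> conv3' (E i \<otimes> e \<otimes> Kb i) x = \<zero>"
      using E x by (simp add: r_distr[symmetric])
    then have "?u \<otimes> conv3' (e \<otimes> T (E i)) x \<oplus> (?u \<otimes> conv3' (E i \<otimes> e \<otimes> Kb i) x \<oplus> w) = w"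
      if "w \<in> carrier B" for w
      using E x that by (simp add: a_assoc[symmetric])
    note cancel = this
    show ?thesis using x E unfolding E(2) m(2)[OF E(1)]
      by (simp add: cancel del: m_assoc) (simp add: e_torus K_Kb IH T_ops com)
  next
    case (F i)
    let ?u = "uF i"
    have z: "F i \<otimes> e \<oplus> Kb i \<otimes> T (F i) = \<zero>"
      using F smult_add_cancel[of "F i \<otimes> e" 1 "- 1"] by (simp add: e_T)
    have "conv3' (F i \<otimes> e) x \<oplus> conv3' (Kb i \<otimes> T (F i)) x = \<zero>"
      using add[of "F i \<otimes> e" "Kb i \<otimes> T (F i)"] F x by (simp add: z)
    then have "K i \<otimes> conv3' (F i \<otimes> e) x \<oplus> K i \<otimes> conv3' (Kb i \<otimes> T (F i)) x = \<zero>"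
      using F x by (simp add: r_distr[symmetric])
    then show ?thesis using x F by (simp add: m(3) e_torus m_assoc IH T_ops a_assoc com)
  qed
qed

text \<open>
  For \<open>conv3'\<close> the parameter changes under right multiplication of \<open>x\<close> by \<open>E\<^sub>i\<close>, to \<open>z T(E\<^sub>i)\<close>, so the
  roles of \<open>E\<close> and \<open>F\<close> are exchanged compared with \<open>E_central\<close>.
\<close>

definition TF_central :: "'b \<Rightarrow> bool" where
  "TF_central z \<longleftrightarrow> z \<in> carrier B \<and> z \<otimes> f = z \<and> (\<forall>i\<in>idx P. z \<otimes> T (F i) = T (F i) \<otimes> z)"

lemma TF_central_f: "TF_central f"
  by (simp add: TF_central_def f_T)

text \<open>
  Apply \<open>T\<close> to \<open>f_E_F\<close>, using \<open>T(f) = f\<close>.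
\<close>

lemma f_TE_TF: 
  assumes "i \<in> idx P" "j \<in> idx P"
  shows "f \<otimes> (T (E i) \<otimes> T (F j)) = f \<otimes> (T (F j) \<otimes> T (E i))"
proof -
  have E: "f \<otimes> E i = E i \<otimes> f" and F: "f \<otimes> F j = F j \<otimes> f" using f_EF assms by simp_all
  have "T (F j \<otimes> E i \<otimes> f) = T (E i \<otimes> F j \<otimes> f)"
    using f_E_F[OF assms] f_commutes assms by simp
  moreover have "T f = f" using T_ops T_vals(1) by (simp add: f_def)
  ultimately show ?thesis using assms by (simp add: T_ops)
qed

lemma TF_central_TE: 
  assumes z: "TF_central z" and j: "j \<in> idx P" shows "TF_central (z \<otimes> T (E j))"
proof -
  have c: "z \<in> carrier B" "z \<otimes> f = z" using z by (auto simp: TF_central_def)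
  let ?t = "T (E j)"
  have "z \<otimes> ?t \<otimes> T (F i) = T (F i) \<otimes> (z \<otimes> ?t)" if i: "i \<in> idx P" for i
  proof -
    let ?s = "T (F i)"
    have "z \<otimes> ?t \<otimes> ?s = (z \<otimes> f) \<otimes> (?t \<otimes> ?s)" using i j c by (simp add: m_assoc)
    also have "\<dots> = z \<otimes> (f \<otimes> (?t \<otimes> ?s))" by (rule m_assoc) (use i j c in simp_all)
    also have "\<dots> = (z \<otimes> f) \<otimes> ?s \<otimes> ?t" unfolding f_TE_TF[OF j i] using i j c(1) by (simp add: m_assoc)
    also have "\<dots> = ?s \<otimes> (z \<otimes> ?t)" using z i j c by (simp add: TF_central_def m_assoc)
    finally show ?thesis .
  qed
  moreover have "z \<otimes> ?t \<otimes> f = z \<otimes> ?t"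
    using f_commutes[of ?t] j c m_assoc[of z f ?t] m_assoc[of z ?t f] by simp
  ultimately show ?thesis using c j by (simp add: TF_central_def)
qed

lemma conv3'_TF_central: "x \<in> carrier B \<Longrightarrow> \<forall>z. TF_central z \<longrightarrow> conv3' z x = z \<otimes> T x"
proof (induction rule: gens_induct)
  case zero
  then show ?case using lin_map_zero[OF conv3'_lin(1)] T_ops(3)[of \<zero> 0] kalg_axioms by (simp add: TF_central_def)
next
  case (add x y) then show ?case by (simp add: lin_mapD[OF conv3'_lin(1)] r_distr TF_central_def T_ops)
next
  case (smult c x) then show ?case by (simp add: lin_mapD[OF conv3'_lin(1)] TF_central_def T_ops)
next
  case one then show ?case by (simp add: conv3'_one TF_central_def T_ops)
next
  case (gen x g)
  note x = gen(1)
  show ?case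
  proof (intro allI impI)
    fix z assume z: "TF_central z"
    then have zc: "z \<in> carrier B" and zf: "z \<otimes> f = z" by (auto simp: TF_central_def)
    have IH: "conv3' z x = z \<otimes> T x" using gen(3) z by blast
    note m = conv3'_mult[OF zc x]
    from gen(2) show "conv3' z (x \<otimes> \<phi> g) = z \<otimes> T (x \<otimes> \<phi> g)"
    proof (cases rule: gens_cases)
      case torus
      then show ?thesis using x zc torus_closed[OF torus] torus_T_torus(3)[OF torus]
        by (simp add: m(1) z_torus[OF zc zf torus] T_ops m_assoc[symmetric])
    next
      case (E i)
      have zK: "z \<otimes> Kb i = \<zero>" using z_torus(1)[OF zc zf] E by simp
      have IH': "conv3' (z \<otimes> T (E i)) x = z \<otimes> T (E i) \<otimes> T x" using gen(3) TF_central_TE[OF z E(1)] by blast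
      have z0: "z \<otimes> T (E i) = \<zero>" if "tyE P i \<noteq> 1"
        using EF_f_zero(1)[of i] f_T(1)[of i] that E zc zf m_assoc[of z f "T (E i)"] by simp
      have m2: "conv3' z (x \<otimes> E i) = uE i \<otimes> conv3' (uE i \<otimes> z \<otimes> T (E i)) x"
        using E x zc zK by (simp add: m(2) m_assoc)
      show ?thesis
      proof (cases "tyE P i = 1")
        case True
        then show ?thesis using E x zc zf IH' m2 by (simp add: unit_of_type_def T_ops m_assoc)
      next
        case False
        have "z \<otimes> T (x \<otimes> E i) = \<zero>" using z0[OF False] E x zc by (simp add: T_ops m_assoc[symmetric])
        then show ?thesis using False E x zc zf m2 by (simp add: unit_f)
      qed
    next
      case (F i)
      have zK: "Kb i \<otimes> z = \<zero>" using z_torus(2)[OF zc zf] F by simp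
      let ?u = "uF i"
      have zu: "z \<otimes> ?u \<otimes> f = z \<otimes> ?u" using zf zc f_commutes[of ?u] m_assoc[of z f ?u] m_assoc[of z ?u f] by simp
      have "conv3' (F i \<otimes> z \<otimes> ?u) x = conv3' (F i \<otimes> z \<otimes> ?u \<otimes> f) x"
        using zu zc F by (simp add: m_assoc)
      also have "\<dots> = f \<otimes> conv3' (F i \<otimes> z \<otimes> ?u) x" using F zc x by (simp add: conv3'_f f_commutes)
      finally have "K i \<otimes> conv3' (F i \<otimes> z \<otimes> ?u) x = K i \<otimes> f \<otimes> conv3' (F i \<otimes> z \<otimes> ?u) x"
        using F zc x by (simp add: m_assoc)
      then have K0: "K i \<otimes> conv3' (F i \<otimes> z \<otimes> ?u) x = \<zero>" using F zc x by (simp add: f_torus)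
      have m3: "conv3' z (x \<otimes> F i) = T (F i) \<otimes> conv3' (?u \<otimes> z \<otimes> ?u) x"
        using F x zc zK K0 by (simp add: m(3))
      have com: "z \<otimes> T (F i) = T (F i) \<otimes> z" using z F by (simp add: TF_central_def)
      show ?thesis
      proof (cases "tyF P i = 1")
        case True
        have "conv3' z (x \<otimes> F i) = T (F i) \<otimes> (z \<otimes> T x)"
          using True x zc IH m3 by (simp add: unit_of_type_def)
        also have "\<dots> = z \<otimes> T (F i) \<otimes> T x" unfolding com using F x zc by (simp add: m_assoc)
        finally show ?thesis using F x zc by (simp add: T_ops m_assoc)
      next
        case False
        have "z \<otimes> T (F i) = \<zero>"
          using EF_f_zero(2)[of i] f_T(2)[of i] False F zc zf m_assoc[of z f "T (F i)"] by simp
        then have "z \<otimes> T (x \<otimes> F i) = \<zero>" using F x zc by (simp add: T_ops m_assoc[symmetric])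
        then show ?thesis using False F x zc zf m3 by (simp add: unit_f)
      qed
    qed
  qed
qed

lemma T_id_T: "x \<in> carrier B \<Longrightarrow> convolution B \<Delta> (convolution B \<Delta> T (\<lambda>y. y)) T x = T x"
proof -
  assume x: "x \<in> carrier B"
  have "convolution B \<Delta> (convolution B \<Delta> T (\<lambda>y. y)) T x = conv3' \<one> x"
    unfolding convolution_def conv_mid_def[symmetric] conv3'_def
    by (rule lift_cong[OF _ conv3'_bilinear])
      (use x in \<open>simp_all add: bilinear_mapI l_distr r_distr lin_mapD[OF conv_mid_lin] T_ops\<close>)
  also have "\<dots> = conv3' e x \<oplus> conv3' f x"
    using lin_mapD(2)[OF conv3'_lin(2)[OF x], of e f] one_split by simp
  also have "\<dots> = (e \<oplus> f) \<otimes> T x"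
    using conv3'_e[OF x] conv3'_TF_central[OF x] TF_central_f x by (simp add: l_distr)
  finally show ?thesis using x by (simp add: one_split[symmetric])
qed

lemma weak_antipode: "weak_antipode B \<Delta> T"
  unfolding weak_antipode_def using T_hom id_T_id T_id_T by blast

end

subsection \<open>Bijectivity\<close>

text \<open>
  On the \<open>e\<close>-part \<open>S\<close> sends \<open>\<alpha> E\<^sub>i Kb\<^sub>i\<close> to \<open>\<alpha> \<alpha>' K\<^sub>i E\<^sub>i Kb\<^sub>i = \<alpha> \<alpha>' wt\<^sub>i\<^sub>i E\<^sub>i e\<close>. On the \<open>f\<close>-part both
  maps fix \<open>E\<^sub>i f\<close>, since \<open>d = 1\<close>.
\<close>

lemma (in wq_bialg) antirep_inverse:
  assumes T: "T \<in> alg_hom B (op_alg B)" "\<And>g. g \<in> gens (idx P) \<Longrightarrow> T (\<phi> g) = antirep \<alpha> \<beta> 1 g"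
    and S: "S \<in> alg_hom B (op_alg B)" "\<And>g. g \<in> gens (idx P) \<Longrightarrow> S (\<phi> g) = antirep \<alpha>' \<beta>' 1 g"
    and ab: "\<And>i. i \<in> idx P \<Longrightarrow> \<alpha> i * \<alpha>' i * wt P i i = 1" "\<And>i. i \<in> idx P \<Longrightarrow> \<beta> i * \<beta>' i * wt P i i = 1"
    and x: "x \<in> carrier B"
  shows "S (T x) = x"
proof -
  have op: "kalg (op_alg B)" by (simp add: kalg_def k_algebra_op_alg k_algebra)
  interpret S: alg_hom_pair B "op_alg B" S
    by (intro alg_hom_pair.intro alg_hom_pair_axioms.intro kalg_axioms S(1) op)
  interpret T: alg_hom_pair B "op_alg B" T
    by (intro alg_hom_pair.intro alg_hom_pair_axioms.intro kalg_axioms T(1) op)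
  note So = S.add[simplified] S.mult[simplified] S.smult[simplified] S.one[simplified]
  note To = T.add[simplified] T.mult[simplified] T.smult[simplified] T.one[simplified]
  have cl: "S y \<in> carrier B" "T y \<in> carrier B" if "y \<in> carrier B" for y using that S.closed T.closed by simp_all
  have h: "(\<lambda>x. S (T x)) \<in> alg_hom B B" by (rule alg_homI) (simp_all add: So To cl)
  have i: "(\<lambda>y. y) \<in> alg_hom B B" by (simp add: alg_homI)
  have Se: "S e = e" using S(2)[of GJ] J_is_e by simp
  then have Sf: "S f = f" by (simp add: f_def So)
  note Sg = S(2)[simplified]
  have e_plus_f: "y \<otimes> e \<oplus> y \<otimes> f = y" if "y \<in> carrier B" for y
    using that r_distr[of e f y] one_split r_one[of y] e_closed f_closed by metis
  have gen: "S (T (\<phi> g)) = \<phi> g" if g: "g \<in> gens (idx P)" for g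
    using g
  proof (cases rule: gens_cases)
    case torus
    then show ?thesis using T(2)[OF g] by (cases g) (simp_all add: S(2) J_is_e Se)
  next
    case (E i)
    let ?E = "E i" and ?K = "K i" and ?Kb = "Kb i"
    have K: "?K \<otimes> (?E \<otimes> ?Kb) = wt P i i \<odot> (?E \<otimes> e)"
    proof -
      have "?K \<otimes> (?E \<otimes> ?Kb) = ?K \<otimes> ?E \<otimes> ?Kb" using E by (simp add: m_assoc)
      then show ?thesis using E by (simp add: K_E m_assoc K_Kb)
    qed
    have Kf: "?K \<otimes> (?E \<otimes> f) = \<zero>" using KbQ(1)[of i i "GE i" "GK i"] E by simp
    have f1: "f \<otimes> (?E \<otimes> ?Kb) = \<zero>" using E f_commutes[of "?E \<otimes> ?Kb"] by (simp add: m_assoc f_torus)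
    have f2: "f \<otimes> (?E \<otimes> f) = ?E \<otimes> f" using E f_commutes[of "?E \<otimes> f"] by (simp add: m_assoc)
    have "S (T ?E) = (\<alpha> i * \<alpha>' i * wt P i i) \<odot> (?E \<otimes> e) \<oplus> ?E \<otimes> f"
      using E by (simp add: T(2) So S(2) Sf cl r_distr K Kf f1 f2 mult_ac)
    then show ?thesis using E by (simp add: ab e_plus_f)
  next
    case (F i)
    let ?F = "F i" and ?K = "K i" and ?Kb = "Kb i"
    have K: "?Kb \<otimes> (?F \<otimes> ?K) = wt P i i \<odot> (?F \<otimes> e)"
    proof -
      have "?Kb \<otimes> (?F \<otimes> ?K) = ?Kb \<otimes> ?F \<otimes> ?K" using F by (simp add: m_assoc)
      then show ?thesis using F by (simp add: Kb_F m_assoc Kb_K)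
    qed
    have Kf: "?Kb \<otimes> (?F \<otimes> f) = \<zero>" using KbQ(1)[of i i "GF i" "GKb i"] F by simp
    have f1: "f \<otimes> (?F \<otimes> ?K) = \<zero>" using F f_commutes[of "?F \<otimes> ?K"] by (simp add: m_assoc f_torus)
    have f2: "f \<otimes> (?F \<otimes> f) = ?F \<otimes> f" using F f_commutes[of "?F \<otimes> f"] by (simp add: m_assoc)
    have "S (T ?F) = (\<beta> i * \<beta>' i * wt P i i) \<odot> (?F \<otimes> e) \<oplus> ?F \<otimes> f"
      using F by (simp add: T(2) So S(2) Sf cl r_distr K Kf f1 f2 mult_ac)
    then show ?thesis using F by (simp add: ab e_plus_f)
  qed
  show ?thesis by (rule alg_hom_eq_on_gens[OF kalg_axioms h i gen x])
qed

section \<open>The subalgebra \<open>Utau\<close>\<close>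

lemma wq_rep_cong:
  assumes "wq_rep B P \<phi>" "\<And>g. g \<in> gens (idx P) \<Longrightarrow> \<phi> g = \<psi> g"
  shows "wq_rep B P \<psi>"
proof -
  interpret wq_rep B P \<phi> by fact
  note eq = assms(2)[symmetric]
  have t: "g \<in> torus_gens (idx P) \<Longrightarrow> \<psi> g = \<phi> g" for g using eq torus_gens_subset by blast
  show ?thesis
  proof (intro wq_rep.intro kalg_axioms wq_rep_axioms.intro)
    show "fold (qcomm B (\<psi> (Z i))) (serre_scalars P i j) (\<psi> (Z j)) = \<zero>\<^bsub>B\<^esub>"
      if "Z \<in> {GE, GF}" "i \<in> idx P" "j \<in> idx P" "serre_pair P i j" for Z i j
      using serre[OF that] that eq by auto
  qed (simp_all add: eq t gen_closed K_Kb_raw[simplified] D_Db_raw[simplified] J_e_raw[simplified] torus_comm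
    torus_e_raw[simplified] K_E Kb_E K_F Kb_F type0_E_raw[simplified] type0_F_raw[simplified] E_F)
qed

lemma nat_pow_restrict: "x [^]\<^bsub>B\<lparr>carrier := C\<rparr>\<^esub> (n::nat) = x [^]\<^bsub>B\<^esub> n"
  by (simp add: nat_pow_def)

lemma qcomm_restrict: "qcomm (B\<lparr>carrier := C\<rparr>) = qcomm B"
  by (intro ext) (simp add: qcomm_def)

lemma (in wq_rep) rep_subalgebra:
  assumes "subalgebra B C" "\<And>g. g \<in> gens (idx P) \<Longrightarrow> \<phi> g \<in> C"
  shows "wq_rep (B\<lparr>carrier := C\<rparr>) P \<phi>"
proof (intro wq_rep.intro wq_rep_axioms.intro)
  show "kalg (B\<lparr>carrier := C\<rparr>)" using subalgebra_k_algebra[OF assms(1)] by (simp add: kalg_def)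
qed (simp_all add: assms(2) nat_pow_restrict qcomm_restrict K_Kb_raw[simplified] D_Db_raw[simplified] J_e_raw[simplified] torus_comm torus_e_raw[simplified] K_E Kb_E K_F Kb_F
    type0_E_raw[simplified] type0_F_raw[simplified] E_F serre)

lemma (in kalg) subalgebra_hull: "S \<subseteq> carrier A \<Longrightarrow> subalgebra A ((subalgebra A) hull S)"
proof -
  assume S: "S \<subseteq> carrier A"
  have "subalgebra A (carrier A)" by (simp add: subalgebra_iff)
  then show ?thesis
    unfolding hull_def using S by (subst subalgebra_iff) (auto simp: subalgebra_iff)
qed

lemma alg_hom_cong:
  assumes "kalg A" "f \<in> alg_hom A B" "\<And>x. x \<in> carrier A \<Longrightarrow> g x = f x"
  shows "g \<in> alg_hom A B"
proof -
  interpret A: kalg A by fact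
  show ?thesis using assms(2) unfolding alg_hom_def ring_hom_def by (auto simp: assms(3))
qed

lemma alg_hom_restrict:
  assumes "h \<in> alg_hom A B" "C \<subseteq> carrier A"
  shows "h \<in> alg_hom (A\<lparr>carrier := C\<rparr>) B"
  using assms unfolding alg_hom_def ring_hom_def by (auto simp: subset_iff)

lemma alg_hom_enlarge:
  assumes "h \<in> alg_hom A (B\<lparr>carrier := C\<rparr>)" "C \<subseteq> carrier B"
  shows "h \<in> alg_hom A B"
  using assms unfolding alg_hom_def ring_hom_def by (auto simp: subset_iff)

lemma (in wq_rep_valid) deltarep_e: "deltarep GJ [^]\<^bsub>BB\<^esub> (jexp P - 1) = pt e e"
proof -
  interpret T: kalg2 B B by (rule kalg2_BB)
  interpret R: wq_rep BB P deltarep by (rule deltarep_rep)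
  show ?thesis using R.K_Kb_raw[OF idx_nonempty] idx_nonempty by (simp add: T.pt_mult K_Kb)
qed

lemma (in wq_rep_valid) antirep_e: "antirep \<alpha> \<beta> d GJ [^]\<^bsub>op_alg B\<^esub> (jexp P - 1) = e"
  using nat_pow_op[of "\<phi> GJ" "jexp P - 1"] by (simp add: e_def)

lemma (in wq_rep_valid) standard_antirep_rep: "wq_rep (op_alg B) P (standard_antirep d)"
  unfolding standard_antirep_def by (rule antirep_rep) (simp add: wt_nonzero valid)

context wq_datum
begin

abbreviation "U \<equiv> Utau P"
text \<open>
  \<open>J\<close> need not lie in \<open>Utau\<close>, but \<open>e\<close> does, and with \<open>e\<close> in place of \<open>J\<close> the generators of \<open>Utau\<close> form a
  representation. Hence the constructions above apply to \<open>Utau\<close> itself.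
\<close>

definition Utau_gen :: "gen \<Rightarrow> 'k fa set" where
  "Utau_gen = (wgen P)(GJ := wJe P)"

lemma Utau_gen_simps [simp]: "Utau_gen GJ = wJe P" "g \<noteq> GJ \<Longrightarrow> Utau_gen g = wgen P g"
  by (simp_all add: Utau_gen_def)

interpretation W: wq_rep_valid H P "wgen P"
  by (intro wq_rep_valid.intro wq_rep_valid_axioms.intro wU_rep valid)

lemma W_e: "W.e = wJe P"
  by (simp add: W.e_def wJe_def)

lemma gens_set: "insert (wJe P) (wgen P ` (gens I - {GJ})) = Utau_gen ` gens I"
proof -
  have "gens I = insert GJ (gens I - {GJ})" by auto
  then have "Utau_gen ` gens I = insert (wJe P) (Utau_gen ` (gens I - {GJ}))" by (metis Utau_gen_simps(1) image_insert)
  moreover have "Utau_gen ` (gens I - {GJ}) = wgen P ` (gens I - {GJ})" by (rule image_cong) simp_all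
  ultimately show ?thesis by simp
qed

lemma gens_set_closed: "Utau_gen ` gens I \<subseteq> carrier H"
proof
  fix x assume "x \<in> Utau_gen ` gens I"
  then obtain g where "g \<in> gens I" "x = Utau_gen g" by blast
  then show "x \<in> carrier H" using W.gen_closed[of g] W.e_closed W_e by (cases "g = GJ") simp_all
qed

lemma U_eq: "U = H\<lparr>carrier := (subalgebra H) hull (Utau_gen ` gens I)\<rparr>"
  by (simp only: Utau_def generated_subalgebra_def gens_set)

lemma U_carrier: "carrier U = (subalgebra H) hull (Utau_gen ` gens I)"
  by (simp add: U_eq)

lemma U_subalgebra: "subalgebra H (carrier U)"
  unfolding U_carrier by (rule W.subalgebra_hull[OF gens_set_closed])

lemma U_restrict: "U = H\<lparr>carrier := carrier U\<rparr>"
  by (simp add: U_eq)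

lemma U_ops: "x \<otimes>\<^bsub>U\<^esub> y = x \<otimes>\<^bsub>H\<^esub> y" "x \<oplus>\<^bsub>U\<^esub> y = x \<oplus>\<^bsub>H\<^esub> y" "c \<odot>\<^bsub>U\<^esub> x = c \<odot>\<^bsub>H\<^esub> x" "\<one>\<^bsub>U\<^esub> = \<one>\<^bsub>H\<^esub>" "\<zero>\<^bsub>U\<^esub> = \<zero>\<^bsub>H\<^esub>"
  by (simp_all add: U_eq)

lemma U_subset: "carrier U \<subseteq> carrier H"
  using U_subalgebra by (simp add: subalgebra_def)

lemma U_gen: "g \<in> gens I \<Longrightarrow> Utau_gen g \<in> carrier U"
  unfolding U_carrier by (rule hull_inc) (rule imageI)

lemma U_rep: "wq_rep U P Utau_gen"
  using wq_rep.rep_subalgebra[OF W.rep_J_to_e[unfolded W_e, folded Utau_gen_def] U_subalgebra U_gen] U_restrict by simp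

interpretation U: wq_rep_valid U P Utau_gen
  by (intro wq_rep_valid.intro wq_rep_valid_axioms.intro U_rep valid)

lemma U_e: "U.e = wJe P"
proof -
  have "jexp P - 1 > 0" using valid by (auto simp: valid_wq_datum_def)
  then have "wJe P [^]\<^bsub>H\<^esub> (jexp P - 1) = wJe P" using W.e_pow[unfolded W_e] by blast
  then show ?thesis unfolding U.e_def by (subst U_restrict) (simp add: nat_pow_restrict)
qed

lemma U_generated:
  assumes "subalgebra U C" "Utau_gen ` gens I \<subseteq> C"
  shows "carrier U \<subseteq> C"
proof -
  have "subalgebra H C"
    using assms(1) U_subset unfolding W.subalgebra_iff U.subalgebra_iff U_ops by blast
  then show ?thesis unfolding U_carrier using assms(2) by (intro hull_minimal)
qed

text \<open>
  The restriction to \<open>Utau\<close> of a morphism out of \<open>wU\<close>. The value at the generator \<open>e\<close> of \<open>Utau\<close> is a power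
  of the value at \<open>J\<close>.
\<close>

lemma induced_hom_U:
  assumes "wq_rep B P \<psi>"
  shows "induced_hom B \<psi> \<in> alg_hom U B"
    and "\<And>g. g \<in> gens I \<Longrightarrow> induced_hom B \<psi> (Utau_gen g) = (if g = GJ then \<psi> GJ [^]\<^bsub>B\<^esub> (jexp P - 1) else \<psi> g)"
proof -
  interpret R: wq_rep B P \<psi> by fact
  note h = induced_hom_rep[OF assms]
  interpret h: alg_hom_pair H B "induced_hom B \<psi>"
    by (intro alg_hom_pair.intro alg_hom_pair_axioms.intro W.kalg_axioms R.kalg_axioms h(1))
  show "induced_hom B \<psi> \<in> alg_hom U B"
    by (subst U_restrict) (rule alg_hom_restrict[OF h(1) U_subset])
  show "induced_hom B \<psi> (Utau_gen g) = (if g = GJ then \<psi> GJ [^]\<^bsub>B\<^esub> (jexp P - 1) else \<psi> g)" if "g \<in> gens I" for g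
    using h(2)[OF that] h(2)[of GJ] W.closed(1) by (cases "g = GJ") (simp_all add: wJe_def h.nat_pow)
qed

text \<open>
  A comultiplication with values in \<open>U \<otimes> U\<close>, constructed without reference to \<open>wDelta\<close>. It turns out
  to be \<open>Udelta\<close>, which is given by a unique-existence condition.
\<close>

definition "DU = induced_hom (tensor U U) U.deltarep"

lemma DU_hom: "DU \<in> alg_hom U (tensor U U)"
  unfolding DU_def by (rule induced_hom_U(1)[OF U.deltarep_rep])

lemma U_J_e: "Utau_gen GJ = U.e" by (simp add: U_e)

lemma DU_gen: "g \<in> gens I \<Longrightarrow> DU (Utau_gen g) = U.deltarep g"
  unfolding DU_def using induced_hom_U(2)[OF U.deltarep_rep, of g] U.deltarep_e U_J_e by simp

lemma U_hom_eq:
  assumes "kalg C" "h \<in> alg_hom U C" "h' \<in> alg_hom U C"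
    and "\<And>g. g \<in> gens I \<Longrightarrow> h (Utau_gen g) = h' (Utau_gen g)" "x \<in> carrier U"
  shows "h x = h' x"
proof -
  have "wq_bialg U P Utau_gen DU"
    by (intro wq_bialg.intro wq_bialg_axioms.intro U.wq_rep_valid_axioms U_J_e U_generated DU_hom DU_gen)
  from wq_bialg.alg_hom_eq_on_gens[OF this assms] show ?thesis .
qed

lemma U_incl: "(\<lambda>x. x) \<in> alg_hom U H"
  using U_subset by (intro alg_homI) (auto simp: U_ops)

definition "retr = induced_hom U Utau_gen"

lemma retr_hom: "retr \<in> alg_hom H U"
  unfolding retr_def by (rule induced_hom_rep(1)[OF U_rep])

lemma retr_id: "x \<in> carrier U \<Longrightarrow> retr x = x"
proof (rule U_hom_eq[where h = retr and h' = "\<lambda>x. x"])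
  show "retr \<in> alg_hom U U" unfolding retr_def by (rule induced_hom_U(1)[OF U_rep])
  show "(\<lambda>x. x) \<in> alg_hom U U" by (rule alg_homI) simp_all
  show "retr (Utau_gen g) = Utau_gen g" if "g \<in> gens I" for g
    unfolding retr_def using induced_hom_U(2)[OF U_rep that] U_J_e by (simp add: U.e_def)
qed (simp_all add: U.kalg_axioms)

lemma kalg4_U_H: "kalg4 U U H H" "kalg4 H H U U"
  by (intro kalg4.intro U.kalg2_BB W.kalg2_BB)+

lemma unit_of_type_eq: "U.unit_of_type t = W.unit_of_type t"
  by (simp add: U.unit_of_type_def W.unit_of_type_def U_e W_e U_ops)

lemma wDelta_eq: "wDelta P = induced_hom (tensor H H) W.deltarep"
  unfolding wDelta_def Let_def W.deltarep_def W.unit_of_type_def W_e by (rule refl)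

lemma tensor_incl_DU: "x \<in> carrier U \<Longrightarrow> tensor_map H H (\<lambda>y. y) (\<lambda>y. y) (DU x) = wDelta P x"
proof (rule U_hom_eq[where h' = "wDelta P"])
  interpret K: kalg2 H H by (rule W.kalg2_BB)
  interpret L: kalg2 U U by (rule U.kalg2_BB)
  note tm = kalg4.tensor_map_alg_hom[OF kalg4_U_H(1) U_incl U_incl]
  note i = alg_hom_lin_map[OF U_incl]
  note tp = kalg4.tensor_map_pt[OF kalg4_U_H(1) i i]
  note ta = lin_mapD(2)[OF alg_hom_lin_map[OF tm]]
  show "kalg (tensor H H)" by (rule K.T.kalg_axioms)
  show "(\<lambda>x. tensor_map H H (\<lambda>y. y) (\<lambda>y. y) (DU x)) \<in> alg_hom U (tensor H H)"
    by (rule alg_hom_compose[OF DU_hom tm])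
  show "wDelta P \<in> alg_hom U (tensor H H)"
    unfolding wDelta_eq by (rule induced_hom_U(1)[OF W.deltarep_rep])
  fix g assume g: "g \<in> gens I"
  have r: "wDelta P (Utau_gen g) = (if g = GJ then W.pt (wJe P) (wJe P) else W.deltarep g)"
    unfolding wDelta_eq using induced_hom_U(2)[OF W.deltarep_rep g] W.deltarep_e W_e by simp
  have u: "W.unit_of_type t \<in> carrier U" for t using U.unit_of_type_facts(1) unit_of_type_eq by metis
  have e: "wJe P \<in> carrier U" using U.e_closed U_e by simp
  have c: "g' \<in> gens I \<Longrightarrow> g' \<noteq> GJ \<Longrightarrow> wgen P g' \<in> carrier U" for g' using U_gen[of g'] by simp
  show "tensor_map H H (\<lambda>y. y) (\<lambda>y. y) (DU (Utau_gen g)) = wDelta P (Utau_gen g)"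
    unfolding DU_gen[OF g] r using g
    by (cases g) (simp_all add: tp ta unit_of_type_eq u c e)
qed

text \<open>
  Hence the map from \<open>U \<otimes> U\<close> to \<open>wU \<otimes> wU\<close> is injective, which is not obvious for a subalgebra without
  choosing bases.
\<close>

lemma retr_tensor_incl: 
  assumes "t \<in> carrier (tensor U U)"
  shows "tensor_map U U retr retr (tensor_map H H (\<lambda>y. y) (\<lambda>y. y) t) = t"
proof -
  interpret L: kalg2 U U by (rule U.kalg2_BB)
  note i = alg_hom_lin_map[OF U_incl] and r = alg_hom_lin_map[OF retr_hom]
  note tp = kalg4.tensor_map_pt[OF kalg4_U_H(1) i i] and rp = kalg4.tensor_map_pt[OF kalg4_U_H(2) r r]
  show ?thesis
    by (rule L.tensor_eqI[OF L.k_algebra_tensor lin_map_comp[OF kalg4.tensor_map_lin_map[OF kalg4_U_H(1) i i]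
          kalg4.tensor_map_lin_map[OF kalg4_U_H(2) r r]] _ _ assms])
      (simp_all add: tp rp retr_id lin_map_def subsetD[OF U_subset])
qed

lemma Udelta_eq: "x \<in> carrier U \<Longrightarrow> Udelta P x = DU x"
proof -
  assume x: "x \<in> carrier U"
  have D: "DU x \<in> carrier (tensor U U)" using lin_mapD(1)[OF alg_hom_lin_map[OF DU_hom] x] .
  show "Udelta P x = DU x"
    unfolding Udelta_def
  proof (rule the_equality)
    show "DU x \<in> carrier (tensor U U) \<and> tensor_map H H (\<lambda>y. y) (\<lambda>y. y) (DU x) = wDelta P x"
      using D tensor_incl_DU[OF x] by blast
    show "t = DU x" if "t \<in> carrier (tensor U U) \<and> tensor_map H H (\<lambda>y. y) (\<lambda>y. y) t = wDelta P x" for t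
      using that D tensor_incl_DU[OF x] retr_tensor_incl by metis
  qed
qed

lemma U_bialg: "wq_bialg U P Utau_gen (Udelta P)"
proof (intro wq_bialg.intro wq_bialg_axioms.intro U.wq_rep_valid_axioms U_J_e U_generated)
  show "Udelta P \<in> alg_hom U (tensor U U)" by (rule alg_hom_cong[OF U.kalg_axioms DU_hom Udelta_eq])
  show "Udelta P (Utau_gen g) = U.deltarep g" if "g \<in> gens I" for g
    using Udelta_eq[OF U_gen[OF that]] DU_gen[OF that] by simp
qed

lemma U_f: "U.f = W.f"
  by (simp add: U.f_def W.f_def U_ops U_e W_e)

definition "TU d = induced_hom (op_alg U) (U.standard_antirep d)"

lemma TU_hom: "TU d \<in> alg_hom U (op_alg U)"
  unfolding TU_def by (rule induced_hom_U(1)[OF U.standard_antirep_rep])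

lemma TU_gen: "g \<in> gens I \<Longrightarrow> TU d (Utau_gen g) = U.standard_antirep d g"
  unfolding TU_def using induced_hom_U(2)[OF U.standard_antirep_rep, of g d] U.antirep_e U_J_e
  by (simp add: U.standard_antirep_def)

lemma antiT_rep: "antiT P \<in> alg_hom U (op_alg H)"
  "g \<in> gens I \<Longrightarrow> antiT P (Utau_gen g) = (if g = GJ then wJe P else W.standard_antirep 0 g)"
proof -
  let ?\<psi> = "\<lambda>g. case g of GJ \<Rightarrow> wgen P GJ | GK i \<Rightarrow> wgen P (GKb i) | GKb i \<Rightarrow> wgen P (GK i)
         | GD i \<Rightarrow> wgen P (GDb i) | GDb i \<Rightarrow> wgen P (GD i)
         | GE i \<Rightarrow> \<ominus>\<^bsub>H\<^esub> (wgen P (GE i) \<otimes>\<^bsub>H\<^esub> wgen P (GKb i))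
         | GF i \<Rightarrow> \<ominus>\<^bsub>H\<^esub> (wgen P (GK i) \<otimes>\<^bsub>H\<^esub> wgen P (GF i))"
  have eq: "W.standard_antirep 0 g = ?\<psi> g" if "g \<in> gens I" for g
    using that by (cases g) (simp_all add: W.standard_antirep_def W.a_inv_smult W.K_F)
  have rep: "wq_rep (op_alg H) P ?\<psi>" by (rule wq_rep_cong[OF W.standard_antirep_rep eq])
  have T: "antiT P = induced_hom (op_alg H) ?\<psi>"
    unfolding antiT_def Let_def by (rule arg_cong[where f = "induced_hom (op_alg H)"]) (auto split: gen.split)
  show "antiT P \<in> alg_hom U (op_alg H)" unfolding T by (rule induced_hom_U(1)[OF rep])
  show "antiT P (Utau_gen g) = (if g = GJ then wJe P else W.standard_antirep 0 g)" if "g \<in> gens I" for g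
    unfolding T using induced_hom_U(2)[OF rep that] eq[OF that] W.nat_pow_op[of "wgen P GJ"] by (simp add: wJe_def)
qed

text \<open>
  \<open>antiT\<close> is defined on \<open>wU\<close> and \<open>TU 0\<close> on \<open>Utau\<close>. Both are morphisms from \<open>Utau\<close> to the opposite algebra of
  \<open>wU\<close>, with the same values on generators.
\<close>

lemma antiT_eq: "x \<in> carrier U \<Longrightarrow> antiT P x = TU 0 x"
proof (rule U_hom_eq[where h' = "TU 0"])
  show "kalg (op_alg H)" by (simp add: kalg_def k_algebra_op_alg k_algebra_wU)
  show "antiT P \<in> alg_hom U (op_alg H)" by (rule antiT_rep)
  have "op_alg U = (op_alg H)\<lparr>carrier := carrier U\<rparr>" by (simp add: op_alg_def U_eq)
  then show "TU 0 \<in> alg_hom U (op_alg H)" using alg_hom_enlarge[where h = "TU 0" and A = U and B = "op_alg H" and C = "carrier U"] TU_hom[of 0] U_subset by simp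
  show "antiT P (Utau_gen g) = TU 0 (Utau_gen g)" if "g \<in> gens I" for g
    unfolding TU_gen[OF that] antiT_rep(2)[OF that] using that
    by (cases g) (simp_all add: U.standard_antirep_def W.standard_antirep_def U_ops U_f)
qed

lemma U_antipode: "wq_antipode U P Utau_gen (Udelta P) (TU d) d"
  by (intro wq_antipode.intro wq_antipode_axioms.intro U_bialg TU_hom TU_gen)

lemma U_antiT: "wq_antipode U P Utau_gen (Udelta P) (antiT P) 0"
proof (intro wq_antipode.intro wq_antipode_axioms.intro U_bialg)
  show "antiT P \<in> alg_hom U (op_alg U)" by (rule alg_hom_cong[OF U.kalg_axioms TU_hom antiT_eq])
  show "antiT P (Utau_gen g) = U.standard_antirep 0 g" if "g \<in> gens I" for g
    using antiT_eq[OF U_gen[OF that]] TU_gen[OF that] by simp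
qed

lemma TU_bij: "bij_betw (TU 1) (carrier U) (carrier U)"
proof -
  \<comment> \<open>The scalars of the inverse solve \<open>\<alpha> \<alpha>' wt = 1\<close> and
    \<open>\<beta> \<beta>' wt = 1\<close> for those of \<open>standard_antirep\<close>.\<close>
  let ?\<alpha> = "\<lambda>i. - inverse (wt P i i)" and ?\<beta> = "\<lambda>i::nat. - 1"
  let ?S = "induced_hom (op_alg U) (U.antirep ?\<alpha> ?\<beta> 1)"
  have rep: "wq_rep (op_alg U) P (U.antirep ?\<alpha> ?\<beta> 1)"
    by (rule U.antirep_rep) (simp add: wt_nonzero valid)
  have S: "?S \<in> alg_hom U (op_alg U)" by (rule induced_hom_U(1)[OF rep])
  have Sg: "?S (Utau_gen g) = U.antirep ?\<alpha> ?\<beta> 1 g" if "g \<in> gens I" for g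
    using induced_hom_U(2)[OF rep that] U.antirep_e U_J_e by simp
  have Tg: "TU 1 (Utau_gen g) = U.antirep (\<lambda>i. - 1) (\<lambda>i. - inverse (wt P i i)) 1 g" if "g \<in> gens I" for g
    using TU_gen[OF that] by (simp add: U.standard_antirep_def)
  have w: "wt P i i \<noteq> 0" if "i \<in> I" for i using wt_nonzero[OF valid that] .
  show ?thesis
  proof (rule bij_betw_byWitness[where f' = ?S])
    show "\<forall>x\<in>carrier U. ?S (TU 1 x) = x"
    proof
      fix x assume x: "x \<in> carrier U"
      show "?S (TU 1 x) = x"
        by (rule wq_bialg.antirep_inverse[OF U_bialg TU_hom Tg S Sg _ _ x]) (simp_all add: w)
    qed
    show "\<forall>x\<in>carrier U. TU 1 (?S x) = x"
    proof
      fix x assume x: "x \<in> carrier U"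
      show "TU 1 (?S x) = x"
        by (rule wq_bialg.antirep_inverse[OF U_bialg S Sg TU_hom Tg _ _ x]) (simp_all add: w)
    qed
    show "TU 1 ` carrier U \<subseteq> carrier U" using lin_mapD(1)[OF alg_hom_lin_map[OF TU_hom]] by auto
    show "?S ` carrier U \<subseteq> carrier U" using lin_mapD(1)[OF alg_hom_lin_map[OF S]] by auto
  qed
qed

text \<open>
  \<open>TU 0\<close> and \<open>TU 1\<close> differ on generators only by \<open>E\<^sub>i f\<close> and \<open>F\<^sub>i f\<close>, which vanish in type zero.
\<close>

lemma antiT_bij:
  assumes "\<forall>i\<in>I. tyE P i = 0 \<and> tyF P i = 0"
  shows "bij_betw (antiT P) (carrier U) (carrier U)"
proof -
  interpret A: wq_antipode U P Utau_gen "Udelta P" "antiT P" 0 by (rule U_antiT)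
  have "TU 1 x = antiT P x" if "x \<in> carrier U" for x
  proof (rule A.alg_hom_eq_on_gens[OF _ TU_hom A.T_hom _ that])
    show "kalg (op_alg U)" by (simp add: kalg_def k_algebra_op_alg U.k_algebra)
    show "TU 1 (Utau_gen g) = antiT P (Utau_gen g)" if g: "g \<in> gens I" for g
      unfolding TU_gen[OF g] A.T_gen[OF g] U.standard_antirep_def
      using g assms A.EF_f_zero by (cases g) simp_all
  qed
  then show ?thesis using TU_bij bij_betw_cong[of "carrier U" "TU 1" "antiT P"] by blast
qed

lemma U_bialgebra: "bialgebra U (Udelta P) (wepsilon P)"
proof (rule wq_bialg.bialgebra[OF U_bialg])
  note rep = scalar_rep[OF valid]
  show "wepsilon P \<in> alg_hom U scalar_algebra"
    unfolding wepsilon_def by (rule induced_hom_U(1)[OF rep])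
  interpret R: wq_rep scalar_algebra P "\<lambda>g. case g of GE i \<Rightarrow> 0 | GF i \<Rightarrow> 0 | _ \<Rightarrow> (1::'k)" by (rule rep)
  have "(1::'k) [^]\<^bsub>scalar_algebra\<^esub> (jexp P - 1) = 1" using R.nat_pow_one[of "jexp P - 1"] by simp
  then show "wepsilon P (Utau_gen g) = (case g of GE i \<Rightarrow> 0 | GF i \<Rightarrow> 0 | _ \<Rightarrow> 1)" if "g \<in> gens I" for g
    unfolding wepsilon_def using induced_hom_U(2)[OF rep that] by simp
qed

end

theorem mainTheorem3:
  fixes P :: "'k::field_char_0 wq_datum"
  assumes "valid_wq_datum P"
  shows "weak_antipode (Utau P) (Udelta P) (antiT P) \<and>
    ((\<forall>i\<in>idx P. tyE P i = 0 \<and> tyF P i = 0) \<longrightarrow>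
       bij_betw (antiT P) (carrier (Utau P)) (carrier (Utau P))) \<and>
    weak_hopf_algebra (Utau P) (Udelta P) (wepsilon P)"
proof -
  interpret wq_datum P using assms by (rule wq_datum.intro)
  show ?thesis
    unfolding weak_hopf_algebra_def
    using wq_antipode.weak_antipode[OF U_antiT] antiT_bij U_bialgebra
      wq_antipode.weak_antipode[OF U_antipode[of 1]] TU_bij by blast
qed

end
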